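(* Let $\mathsf{k}$ be an infinite field, let $u>r\ge 2$ be integers, and let $Q=(u,u-r)$ (a stable partition with two parts). If $P$ is a partition with $\mathfrak D(P)=Q$, then the closure of $W^Q_P$ in $\mathcal N_{J_Q}$ is an irreducible complete intersection of codimension $\ell(P)-2$, where $\ell(P)$ is the number of parts of $P$. Moreover, for $1\le k\le r-1$ and $1\le l\le u-r$, the closure of the locus $W^Q_P$ where $P=P^Q_{k,l}$ is $X^Q_{k,l}$, the variety defined by the equations $E^Q_{k,l}$.
   Context: **Commuting nilpotent matrices.** The Jordan type $P_B$ of a nilpotent matrix $B$ is the partition given by its Jordan block sizes. For a partition $Q$ of $n$, $J_Q$ is the nilpotent Jordan matrix with block sizes the parts of $Q$ (ones on the superdiagonal of each block, larger blocks first), and $\mathcal N_{J_Q}=\{B\in M_{n,n}(\mathsf{k}): B^n=0,\ BJ_Q=J_QB\}$. This is an irreducible variety, and $\mathfrak D(Q)$ denotes the Jordan type of a generic element of $\mathcal N_{J_Q}$ (the maximum Jordan type, in dominance order, occurring in $\mathcal N_{J_Q}$); likewise $\mathfrak D(P)$ for any partition $P$. A partition is stable if its parts differ pairwise by at least two (equivalently $\mathfrak D(Q)=Q$). Put $W^Q_P=\{B\in\mathcal N_{J_Q}: P_B=P\}$. Closures are Zariski closures. **Coordinates.** For $Q=(u,u-r)$, $\mathcal N_{J_Q}$ is the affine space of $(2u-r)\times(2u-r)$ matrices $B$ with $B_{i,j}=a_{j-i}$ for $1\le i<j\le u$; $B_{i,u+j}=g_{j-i}$ and $B_{u+i,r+j}=h_{j-i}$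 for $1\le i\le j\le u-r$; $B_{u+i,u+j}=b_{j-i}$ for $1\le i<j\le u-r$; all other entries zero. Its coordinate ring is $\mathsf{k}[\mathcal N_{J_Q}]=\mathsf{k}[a_1,\dots,a_{u-1},b_1,\dots,b_{u-r-1},g_0,\dots,g_{u-r-1},h_0,\dots,h_{u-r-1}]$. **Equations.** For $1\le k\le r-1$, $1\le l\le u-r$: if $k+l\le r$ let $E^Q_{k,l}=\{a_1,\dots,a_{k-1},b_1,\dots,b_{l-1}\}$; if $k+l\ge r+1$ let $$E^Q_{k,l}=\{a_1,\dots,a_{k-1},b_1,\dots,b_{r-k-1}\}\cup\Big\{\sum_{j=0}^{m}(a_{k+j}b_{r-k+m-j}-g_jh_{m-j}) : 0\le m\le k+l-r-1\Big\}.$$ Let $I^Q_{k,l}$ be the ideal of $\mathsf{k}[\mathcal N_{J_Q}]$ generated by $E^Q_{k,l}$ and $X^Q_{k,l}=V(I^Q_{k,l})\subseteq \mathcal N_{J_Q}$. **Burge code.** For a partition $P$ let $f=(f_1,f_2,\dots)$ be its frequency sequence ($f_i$ = number of parts equal to $i$). Parse $f$ from right to left, forming disjoint backward pairs: take the largest $j$ with $f_j>0$, form the pair $(f_{j-1},f_j)$, then continue with the indices smaller than $j-1$ (taking the next largest $j$ with $f_j>0$), and so on. Let $\mathsf R(P)$ be the set of indices $j$ of the right members of these pairs. Let $\partial P$ be the partition whose frequency sequence is obtained by replacing $(f_{j-1},f_j)$ by $(f_{j-1}+1,f_j-1)$ for every $j\in\mathsf R(P)$ (for $j=1$, just decrease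 $f_1$ by 1). The Burge code of $P$ is the word $w_1\cdots w_m$ with $w_i=\beta$ if $1\in\mathsf R(\partial^{i-1}P)$ and $w_i=\alpha$ otherwise, where $m=\min\{i:\partial^{i-1}P \text{ is the empty partition}\}$. The Burge code determines the partition. $P^Q_{k,l}$ is the partition with Burge code $\alpha^{u-r-l}\beta^{l}\alpha^{r-k}\beta^{k}\alpha$. It is known (the Box Theorem of Irving, Košir and Mastnak) that $\mathfrak D^{-1}(Q)=\{P^Q_{k,l}: 1\le k\le r-1,\ 1\le l\le u-r\}$ and that $P^Q_{k,l}$ has $k+l$ parts. *)

theory Defs
  imports
    "Jordan_Normal_Form.Jordan_Normal_Form"
    "HOL-Algebra.Ideal"
    "HOL-Analysis.Abstract_Topology"
    "HOL-Library.Poly_Mapping"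
    "HOL-Library.Multiset"
    "HOL-Library.Extended_Nat"
begin

text \<open>A partition is a multiset of positive naturals: the frequency \<open>f\<^sub>i\<close> is \<^term>\<open>count P i\<close> and the
  number of parts is \<^term>\<open>size P\<close>.\<close>

definition is_partition :: "nat multiset \<Rightarrow> bool" where
  "is_partition P \<longleftrightarrow> 0 \<notin># P"


section \<open>Multivariate polynomials\<close>

type_synonym ('x, 'k) mpol = "('x \<Rightarrow>\<^sub>0 nat) \<Rightarrow>\<^sub>0 'k"

definition mvar :: "'x \<Rightarrow> ('x, 'k::comm_ring_1) mpol" where
  "mvar x = Poly_Mapping.single (Poly_Mapping.single x 1) 1"

definition mon_eval :: "('x \<Rightarrow> 'k::comm_ring_1) \<Rightarrow> ('x \<Rightarrow>\<^sub>0 nat) \<Rightarrow> 'k" where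
  "mon_eval c m = (\<Prod>x\<in>Poly_Mapping.keys m. c x ^ Poly_Mapping.lookup m x)"

definition meval :: "('x \<Rightarrow> 'k::comm_ring_1) \<Rightarrow> ('x, 'k) mpol \<Rightarrow> 'k" where
  "meval c p = (\<Sum>m\<in>Poly_Mapping.keys p. Poly_Mapping.lookup p m * mon_eval c m)"

definition mvars :: "('x, 'k::zero) mpol \<Rightarrow> 'x set" where
  "mvars p = (\<Union>m\<in>Poly_Mapping.keys p. Poly_Mapping.keys m)"

lemma mon_eval_superset:
  assumes "finite K" "Poly_Mapping.keys m \<subseteq> K"
  shows "mon_eval c m = (\<Prod>x\<in>K. c x ^ Poly_Mapping.lookup m x)"
  unfolding mon_eval_def
  by (rule prod.mono_neutral_left) (use assms in \<open>auto simp: in_keys_iff\<close>)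

lemma mon_eval_0 [simp]: "mon_eval c 0 = 1"
  by (simp add: mon_eval_def)

lemma mon_eval_add: "mon_eval c (m + n) = mon_eval c m * mon_eval c n"
proof -
  define K where "K = Poly_Mapping.keys m \<union> Poly_Mapping.keys n"
  have K: "finite K" "Poly_Mapping.keys m \<subseteq> K" "Poly_Mapping.keys n \<subseteq> K"
      "Poly_Mapping.keys (m + n) \<subseteq> K"
    using Poly_Mapping.keys_add[of m n] by (auto simp: K_def)
  show ?thesis
    unfolding mon_eval_superset[OF K(1,2)] mon_eval_superset[OF K(1,3)] mon_eval_superset[OF K(1,4)]
    by (simp add: lookup_add power_add prod.distrib)
qed

lemma meval_superset:
  assumes "finite K" "Poly_Mapping.keys p \<subseteq> K"
  shows "meval c p = (\<Sum>m\<in>K. Poly_Mapping.lookup p m * mon_eval c m)"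
  unfolding meval_def
  by (rule sum.mono_neutral_left) (use assms in \<open>auto simp: in_keys_iff\<close>)

lemma meval_0 [simp]: "meval c 0 = 0"
  by (simp add: meval_def)

lemma meval_single: "meval c (Poly_Mapping.single m a) = a * mon_eval c m"
  by (simp add: meval_superset[of "{m}"])

lemma meval_1 [simp]: "meval c 1 = 1"
  using meval_single[of c 0 1] by simp

lemma meval_mvar [simp]: "meval c (mvar x) = c x"
  by (simp add: mvar_def meval_single mon_eval_def)

lemma meval_add: "meval c (p + q) = meval c p + meval c q"
proof -
  define K where "K = Poly_Mapping.keys p \<union> Poly_Mapping.keys q"
  have K: "finite K" "Poly_Mapping.keys p \<subseteq> K" "Poly_Mapping.keys q \<subseteq> K"
      "Poly_Mapping.keys (p + q) \<subseteq> K"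
    using Poly_Mapping.keys_add[of p q] by (auto simp: K_def)
  show ?thesis
    unfolding meval_superset[OF K(1,2)] meval_superset[OF K(1,3)] meval_superset[OF K(1,4)]
    by (simp add: lookup_add distrib_right sum.distrib)
qed

lemma mpol_induct [case_names zero add]:
  assumes "P 0" and "\<And>m a p. P p \<Longrightarrow> P (Poly_Mapping.single m a + p)"
  shows "P (p :: ('x, 'k::comm_ring_1) mpol)"
proof (induction p rule: update_induct)
  case const
  then show ?case by (rule assms(1))
next
  case (update p m a)
  have "Poly_Mapping.update m a p = Poly_Mapping.single m a + p"
    using update(1)
    by (intro poly_mapping_eqI) (auto simp: lookup_update lookup_add lookup_single in_keys_iff when_def)
  then show ?case using assms(2) update by simp
qed

lemma meval_mult: "meval c (p * q) = meval c p * meval c q"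
proof (induction p rule: mpol_induct)
  case (add m a p)
  have "meval c (Poly_Mapping.single m a * q) = meval c (Poly_Mapping.single m a) * meval c q"
    by (induction q rule: mpol_induct)
      (simp_all add: distrib_left mult_single meval_add meval_single mon_eval_add mult_ac)
  then show ?case using add by (simp add: distrib_right meval_add)
qed simp


section \<open>The Zariski topology on a set of matrices\<close>

definition entry :: "'k::zero mat \<Rightarrow> nat \<times> nat \<Rightarrow> 'k" where
  "entry B = (\<lambda>(i, j). if i < dim_row B \<and> j < dim_col B then B $$ (i, j) else 0)"

definition zariski :: "'k::field mat set \<Rightarrow> 'k mat topology" where
  "zariski X = topology (\<lambda>U. \<exists>S :: (nat \<times> nat, 'k) mpol set.
     U = X - {B \<in> X. \<forall>p\<in>S. meval (entry B) p = 0})"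

lemma openin_zariski:
  fixes X :: "'k::field mat set"
  shows "openin (zariski X) U \<longleftrightarrow> (\<exists>S :: (nat \<times> nat, 'k) mpol set.
     U = X - {B \<in> X. \<forall>p\<in>S. meval (entry B) p = 0})"
proof -
  define V where "V S = {B \<in> X. \<forall>p\<in>S. meval (entry B) p = 0}" for S :: "(nat \<times> nat, 'k) mpol set"
  have "istopology (\<lambda>U. \<exists>S. U = X - V S)"
    unfolding istopology_def
  proof safe
    fix S T
    have "(X - V S) \<inter> (X - V T) = X - V (\<Union>p\<in>S. (*) p ` T)" (is "?L = ?R")
    proof (rule Set.set_eqI)
      fix B
      have "B \<in> ?L \<longleftrightarrow> B \<in> X \<and> (\<exists>p\<in>S. \<exists>q\<in>T. meval (entry B) p \<noteq> 0 \<and> meval (entry B) q \<noteq> 0)"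
        unfolding V_def by blast
      also have "\<dots> \<longleftrightarrow> B \<in> X \<and> (\<exists>p\<in>S. \<exists>q\<in>T. meval (entry B) (p * q) \<noteq> 0)"
        by (simp add: meval_mult)
      also have "\<dots> \<longleftrightarrow> B \<in> ?R"
        unfolding V_def by blast
      finally show "B \<in> ?L \<longleftrightarrow> B \<in> ?R" .
    qed
    then show "\<exists>R. (X - V S) \<inter> (X - V T) = X - V R" by blast
  next
    fix \<U> assume "\<forall>U\<in>\<U>. \<exists>S. U = X - V S"
    then obtain S where S: "\<And>U. U \<in> \<U> \<Longrightarrow> U = X - V (S U)" by metis
    have "\<Union>\<U> = (\<Union>U\<in>\<U>. X - V (S U))" using S by auto
    also have "\<dots> = X - V (\<Union>U\<in>\<U>. S U)" by (auto simp: V_def)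
    finally show "\<exists>R. \<Union>\<U> = X - V R" by blast
  qed
  then show ?thesis by (simp add: zariski_def V_def)
qed

lemma topspace_zariski [simp]: "topspace (zariski X) = X"
proof
  have "openin (zariski X) X"
    unfolding openin_zariski by (rule exI[of _ "{1}"]) auto
  then show "X \<subseteq> topspace (zariski X)" by (rule openin_subset)
  show "topspace (zariski X) \<subseteq> X"
    using openin_topspace[of "zariski X"] unfolding openin_zariski by blast
qed

definition irreducible_closed :: "'a topology \<Rightarrow> 'a set \<Rightarrow> bool" where
  "irreducible_closed T Z \<longleftrightarrow> closedin T Z \<and> Z \<noteq> {} \<and>
     (\<forall>C D. closedin T C \<and> closedin T D \<and> Z \<subseteq> C \<union> D \<longrightarrow> Z \<subseteq> C \<or> Z \<subseteq> D)"

text \<open>Codimension of an irreducible closed set \<open>Z\<close>: the supremum of the lengths of the chains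
  \<open>Z = Z\<^sub>0 \<subset> Z\<^sub>1 \<subset> \<dots> \<subset> Z\<^sub>c\<close> of irreducible closed sets.\<close>

definition codimension :: "'a topology \<Rightarrow> 'a set \<Rightarrow> enat" where
  "codimension T Z = Sup {enat c | c. \<exists>F :: nat \<Rightarrow> 'a set. F 0 = Z \<and>
     (\<forall>i\<le>c. irreducible_closed T (F i)) \<and> (\<forall>i<c. F i \<subset> F (Suc i))}"


section \<open>Nilpotent commutators and Jordan types\<close>

text \<open>Blocks in decreasing order of size; the order matters for the coordinates below.\<close>

definition jordan_blocks :: "nat multiset \<Rightarrow> (nat \<times> 'k::zero) list" where
  "jordan_blocks P = map (\<lambda>q. (q, 0)) (rev (sorted_list_of_multiset P))"

definition nilpotent_commutator :: "nat multiset \<Rightarrow> 'k::field mat set" where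
  "nilpotent_commutator Q = (let n = sum_mset Q; J = jordan_matrix (jordan_blocks Q) in
     {B \<in> carrier_mat n n. B ^\<^sub>m n = 0\<^sub>m n n \<and> B * J = J * B})"

definition has_jordan_type :: "'k::field mat \<Rightarrow> nat multiset \<Rightarrow> bool" where
  "has_jordan_type B P \<longleftrightarrow> jordan_nf B (jordan_blocks P)"

text \<open>\<open>generic_jordan_type TYPE('k) P Q\<close> is the relation \<open>\<DD>(P) = Q\<close> over the field \<open>'k\<close>; it is
  single-valued when \<open>'k\<close> is infinite, because the nilpotent commutator is then irreducible.\<close>

definition generic_jordan_type :: "'k::field itself \<Rightarrow> nat multiset \<Rightarrow> nat multiset \<Rightarrow> bool" where
  "generic_jordan_type _ P Q \<longleftrightarrow>
     (\<exists>U. openin (zariski (nilpotent_commutator P :: 'k mat set)) U \<and> U \<noteq> {} \<and>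
          (\<forall>B\<in>U. has_jordan_type B Q))"

definition jordan_locus :: "nat multiset \<Rightarrow> nat multiset \<Rightarrow> 'k::field mat set" where
  "jordan_locus Q P = {B \<in> nilpotent_commutator Q. has_jordan_type B P}"


section \<open>Coordinates for two-part partitions\<close>

datatype coord = Ca nat | Cb nat | Cg nat | Ch nat

definition coords :: "nat \<Rightarrow> nat \<Rightarrow> coord set" where
  "coords u r = Ca ` {1..<u} \<union> Cb ` {1..<u - r} \<union> Cg ` {0..<u - r} \<union> Ch ` {0..<u - r}"

text \<open>The coordinates of a matrix in the nilpotent commutator of \<open>(u, u - r)\<close>, read off from the first
  rows of the four blocks (each block is constant along its diagonals).  Matrix indices start at 0.
  The values are used only for the coordinates in \<^term>\<open>coords u r\<close>.\<close>

fun coord_val :: "nat \<Rightarrow> nat \<Rightarrow> 'k mat \<Rightarrow> coord \<Rightarrow> 'k" where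
  "coord_val u r B (Ca i) = B $$ (0, i)"
| "coord_val u r B (Cb i) = B $$ (u, u + i)"
| "coord_val u r B (Cg i) = B $$ (0, u + i)"
| "coord_val u r B (Ch i) = B $$ (u, r + i)"

definition coord_ring :: "nat \<Rightarrow> nat \<Rightarrow> (coord, 'k::field) mpol ring" where
  "coord_ring u r = \<lparr>carrier = {p. mvars p \<subseteq> coords u r}, mult = (*), one = 1, zero = 0, add = (+)\<rparr>"

lemma cring_coord_ring: "cring (coord_ring u r :: (coord, 'k::field) mpol ring)"
proof -
  let ?R = "coord_ring u r :: (coord, 'k) mpol ring"
  have add: "mvars (p + q) \<subseteq> V" if "mvars p \<subseteq> V" "mvars q \<subseteq> V" for p q :: "(coord, 'k) mpol" and V
    using that Poly_Mapping.keys_add[of p q] unfolding mvars_def by blast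
  have mult: "mvars (p * q) \<subseteq> V" if "mvars p \<subseteq> V" "mvars q \<subseteq> V" for p q :: "(coord, 'k) mpol" and V
  proof
    fix x assume "x \<in> mvars (p * q)"
    then obtain m where m: "m \<in> Poly_Mapping.keys (p * q)" "x \<in> Poly_Mapping.keys m"
      by (auto simp: mvars_def)
    then obtain a b where ab: "m = a + b" "a \<in> Poly_Mapping.keys p" "b \<in> Poly_Mapping.keys q"
      using keys_mult[of p q] by blast
    with m Poly_Mapping.keys_add[of a b] have "x \<in> mvars p \<union> mvars q"
      unfolding mvars_def by blast
    with that show "x \<in> V" by blast
  qed
  have uminus: "mvars (- p) = mvars p" for p :: "(coord, 'k) mpol"
  proof -
    have "Poly_Mapping.keys (- p) = Poly_Mapping.keys p" by (auto simp: in_keys_iff)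
    then show ?thesis by (simp add: mvars_def)
  qed
  have const: "mvars (0 :: (coord, 'k) mpol) = {}" "mvars (1 :: (coord, 'k) mpol) = {}"
    by (simp_all add: mvars_def)
  show ?thesis
  proof (rule cringI)
    show "abelian_group ?R"
    proof (rule abelian_groupI, goal_cases)
      case (6 p)
      then show ?case
        by (intro bexI[of _ "- p"]) (simp_all add: coord_ring_def uminus)
    qed (simp_all add: coord_ring_def add add_ac const)
    show "comm_monoid ?R"
      by (rule comm_monoidI) (simp_all add: coord_ring_def mult mult_ac const)
  qed (simp add: coord_ring_def distrib_right)
qed

definition vanishing_ideal :: "nat \<Rightarrow> nat \<Rightarrow> 'k::field mat set \<Rightarrow> (coord, 'k) mpol set" where
  "vanishing_ideal u r Z =
     {p \<in> carrier (coord_ring u r). \<forall>B\<in>Z. meval (coord_val u r B) p = 0}"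

definition zero_locus :: "nat \<Rightarrow> nat \<Rightarrow> (coord, 'k::field) mpol set \<Rightarrow> 'k mat set" where
  "zero_locus u r I =
     {B \<in> nilpotent_commutator {#u, u - r#}. \<forall>p\<in>I. meval (coord_val u r B) p = 0}"

text \<open>An irreducible complete intersection: its ideal in the coordinate ring (not just its underlying
  point set) is cut out by as many elements as its codimension.\<close>

definition irreducible_complete_intersection :: "nat \<Rightarrow> nat \<Rightarrow> 'k::field mat set \<Rightarrow> bool" where
  "irreducible_complete_intersection u r Z \<longleftrightarrow>
     (let T = zariski (nilpotent_commutator {#u, u - r#}) in
       irreducible_closed T Z \<and>
       (\<exists>F. finite F \<and> F \<subseteq> carrier (coord_ring u r) \<and>
            vanishing_ideal u r Z = genideal (coord_ring u r) F \<and>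
            codimension T Z = enat (card F)))"

definition box_equations :: "nat \<Rightarrow> nat \<Rightarrow> nat \<Rightarrow> (coord, 'k::field) mpol set" where
  "box_equations r k l =
     (if k + l \<le> r
      then (\<lambda>i. mvar (Ca i)) ` {1..k - 1} \<union> (\<lambda>i. mvar (Cb i)) ` {1..l - 1}
      else (\<lambda>i. mvar (Ca i)) ` {1..k - 1} \<union> (\<lambda>i. mvar (Cb i)) ` {1..r - k - 1} \<union>
        (\<lambda>m. \<Sum>j=0..m. mvar (Ca (k + j)) * mvar (Cb (r - k + m - j)) - mvar (Cg j) * mvar (Ch (m - j)))
          ` {0..k + l - r - 1})"

definition box_variety :: "nat \<Rightarrow> nat \<Rightarrow> nat \<Rightarrow> nat \<Rightarrow> 'k::field mat set" where
  "box_variety u r k l = zero_locus u r (genideal (coord_ring u r) (box_equations r k l))"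


section \<open>Burge codes\<close>

text \<open>\<open>right_members P n\<close> parses the frequencies \<open>f\<^sub>n, f\<^sub>n\<^sub>-\<^sub>1, \<dots>, f\<^sub>1\<close> from right to left.\<close>

fun right_members :: "nat multiset \<Rightarrow> nat \<Rightarrow> nat set" where
  "right_members P 0 = {}"
| "right_members P (Suc j) =
     (if count P (Suc j) > 0 then insert (Suc j) (right_members P (j - 1)) else right_members P j)"

text \<open>No part exceeds the sum of all parts, so the parsing may start there.\<close>

definition burge_R :: "nat multiset \<Rightarrow> nat set" where
  "burge_R P = right_members P (sum_mset P)"

definition burge_diff :: "nat multiset \<Rightarrow> nat multiset" where
  "burge_diff P = P - mset_set (burge_R P) + mset_set ((\<lambda>j. j - 1) ` (burge_R P - {1}))"

datatype burge_letter = Alpha | Beta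

text \<open>The letter with list index \<open>i\<close> belongs to the \<open>i\<close>-th iterate; the final letter (an \<open>Alpha\<close>)
  is the one of the empty partition.\<close>

definition burge_code :: "nat multiset \<Rightarrow> burge_letter list" where
  "burge_code P =
     map (\<lambda>i. if 1 \<in> burge_R ((burge_diff ^^ i) P) then Beta else Alpha)
       [0..<Suc (LEAST i. (burge_diff ^^ i) P = {#})]"

definition box_partition :: "nat \<Rightarrow> nat \<Rightarrow> nat \<Rightarrow> nat \<Rightarrow> nat multiset" where
  "box_partition u r k l = (THE P. is_partition P \<and>
     burge_code P = replicate (u - r - l) Alpha @ replicate l Beta @
       replicate (r - k) Alpha @ replicate k Beta @ [Alpha])"

end

theory Submission
  imports Defs
    "HOL-Combinatorics.List_Permutation"
    "Jordan_Normal_Form.Jordan_Normal_Form_Existence"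
    "HOL-Computational_Algebra.Formal_Power_Series"
begin

text \<open>A matrix commuting with \<open>J\<^sub>Q\<close> is a \<open>2 \<times> 2\<close> matrix \<open>A\<close> over \<open>k[[X]]\<close> with rows \<open>(a, X\<^sup>r g)\<close> and
  \<open>(h, b)\<close>, acting on \<open>k[X]/X\<^sup>u \<oplus> k[X]/X\<^sup>u\<^sup>-\<^sup>r\<close>.  The box equations say that \<open>X\<^sup>k\<close> divides \<open>a\<close>, that \<open>X\<^sup>m\<close>
  with \<open>m = min l (r - k)\<close> divides \<open>b\<close>, and that \<open>X\<^sup>k\<^sup>+\<^sup>l\<close> divides \<open>det A\<close>.  The coranks of the powers of
  \<open>A\<close> determine its Jordan type; as orders of minors they are bounded below on the box variety by
  those of \<open>P\<^sub>k\<^sub>,\<^sub>l\<close>, with equality at a generic point.  Conversely, a partition with \<open>\<DD>(P) = Q\<close> consists of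
  two almost rectangular clusters, and for these there is a grading of the Jordan basis that is raised
  by every nilpotent matrix commuting with \<open>J\<^sub>P\<close> (up to conjugation); it forces the three divisibilities
  on every \<open>A\<close> of type \<open>P\<close>.  The box equations have coprime leading monomials, which do not involve
  \<open>g\<^sub>0\<close>; since they can be solved for coordinates after inverting \<open>g\<^sub>0\<close>, their ideal is prime.  The
  codimension follows by comparing the growth of coordinate rings along chains.\<close>

text \<open>The field is merely infinite, so a prime ideal need not be the full vanishing ideal;
  this is secured by producing enough rational points: once \<open>g_0\<close> is nonzero, the box
  equations can be solved for some of the \<open>h_n\<close>. The hypothesis that \<open>Q\<close>
  is the generic type enters in two ways. Some matrix of type \<open>Q\<close> commutes with one of
  type \<open>P\<close>, and its corank 2 leaves at most two clusters of parts. And the generic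
  nilpotency index is the largest one occurring, which pins down \<open>u\<close> and hence
  \<open>Q\<close>. The constants for two clusters come from Oblak's formula for that index: the
  maximum, over almost rectangular subpartitions, of their size plus twice the number of larger
  parts. The candidates are the upper cluster, the lower cluster, and, for clusters at distance two,
  the middle pair of sizes; this is the source of the case distinction. Levels certify that no index
  exceeds \<open>u\<close>; that \<open>u\<close> is attained follows by realising \<open>P\<close>
  inside the commutator of \<open>Q\<close> and exchanging the two commuting matrices.\<close>

abbreviation "lookup \<equiv> Poly_Mapping.lookup"
abbreviation "keys \<equiv> Poly_Mapping.keys"
abbreviation "single \<equiv> Poly_Mapping.single"
abbreviation "sqm n \<equiv> carrier_mat n n"
type_synonym 'k cpol = "(coord, 'k) mpol"

section \<open>Partitions and Burge codes\<close>

text \<open>The corank of the \<open>i\<close>-th power of a nilpotent matrix of type \<open>P\<close>.\<close>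

definition prof :: "nat multiset => nat => nat" where
 "prof P i = (\<Sum>p\<in>#P. min i p)"

lemma prof_0 [simp]: "prof P 0 = 0"
 by (simp add: prof_def)

lemma prof_empty [simp]: "prof {#} i = 0"
 by (simp add: prof_def)

lemma prof_add [simp]: "prof (P + P') i = prof P i + prof P' i"
 by (simp add: prof_def)

lemma prof_add_mset [simp]: "prof (add_mset p P) i = min i p + prof P i"
 by (simp add: prof_def)

text \<open>As a function of \<open>i\<close>, \<open>min i p\<close> bends only at
  \<open>p\<close>; so the negated second differences of the profile are the frequencies, and the
  partition can be recovered from it.\<close>

lemma prof_count: "prof P j + prof P (j + 2) + count P (j + 1) = 2 * prof P (j + 1)"
proof (induction P)
 case (add x P)
 have "min j x + min (j + 2) x + of_bool (x = j + 1) = 2 * min (j + 1) x"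
  by (cases "x <= j"; cases "x = j + 1") (auto simp: min_def)
 then show ?case using add by auto
qed simp

lemma prof_1:
 assumes "is_partition P"
 shows "prof P 1 = size P"
 using assms unfolding is_partition_def by (induction P) auto

lemma prof_ge:
 assumes "\<And>p. p \<in># P ==> p <= i"
 shows "prof P i = sum_mset P"
 using assms by (induction P) (auto simp: min_absorb2)

lemma part_le_sum_mset: "p \<in># P ==> p <= sum_mset (P :: nat multiset)"
 by (subst sum_mset.remove[of p]) auto

lemma prof_inject:
 assumes "is_partition P" "is_partition P'" "\<And>i. prof P i = prof P' i"
 shows "P = P'"
proof (rule multiset_eqI)
 fix p
 show "count P p = count P' p"
 proof (cases p)
  case 0
  then show ?thesis using assms(1,2) by (simp add: is_partition_def not_in_iff)
 next
  case (Suc j)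
  then show ?thesis
   using prof_count[of P j] prof_count[of P' j] assms(3) by simp
 qed
qed

lemma right_members_bounds: "j \<in> right_members P n ==> 1 <= j \<and> j <= n"
 by (induction P n rule: right_members.induct) (auto split: if_splits)

text \<open>The greedy parse from the right turns into a local rule: a part is a right member
  exactly if its right neighbour has not taken it as a left member. All later arguments use this
  rule instead of the recursion.\<close>

lemma right_members_iff:
 "j \<in> right_members P n \<longleftrightarrow> 1 <= j \<and> j <= n \<and> count P j > 0 \<and> Suc j \<notin> right_members P n"
proof (induction P n rule: right_members.induct)
 case (2 P n)
 have b: "i \<in> right_members P (n - 1) ==> 1 <= i \<and> i <= n - 1" for i
  by (rule right_members_bounds)
 have b2: "i \<in> right_members P n ==> 1 <= i \<and> i <= n" for i
  by (rule right_members_bounds)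
 show ?case
 proof (cases "count P (Suc n) > 0")
  case True
  have "j \<in> right_members P (n - 1) \<longleftrightarrow>
    1 <= j \<and> j <= n - 1 \<and> 0 < count P j \<and> Suc j \<notin> right_members P (n - 1)"
   using 2(1) True by blast
  moreover have "Suc j \<notin> right_members P (n - 1)" if "j >= n" using b[of "Suc j"] that by auto
  ultimately show ?thesis using True b[of j]
   by (cases "j = Suc n"; cases "j = n"; cases "j > n") auto
 next
  case False
  have "j \<in> right_members P n \<longleftrightarrow> 1 <= j \<and> j <= n \<and> 0 < count P j \<and> Suc j \<notin> right_members P n"
   using 2(2) False by blast
  then show ?thesis using False b2[of j] b2[of "Suc j"]
   by (auto simp: le_Suc_eq)
 qed
qed simp

lemma finite_burge_R [simp]: "finite (burge_R P)"
 by (rule finite_subset[of _ "{..sum_mset P}"]) (auto simp: burge_R_def dest: right_members_bounds)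

lemma burge_R_iff: "j \<in> burge_R P \<longleftrightarrow> 1 <= j \<and> j \<in># P \<and> Suc j \<notin> burge_R P"
 unfolding burge_R_def
 using right_members_iff[of j P "sum_mset P"] part_le_sum_mset[of j P] by auto

lemma burge_R_D:
 assumes "j \<in> burge_R P"
 shows "1 <= j" "j \<in># P"
 using assms burge_R_iff[of j P] by blast+

text \<open>The local rule computes membership of \<open>j\<close> from that of
  \<open>Suc j\<close>, and no index above the sum is a part; descending induction therefore leaves
  only one solution.\<close>

lemma burge_R_eqI:
 assumes "\<And>j. j \<in> S \<longleftrightarrow> 1 <= j \<and> j \<in># P \<and> Suc j \<notin> S"
 shows "burge_R P = S"
proof -
 have "j \<in> burge_R P \<longleftrightarrow> j \<in> S" for j
 proof (induction "Suc (sum_mset P) - j" arbitrary: j)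
  case 0
  then have "j \<notin># P" using part_le_sum_mset[of j P] by auto
  then show ?case using burge_R_iff[of j P] assms[of j] by blast
 next
  case (Suc d)
  then have "Suc j \<in> burge_R P \<longleftrightarrow> Suc j \<in> S" by (intro Suc(1)) simp
  then show ?case using burge_R_iff[of j P] assms[of j] by blast
 qed
 then show ?thesis by blast
qed

lemma burge_R_subset: "mset_set (burge_R P) \<subseteq># P"
proof -
 have "burge_R P \<subseteq> set_mset P" using burge_R_D(2) by blast
 then have "mset_set (burge_R P) \<subseteq># mset_set (set_mset P)"
  by (intro subset_imp_msubset_mset_set) auto
 then show ?thesis by (rule subset_mset.trans) (rule mset_set_set_mset_msubset)
qed

lemma count_burge_diff:
 assumes "j >= 1"
 shows "count (burge_diff P) j + of_bool (j \<in> burge_R P) = count P j + of_bool (Suc j \<in> burge_R P)"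
proof -
 have "j \<in> (\<lambda>j. j - 1) ` (burge_R P - {1}) \<longleftrightarrow> Suc j \<in> burge_R P"
 proof
  assume "j \<in> (\<lambda>j. j - 1) ` (burge_R P - {1})"
  then obtain i where "i \<in> burge_R P" "j = i - 1" by blast
  then show "Suc j \<in> burge_R P" using burge_R_D(1)[of i P] by simp
 next
  assume "Suc j \<in> burge_R P"
  then show "j \<in> (\<lambda>j. j - 1) ` (burge_R P - {1})"
   using assms by (intro image_eqI[of _ _ "Suc j"]) auto
 qed
 moreover have "of_bool (j \<in> burge_R P) <= count P j"
  using burge_R_D(2)[of j P] by (cases "j \<in> burge_R P") (simp_all add: Suc_le_eq)
 ultimately show ?thesis
  by (auto simp: burge_diff_def count_mset_set')
qed

lemma is_partition_burge_diff:
 assumes "is_partition P"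
 shows "is_partition (burge_diff P)"
proof -
 have "0 \<notin> (\<lambda>j. j - 1) ` (burge_R P - {1})"
  using burge_R_D(1)[of _ P] by (fastforce simp: image_iff)
 moreover have "0 \<notin># P - mset_set (burge_R P)"
  using assms in_diffD[of 0 P "mset_set (burge_R P)"] by (auto simp: is_partition_def)
 ultimately show ?thesis
  by (simp add: is_partition_def burge_diff_def)
qed

lemma prof_mset_set: "finite A ==> prof (mset_set A) i = (\<Sum>j\<in>A. min i j)"
 by (simp add: prof_def sum_unfold_sum_mset)

text \<open>Lowering a part \<open>j\<close> by one lowers \<open>min i j\<close> exactly when
  \<open>j <= i\<close>. A right member 1 disappears altogether, which the profile does not notice
  since a part 0 contributes nothing.\<close>

lemma prof_burge_diff: "prof (burge_diff P) i + card (burge_R P \<inter> {..i}) = prof P i"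
proof -
 let ?R = "burge_R P"
 have 1: "prof P i = prof (P - mset_set ?R) i + (\<Sum>j\<in>?R. min i j)"
  using prof_add[of "P - mset_set ?R" "mset_set ?R" i] burge_R_subset[of P]
  by (simp add: prof_mset_set)
 have pos: "j >= 1" if "j \<in> ?R" for j using that burge_R_D(1) by blast
 have inj: "inj_on (\<lambda>j. j - 1) (?R - {1})"
  using pos by (intro inj_onI) (metis DiffD1 le_add_diff_inverse)
 have "(\<Sum>j\<in>?R. min i j) = (\<Sum>j\<in>?R. min i (j - 1) + of_bool (j <= i))"
  using pos by (intro sum.cong) (fastforce simp: min_def)+
 also have "\<dots> = (\<Sum>j\<in>?R. min i (j - 1)) + card (?R \<inter> {..i})"
  by (simp add: sum.distrib of_bool_def sum.If_cases atMost_def)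
 also have "(\<Sum>j\<in>?R. min i (j - 1)) = (\<Sum>j\<in>?R - {1}. min i (j - 1))"
  by (intro sum.mono_neutral_right) auto
 also have "\<dots> = prof (mset_set ((\<lambda>j. j - 1) ` (?R - {1}))) i"
  by (subst prof_mset_set, simp, subst sum.reindex[OF inj]) (simp add: o_def)
 finally show ?thesis using 1 by (simp add: burge_diff_def)
qed

lemma burge_R_nonempty:
 assumes "is_partition P" "P \<noteq> {#}"
 shows "burge_R P \<noteq> {}"
proof -
 define m where "m = Max (set_mset P)"
 have m: "m \<in># P" "\<And>p. p \<in># P ==> p <= m"
  using assms(2) by (auto simp: m_def)
 have "m >= 1" using m(1) assms(1) by (cases m) (auto simp: is_partition_def)
 moreover have "Suc m \<notin> burge_R P" using m(2)[of "Suc m"] burge_R_iff[of "Suc m" P] by auto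
 ultimately show ?thesis using burge_R_iff[of m P] m(1) by blast
qed

lemma burge_diff_sum_less:
 assumes "is_partition P" "P \<noteq> {#}"
 shows "sum_mset (burge_diff P) < sum_mset P"
proof -
 let ?i = "sum_mset P + sum_mset (burge_diff P)"
 have "burge_R P \<inter> {..?i} = burge_R P"
  using part_le_sum_mset[of _ P] burge_R_D(2)[of _ P] by (auto intro: trans_le_add1)
 then have "card (burge_R P \<inter> {..?i}) > 0"
  using burge_R_nonempty[OF assms] by (simp add: card_gt_0_iff)
 moreover have "prof P ?i = sum_mset P" "prof (burge_diff P) ?i = sum_mset (burge_diff P)"
  using part_le_sum_mset by (intro prof_ge; fastforce)+
 ultimately show ?thesis using prof_burge_diff[of P ?i] by linarith
qed

lemma burge_diff_terminates:
 assumes "is_partition P"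
 shows "\<exists>i. (burge_diff ^^ i) P = {#}"
 using assms
proof (induction "sum_mset P" arbitrary: P rule: less_induct)
 case less
 show ?case
 proof (cases "P = {#}")
  case True
  then show ?thesis by (intro exI[of _ 0]) simp
 next
  case False
  then obtain i where "(burge_diff ^^ i) (burge_diff P) = {#}"
   using less(1)[OF burge_diff_sum_less is_partition_burge_diff] less(2) by blast
  then show ?thesis by (intro exI[of _ "Suc i"]) (simp add: funpow_swap1)
 qed
qed

lemma burge_code_empty: "burge_code {#} = [Alpha]"
proof -
 have "(LEAST i. (burge_diff ^^ i) ({#} :: nat multiset) = {#}) = 0"
  by (rule Least_eq_0) simp
 moreover have "burge_R {#} = {}" by (simp add: burge_R_def)
 ultimately show ?thesis by (simp add: burge_code_def)
qed

lemma burge_code_neq_Nil: "burge_code P \<noteq> []"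
 unfolding burge_code_def by (simp only: map_is_Nil_conv upt_eq_Nil_conv) simp

lemma burge_code_Cons:
 assumes "is_partition P" "P \<noteq> {#}"
 shows "burge_code P = (if 1 \<in> burge_R P then Beta else Alpha) # burge_code (burge_diff P)"
proof -
 obtain i where i: "(burge_diff ^^ i) P = {#}" using burge_diff_terminates[OF assms(1)] ..
 have "(LEAST i. (burge_diff ^^ i) P = {#}) = Suc (LEAST i. (burge_diff ^^ Suc i) P = {#})"
 proof (rule Least_Suc)
  show "(burge_diff ^^ i) P = {#}" by (rule i)
  show "(burge_diff ^^ 0) P \<noteq> {#}" using assms(2) by simp
 qed
 then have *: "(LEAST i. (burge_diff ^^ i) P = {#}) = Suc (LEAST i. (burge_diff ^^ i) (burge_diff P) = {#})"
  unfolding funpow_Suc_right o_apply .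
 have upt: "[0..<Suc (Suc n)] = 0 # map Suc [0..<Suc n]" for n
  by (subst upt_conv_Cons) (simp_all add: map_Suc_upt del: upt_Suc)
 show ?thesis
  unfolding burge_code_def * upt list.map map_map o_def funpow_Suc_right
  by simp
qed

text \<open>Reading the frequencies of \<^term>\<open>burge_diff P\<close> from left to right recovers the pairs.\<close>

lemma burge_diff_inject:
 assumes P: "is_partition P" and P': "is_partition P'"
  and diff: "burge_diff P = burge_diff P'" and one: "1 \<in> burge_R P \<longleftrightarrow> 1 \<in> burge_R P'"
 shows "P = P'"
proof -
 have rec: "Suc j \<in> burge_R X \<longleftrightarrow> j \<in># burge_diff X \<and> j \<notin> burge_R X"
  if "is_partition X" "j >= 1" for j X
 proof
  assume "Suc j \<in> burge_R X"
  moreover from this have "j \<notin> burge_R X" using burge_R_iff[of j X] by blast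
  moreover from calculation have "count (burge_diff X) j > 0"
   using count_burge_diff[OF that(2), of X] by (simp del: count_greater_zero_iff)
  ultimately show "j \<in># burge_diff X \<and> j \<notin> burge_R X" by simp
 next
  assume *: "j \<in># burge_diff X \<and> j \<notin> burge_R X"
  show "Suc j \<in> burge_R X"
  proof (rule ccontr)
   assume **: "Suc j \<notin> burge_R X"
   have "count (burge_diff X) j > 0" using * by simp
   then have "count X j > 0"
    using count_burge_diff[OF that(2), of X] * ** by (simp del: count_greater_zero_iff)
   then show False using burge_R_iff[of j X] * ** that(2) by auto
  qed
 qed
 have R: "j \<in> burge_R P \<longleftrightarrow> j \<in> burge_R P'" for j
 proof (induction j)
  case 0
  then show ?case using burge_R_iff[of 0] by auto
 next
  case (Suc j)
  then show ?case using rec[OF P, of j] rec[OF P', of j] diff one by (cases "j = 0") auto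
 qed
 show ?thesis
 proof (rule multiset_eqI)
  fix j
  show "count P j = count P' j"
  proof (cases "j = 0")
   case True
   then show ?thesis using P P' by (simp add: is_partition_def not_in_iff)
  next
   case False
   then show ?thesis using count_burge_diff[of j P] count_burge_diff[of j P'] R diff
    by auto
  qed
 qed
qed

lemma burge_code_inject:
 assumes "is_partition P" "is_partition P'" "burge_code P = burge_code P'"
 shows "P = P'"
 using assms
proof (induction "sum_mset P" arbitrary: P P' rule: less_induct)
 case less
 have ne: "burge_code X \<noteq> [Alpha]" if "is_partition X" "X \<noteq> {#}" for X
  by (subst burge_code_Cons[OF that]) (simp add: burge_code_neq_Nil)
 show ?case
 proof (cases "P = {#} \<or> P' = {#}")
  case True
  then show ?thesis
  proof
   assume "P = {#}"
   then show ?thesis using ne[OF less.prems(2)] less.prems(3) burge_code_empty by auto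
  next
   assume "P' = {#}"
   then show ?thesis using ne[OF less.prems(1)] less.prems(3) burge_code_empty by auto
  qed
 next
  case False
  then have ne: "P \<noteq> {#}" "P' \<noteq> {#}" by auto
  have eq: "(if 1 \<in> burge_R P then Beta else Alpha) # burge_code (burge_diff P) =
    (if 1 \<in> burge_R P' then Beta else Alpha) # burge_code (burge_diff P')"
   using less.prems(3)
   unfolding burge_code_Cons[OF less.prems(1) ne(1)] burge_code_Cons[OF less.prems(2) ne(2)] .
  then have *: "burge_code (burge_diff P) = burge_code (burge_diff P')" by (simp only: list.inject)
  have "1 \<in> burge_R P \<longleftrightarrow> 1 \<in> burge_R P'"
   using eq unfolding list.inject by (cases "1 \<in> burge_R P"; cases "1 \<in> burge_R P'") simp_all
  moreover have "burge_diff P = burge_diff P'"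
   by (rule less.hyps[OF burge_diff_sum_less[OF less.prems(1) ne(1)]
      is_partition_burge_diff[OF less.prems(1)] is_partition_burge_diff[OF less.prems(2)] *])
  ultimately show ?thesis using burge_diff_inject[OF less.prems(1,2)] by simp
 qed
qed

section \<open>Burge codes of the profiles with two bends\<close>

lemma min_diff_nat: "min (a - c) (b - c) = min a b - (c :: nat)"
 by (simp add: min_def)

text \<open>The profile of \<^const>\<open>box_partition\<close>, as the corank function of a generic point of the
 box variety; the clause for \<open>0\<close> is needed since the third entry has an offset.\<close>

definition nu :: "nat => nat => nat => nat => nat => nat" where
 "nu u r k l i = (if i = 0 then 0 else
  min (min (i * (k + l)) (u - r + i * k))
    (min (u + i * min l (r - k) - 2 * min l (r - k)) (2 * u - r)))"

lemma nu_eq: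
 assumes "i >= 1"
 shows "nu u r k l i = min (i * (k + l)) (min (min (u - r + i * k)
  (u + i * min l (r - k) - 2 * min l (r - k))) (2 * u - r))"
proof -
 have "i \<noteq> 0" using assms by simp
 then show ?thesis unfolding nu_def by (simp only: if_False min.assoc)
qed

definition box_word :: "nat => nat => nat => nat => burge_letter list" where
 "box_word u r k l = replicate (u - r - l) Alpha @ replicate l Beta @
   replicate (r - k) Alpha @ replicate k Beta @ [Alpha]"

lemma replicate_append_inject:
 assumes "replicate n a @ b # xs = replicate n' a @ b # xs'" "a \<noteq> b"
 shows "n = n' \<and> xs = xs'"
 using assms
proof (induction n arbitrary: n')
 case 0
 then show ?case by (cases n') auto
next
 case (Suc n)
 then show ?case by (cases n') auto
qed

lemma box_word_inject:
 assumes eq: "box_word u r k l = box_word u' r' k' l'"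
  and v: "1 <= k" "k < r" "1 <= l" "l <= u - r" "r < u" "1 <= k'" "k' < r'" "1 <= l'" "l' <= u' - r'" "r' < u'"
 shows "u = u' \<and> r = r' \<and> k = k' \<and> l = l'"
proof -
 have w: "box_word u r k l = replicate (u - r - l) Alpha @ Beta # (replicate (l - 1) Beta @
   Alpha # (replicate (r - k - 1) Alpha @ Beta # (replicate (k - 1) Beta @ Alpha # [])))"
  if "1 <= k" "k < r" "1 <= l" for u r k l
 proof -
  have a: "replicate k Beta = Beta # replicate (k - 1) Beta" using that by (cases k) auto
  have b: "replicate l Beta = Beta # replicate (l - 1) Beta" using that by (cases l) auto
  have c: "replicate (r - k) Alpha = Alpha # replicate (r - k - 1) Alpha"
   using that by (cases "r - k") auto
  show ?thesis unfolding box_word_def a b c by simp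
 qed
 note E = eq[unfolded w[OF v(1,2,3)] w[OF v(6,7,8)]]
 have ne: "Alpha \<noteq> Beta" "Beta \<noteq> Alpha" by simp_all
 note E1 = replicate_append_inject[OF E ne(1)]
 note E2 = replicate_append_inject[OF E1[THEN conjunct2] ne(2)]
 note E3 = replicate_append_inject[OF E2[THEN conjunct2] ne(1)]
 note E4 = replicate_append_inject[OF E3[THEN conjunct2] ne(2)]
 have k: "k = k'" using E4[THEN conjunct1] v(1,6) by simp
 have l: "l = l'" using E2[THEN conjunct1] v(3,8) by simp
 have r: "r = r'" using E3[THEN conjunct1] v(2,7) k by simp
 have "u = u'" using E1[THEN conjunct1] v(4,5,9,10) r l by simp
 then show ?thesis using k l r by blast
qed

lemma two_jumps_burge_R:
 assumes j: "1 <= j2" "j2 + 2 <= j1" "j2 \<in># P" "j1 \<in># P"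
  and z: "\<And>i. 1 <= i ==> i \<in># P ==> i \<in> {j2 - 1, j2, j1 - 1, j1}"
 shows "burge_R P = {j2, j1}"
proof (rule burge_R_eqI)
 fix i
 show "i \<in> {j2, j1} \<longleftrightarrow> 1 <= i \<and> i \<in># P \<and> Suc i \<notin> {j2, j1}"
 proof
  assume "i \<in> {j2, j1}"
  then show "1 <= i \<and> i \<in># P \<and> Suc i \<notin> {j2, j1}" using j by (elim insertE) simp_all
 next
  assume *: "1 <= i \<and> i \<in># P \<and> Suc i \<notin> {j2, j1}"
  then have "i \<in> {j2 - 1, j2, j1 - 1, j1}" by (intro z) simp_all
  with * j(1,2) show "i \<in> {j2, j1}" by (elim insertE) simp_all
 qed
qed

text \<open>The profile is the line of slope \<open>k + l\<close> up to \<open>j2\<close>, then the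
  concave function \<open>K = min L1 L2\<close> up to \<open>j1\<close>, then the constant
  \<open>L3\<close>; the right members are the two bends. Subtracting one from \<open>K\<close> and
  two from \<open>L3\<close> reproduces the formula with \<open>u - 1\<close> for \<open>u\<close>.
  The letter is \<open>Beta\<close> exactly when the first bend is at 1, and then \<open>l\<close>
  drops as well.\<close>

lemma nu_burge_step:
 assumes P: "is_partition P" and nu: "\<And>i. prof P i = nu u r k l i"
  and v: "1 <= k" "k < r" "1 <= l" "l <= u - r" "r < u"
 shows "1 \<in> burge_R P \<longleftrightarrow> l = u - r"
  and "prof (burge_diff P) i = nu (u - 1) r k (if l = u - r then l - 1 else l) i"
proof -
 define c where "c = min l (r - k)"
 define L1 where "L1 i = u - r + i * k" for i
 define L2 where "L2 i = u + i * c - 2 * c" for i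
 define K where "K i = min (L1 i) (L2 i)" for i
 define L3 where "L3 = 2 * u - r"
 have c: "1 <= c" "c <= l" "c <= r - k" "2 * c < u" using v by (auto simp: c_def)
 have nuK: "nu u r k l i = min (i * (k + l)) (min (K i) L3)" if "i >= 1" for i
  unfolding nu_eq[OF that] K_def L1_def L2_def L3_def c_def ..
 have L2_eq: "L2 (Suc i) = L2 i + c" for i using c by (simp add: L2_def)
 have L1_eq: "L1 (Suc i) = L1 i + k" for i by (simp add: L1_def)
 have K_mono: "K i <= K j" if "i <= j" for i j
  using that by (induction rule: dec_induct) (auto simp: K_def L1_eq L2_eq)
 have K_conc: "K i + K (i + 2) <= 2 * K (i + 1)" for i
 proof -
  have "K i <= L1 i" "K i <= L2 i" "K (i + 2) <= L1 i + 2 * k" "K (i + 2) <= L2 i + 2 * c"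
   by (simp_all add: K_def L1_eq L2_eq numeral_2_eq_2)
  moreover have "K (i + 1) = L1 i + k \<or> K (i + 1) = L2 i + c"
   by (simp add: K_def L1_eq L2_eq min_def)
  ultimately show ?thesis by linarith
 qed
 have K0: "K 0 > 0" using v c by (simp add: K_def L1_def L2_def)
 define j2 where "j2 = (LEAST i. 1 <= i \<and> K i <= i * (k + l))"
 define j1 where "j1 = (LEAST i. L3 <= K i)"
 have "K u <= u * (k + l)"
 proof -
  have "K u <= u - r + u * k" by (simp add: K_def L1_def)
  also have "\<dots> <= u * l + u * k" using v by (intro add_mono) (auto simp: le_trans[of _ u])
  finally show ?thesis by (simp add: algebra_simps)
 qed
 then have j2: "1 <= j2" "K j2 <= j2 * (k + l)" and j2_least: "\<And>i. 1 <= i ==> i < j2 ==> i * (k + l) < K i"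
  using LeastI[of "\<lambda>i. 1 <= i \<and> K i <= i * (k + l)" u] not_less_Least[of _ "\<lambda>i. 1 <= i \<and> K i <= i * (k + l)"] v
  unfolding j2_def by force+
 have "L3 <= K (u + 2)"
 proof -
  have "u <= u * k" "u <= u * c" using v c by simp_all
  then have "L3 <= L1 (u + 2)" "L3 <= L2 (u + 2)"
   unfolding L1_def L2_def L3_def distrib_right by linarith+
  then show ?thesis by (simp add: K_def)
 qed
 then have j1: "L3 <= K j1" and j1_least: "\<And>i. i < j1 ==> K i < L3"
  unfolding j1_def by (rule LeastI) (use not_less_Least in "simp add: not_le[symmetric]")
 have K_le: "K i <= i * (k + l)" if "j2 <= i" for i
 proof (cases "L1 j2 <= L2 j2")
  case True
  then have "u - r <= j2 * l" using j2(2) by (simp add: K_def L1_def algebra_simps)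
  also have "\<dots> <= i * l" using that by simp
  finally show ?thesis by (simp add: K_def L1_def algebra_simps min_le_iff_disj)
 next
  case False
  then have *: "L2 j2 <= j2 * (k + l)" using j2(2) by (simp add: K_def)
  have "L2 i <= i * (k + l)" using that
  proof (induction rule: dec_induct)
   case (step n)
   then show ?case using c v by (simp add: L2_eq)
  qed (rule *)
  then show ?thesis by (simp add: K_def)
 qed
 \<comment> \<open>If \<open>K\<close> had reached the total at \<open>j2 + 1\<close>, then
   \<open>L2\<close> would give \<open>u - r <= (j2 - 1) * l\<close>, and so \<open>L1\<close> would
   meet the line of slope \<open>k + l\<close> already at \<open>j2 - 1\<close>, against the
   minimality of \<open>j2\<close>.\<close>
 have gap: "j2 + 2 <= j1"
 proof -
  have "K (j2 + 1) < L3"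
  proof (rule ccontr)
   assume "\<not> K (j2 + 1) < L3"
   then have "L3 <= L2 (j2 + 1)" by (simp add: K_def)
   then have *: "u - r <= (j2 - 1) * c"
    using c j2(1) v by (cases j2) (auto simp: L2_def L3_def)
   then have "j2 >= 2" using v j2(1) by (cases "j2 = 1") auto
   have "u - r <= (j2 - 1) * l" by (rule le_trans[OF * mult_le_mono2[OF c(2)]])
   then have "L1 (j2 - 1) <= (j2 - 1) * (k + l)" by (simp add: L1_def distrib_left)
   then have "K (j2 - 1) <= (j2 - 1) * (k + l)" by (simp add: K_def)
   moreover have "1 <= j2 - 1" "j2 - 1 < j2" using \<open>j2 >= 2\<close> by linarith+
   ultimately show False using j2_least[of "j2 - 1"] by linarith
  qed
  then show ?thesis using K_mono[of j1 "j2 + 1"] j1 by (cases "j1 <= j2 + 1") auto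
 qed
 have nu1: "nu u r k l i = i * (k + l)" if "i < j2" for i
 proof (cases "i = 0")
  case False
  then have "i * (k + l) < K i" "K i < L3" using j2_least[of i] j1_least[of i] that gap by simp_all
  then show ?thesis using False by (simp add: nuK)
 qed (simp add: nu_def)
 have nu2: "nu u r k l i = K i" if "j2 <= i" "i < j1" for i
 proof -
  have "K i <= i * (k + l)" "K i < L3" "1 <= i"
   using K_le[OF that(1)] j1_least[OF that(2)] that(1) j2(1) by simp_all
  then show ?thesis by (simp add: nuK)
 qed
 have nu3: "nu u r k l i = L3" if "j1 <= i" for i
 proof -
  have "K i <= i * (k + l)" "L3 <= K i" "1 <= i"
   using K_le[of i] K_mono[OF that] j1 that gap j2(1) by simp_all
  then show ?thesis by (simp add: nuK)
 qed
 have cnt: "prof P j + prof P (j + 2) + count P (j + 1) = 2 * prof P (j + 1)" for j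
  by (rule prof_count)
 \<comment> \<open>Strictly between the bends \<open>K\<close> has to be linear, so that no further
   part occurs. Only a sign change of \<open>D = L2 - L1\<close> could prevent this. It requires
   \<open>k > c\<close>, and if it happens between the bends (the third case below), then
   \<open>c = l\<close> and \<open>j1 <= j2 + 2\<close>, so that there is no such
   \<open>i\<close>.\<close>
 have lin: "K (i - 1) + K (i + 1) = 2 * K i" if i: "j2 < i" "i + 1 < j1" for i
 proof -
  define D where "D i = int (L2 i) - int (L1 i)" for i
  have D_Suc: "D (Suc i) = D i + (int c - int k)" for i by (simp add: D_def L1_eq L2_eq)
  have lin': "K (i - 1) + K (i + 1) = 2 * K i"
   if "(D (i - 1) >= 0 \<and> D i >= 0 \<and> D (i + 1) >= 0) \<or> (D (i - 1) <= 0 \<and> D i <= 0 \<and> D (i + 1) <= 0)" "i >= 1"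
   using that L1_eq[of "i - 1"] L1_eq[of i] L2_eq[of "i - 1"] L2_eq[of i]
   by (auto simp: K_def D_def)
  have i1: "i >= 1" using i by simp
  have Dlin: "D (j + d) = D j + int d * (int c - int k)" for j d
   by (induction d) (simp_all add: D_Suc algebra_simps)
  show ?thesis
  proof (cases "k <= c")
   case True
   have "D 1 >= 0" using c v by (simp add: D_def L1_def L2_def)
   then have "D (1 + d) >= 0" for d unfolding Dlin using True by simp
   then have "D j >= 0" if "j >= 1" for j using that le_Suc_ex by blast
   then show ?thesis using i j2(1) by (intro lin' disjI1) simp_all
  next
   case False
   have mono: "D b <= D a" if "a <= b" for a b
    using that False Dlin[of a "b - a"] by (simp add: mult_nonneg_nonpos)
   consider "D j2 <= 0" | "D (j1 - 1) >= 0" | "D j2 > 0" "D (j1 - 1) < 0" by linarith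
   then show ?thesis
   proof cases
    case 1
    then have "D b <= 0" if "j2 <= b" for b using mono[OF that] by linarith
    then show ?thesis using i by (intro lin' disjI2) simp_all
   next
    case 2
    then have "D b >= 0" if "b <= j1 - 1" for b using mono[OF that] by linarith
    then show ?thesis using i by (intro lin' disjI1) simp_all
   next
    case 3
    have "c = l"
    proof (rule ccontr)
     assume "c \<noteq> l"
     then have "c = r - k" by (auto simp: c_def)
     then have "D 1 = 0" using v c by (simp add: D_def L1_def L2_def)
     then show False using mono[OF j2(1)] 3 by simp
    qed
    have "L1 j2 <= j2 * (k + l)" using K_le[of j2] 3(1) by (simp add: K_def D_def)
    then have "u - r <= j2 * c" using \<open>c = l\<close> by (simp add: L1_def distrib_left)
    then have L2: "L3 <= L2 (j2 + 2)" using v by (simp add: L2_def L3_def)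
    have "j1 <= j2 + 2"
    proof (cases "D (j2 + 2) <= 0")
     case True
     then have "L3 <= K (j2 + 2)" using L2 by (simp add: K_def D_def)
     then show ?thesis using j1_least[of "j2 + 2"] by linarith
    next
     case False
     then have "j2 + 2 <= j1 - 1" using mono[of "j1 - 1" "j2 + 2"] 3 by linarith
     then have "(j2 + 2) * c <= (j1 - 1) * c" by (rule mult_le_mono1)
     then have "L2 (j2 + 2) <= L2 (j1 - 1)" unfolding L2_def by (intro diff_le_mono add_left_mono)
     then have "L3 <= K (j1 - 1)" using L2 3 by (simp add: K_def D_def)
     then show ?thesis using j1_least[of "j1 - 1"] gap by simp
    qed
    then show ?thesis using i by simp
   qed
  qed
 qed
 have R: "burge_R P = {j2, j1}"
 proof (rule two_jumps_burge_R[OF j2(1) gap])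
  have "nu u r k l (j2 - 1) < K (j2 - 1)"
  proof (cases "j2 = 1")
   case True
   then show ?thesis using K0 by (simp add: nu_def)
  next
   case False
   then have "1 <= j2 - 1" "j2 - 1 < j2" using j2(1) by linarith+
   then show ?thesis using j2_least[of "j2 - 1"] nu1[of "j2 - 1"] by simp
  qed
  moreover have "nu u r k l j2 = K j2" "nu u r k l (j2 + 1) = K (j2 + 1)"
   using gap by (intro nu2; simp)+
  ultimately have "count P (j2 - 1 + 1) > 0"
   using cnt[of "j2 - 1"] K_conc[of "j2 - 1"] j2(1) unfolding nu by (simp del: count_greater_zero_iff)
  then show "j2 \<in># P" using j2(1) by simp
  show "j1 \<in># P"
  proof -
   have "nu u r k l (j1 - 1) = K (j1 - 1)" using gap by (intro nu2) simp_all
   moreover have "nu u r k l j1 = L3" "nu u r k l (j1 + 1) = L3" by (intro nu3; simp)+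
   moreover have "K (j1 - 1) < L3" using gap by (intro j1_least) simp
   ultimately have "count P (j1 - 1 + 1) > 0"
    using cnt[of "j1 - 1"] gap unfolding nu by (simp del: count_greater_zero_iff)
   then show ?thesis using gap by simp
  qed
  fix i assume i: "1 <= i" "i \<in># P"
  then have pos: "nu u r k l (i - 1) + nu u r k l (i + 1) < 2 * nu u r k l i"
  proof -
   have "count P (i - 1 + 1) > 0" using i by simp
   then show ?thesis using cnt[of "i - 1"] i(1) unfolding nu by (simp del: count_greater_zero_iff)
  qed
  show "i \<in> {j2 - 1, j2, j1 - 1, j1}"
  proof (rule ccontr)
   assume "i \<notin> {j2 - 1, j2, j1 - 1, j1}"
   then have "i \<noteq> j2 - 1" "i \<noteq> j2" "i \<noteq> j1 - 1" "i \<noteq> j1" by simp_all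
   then consider "i + 1 < j2" | "j2 < i" "i + 1 < j1" | "i > j1" using gap by linarith
   then show False
   proof cases
    case 1
    obtain i' where "i = Suc i'" using i(1) by (cases i) simp_all
    then show False using pos nu1[of i'] nu1[of "Suc i'"] nu1[of "Suc (Suc i')"] 1 by simp
   next
    case 2
    then have "nu u r k l (i - 1) = K (i - 1)" "nu u r k l i = K i" "nu u r k l (i + 1) = K (i + 1)"
     by (intro nu2; simp)+
    then show False using pos lin[OF 2] by simp
   next
    case 3
    then have "nu u r k l (i - 1) = L3" "nu u r k l i = L3" "nu u r k l (i + 1) = L3"
     by (intro nu3; simp)+
    then show False using pos by simp
   qed
  qed
 qed
 have K1: "K 1 = u - r + k" using v c by (simp add: K_def L1_def L2_def)
 have j2_1: "j2 = 1 \<longleftrightarrow> l = u - r"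
 proof
  assume "j2 = 1"
  then have "K 1 <= k + l" using j2(2) by simp
  then show "l = u - r" using K1 v(4) by linarith
 next
  assume "l = u - r"
  then have "K 1 <= 1 * (k + l)" using K1 by simp
  then show "j2 = 1" using j2_least[of 1] j2(1) by (cases "1 < j2") linarith+
 qed
 show "1 \<in> burge_R P \<longleftrightarrow> l = u - r" using R j2_1 gap by auto
 have card: "prof (burge_diff P) i + (of_bool (j2 <= i) + of_bool (j1 <= i)) = nu u r k l i"
 proof -
  have "card ({j2, j1} \<inter> {..i}) = of_bool (j2 <= i) + of_bool (j1 <= i)" using gap by auto
  then show ?thesis using prof_burge_diff[of P i] R nu by simp
 qed
 have L: "L1 i - 1 = u - 1 - r + i * k" "L2 i - 1 = u - 1 + i * c - 2 * c" "L3 - 2 = 2 * (u - 1) - r" for i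
  using v c by (simp_all add: L1_def L2_def L3_def)
 \<comment> \<open>Lowering \<open>L1\<close> and \<open>L2\<close> by one and \<open>L3\<close> by
   two turns them into the entries for \<open>u - 1\<close>. If \<open>l = u - r\<close>, the line
   of the new slope stays above \<open>L1 - 1\<close> and drops out of the minimum; and replacing
   \<open>c\<close> by \<open>c'\<close> alters the third entry only where it is not the
   smallest.\<close>
 have nu': "nu (u - 1) r k (if l = u - r then l - 1 else l) i =
   (if l = u - r then min (K i - 1) (L3 - 2) else min (i * (k + l)) (min (K i - 1) (L3 - 2)))" if i: "1 <= i" for i
 proof (cases "l = u - r")
  case False
  then show ?thesis unfolding nu_eq[OF i] K_def min_diff_nat[symmetric] L c_def by (simp only: if_False)
 next
  case True
  define c' where "c' = min (l - 1) (r - k)"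
  define e where "e = u - 1 + i * c' - 2 * c'"
  have "1 * (l - 1) <= i * (l - 1)" using i by (intro mult_le_mono) auto
  then have le: "L1 i - 1 <= i * (k + (l - 1))" unfolding L using True by (simp add: algebra_simps)
  have "e = L2 i - 1 \<or> (L1 i - 1 <= e \<and> L1 i - 1 <= L2 i - 1) \<or> (L3 - 2 <= e \<and> L3 - 2 <= L2 i - 1)"
  proof (cases "c' = c \<or> i = 2")
   case True
   then show ?thesis by (elim disjE) (simp_all only: e_def L diff_add_inverse2 simp_thms)
  next
   case False
   then have cl: "c = l" "c' = l - 1" by (auto simp: c'_def c_def)
   show ?thesis
   proof (cases "i = 1")
    case 1: True
    have "L1 i - 1 <= e" "L1 i <= L2 i" using c v True cl unfolding 1 e_def L1_def L2_def by linarith+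
    then show ?thesis using diff_le_mono[of "L1 i" "L2 i" 1] by blast
   next
    case 1: False
    then obtain d where d: "i = d + 3" using i False le_Suc_ex[of 3 i] by (auto simp: add.commute)
    have "L2 i = u + (d + 1) * l" using c cl by (simp add: L2_def d algebra_simps)
    moreover have "e = u - 1 + (d + 1) * c'" by (simp add: e_def d algebra_simps)
    then have "e = u - 1 + (d + 1) * (l - 1)" using cl by simp
    moreover have "l <= (d + 1) * l" "l - 1 <= (d + 1) * (l - 1)" by simp_all
    moreover have "L3 = u + l" using True v by (simp add: L3_def)
    ultimately have "L3 - 2 <= e" "L3 - 2 <= L2 i - 1" using v by linarith+
    then show ?thesis by blast
   qed
  qed
  then have "min (L1 i - 1) (min e (L3 - 2)) = min (L1 i - 1) (min (L2 i - 1) (L3 - 2))" by (auto simp: min_def)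
  moreover have "min a (min (min b d) f) = min b (min d f)" if "b <= a" for a b d f :: nat
   using that by (simp add: min_def)
  from this[OF le] have "nu (u - 1) r k (l - 1) i = min (L1 i - 1) (min e (L3 - 2))"
   unfolding nu_eq[OF i] c'_def[symmetric] e_def L .
  ultimately show ?thesis using True unfolding K_def min_diff_nat[symmetric] min.assoc by (simp only: if_True simp_thms)
 qed
 consider "i = 0" | "1 <= i" "i < j2" | "1 <= i" "j2 <= i" "i < j1" | "1 <= i" "j1 <= i" by linarith
 then show "prof (burge_diff P) i = nu (u - 1) r k (if l = u - r then l - 1 else l) i"
 proof cases
  case 1
  then show ?thesis by (simp add: nu_def)
 next
  case 2
  then have "i * (k + l) < K i" "K i < L3" "l \<noteq> u - r" using j2_least[of i] j1_least[of i] gap j2_1 by simp_all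
  then show ?thesis using card nu1[of i] 2 gap unfolding nu'[OF 2(1)] by simp
 next
  case 3
  then have "K i <= i * (k + l)" "K i < L3" using K_le[of i] j1_least[of i] by simp_all
  then show ?thesis using card nu2[of i] 3 unfolding nu'[OF 3(1)] by simp
 next
  case 4
  then have "L3 <= K i" "K i <= i * (k + l)" using K_le[of i] K_mono[OF 4(2)] j1 gap by simp_all
  then show ?thesis using card nu3[of i] 4 gap unfolding nu'[OF 4(1)] by simp
 qed
qed

text \<open>The analogue of \<open>nu_burge_step\<close> for one cluster: the profile bends only
  where the line of slope \<open>k\<close> reaches \<open>r\<close>, so there is a single right
  member.\<close>

lemma almost_rectangular_burge_step:
 assumes P: "is_partition P" and prof: "\<And>i. prof P i = min (i * k) r" and v: "1 <= k" "k <= r"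
 shows "1 \<in> burge_R P \<longleftrightarrow> k = r"
  and "prof (burge_diff P) i = min (i * (if k = r then k - 1 else k)) (r - 1)"
proof -
 define j where "j = (LEAST i. r <= i * k)"
 have "r <= r * k" using v by simp
 then have j: "r <= j * k" and j_least: "\<And>i. i < j ==> i * k < r"
  using LeastI[of "\<lambda>i. r <= i * k" r] not_less_Least[of _ "\<lambda>i. r <= i * k"]
  unfolding j_def by force+
 have j1: "1 <= j" using j v by (cases j) auto
 have ge: "r <= i * k" if "j <= i" for i using that j by (meson le_trans mult_le_mono1)
 have pos: "j \<in># P"
  using prof_count[of P "j - 1"] prof j j1 j_least[of "j - 1"] ge[of "j + 1"]
  by (simp flip: count_greater_zero_iff)
 have R: "burge_R P = {j}"
 proof (rule burge_R_eqI)
  fix i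
  show "i \<in> {j} \<longleftrightarrow> 1 <= i \<and> i \<in># P \<and> Suc i \<notin> {j}"
  proof -
   have "i \<in> {j - 1, j}" if i: "1 <= i" "i \<in># P"
   proof (rule ccontr)
    assume "i \<notin> {j - 1, j}"
    then consider "i + 1 < j" | "j < i" by fastforce
    then have "2 * prof P i = prof P (i - 1) + prof P (i + 1)"
    proof cases
     case 1
     then show ?thesis using prof j_least[of "i - 1"] j_least[of i] j_least[of "i + 1"] i
      by (cases i) (auto simp: algebra_simps)
    next
     case 2
     then show ?thesis using prof ge[of "i - 1"] ge[of i] ge[of "i + 1"] by simp
    qed
    then show False using prof_count[of P "i - 1"] i by (simp flip: count_greater_zero_iff)
   qed
   then show ?thesis using pos j1 by auto
  qed
 qed
 have j_1: "j = 1 \<longleftrightarrow> k = r" using j j1 j_least[of 1] v by (cases "j = 1") auto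
 then show "1 \<in> burge_R P \<longleftrightarrow> k = r" using R by auto
 have card: "prof (burge_diff P) i + of_bool (j <= i) = min (i * k) r"
  using prof_burge_diff[of P i] R prof by (cases "j <= i") simp_all
 show "prof (burge_diff P) i = min (i * (if k = r then k - 1 else k)) (r - 1)"
 proof (cases "k = r")
  case True
  then have "j = 1" using j_1 by simp
  then show ?thesis using card True v by (cases i) auto
 next
  case False
  then show ?thesis using card ge[of i] j_least[of i] by (cases "j <= i") auto
 qed
qed

lemma burge_code_almost_rectangular:
 assumes "is_partition P" "\<And>i. prof P i = min (i * k) r" "k <= r" "k = 0 \<longleftrightarrow> r = 0"
 shows "burge_code P = replicate (r - k) Alpha @ replicate k Beta @ [Alpha]"
 using assms
proof (induction r arbitrary: P k)
 case 0
 then have "P = {#}"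
  by (intro prof_inject) (simp_all add: is_partition_def)
 then show ?case using 0 by (simp add: burge_code_empty)
next
 case (Suc r)
 have k: "1 <= k" using Suc.prems by (cases k) auto
 have ne: "P \<noteq> {#}" using Suc.prems(2)[of 1] k by auto
 note step = almost_rectangular_burge_step[OF Suc.prems(1,2) k Suc.prems(3)]
 note code = burge_code_Cons[OF Suc.prems(1) ne]
 show ?case
 proof (cases "k = Suc r")
  case True
  have "burge_code (burge_diff P) = replicate (r - r) Alpha @ replicate r Beta @ [Alpha]"
   using step(2) True by (intro Suc.IH is_partition_burge_diff Suc.prems(1)) simp_all
  then show ?thesis using code step(1) True by simp
 next
  case False
  have "burge_code (burge_diff P) = replicate (r - k) Alpha @ replicate k Beta @ [Alpha]"
   using step(2) False k Suc.prems(3) by (intro Suc.IH is_partition_burge_diff Suc.prems(1)) simp_all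
  then show ?thesis using code step(1) False Suc.prems(3) by (simp add: Suc_diff_le)
 qed
qed

text \<open>Each derivative lowers \<open>u\<close>, and once \<open>l = u - r\<close> also
  \<open>l\<close>. When \<open>l = 0\<close> and \<open>u = r\<close>, the profile has become
  \<open>min (i * k) r\<close>, and the code of that almost rectangular partition supplies the
  remaining runs.\<close>

lemma burge_code_nu:
 assumes "is_partition P" "\<And>i. prof P i = nu u r k l i"
  "1 <= k" "k < r" "l <= u - r" "l = 0 \<longleftrightarrow> u = r" "r <= u"
 shows "burge_code P = box_word u r k l"
 using assms
proof (induction u arbitrary: P l)
 case (Suc u)
 show ?case
 proof (cases "l = 0")
  case True
  then have "prof P i = min (i * k) r" for i
   using Suc.prems by (cases i) (simp_all add: nu_def)
  then show ?thesis using burge_code_almost_rectangular[of P k r] Suc.prems True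
   by (simp add: box_word_def)
 next
  case False
  then have v: "1 <= l" "r < Suc u" using Suc.prems by auto
  have ne: "P \<noteq> {#}" using Suc.prems(2)[of 1] Suc.prems(3) v Suc.prems(4) by (auto simp: nu_def)
  note step = nu_burge_step[OF Suc.prems(1-4) v(1) Suc.prems(5) v(2)]
  note code = burge_code_Cons[OF Suc.prems(1) ne]
  define l' where "l' = (if l = Suc u - r then l - 1 else l)"
  have "burge_code (burge_diff P) = box_word u r k l'"
  proof (rule Suc.IH)
   show "is_partition (burge_diff P)" by (rule is_partition_burge_diff[OF Suc.prems(1)])
   show "prof (burge_diff P) i = nu u r k l' i" for i using step(2)[of i] by (simp add: l'_def)
  qed (use v Suc.prems(3-7) in "auto simp: l'_def")
  moreover have "box_word (Suc u) r k l = (if l = Suc u - r then Beta else Alpha) # box_word u r k l'"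
  proof (cases "l = Suc u - r")
   case True
   then have "l = Suc (u - r)" using v by simp
   then show ?thesis using True by (simp add: l'_def box_word_def)
  next
   case False
   then have "Suc u - r - l = Suc (u - r - l)" using Suc.prems v by simp
   then show ?thesis using False by (simp add: l'_def box_word_def)
  qed
  ultimately show ?thesis using code step(1) by simp
 qed
qed simp

lemma box_partition_eqI:
 assumes "is_partition P" "\<And>i. prof P i = nu u r k l i" "1 <= k" "k < r" "1 <= l" "l <= u - r" "r < u"
 shows "box_partition u r k l = P"
proof -
 have code: "burge_code P = box_word u r k l"
  using assms(3-7) by (intro burge_code_nu[OF assms(1,2)]) simp_all
 show ?thesis
  unfolding box_partition_def box_word_def[symmetric]
 proof (rule the_equality)
  show "is_partition P \<and> burge_code P = box_word u r k l" using assms(1) code by blast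
  show "P' = P" if "is_partition P' \<and> burge_code P' = box_word u r k l" for P'
   by (rule burge_code_inject[OF _ assms(1)]) (use that code in simp_all)
 qed
qed

lemma nu_inject:
 assumes "is_partition P" "\<And>i. prof P i = nu u r k l i" "\<And>i. prof P i = nu u' r' k' l' i"
  and v: "1 <= k" "k < r" "1 <= l" "l <= u - r" "r < u" "1 <= k'" "k' < r'" "1 <= l'" "l' <= u' - r'" "r' < u'"
 shows "u = u' \<and> r = r' \<and> k = k' \<and> l = l'"
proof (rule box_word_inject[OF _ v])
 have "burge_code P = box_word u r k l" using v by (intro burge_code_nu[OF assms(1,2)]) simp_all
 moreover have "burge_code P = box_word u' r' k' l'" using v by (intro burge_code_nu[OF assms(1,3)]) simp_all
 ultimately show "box_word u r k l = box_word u' r' k' l'" by (rule trans[OF sym])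
qed

section \<open>Unions of two almost rectangular partitions\<close>

text \<open>Position \<open>p\<close> in a Jordan block is counted from its cyclic generator.  Blocks are listed in decreasing
 order of size; \<open>T_move\<close> describes the entries that may be nonzero in a nilpotent matrix commuting with
 the Jordan matrix, after triangularisation of its diagonal parts.\<close>

definition T_move :: "(nat => nat) => nat => nat => nat => nat => bool" where
 "T_move sz s p t q \<longleftrightarrow> (if s < t then p <= q else p < q \<and> p + sz t <= q + sz s)"

text \<open>The first clause makes nilpotent matrices commuting with the Jordan matrix raise the level.  The last
 one bounds the number of positions at low or high levels, which later forces \<open>b\<close> to be divisible.\<close>

definition good_levels ::
  "nat => (nat => nat) => nat => nat => nat => nat => (nat => nat => nat) => bool" where
 "good_levels b sz u r k l lev \<longleftrightarrow>
  (\<forall>s<b. \<forall>t<b. \<forall>p<sz s. \<forall>q<sz t. T_move sz s p t q --> lev s p < lev t q) \<and>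
  (\<forall>s<b. \<forall>p<sz s. lev s p < u) \<and>
  (\<forall>s<b. \<forall>p<sz s. 1 <= p --> k <= lev s p) \<and>
  (if min l (r - k) <= k
   then (\<forall>s<b. lev s 0 = s) \<and> (\<forall>s<min l (r - k). 2 <= sz s \<and> lev s 1 = k + s) \<and>
    (\<forall>s<b. \<forall>p. p + 1 < sz s \<and> k <= lev s p --> k + min l (r - k) <= lev s (p + 1))
   else (\<forall>s<b. \<forall>p<sz s. u <= k + lev s p --> p + 1 = sz s) \<and>
    (\<exists>s<b. \<exists>p. p + 1 < sz s \<and> lev s p + k + 1 = u) \<and>
    card {(s, p). s < b \<and> p < sz s \<and> u <= lev s p + k + 1} <= k + 1)"

text \<open>The condition \<open>n + r = 2 * u\<close> says that \<open>u\<close> and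
  \<open>u - r\<close> add up to the size \<open>n\<close>, and \<open>k + l = b\<close> that the
  parameters account for all blocks.\<close>

definition box_data :: "nat => (nat => nat) => (nat => nat) => nat => bool" where
 "box_data b sz pf n \<longleftrightarrow> (\<exists>u r k l lev. n + r = 2 * u \<and> 1 <= k \<and> k < r \<and> 1 <= l \<and> l <= u - r \<and> r < u \<and>
  k + l = b \<and> (\<forall>i. pf i = nu u r k l i) \<and> good_levels b sz u r k l lev)"

lemma far_less: "p + d <= q ==> s < t + d * c ==> p * c + s < q * c + (t :: nat)"
 using mult_le_mono1[of "p + d" q c] unfolding distrib_right by linarith

text \<open>The basic candidate for a level is \<open>p * c + s\<close>, which numbers the positions
  row by row with \<open>c\<close> per row. A move within a row increases the block index, and a
  move to a later row gains at least \<open>c\<close>; this can fall short only when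
  \<open>s >= t + c\<close>.\<close>

lemma move_less: "T_move sz s p t q ==> s < t + c ==> p * c + s < q * c + t"
 using far_less[of p 0 q s t c] far_less[of p 1 q s t c] by (cases "s < t") (simp_all add: T_move_def)

lemma nu_eqI:
 assumes "1 <= i" "v <= i * (k + l)" "v <= u - r + i * k"
  "v + 2 * min l (r - k) <= u + i * min l (r - k)" "v <= 2 * u - r"
  "v = i * (k + l) \<or> v = u - r + i * k \<or> v + 2 * min l (r - k) = u + i * min l (r - k) \<or> v = 2 * u - r"
 shows "v = nu u r k l i"
proof -
 define c where "c = min l (r - k)"
 define d where "d = u + i * c - 2 * c"
 have "v <= d" "v + 2 * c = u + i * c --> v = d"
  using assms(4) unfolding c_def[symmetric] d_def by linarith+
 then show ?thesis
  unfolding nu_eq[OF assms(1)] c_def[symmetric] d_def[symmetric]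
  using assms(2,3,5,6) unfolding c_def[symmetric]
  by (metis min.absorb1 min.absorb2 min.boundedI)
qed

locale two_clusters =
 fixes j j' x y z w :: nat
 assumes x: "1 <= x" and z: "1 <= z" and j': "1 <= j'" and gap: "j' + 2 <= j" and w: "j' = 1 ==> w = 0"
begin

definition "m = x + y"
definition "m' = z + w"
definition "N = (j - 1) * m + x"
definition "N' = (j' - 1) * m' + z"
definition "sz s = (if s < x then j else if s < m then j - 1 else if s < m + z then j' else j' - 1)"
definition "pf i = x * min i j + y * min i (j - 1) + z * min i j' + w * min i (j' - 1)"

lemma m_pos: "1 <= m" "x <= m" "1 <= m'" "z <= m'"
 using x z by (simp_all add: m_def m'_def)

lemma m'_le: "m' <= N'"
proof (cases "j' = 1")
 case False
 then have "1 * m' <= (j' - 1) * m'" using j' by (intro mult_le_mono1) simp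
 then show ?thesis unfolding N'_def by linarith
next
 case True
 then have "w = 0" using w by simp
 then show ?thesis unfolding m'_def N'_def by linarith
qed

lemma sz_cases:
 assumes "s < m + m'"
 obtains "s < x" "sz s = j" | "x <= s" "s < m" "sz s = j - 1" | "m <= s" "s < m + z" "sz s = j'"
  | "m + z <= s" "sz s = j' - 1"
 using assms m_pos unfolding sz_def by (metis not_le order_less_le_trans)

lemma mult_pred: "1 <= a ==> (a - 1) * c + c = a * (c :: nat)"
 by (cases a) simp_all

lemma N_alt: "x * j + y * (j - 1) = N" and N'_alt: "z * j' + w * (j' - 1) = N'"
proof -
 have "1 <= j" using gap by linarith
 then show "x * j + y * (j - 1) = N"
  unfolding N_def m_def distrib_left using mult_pred[of j x] mult.commute[of x j] mult.commute[of y "j - 1"]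
  by linarith
 show "z * j' + w * (j' - 1) = N'"
  unfolding N'_def m'_def distrib_left
  using mult_pred[OF j', of z] mult.commute[of z j'] mult.commute[of w "j' - 1"] by linarith
qed

lemma pf_low: "pf i = i * (m + m')" if "i < j'"
 using that gap by (simp add: pf_def m_def m'_def algebra_simps)

lemma pf_mid: "pf i = N' + i * m" if "j' <= i" "i < j"
proof -
 have "min i j = i" "min i (j - 1) = i" "min i j' = j'" "min i (j' - 1) = j' - 1" using that by auto
 then show ?thesis using N'_alt by (simp add: pf_def m_def algebra_simps)
qed

lemma pf_high: "pf i = N + N'" if "j <= i"
proof -
 have "min i j = j" "min i (j - 1) = j - 1" "min i j' = j'" "min i (j' - 1) = j' - 1"
  using that gap by auto
 then show ?thesis using N_alt N'_alt by (simp add: pf_def)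
qed

lemma N_le: "N <= j * m"
proof -
 have "(j - 1) * m + m = j * m" using gap by (intro mult_pred) linarith
 then show ?thesis using m_pos unfolding N_def by linarith
qed

lemma N'_le: "N' <= j' * m'"
 using mult_pred[OF j', of m'] m_pos unfolding N'_def by linarith

lemma pf_le_slope: "pf i <= N' + i * m"
proof -
 consider "i < j'" | "j' <= i" "i < j" | "j <= i" by linarith
 then show ?thesis
 proof cases
  case 1
  then have "i * m' <= (j' - 1) * m'" by (intro mult_le_mono1) simp
  then show ?thesis unfolding pf_low[OF 1] N'_def distrib_left by linarith
 next
  case 3
  then have "j * m <= i * m" by simp
  then show ?thesis using pf_high[OF 3] N_le by linarith
 qed (simp add: pf_mid)
qed

lemma pf_le_blocks: "pf i <= i * (m + m')"
proof -
 consider "i < j'" | "j' <= i" by linarith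
 then show ?thesis
 proof cases
  case 2
  then have "j' * m' <= i * m'" by simp
  then show ?thesis using pf_le_slope[of i] N'_le unfolding distrib_left by linarith
 qed (simp add: pf_low)
qed

lemma pf_le_total: "pf i <= N + N'"
proof (cases "j <= i")
 case False
 then have "i * m <= (j - 1) * m" by (intro mult_le_mono1) simp
 then show ?thesis using pf_le_slope[of i] unfolding N_def by linarith
qed (simp add: pf_high)

text \<open>The initial slope and the final value agree with the first and last entries of
  \<open>nu\<close>. It remains to bound the profile by the other two entries and to attain one of
  them on the middle piece. For \<open>i = 1\<close> the third bound follows from the second,
  because \<open>min l (r - k) <= r - k\<close>.\<close>

lemma pf_eq_nu:
 assumes "N + N' + r = 2 * u" "k + l = m + m'" "k < r" "r < u" "1 <= k"
  and L1: "\<And>i. 1 <= i ==> pf i <= u - r + i * k"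
  and L2: "\<And>i. 2 <= i ==> pf i + 2 * min l (r - k) <= u + i * min l (r - k)"
  and eq: "\<And>i. j' <= i ==> i < j ==> pf i = u - r + i * k \<or> pf i + 2 * min l (r - k) = u + i * min l (r - k)"
 shows "pf i = nu u r k l i"
proof (cases "i = 0")
 case False
 show ?thesis
 proof (rule nu_eqI)
  show i: "1 <= i" using False by simp
  show "pf i <= i * (k + l)" using pf_le_blocks[of i] assms(2) by simp
  show "pf i <= u - r + i * k" by (rule L1[OF i])
  show "pf i + 2 * min l (r - k) <= u + i * min l (r - k)"
  proof (cases "i = 1")
   case True
   have "min l (r - k) <= r - k" by simp
   then show ?thesis using L1[of 1] True assms(3,4) by simp
  next
   case False
   then show ?thesis using i by (intro L2) simp
  qed
  show "pf i <= 2 * u - r" using pf_le_total[of i] assms(1) by simp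
  show "pf i = i * (k + l) \<or> pf i = u - r + i * k \<or>
    pf i + 2 * min l (r - k) = u + i * min l (r - k) \<or> pf i = 2 * u - r"
  proof -
   consider "i < j'" | "j' <= i" "i < j" | "j <= i" by linarith
   then show ?thesis
   proof cases
    case 1
    then show ?thesis using pf_low assms(2) by simp
   next
    case 2
    then show ?thesis using eq by blast
   next
    case 3
    then show ?thesis using pf_high[OF 3] assms(1) by linarith
   qed
  qed
 qed
qed (simp add: nu_def pf_def)

lemma j_facts: "3 <= j" "(j - 1) * m = (j - 2) * m + m" "(j - 2) * m = (j - 3) * m + m"
 "(j' - 1) * c + c = j' * c"
proof -
 show "3 <= j" using gap j' by simp
 then have "j - 1 = Suc (j - 2)" "j - 2 = Suc (j - 3)" by linarith+
 then show "(j - 1) * m = (j - 2) * m + m" "(j - 2) * m = (j - 3) * m + m"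
  by (simp_all only: mult_Suc add.commute)
 show "(j' - 1) * c + c = j' * c" using j' by (rule mult_pred)
qed

lemma N_bound:
 assumes "s < m" "p < sz s"
 shows "p * m + s < N"
proof (cases "s < x")
 case True
 then have "p * m <= (j - 1) * m" using assms by (intro mult_le_mono1) (simp add: sz_def)
 then show ?thesis using True unfolding N_def by linarith
next
 case False
 then have "p * m <= (j - 2) * m" using assms by (intro mult_le_mono1) (simp add: sz_def)
 then show ?thesis using assms(1) j_facts(2) unfolding N_def by linarith
qed

lemma N'_bound:
 assumes "m <= s" "s < m + m'" "p < sz s"
 shows "p * m' + s < N' + m"
proof (cases "s < m + z")
 case True
 then have "p * m' <= (j' - 1) * m'" using assms m_pos by (intro mult_le_mono1) (simp add: sz_def)
 then show ?thesis using True unfolding N'_def by linarith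
next
 case False
 then have "(p + 1) * m' <= (j' - 1) * m'" using assms m_pos by (intro mult_le_mono1) (simp add: sz_def)
 then show ?thesis using assms(2) z unfolding N'_def distrib_right by linarith
qed

text \<open>The upper cluster attains the index, so \<open>u = N\<close>, and the lower cluster is
  the second part, \<open>u - r = N'\<close>. The slopes are \<open>k = m\<close> and
  \<open>l = m'\<close>, and plain row numbering with \<open>m\<close> per row is a level
  function.\<close>

lemma case_i:
 assumes mm: "m' < m" and far: "j' + 3 <= j \<or> z <= x"
 shows "box_data (m + m') sz pf (N + N')"
proof -
 have far': "j' + 3 <= j \<or> (j' + 2 = j \<and> z <= x)" using far gap by linarith
 have NN: "N' + 2 * m <= N"
  using far'
 proof
  assume 3: "j' + 3 <= j"
  then have "j' * m' <= (j - 3) * m" using mm by (intro mult_le_mono) linarith+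
  then show ?thesis using N'_le x j_facts(2,3) unfolding N_def by linarith
 next
  assume *: "j' + 2 = j \<and> z <= x"
  then have "(j' - 1) * m' <= (j - 3) * m" using mm by (intro mult_le_mono) linarith+
  then show ?thesis using * j_facts(2,3) unfolding N_def N'_def by linarith
 qed
 define r where "r = N - N'"
 have r: "N + N' + r = 2 * N" "m + m' <= r" "N - r = N'" using NN mm unfolding r_def by linarith+
 have c: "min m' (r - m) = m'" using r(2) by simp
 have N': "1 <= N'" using m'_le m_pos by simp
 have lt_j: "N' + 2 * m' <= (j - 1) * m' + x"
  using far'
 proof
  assume "j' + 3 <= j"
  then have "(j' + 2) * m' <= (j - 1) * m'" by (intro mult_le_mono1) linarith
  then show ?thesis using N'_le unfolding distrib_right by linarith
 next
  assume *: "j' + 2 = j \<and> z <= x"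
  then have "j - 1 = j' + 1" by linarith
  then have "(j - 1) * m' = j' * m' + m'" by simp
  then show ?thesis using * j_facts(4)[of m'] unfolding N'_def by linarith
 qed
 define lev where "lev s p = p * m + s" for s p
 have "pf i = nu N r m m' i" for i
 proof (rule pf_eq_nu)
  show "N + N' + r = 2 * N" "m + m' = m + m'" "m < r" "r < N" "1 <= m"
   using r m_pos N' by (simp_all add: r_def)
  show "pf i <= N - r + i * m" for i using pf_le_slope[of i] r(3) by simp
  show "pf i = N - r + i * m \<or> pf i + 2 * min m' (r - m) = N + i * min m' (r - m)"
   if "j' <= i" "i < j" for i
   using pf_mid[OF that] r(3) by simp
  fix i :: nat assume i: "2 <= i"
  show "pf i + 2 * min m' (r - m) <= N + i * min m' (r - m)"
   unfolding c
  proof (cases "j <= i")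
   case True
   then have "(j' + 2) * m' <= i * m'" using gap by (intro mult_le_mono1) linarith
   then show "pf i + 2 * m' <= N + i * m'" using pf_high[OF True] N'_le unfolding distrib_right by linarith
  next
   case False
   show "pf i + 2 * m' <= N + i * m'"
   proof -
    have "i <= j - 1" using False by linarith
    then obtain e where e: "j - 1 = i + e" using le_Suc_ex by blast
    have "e * m' <= e * m" using mm by simp
    moreover have "N' + 2 * m' <= (i + e) * m' + x" using lt_j unfolding e .
    moreover have "N = (i + e) * m + x" unfolding N_def e ..
    ultimately show ?thesis using pf_le_slope[of i] unfolding distrib_right by linarith
   qed
  qed
 qed
 moreover have "good_levels (m + m') sz N r m m' lev"
  unfolding good_levels_def c
 proof (intro conjI allI impI, goal_cases)
  case (1 s t p q)
  show ?case
  proof (cases "s < t + m")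
   case True
   then show ?thesis unfolding lev_def by (rule move_less[OF 1(5)])
  next
   \<comment> \<open>Here the move leads from the lower to the upper cluster. It skips a row unless
     the block sizes differ by one only, which means sizes \<open>j'\<close> and
     \<open>j - 1 = j' + 1\<close>; then \<open>z <= x\<close> forces \<open>s < t + m\<close> after
     all.\<close>
   case False
   then have pq: "p < q" "p + sz t <= q + sz s" and st: "m <= s" "t < m" using 1 mm by (simp_all add: T_move_def)
   show ?thesis
   proof (cases "p + 2 <= q")
    case True
    then show ?thesis unfolding lev_def by (rule far_less) (use 1(1) mm in linarith)
   next
    case p: False
    then have d: "sz t <= sz s + 1" using pq by simp
    have "sz s <= j'" "s < m + z \<or> sz s = j' - 1" using st m_pos by (auto simp: sz_def)
    moreover have "sz t = j \<or> (x <= t \<and> sz t = j - 1)" using st by (auto simp: sz_def)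
    ultimately have "x <= t" "s < m + z" "z <= x" using d far' j' gap by linarith+
    then show ?thesis using False by linarith
   qed
  qed
 next
  case (2 s p)
  show ?case using 2(1)
  proof (cases rule: sz_cases)
   case 1
   then show ?thesis unfolding lev_def using m_pos 2(2) by (intro N_bound) linarith+
  next
   case 2
   then show ?thesis unfolding lev_def using \<open>p < sz s\<close> by (intro N_bound)
  next
   case 3
   then have "p * m <= (j' - 1) * m" using 2 by (intro mult_le_mono1) simp
   then have "p * m + s < j' * m + z" using 3 j_facts(4)[of m] by linarith
   moreover have "j' * m + z <= N"
    using far'
   proof
    assume "j' + 3 <= j"
    then have "j' * m <= (j - 3) * m" by (intro mult_le_mono1) linarith
    then show ?thesis using m_pos mm j_facts(2,3) unfolding N_def by linarith
   next
    assume *: "j' + 2 = j \<and> z <= x"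
    then have "j' * m <= (j - 2) * m" by (intro mult_le_mono1) linarith
    then show ?thesis using * j_facts(2) unfolding N_def by linarith
   qed
   ultimately show ?thesis unfolding lev_def by linarith
  next
   case 4
   then have "p + 2 <= j'" using 2(2) by linarith
   then have "(p + 2) * m <= (j - 2) * m" using gap by (intro mult_le_mono1) linarith
   then show ?thesis using 2(1) mm j_facts(2) m_pos x unfolding lev_def N_def distrib_right by linarith
  qed
 next
  case (3 s p)
  then show ?case using mult_le_mono1[of 1 p m] unfolding lev_def by linarith
 next
  case 4
  have "2 <= sz s \<and> lev s 1 = m + s" if "s < m'" for s
  proof
   have "sz s = j \<or> sz s = j - 1" using that mm by (simp add: sz_def)
   then show "2 <= sz s" using j_facts(1) by linarith
  qed (simp add: lev_def)
  then show ?case using mm by (simp add: lev_def)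
 qed
 ultimately show ?thesis
  unfolding box_data_def using r m_pos m'_le N'
  by (intro exI[of _ N] exI[of _ r] exI[of _ m] exI[of _ m'] exI[of _ lev]) simp
qed

text \<open>The index is \<open>N\<close> or \<open>N' + 2 * m\<close>: a chain through the lower
  cluster can be prolonged at both ends by the \<open>m\<close> upper blocks. The excess of
  \<open>u\<close> over \<open>N\<close> is \<open>\<delta>\<close>, and
  \<open>k = min m' (m + \<delta>)\<close> is the level that position 1 of block 0 receives
  below.\<close>

lemma case_ii:
 assumes mm: "m <= m'" and far: "j' + 3 <= j \<or> y <= w"
 shows "box_data (m + m') sz pf (N + N')"
proof -
 have far': "j' + 3 <= j \<or> (j' + 2 = j \<and> y <= w)" using far gap by linarith
 define u where "u = max N (N' + 2 * m)"
 define \<delta> where "\<delta> = u - N"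
 define k where "k = min m' (m + \<delta>)"
 define l where "l = m + m' - k"
 define r where "r = 2 * u - (N + N')"
 define c where "c = min l (r - k)"
 have u: "N <= u" "N' + 2 * m <= u" "u = N \<or> u = N' + 2 * m" by (simp_all add: u_def max_def)
 have N3: "3 * m <= N"
 proof (cases "4 <= j")
  case True
  then have "3 * m <= (j - 1) * m" by (intro mult_le_mono1) linarith
  then show ?thesis unfolding N_def by linarith
 next
  case False
  then have "j = 3" "j' = 1" using gap j' by linarith+
  then have "w = 0" "y <= w" using w far' by linarith+
  then have "x = m" unfolding m_def by linarith
  then show ?thesis using \<open>j = 3\<close> unfolding N_def by simp
 qed
 have N': "m' <= N'" by (rule m'_le)
 have u_lt: "u < N + N'" using u(3) N' N3 m_pos by linarith
 have r: "N + N' + r = 2 * u" "r + N + N' = 2 * u" "r = \<delta> + (u - N')" "2 * m + \<delta> <= r" "u - r = N + N' - u" "r < u"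
  using u u_lt unfolding r_def \<delta>_def by linarith+
 have k: "m <= k" "k <= m'" "k <= m + \<delta>" "k = m' \<or> k = m + \<delta>" using mm by (simp_all add: k_def min_def)
 have kl: "k + l = m + m'" "m <= l" using k by (simp_all add: l_def)
 have k_lt: "1 <= k" "k < r" using k r m_pos by linarith+
 have l_le: "l <= u - r"
  using u k kl(1) N' N3 mm unfolding r(5) \<delta>_def by linarith
 have c_ge: "m <= c" unfolding c_def using kl(2) r(4) k(3) by simp
 have c_eq: "c = m" if "u = N' + 2 * m"
 proof -
  have "r = \<delta> + 2 * m" using r(3) that by simp
  then have "l = m \<or> r - k = m" using k(4) kl(1) by linarith
  then show ?thesis using c_ge unfolding c_def by linarith
 qed
 have nu: "pf i = nu u r k l i" for i
 proof (rule pf_eq_nu)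
  fix i :: nat assume i: "1 <= i"
  show "pf i <= u - r + i * k"
  proof (cases "u = N")
   case True
   have "i * m <= i * k" using k(1) by simp
   then show ?thesis using pf_le_slope[of i] True unfolding r(5) by linarith
  next
   case False
   then have ub: "u = N' + 2 * m" using u(3) by blast
   have e: "u - r = N - 2 * m" using r(5) ub N3 by linarith
   show ?thesis
    using k(4)
   proof
    assume "k = m + \<delta>"
    moreover have "1 * \<delta> <= i * \<delta>" using i by (intro mult_le_mono1)
    ultimately have "i * m + \<delta> <= i * k" by (simp only: distrib_left)
    then show ?thesis using pf_le_slope[of i] N3 u(1) e ub \<delta>_def by linarith
   next
    assume km: "k = m'"
    consider "i < j'" | "j' <= i" "i < j" | "j <= i" by linarith
    then have "pf i + 2 * m <= N + i * m'"
    proof cases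
     case 1
     then have "(i + 2) * m <= (j - 1) * m" using gap by (intro mult_le_mono1) linarith
     then show ?thesis unfolding pf_low[OF 1] N_def distrib_left distrib_right by linarith
    next
     case 2
     obtain e where e: "i = j' + e" using le_Suc_ex[OF 2(1)] by blast
     have em: "e * m <= e * m'" using mm by simp
     have "N' + j' * m + 2 * m <= N + j' * m'"
      using far'
     proof
      assume "j' + 3 <= j"
      then have "(j' + 2) * m <= (j - 1) * m" by (intro mult_le_mono1) linarith
      then show ?thesis using N'_le unfolding N_def distrib_right by linarith
     next
      assume *: "j' + 2 = j \<and> y <= w"
      then have "j - 1 = j' + 1" by linarith
      then have "(j - 1) * m = j' * m + m" by simp
      then show ?thesis using * j_facts(4)[of m'] m_def m'_def unfolding N_def N'_def by linarith
     qed
     then show ?thesis using em unfolding pf_mid[OF 2] unfolding e distrib_right by linarith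
    next
     case 3
     then have "(j' + 2) * m' <= i * m'" using gap by (intro mult_le_mono1) linarith
     then show ?thesis using N'_le mm unfolding pf_high[OF 3] distrib_right by linarith
    qed
    then show ?thesis using e N3 unfolding km by linarith
   qed
  qed
 next
  fix i :: nat assume i: "2 <= i"
  then obtain e where e: "i = e + 2" by (metis add.commute le_Suc_ex)
  have "e * m <= e * c" using c_ge by simp
  then show "pf i + 2 * min l (r - k) <= u + i * min l (r - k)"
   using pf_le_slope[of i] u(2) unfolding c_def[symmetric] e distrib_right by linarith
 next
  fix i assume i: "j' <= i" "i < j"
  show "pf i = u - r + i * k \<or> pf i + 2 * min l (r - k) = u + i * min l (r - k)"
  proof (cases "u = N")
   case True
   then have "\<delta> = 0" by (simp add: \<delta>_def)
   then have "k = m" using mm by (simp add: k_def)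
   then show ?thesis using pf_mid[OF i] True unfolding r(5) by simp
  next
   case False
   then have ub: "u = N' + 2 * m" using u(3) by blast
   then show ?thesis using pf_mid[OF i] c_eq[OF ub] unfolding c_def[symmetric] by simp
  qed
 qed (use r kl k_lt in simp_all)
 \<comment> \<open>An upper block starts in step with the lower cluster, \<open>m'\<close> per row,
   but has to end below \<open>u = N + \<delta>\<close>. The second term of the minimum counts
   \<open>m\<close> per row from a start shifted by \<open>\<delta>\<close>, so that the last row
   just fits.\<close>
 define lev where "lev s p = (if s < m then min (p * m' + s) (p * m + s + \<delta>) else p * m' + s)" for s p
 have lev_le: "lev s p <= p * m' + s" for s p by (simp add: lev_def)
 have "good_levels (m + m') sz u r k l lev"
  unfolding good_levels_def c_def[symmetric]
 proof (intro conjI allI impI, goal_cases)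
  case (1 s t p q)
  note a = move_less[OF 1(5), of m']
  show ?case
  proof (cases "t < m")
   case False
   then have "s < t + m'" using 1(1) by linarith
   then have "p * m' + s < q * m' + t" by (rule a)
   moreover have "lev t q = q * m' + t" using False by (auto simp: lev_def)
   ultimately show ?thesis using lev_le[of s p] by linarith
  next
   case t: True
   show ?thesis
   proof (cases "s < m")
    case True
    have "p * m + s < q * m + t" by (rule move_less[OF 1(5)]) (use True in linarith)
    moreover have "p * m' + s < q * m' + t" by (rule a) (use True mm in linarith)
    ultimately show ?thesis using True t unfolding lev_def by (simp add: min_less_iff_disj)
   next
    case s: False
    then have pq: "p < q" "p + sz t <= q + sz s" using 1(5) t by (simp_all add: T_move_def)
    have "p * m' + s < q * m' + t"
    proof (cases "p + 2 <= q")
     case True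
     then show ?thesis by (rule far_less) (use 1(1) mm m_pos in linarith)
    next
     case False
     then have d: "sz t <= sz s + 1" using pq by linarith
     have "sz s <= j'" "s < m + z \<or> sz s = j' - 1" using s m_pos by (auto simp: sz_def)
     moreover have "sz t = j \<or> (x <= t \<and> sz t = j - 1)" using t by (auto simp: sz_def)
     ultimately have "x <= t" "s < m + z" "y <= w" using d far' j' gap by linarith+
     then show ?thesis using m_def m'_def by (intro a) linarith
    qed
    \<comment> \<open>The comparison is made at the ends of the blocks: \<open>e\<close> rows remain
      after \<open>p\<close>, at most \<open>e\<close> after \<open>q\<close>, and
      \<open>N' + 2 * m <= u\<close> closes the gap.\<close>
    moreover have "p * m' + s < q * m + t + \<delta>"
    proof -
     obtain e where e: "sz s = p + 1 + e" using 1(3) le_Suc_ex[of "p + 1" "sz s"] by auto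
     have lo: "(p + e) * m' + s < N' + m" by (rule N'_bound) (use s 1(1) e in linarith)+
     have hi: "N <= (sz t - 1) * m + t + m"
     proof -
      have "sz t = j \<or> (x <= t \<and> sz t = j - 1)" using t by (auto simp: sz_def)
      then show ?thesis
      proof
       assume "sz t = j"
       then show ?thesis using m_pos unfolding N_def by simp
      next
       assume *: "x <= t \<and> sz t = j - 1"
       then have "sz t - 1 = j - 2" by simp
       then show ?thesis using * j_facts(2) unfolding N_def by simp
      qed
     qed
     have "sz t - 1 <= q + e" using pq e by linarith
     then have "(sz t - 1) * m <= (q + e) * m" by (rule mult_le_mono1)
     moreover have "e * m <= e * m'" using mm by simp
     moreover have "N' + 2 * m <= N + \<delta>" using u unfolding \<delta>_def by linarith
     ultimately show ?thesis using lo hi unfolding distrib_right by linarith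
    qed
    ultimately show ?thesis using s t unfolding lev_def by (simp add: min_less_iff_disj)
   qed
  qed
 next
  case (2 s p)
  show ?case
  proof (cases "s < m")
   case True
   then have "lev s p <= p * m + s + \<delta>" by (simp add: lev_def)
   then show ?thesis using N_bound[OF True 2(2)] u(1) unfolding \<delta>_def by linarith
  next
   case False
   then show ?thesis using N'_bound[of s p] 2 lev_le[of s p] u(2) by linarith
  qed
 next
  case (3 s p)
  have "m' <= p * m'" "m <= p * m" using mult_le_mono1[of 1 p] 3 by simp_all
  then have "k <= p * m' + s" "k <= p * m + s + \<delta>" using k(2,3) by linarith+
  then show ?case by (simp add: lev_def)
 next
  case 4
  show ?case
  proof (cases "c <= k")
   case True
   have cm: "c = m"
    using u(3) c_eq c_ge True mm by (auto simp: k_def \<delta>_def)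
   have "2 <= sz s \<and> lev s 1 = k + s" if "s < m" for s
   proof
    have "sz s = j \<or> sz s = j - 1" using that by (simp add: sz_def)
    then show "2 <= sz s" using j_facts(1) by linarith
    show "lev s 1 = k + s" using that by (simp add: lev_def k_def min_def)
   qed
   moreover have "lev s 0 = s" for s by (simp add: lev_def)
   moreover have "k + m <= lev s (p + 1)" if "k <= lev s p" for s p
   proof -
    have "lev s p + m <= lev s (p + 1)" using mm by (auto simp: lev_def min_def)
    then show ?thesis using that by linarith
   qed
   ultimately show ?thesis unfolding cm using k(1) by simp
  next
   \<comment> \<open>Now \<open>u = N\<close> exceeds \<open>N' + 2 * m\<close> and
     \<open>\<delta> = 0\<close>. Levels from \<open>u - k - 1\<close> on occur in the upper cluster
     only, where the row numbering is injective; hence at most \<open>k + 1\<close> positions carry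
     them.\<close>
   case False
   have "u \<noteq> N' + 2 * m" using False c_eq k(1) by linarith
   then have uN: "u = N" "N' + 2 * m < N" using u by linarith+
   then have km: "k = m" using mm by (simp add: k_def \<delta>_def)
   have lev_hi: "lev s p = p * m + s" if "s < m" for s p
   proof -
    have "p * m <= p * m'" using mm by simp
    then show ?thesis using that uN by (simp add: lev_def \<delta>_def)
   qed
   have lev_lo: "lev s p + m + 1 < u" if "m <= s" "s < m + m'" "p < sz s" for s p
    using N'_bound[OF that] lev_le[of s p] uN by linarith
   have last: "p + 1 = sz s" if s: "s < m + m'" and p: "p < sz s" and lev: "u <= m + lev s p" for s p
   proof -
    have sm: "s < m" using lev_lo[of s p] s p lev by linarith
    have le: "N <= m + (p * m + s)" using lev sm uN by (simp add: lev_hi)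
    have "(s < x \<and> sz s = j) \<or> sz s = j - 1" using sm by (simp add: sz_def)
    then show ?thesis
    proof
     assume *: "s < x \<and> sz s = j"
     show ?thesis
     proof (rule ccontr)
      assume "p + 1 \<noteq> sz s"
      then have "p * m <= (j - 2) * m" using * p by (intro mult_le_mono1) linarith
      then show False using le * j_facts(2) unfolding N_def by linarith
     qed
    next
     assume *: "sz s = j - 1"
     show ?thesis
     proof (rule ccontr)
      assume "p + 1 \<noteq> sz s"
      then have "p * m <= (j - 3) * m" using * p by (intro mult_le_mono1) linarith
      then show False using le sm j_facts(2,3) x unfolding N_def by linarith
     qed
    qed
   qed
   have "\<exists>s<m + m'. \<exists>p. p + 1 < sz s \<and> lev s p + m + 1 = u"
   proof (intro exI conjI)
    have s: "x - 1 < x" "x - 1 < m" using x m_pos by linarith+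
    show "x - 1 < m + m'" using s by linarith
    have "sz (x - 1) = j" using s by (simp add: sz_def)
    then show "j - 2 + 1 < sz (x - 1)" using j_facts(1) by linarith
    show "lev (x - 1) (j - 2) + m + 1 = u"
     unfolding lev_hi[OF s(2)] uN(1) N_def using x j_facts(2) by linarith
   qed
   moreover have "card {(s, p). s < m + m' \<and> p < sz s \<and> u <= lev s p + m + 1} <= m + 1"
   proof -
    let ?S = "{(s, p). s < m + m' \<and> p < sz s \<and> u <= lev s p + m + 1}"
    have sm: "s < m" if "s < m + m'" "p < sz s" "u <= lev s p + m + 1" for s p
     using that lev_lo[of s p] by linarith
    have "inj_on (\<lambda>(s, p). p * m + s) ?S"
    proof (rule inj_onI, clarify)
     fix s p t q assume "p * m + s = q * m + t"
      and "u <= lev s p + m + 1" "u <= lev t q + m + 1" "s < m + m'" "t < m + m'" "p < sz s" "q < sz t"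
     moreover from this have "s < m" "t < m" using sm by blast+
     ultimately show "s = t \<and> p = q"
      by (metis add.commute div_mult_self3 div_less mod_less mod_mult_self3 add_0 less_nat_zero_code)
    qed
    moreover have "(\<lambda>(s, p). p * m + s) ` ?S \<subseteq> {N - 1 - m..<N}"
    proof clarify
     fix s p assume *: "s < m + m'" "p < sz s" "u <= lev s p + m + 1"
     then have "s < m" using sm by blast
     have "p * m + s < N" by (rule N_bound) fact+
     then show "p * m + s \<in> {N - 1 - m..<N}"
      using * uN unfolding lev_hi[OF \<open>s < m\<close>] by auto
    qed
    ultimately have "card ?S <= card {N - 1 - m..<N}"
     by (metis (no_types, lifting) card_inj_on_le finite_atLeastLessThan)
    then show ?thesis by simp
   qed
   ultimately show ?thesis using False last unfolding km by auto
  qed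
 qed
 then show ?thesis
  unfolding box_data_def using nu r k_lt kl m_pos l_le
  by (intro exI[of _ u] exI[of _ r] exI[of _ k] exI[of _ l] exI[of _ lev]) simp
qed

text \<open>For clusters at distance two the sizes \<open>j - 1\<close> and \<open>j'\<close> are
  consecutive. This middle pair of \<open>M = y + z\<close> blocks, prolonged at both ends by the
  \<open>x\<close> largest blocks, attains the index \<open>u\<close>, and \<open>q\<close> is what
  is left for the second part.\<close>

lemma case_iii:
 assumes gap2: "j = j' + 2" and zx: "x < z" and yw: "w < y"
 shows "box_data (m + m') sz pf (N + N')"
proof -
 define J where "J = j' - 1"
 have J: "j' = J + 1" "j = J + 3" using j' gap2 unfolding J_def by linarith+
 define M where "M = y + z"
 define l where "l = x + w"
 define q where "q = (J + 1) * x + J * w"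
 define u where "u = (J + 1) * M + 2 * x + y"
 define r where "r = u - q"
 have n: "N + N' = u + q"
  using N_alt N'_alt unfolding u_def q_def M_def J by (simp add: algebra_simps)
 have Jx: "J * x <= J * z" "J * w <= J * y" using zx yw by simp_all
 have r: "N + N' + r = 2 * u" "u - r = q" "M + l <= r"
  using Jx zx yw n unfolding r_def u_def q_def M_def l_def distrib_left distrib_right by linarith+
 have l: "min l (r - M) = l" using r(3) by simp
 have lM: "l < M" "1 <= l" using zx yw x by (simp_all add: l_def M_def)
 have q: "l <= q" using w J unfolding q_def l_def by (cases J) simp_all
 have r_lt: "r < u" using r(2) q lM by linarith
 have mm: "M + l = m + m'" by (simp add: M_def l_def m_def m'_def)
 have nu: "pf i = nu u r M l i" for i
 proof (rule pf_eq_nu)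
  fix i :: nat assume i: "1 <= i"
  show "pf i <= u - r + i * M"
  proof -
   consider "i <= J" | "i = J + 1" | "i = J + 2" | "J + 3 <= i" by linarith
   then show ?thesis
   proof cases
    case 1
    then have "i * x <= J * x" "i * w <= J * w" by simp_all
    moreover have "pf i = i * (m + m')" using 1 J by (intro pf_low) simp
    ultimately show ?thesis unfolding r(2) q_def mm[symmetric] l_def distrib_left distrib_right by linarith
   next
    case 2
    then have "pf i = N' + i * m" using J by (intro pf_mid) simp_all
    then show ?thesis using 2 N'_alt J unfolding r(2) q_def M_def m_def by (simp add: algebra_simps)
   next
    case 3
    then have "pf i = N' + i * m" using J by (intro pf_mid) simp_all
    then show ?thesis using 3 N'_alt J zx unfolding r(2) q_def M_def m_def by (simp add: algebra_simps)
   next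
    case 4
    then have "pf i = N + N'" using J by (intro pf_high) simp
    moreover have "(J + 3) * M <= i * M" using 4 by (intro mult_le_mono1)
    moreover have "u = J * M + M + 2 * x + y" "M = y + z" by (simp_all add: u_def M_def)
    ultimately show ?thesis using zx n r(2) unfolding distrib_right by linarith
   qed
  qed
 next
  fix i :: nat assume i: "2 <= i"
  show "pf i + 2 * min l (r - M) <= u + i * min l (r - M)"
   unfolding l
  proof -
   consider "i <= J" | "i = J + 1" | "i = J + 2" | "J + 3 <= i" by linarith
   then show "pf i + 2 * l <= u + i * l"
   proof cases
    case 1
    then have "i * y <= J * y" "i * z <= J * z" by simp_all
    moreover have "pf i = i * (m + m')" using 1 J by (intro pf_low) simp
    ultimately show ?thesis using yw zx
     unfolding u_def mm[symmetric] l_def M_def distrib_left distrib_right by linarith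
   next
    case 2
    then have "pf i = N' + i * m" using J by (intro pf_mid) simp_all
    then show ?thesis using 2 N'_alt J yw unfolding u_def l_def M_def m_def by (simp add: algebra_simps)
   next
    case 3
    then have "pf i = N' + i * m" using J by (intro pf_mid) simp_all
    then show ?thesis using 3 N'_alt J unfolding u_def l_def M_def m_def by (simp add: algebra_simps)
   next
    case 4
    then have "pf i = N + N'" using J by (intro pf_high) simp
    moreover have "(J + 3) * l <= i * l" using 4 by (intro mult_le_mono1)
    ultimately show ?thesis unfolding n q_def l_def distrib_left distrib_right by linarith
   qed
  qed
 next
  fix i assume i: "j' <= i" "i < j"
  have pf: "pf i = N' + i * m" using i by (rule pf_mid)
  have N'J: "N' = z * (J + 1) + w * J" using N'_alt J by simp
  have "i = J + 1 \<or> i = J + 2" using i J by linarith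
  then show "pf i = u - r + i * M \<or> pf i + 2 * min l (r - M) = u + i * min l (r - M)"
  proof
   assume "i = J + 1"
   then have "pf i = q + i * M" unfolding pf N'J q_def M_def m_def by (simp add: algebra_simps)
   then show ?thesis using r(2) by simp
  next
   assume "i = J + 2"
   then have "pf i + 2 * l = u + i * l"
    unfolding pf N'J u_def l_def M_def m_def by (simp add: algebra_simps)
   then show ?thesis using l by simp
  qed
 qed (use r mm lM r_lt in linarith)+
 \<comment> \<open>Row numbering with \<open>M\<close> per row, except for the last positions of the
   largest blocks. These are pulled down to directly follow all other positions
   (\<open>low\<close>), so that the levels end at \<open>u - 1\<close>.\<close>
 define lev where "lev s p = (if s < x \<and> p + 1 = j then (J + 1) * M + x + y + s else p * M + s)" for s p
 have last_le: "(J + 1) * M + x + y + s <= (J + 2) * M + s" for s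
  using zx unfolding M_def by simp
 have lev_le: "lev s p <= p * M + s" for s p using last_le[of s] J by (simp add: lev_def)
 note d = M_def m_def m'_def
 have low: "p * M + s < (J + 1) * M + x + y" if "s < m + m'" "p < sz s" "\<not> (s < x \<and> p + 1 = j)" for s p
  using that(1)
  proof (cases rule: sz_cases)
   case 1
   then have "p + 1 \<noteq> j" "p < j" using that by simp_all
   then have "p * M <= (J + 1) * M" using J by (intro mult_le_mono1) linarith
   then show ?thesis using 1 yw by linarith
  next
   case 2
   then have "p * M <= (J + 1) * M" using J that(2) by (intro mult_le_mono1) linarith
   then show ?thesis using 2 d by linarith
  next
   case 3
   then have "(p + 1) * M <= (J + 1) * M" using J that(2) by (intro mult_le_mono1) linarith
   then show ?thesis using 3 d unfolding distrib_right by linarith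
  next
   case 4
   then have "(p + 2) * M <= (J + 1) * M" using J that(2) by (intro mult_le_mono1) linarith
   then show ?thesis using 4 d yw that(1) unfolding distrib_right by linarith
  qed
 have "good_levels (m + m') sz u r M l lev"
  unfolding good_levels_def l
 proof (intro conjI allI impI, goal_cases)
  case (1 s t p q)
  show ?case
  proof (cases "t < x \<and> q + 1 = j")
   case False
   have "p * M + s < q * M + t"
   proof (cases "s < t + M")
    case True
    then show ?thesis by (rule move_less[OF 1(5)])
   next
    case st: False
    then have pq: "p < q" "p + sz t <= q + sz s" using 1(5) by (simp_all add: T_move_def)
    show ?thesis
     using 1(1)
    proof (cases rule: sz_cases)
     case 3
     show ?thesis using \<open>t < m + m'\<close>
     proof (cases rule: sz_cases)
      case 1
      then show ?thesis using pq 3 gap2 zx d by (intro far_less[of p 2]) linarith+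
     qed (use 3 zx d st in linarith)+
    next
     case 4
     show ?thesis using \<open>t < m + m'\<close>
     proof (cases rule: sz_cases)
      case 1
      then show ?thesis using pq 4 gap2 j' zx yw d \<open>s < m + m'\<close> by (intro far_less[of p 3]) linarith+
     next
      case 2
      then show ?thesis using pq 4 gap2 j' zx yw d \<open>s < m + m'\<close> by (intro far_less[of p 2]) linarith+
     qed (use 4 zx yw d st \<open>s < m + m'\<close> in linarith)+
    qed (use zx d st in linarith)+
   qed
   moreover have "lev t q = q * M + t" using False by (auto simp: lev_def)
   ultimately show ?thesis using lev_le[of s p] by linarith
  next
   case True
   then have lt: "lev t q = (J + 1) * M + x + y + t" by (simp add: lev_def)
   have szt: "sz t = j" using True by (simp add: sz_def)
   show ?thesis
   proof (cases "s < x \<and> p + 1 = j")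
    case sp: True
    then have "s < t" using 1(5) True by (auto simp: T_move_def split: if_splits)
    then show ?thesis using sp lt by (simp add: lev_def)
   next
    case False
    then have ls: "lev s p = p * M + s" by (auto simp: lev_def)
    show ?thesis using low[OF 1(1,3) False] unfolding lt ls by linarith
   qed
  qed
 next
  case (2 s p)
  show ?case
  proof (cases "s < x \<and> p + 1 = j")
   case True
   then show ?thesis by (simp add: lev_def u_def)
  next
   case False
   then have ls: "lev s p = p * M + s" by (auto simp: lev_def)
   show ?thesis using low[OF 2 False] unfolding ls u_def by linarith
  qed
 next
  case (3 s p)
  have "1 * M <= p * M" "1 * M <= (J + 1) * M" using 3 by (intro mult_le_mono1; simp)+
  then have "M <= p * M + s" "M <= (J + 1) * M + x + y + s" by linarith+
  then show ?case by (simp only: lev_def split: if_split) simp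
 next
  case 4
  have "lev s 0 = s" for s using J by (simp add: lev_def)
  moreover have "2 <= sz s \<and> lev s 1 = M + s" if "s < l" for s
  proof
   have "s < m" using that yw by (simp add: l_def m_def)
   then have "sz s = j \<or> sz s = j - 1" by (simp add: sz_def)
   then show "2 <= sz s" using j_facts(1) by linarith
   show "lev s 1 = M + s" using J by (simp add: lev_def)
  qed
  moreover have "M + l <= lev s (p + 1)" if "p + 1 < sz s" "M <= lev s p" for s p
  proof -
   have "lev s p + l <= lev s (p + 1)"
   proof (cases "s < x \<and> p + 2 = j")
    case True
    then show ?thesis using J yw by (simp add: lev_def l_def)
   next
    case False
    have "\<not> (s < x \<and> p + 1 = j)" using that(1) by (auto simp: sz_def)
    then show ?thesis using False lM by (auto simp: lev_def)
   qed
   then show ?thesis using that(2) by linarith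
  qed
  ultimately show ?case using lM by simp
 qed
 then show ?thesis
  unfolding box_data_def using nu r lM r_lt mm q
  by (intro exI[of _ u] exI[of _ r] exI[of _ M] exI[of _ l] exI[of _ lev]) simp
qed

text \<open>If the extra condition of one of the first two cases fails, then the clusters are at
  distance two and one of \<open>x < z\<close>, \<open>w < y\<close> holds; the comparison of
  \<open>m\<close> and \<open>m'\<close> yields the other one, as the third case requires.\<close>

lemma box_data: "box_data (m + m') sz pf (N + N')"
proof (cases "m' < m")
 case True
 show ?thesis
 proof (cases "j' + 3 <= j \<or> z <= x")
  case False
  then show ?thesis using True gap by (intro case_iii) (simp_all add: m_def m'_def)
 qed (rule case_i[OF True])
next
 case False
 show ?thesis
 proof (cases "j' + 3 <= j \<or> y <= w")
  case True
  then show ?thesis using False by (intro case_ii) simp_all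
 next
  case far: False
  then show ?thesis using False gap by (intro case_iii) (simp_all add: m_def m'_def)
 qed
qed

end

section \<open>Linear algebra on function spaces\<close>

lemma homogeneous_solution:
 fixes M :: "'i => 'j => 'k::field"
 assumes "finite J" "finite I" "card J < card I"
 shows "\<exists>\<alpha>. (\<exists>i\<in>I. \<alpha> i \<noteq> 0) \<and> (\<forall>j\<in>J. (\<Sum>i\<in>I. \<alpha> i * M i j) = 0)"
 using assms
proof (induction J arbitrary: I M rule: finite_induct)
 case empty
 then obtain i where "i \<in> I" by fastforce
 then show ?case by (intro exI[of _ "\<lambda>_. 1"]) auto
next
 case (insert j0 J)
 show ?case
 proof (cases "\<forall>i\<in>I. M i j0 = 0")
  case True
  have "card J < card I" using insert by simp
  then obtain \<alpha> where "\<exists>i\<in>I. \<alpha> i \<noteq> 0" "\<forall>j\<in>J. (\<Sum>i\<in>I. \<alpha> i * M i j) = 0"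
   using insert.IH[of I M] insert.prems by blast
  then show ?thesis using True by (intro exI[of _ \<alpha>]) (auto intro: sum.neutral)
 next
  case False
  then obtain i1 where i1: "i1 \<in> I" "M i1 j0 \<noteq> 0" by blast
  define I' where "I' = I - {i1}"
  have I': "finite I'" "I = insert i1 I'" "i1 \<notin> I'" using insert.prems i1 by (auto simp: I'_def)
  have "card J < card I'" using insert I' by simp
  then obtain \<beta> where \<beta>: "\<exists>i\<in>I'. \<beta> i \<noteq> 0"
    "\<forall>j\<in>J. (\<Sum>i\<in>I'. \<beta> i * (M i j - M i j0 / M i1 j0 * M i1 j)) = 0"
   using insert.IH[of I' "\<lambda>i j. M i j - M i j0 / M i1 j0 * M i1 j"] I' by blast
  define \<alpha> where "\<alpha> = \<beta>(i1 := - (\<Sum>i\<in>I'. \<beta> i * M i j0 / M i1 j0))"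
  have \<alpha>: "(\<Sum>i\<in>I. \<alpha> i * M i j) = (\<Sum>i\<in>I'. \<beta> i * (M i j - M i j0 / M i1 j0 * M i1 j))" for j
  proof -
   have "(\<Sum>i\<in>I. \<alpha> i * M i j) = \<alpha> i1 * M i1 j + (\<Sum>i\<in>I'. \<alpha> i * M i j)"
    using I' by simp
   also have "(\<Sum>i\<in>I'. \<alpha> i * M i j) = (\<Sum>i\<in>I'. \<beta> i * M i j)"
    using I' by (intro sum.cong) (auto simp: \<alpha>_def)
   also have "\<alpha> i1 * M i1 j = - (\<Sum>i\<in>I'. \<beta> i * (M i j0 / M i1 j0 * M i1 j))"
    by (simp add: \<alpha>_def sum_distrib_right mult.assoc)
   finally show ?thesis by (simp add: right_diff_distrib sum_subtractf)
  qed
  have "\<exists>i\<in>I. \<alpha> i \<noteq> 0" using \<beta>(1) I' by (auto simp: \<alpha>_def)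
  moreover have "(\<Sum>i\<in>I. \<alpha> i * M i j0) = 0" unfolding \<alpha> using i1 by simp
  ultimately show ?thesis using \<beta>(2) \<alpha> by (intro exI[of _ \<alpha>]) simp
 qed
qed

definition lcomb :: "('i => 'k::field) => ('i => 'a => 'k) => 'i set => 'a => 'k" where
 "lcomb \<alpha> w I = (\<lambda>x. \<Sum>i\<in>I. \<alpha> i * w i x)"

definition subsp :: "('a => 'k::field) set => bool" where
 "subsp W \<longleftrightarrow> (\<lambda>x. 0) \<in> W \<and> (\<forall>v\<in>W. \<forall>w\<in>W. (\<lambda>x. v x + w x) \<in> W) \<and> (\<forall>c. \<forall>v\<in>W. (\<lambda>x. c * v x) \<in> W)"

definition indep_mod :: "('a => 'k::field) set => ('i => 'a => 'k) => 'i set => bool" where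
 "indep_mod W w I \<longleftrightarrow> (\<forall>\<alpha>. lcomb \<alpha> w I \<in> W --> (\<forall>i\<in>I. \<alpha> i = 0))"

definition spanned_mod :: "('a => 'k::field) set => ('i => 'a => 'k) => 'i set => ('a => 'k) => bool" where
 "spanned_mod W w I v \<longleftrightarrow> (\<exists>\<beta>. (\<lambda>x. v x - lcomb \<beta> w I x) \<in> W)"

definition lin :: "(('a => 'k::field) => ('b => 'k)) => bool" where
 "lin f \<longleftrightarrow> (\<forall>v w. f (\<lambda>x. v x + w x) = (\<lambda>x. f v x + f w x)) \<and> (\<forall>c v. f (\<lambda>x. c * v x) = (\<lambda>x. c * f v x))"

lemma subspD:
 assumes "subsp W"
 shows "(\<lambda>x. 0) \<in> W" "v \<in> W ==> w \<in> W ==> (\<lambda>x. v x + w x) \<in> W" "v \<in> W ==> (\<lambda>x. c * v x) \<in> W"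
 using assms by (auto simp: subsp_def)

lemma subsp_lcomb:
 assumes "subsp W" "\<And>i. i \<in> I ==> w i \<in> W"
 shows "lcomb \<alpha> w I \<in> W"
proof (cases "finite I")
 case True
 then show ?thesis using assms(2)
 proof (induction I rule: finite_induct)
  case empty
  then show ?case using subspD(1)[OF assms(1)] by (simp add: lcomb_def)
 next
  case (insert i I)
  then have "(\<lambda>x. \<alpha> i * w i x + lcomb \<alpha> w I x) \<in> W"
   by (intro subspD(2)[OF assms(1)] subspD(3)[OF assms(1)]) auto
  then show ?case using insert.hyps by (simp add: lcomb_def)
 qed
next
 case False
 then show ?thesis using subspD(1)[OF assms(1)] by (simp add: lcomb_def)
qed

lemma linD:
 assumes "lin f"
 shows "f (\<lambda>x. v x + w x) = (\<lambda>x. f v x + f w x)" "f (\<lambda>x. c * v x) = (\<lambda>x. c * f v x)"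
  "f (\<lambda>x. 0) = (\<lambda>x. 0)" "f (\<lambda>x. v x - w x) = (\<lambda>x. f v x - f w x)"
proof -
 show 1: "f (\<lambda>x. v x + w x) = (\<lambda>x. f v x + f w x)" for v w using assms by (simp add: lin_def)
 show 2: "f (\<lambda>x. c * v x) = (\<lambda>x. c * f v x)" for c v using assms by (simp add: lin_def)
 show "f (\<lambda>x. 0) = (\<lambda>x. 0)" using 2[of 0 "\<lambda>x. 0"] by simp
 show "f (\<lambda>x. v x - w x) = (\<lambda>x. f v x - f w x)" using 1[of v "\<lambda>x. - 1 * w x"] 2[of "-1" w] by simp
qed

lemma lin_lcomb:
 assumes "lin f"
 shows "f (lcomb \<alpha> w I) = lcomb \<alpha> (\<lambda>i. f (w i)) I"
proof (cases "finite I")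
 case True
 then show ?thesis
 proof (induction I rule: finite_induct)
  case empty
  then show ?case using linD(3)[OF assms] by (simp add: lcomb_def)
 next
  case (insert i I)
  have "f (lcomb \<alpha> w (insert i I)) = f (\<lambda>x. \<alpha> i * w i x + lcomb \<alpha> w I x)"
   using insert.hyps by (simp add: lcomb_def)
  also have "\<dots> = lcomb \<alpha> (\<lambda>i. f (w i)) (insert i I)"
   unfolding linD(1)[OF assms] linD(2)[OF assms] insert.IH using insert.hyps by (simp add: lcomb_def)
  finally show ?case .
 qed
next
 case False
 then show ?thesis using linD(3)[OF assms] by (simp add: lcomb_def)
qed

lemma subsp_image:
 assumes "lin f" "subsp U"
 shows "subsp (f ` U)"
 unfolding subsp_def
proof (intro conjI ballI allI)
 show "(\<lambda>x. 0) \<in> f ` U"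
  using linD(3)[OF assms(1)] subspD(1)[OF assms(2)] by (metis imageI)
 fix v assume "v \<in> f ` U"
 then obtain v' where v': "v' \<in> U" "v = f v'" by blast
 show "(\<lambda>x. c * v x) \<in> f ` U" for c
  unfolding v' linD(2)[OF assms(1), symmetric] using v' by (intro imageI subspD(3)[OF assms(2)])
 fix w assume "w \<in> f ` U"
 then obtain w' where w': "w' \<in> U" "w = f w'" by blast
 show "(\<lambda>x. v x + w x) \<in> f ` U"
  unfolding v' w' linD(1)[OF assms(1), symmetric] using v' w' by (intro imageI subspD(2)[OF assms(2)])
qed

text \<open>Steinitz exchange in the quotient by \<open>W\<close>: with more independent vectors
  than spanning ones, \<open>homogeneous_solution\<close> gives a nontrivial combination whose
  coordinates in the spanning family all vanish.\<close>

lemma indep_card_le: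
 assumes W: "subsp W" and fin: "finite I" "finite J"
  and ind: "indep_mod W w I" and sp: "\<And>i. i \<in> I ==> spanned_mod W v J (w i)"
 shows "card I <= card J"
proof (rule ccontr)
 assume "\<not> card I <= card J"
 have "\<forall>i\<in>I. \<exists>\<beta>. (\<lambda>x. w i x - lcomb \<beta> v J x) \<in> W"
  using sp by (simp add: spanned_mod_def)
 then obtain M where M: "\<And>i. i \<in> I ==> (\<lambda>x. w i x - lcomb (M i) v J x) \<in> W" by metis
 obtain \<alpha> where \<alpha>: "\<exists>i\<in>I. \<alpha> i \<noteq> 0" "\<forall>j\<in>J. (\<Sum>i\<in>I. \<alpha> i * M i j) = 0"
  using homogeneous_solution[OF fin(2,1), of M] \<open>\<not> card I <= card J\<close> by auto
 have "lcomb \<alpha> (\<lambda>i x. w i x - lcomb (M i) v J x) I \<in> W"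
  by (rule subsp_lcomb[OF W M])
 moreover have "lcomb \<alpha> (\<lambda>i x. w i x - lcomb (M i) v J x) I = lcomb \<alpha> w I"
 proof
  fix x
  have "(\<Sum>i\<in>I. \<alpha> i * (\<Sum>j\<in>J. M i j * v j x)) = (\<Sum>j\<in>J. (\<Sum>i\<in>I. \<alpha> i * M i j) * v j x)"
   unfolding sum_distrib_left sum_distrib_right by (subst sum.swap) (simp add: mult.assoc)
  also have "\<dots> = 0" using \<alpha>(2) by simp
  finally show "lcomb \<alpha> (\<lambda>i x. w i x - lcomb (M i) v J x) I x = lcomb \<alpha> w I x"
   by (simp add: lcomb_def right_diff_distrib sum_subtractf)
 qed
 ultimately show False using ind \<alpha>(1) by (auto simp: indep_mod_def)
qed

text \<open>A vector outside the span could be adjoined to the independent family, which would then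
  exceed the spanning one. The index \<open>None\<close> stands for the adjoined vector.\<close>

lemma indep_imp_spanned:
 assumes W: "subsp W" and fin: "finite I" "finite J" and card: "card J <= card I"
  and ind: "indep_mod W w I" and sp: "\<And>i. i \<in> I ==> spanned_mod W v J (w i)" and u: "spanned_mod W v J u"
 shows "spanned_mod W w I u"
proof (rule ccontr)
 assume not: "\<not> spanned_mod W w I u"
 define w' where "w' = case_option u w"
 have ind': "indep_mod W w' (insert None (Some ` I))"
  unfolding indep_mod_def
 proof (intro allI impI)
  fix \<alpha> assume "lcomb \<alpha> w' (insert None (Some ` I)) \<in> W"
  moreover have "lcomb \<alpha> w' (insert None (Some ` I)) = (\<lambda>x. \<alpha> None * u x + lcomb (\<alpha> \<circ> Some) w I x)"
  proof -
   have "sum f (insert None (Some ` I)) = f None + (\<Sum>i\<in>I. f (Some i))" for f :: "_ => 'b"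
    using fin(1) by (subst sum.insert) (auto simp: sum.reindex)
   then show ?thesis by (simp add: lcomb_def w'_def)
  qed
  ultimately have *: "(\<lambda>x. \<alpha> None * u x + lcomb (\<alpha> \<circ> Some) w I x) \<in> W" by simp
  have "\<alpha> None = 0"
  proof (rule ccontr)
   assume "\<alpha> None \<noteq> 0"
   then have "(\<lambda>x. inverse (\<alpha> None) * (\<alpha> None * u x + lcomb (\<alpha> \<circ> Some) w I x)) =
     (\<lambda>x. u x - lcomb (\<lambda>i. - inverse (\<alpha> None) * \<alpha> (Some i)) w I x)"
    by (simp add: fun_eq_iff lcomb_def sum_distrib_left sum_negf distrib_left mult.assoc)
   then show False using subspD(3)[OF W *, of "inverse (\<alpha> None)"] not
    unfolding spanned_mod_def by metis
  qed
  moreover from this have "\<forall>i\<in>I. (\<alpha> \<circ> Some) i = 0"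
  proof -
   have "lcomb (\<alpha> \<circ> Some) w I \<in> W" using * \<open>\<alpha> None = 0\<close> by simp
   then show ?thesis using ind unfolding indep_mod_def by blast
  qed
  ultimately show "\<forall>i\<in>insert None (Some ` I). \<alpha> i = 0" by auto
 qed
 have "card (insert None (Some ` I)) <= card J"
  by (rule indep_card_le[OF W _ fin(2) ind']) (use fin(1) sp u in "auto simp: w'_def")
 moreover have "card (insert None (Some ` I)) = Suc (card I)"
  using fin(1) by (subst card_insert_disjoint) (auto simp: card_image)
 ultimately show False using card by simp
qed

text \<open>The dimension of the cokernel of \<open>f\<close> on \<open>U\<close>, witnessed by a
  basis modulo the image. For the powers of a nilpotent matrix these numbers are the profile of its
  Jordan type.\<close>

definition corank :: "('a => 'k::field) set => (('a => 'k) => ('a => 'k)) => nat => bool" where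
 "corank U f s \<longleftrightarrow> (\<exists>w :: nat => 'a => 'k. (\<forall>i<s. w i \<in> U) \<and> indep_mod (f ` U) w {..<s} \<and>
  (\<forall>v\<in>U. spanned_mod (f ` U) w {..<s} v))"

lemma corankI:
 assumes "finite I" "\<And>i. i \<in> I ==> w i \<in> U" "indep_mod (f ` U) w I"
  "\<And>v. v \<in> U ==> spanned_mod (f ` U) w I v"
 shows "corank U f (card I)"
proof -
 obtain e where e: "bij_betw e {..<card I} I"
  using ex_bij_betw_nat_finite[OF assms(1)] by (auto simp: lessThan_atLeast0)
 have lc: "lcomb \<alpha> (w \<circ> e) {..<card I} = lcomb (\<alpha> \<circ> inv_into {..<card I} e) w I" for \<alpha>
 proof
  fix x
  have "(\<Sum>i\<in>I. (\<alpha> \<circ> inv_into {..<card I} e) i * w i x) =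
    (\<Sum>i\<in>{..<card I}. (\<alpha> \<circ> inv_into {..<card I} e) (e i) * w (e i) x)"
   by (rule sum.reindex_bij_betw[OF e, symmetric])
  also have "\<dots> = (\<Sum>i\<in>{..<card I}. \<alpha> i * w (e i) x)"
   using e by (intro sum.cong) (auto simp: bij_betw_def)
  finally show "lcomb \<alpha> (w \<circ> e) {..<card I} x = lcomb (\<alpha> \<circ> inv_into {..<card I} e) w I x"
   by (simp add: lcomb_def)
 qed
 have lc2: "lcomb \<beta> w I = lcomb (\<beta> \<circ> e) (w \<circ> e) {..<card I}" for \<beta>
  unfolding lcomb_def o_def by (rule ext) (rule sum.reindex_bij_betw[OF e, symmetric])
 show ?thesis
  unfolding corank_def
 proof (intro exI[of _ "w \<circ> e"] conjI allI impI ballI)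
  show "(w \<circ> e) i \<in> U" if "i < card I" for i
   using assms(2)[of "e i"] e that by (auto simp: bij_betw_def)
  show "indep_mod (f ` U) (w \<circ> e) {..<card I}"
   unfolding indep_mod_def lc
  proof (intro allI impI ballI)
   fix \<alpha> i assume *: "lcomb (\<alpha> \<circ> inv_into {..<card I} e) w I \<in> f ` U" "i \<in> {..<card I}"
   then have "(\<alpha> \<circ> inv_into {..<card I} e) (e i) = 0"
    using assms(3) e unfolding indep_mod_def bij_betw_def by blast
   then show "\<alpha> i = 0" using e *(2) by (simp add: bij_betw_def)
  qed
  show "spanned_mod (f ` U) (w \<circ> e) {..<card I} v" if "v \<in> U" for v
   using assms(4)[OF that] unfolding spanned_mod_def lc2 by blast
 qed
qed

lemma corank_unique:
 assumes "lin f" "subsp U" "corank U f s" "corank U f t"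
 shows "s = t"
proof -
 have "a <= b" if "corank U f a" "corank U f b" for a b
 proof -
  obtain w v :: "nat => _" where w: "\<forall>i<a. w i \<in> U" "indep_mod (f ` U) w {..<a}"
   and v: "\<forall>x\<in>U. spanned_mod (f ` U) v {..<b} x"
   using \<open>corank U f a\<close> \<open>corank U f b\<close> unfolding corank_def by blast
  have "card {..<a} <= card {..<b}"
   by (rule indep_card_le[OF subsp_image[OF assms(1,2)] _ _ w(2)]) (use w(1) v in auto)
  then show ?thesis by simp
 qed
 then show ?thesis using assms(3,4) by (meson le_antisym)
qed

lemma corank_transfer:
 assumes lin: "lin \<phi>" and U: "\<phi> ` U = U'" and inj: "inj_on \<phi> U" and sub: "subsp U"
  and f: "\<And>v. v \<in> U ==> f v \<in> U" and com: "\<And>v. v \<in> U ==> \<phi> (f v) = f' (\<phi> v)"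
  and cor: "corank U f s"
 shows "corank U' f' s"
proof -
 obtain w :: "nat => _" where w: "\<forall>i<s. w i \<in> U" "indep_mod (f ` U) w {..<s}"
   "\<forall>v\<in>U. spanned_mod (f ` U) w {..<s} v"
  using cor unfolding corank_def by blast
 have im: "f' ` U' = \<phi> ` f ` U" using com by (auto simp: U[symmetric] image_iff)
 have lcU: "lcomb \<alpha> w {..<s} \<in> U" for \<alpha> using w(1) by (intro subsp_lcomb[OF sub]) simp
 show ?thesis
  unfolding corank_def im
 proof (intro exI[of _ "\<lambda>i. \<phi> (w i)"] conjI allI impI ballI)
  show "\<phi> (w i) \<in> U'" if "i < s" for i using w(1) U that by blast
  show "indep_mod (\<phi> ` f ` U) (\<lambda>i. \<phi> (w i)) {..<s}"
   unfolding indep_mod_def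
  proof (intro allI impI)
   fix \<alpha> assume "lcomb \<alpha> (\<lambda>i. \<phi> (w i)) {..<s} \<in> \<phi> ` f ` U"
   then obtain v where v: "v \<in> U" "\<phi> (lcomb \<alpha> w {..<s}) = \<phi> (f v)"
    unfolding lin_lcomb[OF lin, symmetric] by blast
   then have "lcomb \<alpha> w {..<s} = f v" using inj lcU f by (auto dest: inj_onD)
   then show "\<forall>i\<in>{..<s}. \<alpha> i = 0" using w(2) v(1) by (auto simp: indep_mod_def)
  qed
  fix v' assume "v' \<in> U'"
  then obtain v where v: "v \<in> U" "v' = \<phi> v" using U by blast
  have "spanned_mod (f ` U) w {..<s} v" using w(3) v(1) by blast
  then obtain \<beta> where "(\<lambda>x. v x - lcomb \<beta> w {..<s} x) \<in> f ` U"
   unfolding spanned_mod_def ..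
  then have "\<phi> (\<lambda>x. v x - lcomb \<beta> w {..<s} x) \<in> \<phi> ` f ` U" by blast
  then show "spanned_mod (\<phi> ` f ` U) (\<lambda>i. \<phi> (w i)) {..<s} v'"
   unfolding spanned_mod_def v linD(4)[OF lin] lin_lcomb[OF lin] by blast
 qed
qed

section \<open>Matrices in block coordinates and Jordan types\<close>

text \<open>Positions are kept as labels in \<open>I\<close>, for instance pairs of a block and a
  place in it; only \<open>e\<close> translates them into row and column numbers.\<close>

definition indexing :: "nat => 'a set => ('a => nat) => bool" where
 "indexing n I e \<longleftrightarrow> finite I \<and> bij_betw e I {..<n}"

definition opk :: "'b set => ('b => nat) => 'a set => ('a => nat) => 'k::field mat => ('a => 'k) => 'b => 'k" where
 "opk I' e' I e A v = (\<lambda>y. if y \<in> I' then \<Sum>x\<in>I. A $$ (e' y, e x) * v x else 0)"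

definition Vs :: "'a set => ('a => 'k::field) set" where
 "Vs I = {v. \<forall>x. x \<notin> I --> v x = 0}"

definition mkm :: "nat => 'b set => ('b => nat) => 'a set => ('a => nat) => ('b => 'a => 'k) => 'k::field mat" where
 "mkm n I' e' I e K = mat n n (\<lambda>(i, j). K (inv_into I' e' i) (inv_into I e j))"

definition uvec :: "'a => 'a => 'k::field" where
 "uvec x = (\<lambda>y. if y = x then 1 else 0)"

lemma indexing_lt: "indexing n I e ==> x \<in> I ==> e x < n"
 by (auto simp: indexing_def bij_betw_def)

lemma indexing_nat: "indexing n {..<n} (\<lambda>i. i)"
 by (simp add: indexing_def bij_betw_def inj_on_def)

lemma card_indexing: "indexing n I e ==> card I = n"
 by (auto simp: indexing_def dest: bij_betw_same_card)

lemma sum_indexing: "indexing n I e ==> (\<Sum>i<n. f i) = (\<Sum>x\<in>I. f (e x))"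
 unfolding indexing_def by (metis sum.reindex_bij_betw)

lemma mult_square [simp]: "A \<in> sqm n ==> B \<in> sqm n ==> A * B \<in> sqm n"
 by (rule mult_carrier_mat)

lemma mkm_carrier [simp]: "mkm n I' e' I e K \<in> sqm n"
 by (simp add: mkm_def)

lemma index_mkm:
 assumes "indexing n I e" "indexing n I' e'" "x \<in> I" "y \<in> I'"
 shows "mkm n I' e' I e K $$ (e' y, e x) = K y x"
 using assms indexing_lt[OF assms(1,3)] indexing_lt[OF assms(2,4)]
 by (simp add: mkm_def indexing_def bij_betw_def)

lemma index_mult_indexing:
 assumes "indexing n J e" "A \<in> sqm n" "B \<in> sqm n" "i < n" "k < n"
 shows "(A * B) $$ (i, k) = (\<Sum>z\<in>J. A $$ (i, e z) * B $$ (e z, k))"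
proof -
 have "(A * B) $$ (i, k) = (\<Sum>j<n. A $$ (i, j) * B $$ (j, k))"
  using assms by (simp add: scalar_prod_def lessThan_atLeast0)
 then show ?thesis using sum_indexing[OF assms(1)] by simp
qed

lemma mat_eq_indexing:
 assumes "indexing n I e" "indexing n I' e'" "A \<in> sqm n" "B \<in> sqm n"
  and "\<And>x y. x \<in> I ==> y \<in> I' ==> A $$ (e' y, e x) = B $$ (e' y, e x)"
 shows "A = B"
proof (rule eq_matI)
 fix i j assume "i < dim_row B" "j < dim_col B"
 then have "i < n" "j < n" using assms by auto
 then obtain x y where "x \<in> I" "j = e x" "y \<in> I'" "i = e' y"
  using assms(1,2) by (auto simp: indexing_def bij_betw_def image_iff set_eq_iff) blast
 then show "A $$ (i, j) = B $$ (i, j)" using assms(5) by simp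
qed (use assms in auto)

lemma opk_Vs: "opk I' e' I e A v \<in> Vs I'"
 by (simp add: opk_def Vs_def)

lemma lin_opk: "lin (opk I' e' I e A)"
 by (simp add: lin_def opk_def fun_eq_iff algebra_simps sum.distrib sum_distrib_left)

lemma subsp_Vs: "subsp (Vs I)"
 by (simp add: subsp_def Vs_def)

lemma opk_mult:
 assumes "indexing n I e" "indexing n J f" "indexing n K g" "A \<in> sqm n" "B \<in> sqm n"
 shows "opk K g I e (A * B) v = opk K g J f A (opk J f I e B v)"
proof
 fix y
 show "opk K g I e (A * B) v y = opk K g J f A (opk J f I e B v) y"
 proof (cases "y \<in> K")
  case True
  have "(\<Sum>x\<in>I. (A * B) $$ (g y, e x) * v x) =
    (\<Sum>x\<in>I. (\<Sum>z\<in>J. A $$ (g y, f z) * B $$ (f z, e x)) * v x)"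
   by (intro sum.cong refl)
    (simp add: index_mult_indexing[OF assms(2,4,5) indexing_lt[OF assms(3) True] indexing_lt[OF assms(1)]])
  also have "\<dots> = (\<Sum>z\<in>J. A $$ (g y, f z) * (\<Sum>x\<in>I. B $$ (f z, e x) * v x))"
   unfolding sum_distrib_left sum_distrib_right by (subst sum.swap) (simp add: mult.assoc)
  finally show ?thesis using True by (simp add: opk_def)
 qed (simp add: opk_def)
qed

lemma opk_one:
 assumes "indexing n I e" "v \<in> Vs I"
 shows "opk I e I e (1\<^sub>m n) v = v"
proof
 fix y
 show "opk I e I e (1\<^sub>m n) v y = v y"
 proof (cases "y \<in> I")
  case True
  have "(\<Sum>x\<in>I. (1\<^sub>m n) $$ (e y, e x) * v x) = (\<Sum>x\<in>I. if y = x then v x else 0)"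
   using assms(1) True indexing_lt[OF assms(1)]
   by (intro sum.cong) (auto simp: indexing_def bij_betw_def inj_on_def)
  then show ?thesis using True assms(1) by (simp add: opk_def indexing_def)
 qed (use assms in "simp add: opk_def Vs_def")
qed

lemma opk_uvec:
 assumes "finite I" "x \<in> I" "y \<in> I'"
 shows "opk I' e' I e A (uvec x) y = A $$ (e' y, e x)"
 using assms by (simp add: opk_def uvec_def if_distrib cong: if_cong)

lemma uvec_Vs: "x \<in> I ==> uvec x \<in> Vs I"
 by (auto simp: uvec_def Vs_def)

lemma Vs_expand: "finite I ==> v \<in> Vs I ==> v = lcomb v uvec I"
 by (auto simp: lcomb_def uvec_def Vs_def fun_eq_iff if_distrib cong: if_cong)

lemma indep_uvec: "finite I ==> indep_mod {\<lambda>_. 0} uvec I"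
proof -
 assume I: "finite I"
 have "lcomb \<alpha> uvec I x = \<alpha> x" if "x \<in> I" for \<alpha> :: "'a => 'b" and x
  using I that by (simp add: lcomb_def uvec_def if_distrib cong: if_cong)
 then show ?thesis by (auto simp: indep_mod_def fun_eq_iff) metis
qed

lemma subsp_0: "subsp {\<lambda>_. 0}"
 by (simp add: subsp_def)

lemma spanned_0_iff: "spanned_mod {\<lambda>_. 0} w I v \<longleftrightarrow> (\<exists>\<beta>. v = lcomb \<beta> w I)"
 by (auto simp: spanned_mod_def fun_eq_iff)

text \<open>An independent family of full size spans, so the unit vectors have coordinates in it;
  these coordinates form the inverse of the matrix whose columns are the family.\<close>

lemma basis_matrix:
 fixes w :: "'b => 'a => 'k::field"
 assumes I: "indexing n I e" and J: "indexing n J f"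
  and w: "\<And>z. z \<in> J ==> w z \<in> Vs I" and ind: "indep_mod {\<lambda>_. 0} w J"
 shows "\<exists>S T. S \<in> sqm n \<and> T \<in> sqm n \<and> S * T = 1\<^sub>m n \<and> T * S = 1\<^sub>m n \<and>
  (\<forall>z\<in>J. opk I e J f S (uvec z) = w z)"
proof -
 have fin: "finite I" "finite J" using I J by (simp_all add: indexing_def)
 have "\<exists>\<beta>. uvec x = lcomb \<beta> w J" if "x \<in> I" for x
 proof -
  have "spanned_mod {\<lambda>_. 0} w J (uvec x)"
  proof (rule indep_imp_spanned[OF subsp_0 fin(2) fin(1) _ ind])
   show "card I <= card J" using card_indexing[OF I] card_indexing[OF J] by simp
   show "spanned_mod {\<lambda>_. 0} uvec I (w z)" if "z \<in> J" for z
    unfolding spanned_0_iff using Vs_expand[OF fin(1) w[OF that]] by blast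
   show "spanned_mod {\<lambda>_. 0} uvec I (uvec x :: 'a => 'k)"
    unfolding spanned_0_iff using Vs_expand[OF fin(1) uvec_Vs[OF \<open>x \<in> I\<close>]] by blast
  qed
  then show ?thesis by (simp add: spanned_0_iff)
 qed
 then obtain \<beta> where \<beta>: "\<And>x. x \<in> I ==> uvec x = lcomb (\<beta> x) w J" by metis
 define S where "S = mkm n I e J f (\<lambda>x z. w z x)"
 define T where "T = mkm n J f I e (\<lambda>z x. \<beta> x z)"
 have ST: "S * T = 1\<^sub>m n"
 proof (rule mat_eq_indexing[OF I I])
  fix x y assume xy: "x \<in> I" "y \<in> I"
  have "(S * T) $$ (e y, e x) = (\<Sum>z\<in>J. w z y * \<beta> x z)"
   using xy indexing_lt[OF I] by (subst index_mult_indexing[OF J]) (auto simp: S_def T_def index_mkm[OF J I] index_mkm[OF I J])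
  also have "\<dots> = uvec x y" using \<beta>[OF xy(1)] by (simp add: lcomb_def mult.commute)
  finally show "(S * T) $$ (e y, e x) = 1\<^sub>m n $$ (e y, e x)"
   using xy I indexing_lt[OF I] by (auto simp: uvec_def indexing_def bij_betw_def inj_on_def)
 qed (simp_all add: S_def T_def mult_carrier_mat[of _ n n])
 have "T * S = 1\<^sub>m n"
  by (rule mat_mult_left_right_inverse[OF _ _ ST]) (simp_all add: S_def T_def)
 moreover have "opk I e J f S (uvec z) = w z" if z: "z \<in> J" for z
 proof
  fix x
  show "opk I e J f S (uvec z) x = w z x"
  proof (cases "x \<in> I")
   case True
   then show ?thesis using z fin by (simp add: opk_uvec S_def index_mkm[OF J I])
  next
   case False
   then show ?thesis using w[OF z] by (simp add: opk_def Vs_def)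
  qed
 qed
 ultimately show ?thesis using ST by (intro exI[of _ S] exI[of _ T]) (simp add: S_def T_def)
qed

lemma opk_inverse:
 assumes "indexing n I e" "indexing n J f" "S \<in> sqm n" "T \<in> sqm n" "S * T = 1\<^sub>m n" "v \<in> Vs I"
 shows "opk I e J f S (opk J f I e T v) = v"
 using opk_mult[OF assms(1,2,1,3,4), of v] opk_one[OF assms(1,6)] assms(5) by simp

lemma corank_similar:
 assumes I: "indexing n I e" and J: "indexing n J f"
  and c: "A \<in> sqm n" "B \<in> sqm n" "S \<in> sqm n" "T \<in> sqm n"
  and ST: "S * T = 1\<^sub>m n" "T * S = 1\<^sub>m n" and AB: "A = S * B * T"
  and cor: "corank (Vs J) (opk J f J f B) s"
 shows "corank (Vs I) (opk I e I e A) s"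
proof (rule corank_transfer[OF lin_opk[of I e J f S] _ _ subsp_Vs _ _ cor])
 show "opk I e J f S ` Vs J = Vs I"
 proof
  show "opk I e J f S ` Vs J \<subseteq> Vs I" using opk_Vs by blast
  show "Vs I \<subseteq> opk I e J f S ` Vs J"
   using opk_inverse[OF I J c(3,4) ST(1)] opk_Vs by (metis image_eqI subsetI)
 qed
 show "inj_on (opk I e J f S) (Vs J)"
  by (rule inj_on_inverseI[of _ "opk J f I e T"]) (rule opk_inverse[OF J I c(4,3) ST(2)])
 show "opk J f J f B v \<in> Vs J" for v by (rule opk_Vs)
 fix v :: "'b => 'c" assume v: "v \<in> Vs J"
 have "A * S = S * B * (T * S)" using c unfolding AB
  by (simp add: assoc_mult_mat[of _ n n _ n _ n] mult_carrier_mat[of _ n n])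
 then have "A * S = S * B" using ST c by simp
 then show "opk I e J f S (opk J f J f B v) = opk I e I e A (opk I e J f S v)"
  using opk_mult[OF J J I c(3,2), of v] opk_mult[OF J I I c(1,3), of v] by simp
qed

section \<open>Jordan matrices as shifts, and their coranks\<close>

definition Ix :: "nat list => (nat \<times> nat) set" where
 "Ix ps = {(s, p). s < length ps \<and> p < ps ! s}"

text \<open>The Jordan block has its ones above the diagonal, so its cyclic generator is the last
 basis vector of the block.\<close>

definition ix :: "nat list => nat \<times> nat => nat" where
 "ix ps = (\<lambda>(s, p). sum_list (take s ps) + (ps ! s - 1 - p))"

definition jmat :: "nat list => 'k::field mat" where
 "jmat ps = jordan_matrix (map (\<lambda>q. (q, 0)) ps)"

lemma Ix_Cons: "Ix (a # ps) = Pair 0 ` {..<a} \<union> (\<lambda>(s, p). (Suc s, p)) ` Ix ps"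
proof (rule Set.set_eqI)
 fix x :: "nat \<times> nat"
 obtain s p where x: "x = (s, p)" by force
 show "x \<in> Ix (a # ps) \<longleftrightarrow> x \<in> Pair 0 ` {..<a} \<union> (\<lambda>(s, p). (Suc s, p)) ` Ix ps"
  unfolding x by (cases s) (auto simp: Ix_def image_iff)
qed

lemma Ix_Nil [simp]: "Ix [] = {}"
 by (simp add: Ix_def)

lemma ix_Cons: "ix (a # ps) (0, p) = a - 1 - p" "ix (a # ps) (Suc s, p) = a + ix ps (s, p)"
 by (simp_all add: ix_def)

lemma finite_Ix [simp]: "finite (Ix ps)"
 by (induction ps) (simp_all add: Ix_Cons)

lemma indexing_ix: "indexing (sum_list ps) (Ix ps) (ix ps)"
proof (induction ps)
 case Nil
 then show ?case by (simp add: indexing_def bij_betw_def)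
next
 case (Cons a ps)
 have 1: "bij_betw (ix (a # ps)) (Pair 0 ` {..<a}) {..<a}"
  by (rule bij_betw_byWitness[of _ "\<lambda>i. (0, a - 1 - i)"]) (auto simp: ix_Cons)
 have 2: "bij_betw (ix (a # ps)) ((\<lambda>(s, p). (Suc s, p)) ` Ix ps) {a..<a + sum_list ps}"
 proof -
  have "bij_betw (\<lambda>i. a + i) {..<sum_list ps} {a..<a + sum_list ps}"
   by (rule bij_betw_byWitness[of _ "\<lambda>i. i - a"]) auto
  then have "bij_betw ((\<lambda>i. a + i) \<circ> ix ps) (Ix ps) {a..<a + sum_list ps}"
   using Cons by (auto simp: indexing_def intro: bij_betw_trans)
  moreover have "bij_betw (\<lambda>(s, p). (s - 1, p)) ((\<lambda>(s, p). (Suc s, p)) ` Ix ps) (Ix ps)"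
   by (rule bij_betw_byWitness[of _ "\<lambda>(s, p). (Suc s, p)"]) auto
  ultimately have "bij_betw (((\<lambda>i. a + i) \<circ> ix ps) \<circ> (\<lambda>(s, p). (s - 1, p)))
    ((\<lambda>(s, p). (Suc s, p)) ` Ix ps) {a..<a + sum_list ps}"
   by (rule bij_betw_trans[rotated])
  then show ?thesis
   by (rule bij_betw_cong[THEN iffD1, rotated]) (auto simp: ix_Cons)
 qed
 have "bij_betw (ix (a # ps)) (Ix (a # ps)) ({..<a} \<union> {a..<a + sum_list ps})"
  unfolding Ix_Cons by (rule bij_betw_combine[OF 1 2]) auto
 moreover have "{..<a} \<union> {a..<a + sum_list ps} = {..<sum_list (a # ps)}" by auto
 ultimately show ?case by (simp add: indexing_def)
qed

lemma jmat_carrier [simp]: "jmat ps \<in> sqm (sum_list ps)"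
 using jordan_matrix_carrier[of "map (\<lambda>q. (q, 0)) ps"] by (simp add: jmat_def o_def)

lemma index_jmat:
 assumes "(s, p) \<in> Ix ps" "(t, q) \<in> Ix ps"
 shows "jmat ps $$ (ix ps (t, q), ix ps (s, p)) = of_bool (t = s \<and> q = Suc p)"
 using assms
proof (induction ps arbitrary: s t)
 case (Cons a ps)
 have lt: "ix ps (s, p) < sum_list ps" if "(s, p) \<in> Ix ps" for s p
  using indexing_lt[OF indexing_ix that] .
 have 1: "jmat (a # ps) = four_block_mat (jordan_block a 0) (0\<^sub>m a (sum_list ps)) (0\<^sub>m (sum_list ps) a) (jmat ps)"
  by (simp add: jmat_def jordan_matrix_Cons o_def)
 have dims: "dim_row (jmat ps) = sum_list ps" "dim_col (jmat ps) = sum_list ps"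
  using carrier_matD[OF jmat_carrier[of ps]] by simp_all
 show ?case
 proof (cases s; cases t)
  assume "s = 0" "t = 0"
  then show ?thesis using Cons.prems
   by (auto simp: 1 ix_Cons Ix_def dims)
 next
  fix t' assume "s = 0" "t = Suc t'"
  then show ?thesis using Cons.prems lt[of t' q]
   by (auto simp: 1 ix_Cons Ix_def dims)
 next
  fix s' assume "s = Suc s'" "t = 0"
  then show ?thesis using Cons.prems lt[of s' p]
   by (auto simp: 1 ix_Cons Ix_def dims)
 next
  fix s' t' assume *: "s = Suc s'" "t = Suc t'"
  then have in': "(s', p) \<in> Ix ps" "(t', q) \<in> Ix ps" using Cons.prems by (auto simp: Ix_def)
  show ?thesis using Cons.IH[OF in'] lt[OF in'(1)] lt[OF in'(2)] * by (simp add: 1 ix_Cons dims)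
 qed
qed simp

definition shift :: "nat list => nat => (nat \<times> nat => 'k::field) => nat \<times> nat => 'k" where
 "shift ps i v = (\<lambda>(s, p). if (s, p) \<in> Ix ps \<and> i <= p then v (s, p - i) else 0)"

lemma opk_jmat: "opk (Ix ps) (ix ps) (Ix ps) (ix ps) (jmat ps) v = shift ps 1 v"
proof (rule ext, clarify)
 fix t q
 show "opk (Ix ps) (ix ps) (Ix ps) (ix ps) (jmat ps) v (t, q) = shift ps 1 v (t, q)"
 proof (cases "(t, q) \<in> Ix ps")
  case True
  have "(\<Sum>x\<in>Ix ps. jmat ps $$ (ix ps (t, q), ix ps x) * v x) =
    (\<Sum>x\<in>Ix ps. if x = (t, q - 1) then (if q >= 1 then v x else 0) else 0)"
   using True by (intro sum.cong refl) (auto simp: index_jmat)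
  also have "(t, q - 1) \<in> Ix ps" using True by (auto simp: Ix_def)
  then have "(\<Sum>x\<in>Ix ps. if x = (t, q - 1) then (if q >= 1 then v x else 0) else 0) = shift ps 1 v (t, q)"
   using True by (simp add: shift_def)
  finally show ?thesis using True by (simp add: opk_def)
 qed (simp add: opk_def shift_def)
qed

lemma shift_shift: "shift ps i (shift ps j v) = shift ps (i + j) v"
 by (auto simp: shift_def Ix_def fun_eq_iff)

lemma opk_jmat_pow:
 assumes "v \<in> Vs (Ix ps)"
 shows "opk (Ix ps) (ix ps) (Ix ps) (ix ps) (jmat ps ^\<^sub>m i) v = shift ps i v"
 using assms
proof (induction i arbitrary: v)
 case 0
 have "shift ps 0 v = v" using 0 by (auto simp: shift_def Vs_def fun_eq_iff)
 then show ?case using opk_one[OF indexing_ix 0] by (simp add: carrier_matD(1)[OF jmat_carrier])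
next
 case (Suc i)
 have "shift ps 1 v \<in> Vs (Ix ps)"
  using opk_Vs[of "Ix ps" "ix ps" "Ix ps" "ix ps" "jmat ps" v] unfolding opk_jmat .
 then have "opk (Ix ps) (ix ps) (Ix ps) (ix ps) (jmat ps ^\<^sub>m i * jmat ps) v = shift ps i (shift ps 1 v)"
  unfolding opk_mult[OF indexing_ix indexing_ix indexing_ix pow_carrier_mat[OF jmat_carrier] jmat_carrier]
   opk_jmat by (rule Suc.IH)
 then show ?case by (simp add: shift_shift)
qed

lemma card_Ix_below: "card {(s, p). (s, p) \<in> Ix ps \<and> p < i} = prof (mset ps) i"
proof (induction ps)
 case Nil
 then show ?case by simp
next
 case (Cons a ps)
 have "{(s, p). (s, p) \<in> Ix (a # ps) \<and> p < i} =
   Pair 0 ` {..<min i a} \<union> (\<lambda>(s, p). (Suc s, p)) ` {(s, p). (s, p) \<in> Ix ps \<and> p < i}"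
  by (auto simp: Ix_Cons image_iff)
 moreover have "finite {(s, p). (s, p) \<in> Ix ps \<and> p < i}"
  by (rule finite_subset[OF _ finite_Ix[of ps]]) auto
 ultimately have "card {(s, p). (s, p) \<in> Ix (a # ps) \<and> p < i} =
   card (Pair (0::nat) ` {..<min i a}) + card ((\<lambda>(s, p). (Suc s, p)) ` {(s, p). (s, p) \<in> Ix ps \<and> p < i})"
  by (simp only:) (rule card_Un_disjoint, auto)
 also have "\<dots> = min i a + card {(s, p). (s, p) \<in> Ix ps \<and> p < i}"
  by (subst card_image, simp add: inj_on_def, subst card_image) (auto simp: inj_on_def)
 finally show ?case using Cons by simp
qed

text \<open>The image of the \<open>i\<close>-th power consists of the functions vanishing at all
  positions below \<open>i\<close>, so the unit vectors there are a basis of the cokernel.\<close>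

lemma corank_jmat:
 "corank (Vs (Ix ps)) (opk (Ix ps) (ix ps) (Ix ps) (ix ps) (jmat ps ^\<^sub>m i :: 'k::field mat)) (prof (mset ps) i)"
proof -
 let ?I = "Ix ps" and ?f = "opk (Ix ps) (ix ps) (Ix ps) (ix ps) (jmat ps ^\<^sub>m i :: 'k mat)"
 let ?B = "{(s, p). (s, p) \<in> ?I \<and> p < i}"
 have im: "?f ` Vs ?I = {v \<in> Vs ?I. \<forall>x\<in>?B. v x = 0}"
 proof
  show "?f ` Vs ?I \<subseteq> {v \<in> Vs ?I. \<forall>x\<in>?B. v x = 0}"
   by (auto simp: opk_jmat_pow) (auto simp: shift_def Vs_def)
  show "{v \<in> Vs ?I. \<forall>x\<in>?B. v x = 0} \<subseteq> ?f ` Vs ?I"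
  proof
   fix v :: "nat \<times> nat => 'k" assume v: "v \<in> {v \<in> Vs ?I. \<forall>x\<in>?B. v x = 0}"
   define w where "w = (\<lambda>(s, p). if (s, p + i) \<in> ?I then v (s, p + i) else 0)"
   have w: "w \<in> Vs ?I" by (auto simp: w_def Vs_def Ix_def)
   have "v (a, b) = 0" if "b < i" for a b
    using v that by (cases "(a, b) \<in> Ix ps") (auto simp: Vs_def)
   then have "shift ps i w = v"
    using v by (auto simp: shift_def w_def Vs_def fun_eq_iff not_le)
   then show "v \<in> ?f ` Vs ?I" using opk_jmat_pow[OF w, of i] w by (metis imageI)
  qed
 qed
 have fin: "finite ?B" by (rule finite_subset[OF _ finite_Ix[of ps]]) auto
 have lc: "lcomb \<alpha> uvec ?B x = (if x \<in> ?B then \<alpha> x else 0)" for \<alpha> :: "nat \<times> nat => 'k" and x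
  using fin by (simp add: lcomb_def uvec_def if_distrib cong: if_cong)
 have "corank (Vs ?I) ?f (card ?B)"
 proof (rule corankI[OF fin, of uvec])
  show "uvec x \<in> Vs ?I" if "x \<in> ?B" for x using that by (intro uvec_Vs) auto
  show "indep_mod (?f ` Vs ?I) uvec ?B"
   unfolding im indep_mod_def by (auto simp: lc)
  show "spanned_mod (?f ` Vs ?I) uvec ?B v" if "v \<in> Vs ?I" for v
   unfolding im spanned_mod_def using that by (intro exI[of _ v]) (auto simp: lc Vs_def)
 qed
 then show ?thesis by (simp only: card_Ix_below)
qed

definition parts :: "nat multiset => nat list" where
 "parts P = rev (sorted_list_of_multiset P)"

lemma mset_parts [simp]: "mset (parts P) = P"
 by (simp add: parts_def)

lemma sum_list_parts [simp]: "sum_list (parts P) = sum_mset P"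
 by (metis mset_parts sum_mset_sum_list)

lemma jordan_matrix_blocks: "jordan_matrix (jordan_blocks P) = jmat (parts P)"
 by (simp add: jordan_blocks_def jmat_def parts_def)

lemma has_jordan_type_iff:
 "has_jordan_type A P \<longleftrightarrow> is_partition P \<and> similar_mat A (jmat (parts P))"
proof -
 have "set (parts P) = set_mset P" by (metis mset_parts set_mset_mset)
 then have f: "fst ` set (jordan_blocks P) = set_mset P"
  by (simp add: jordan_blocks_def parts_def image_image)
 show ?thesis
  unfolding has_jordan_type_def jordan_nf_def jordan_matrix_blocks is_partition_def f ..
qed

lemma has_jordan_typeE:
 assumes "has_jordan_type A P"
 obtains S T where "A \<in> sqm (sum_mset P)" "S \<in> sqm (sum_mset P)"
  "T \<in> sqm (sum_mset P)" "S * T = 1\<^sub>m (sum_mset P)" "T * S = 1\<^sub>m (sum_mset P)"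
  "A = S * jmat (parts P) * T" "is_partition P"
proof -
 obtain n S T where w: "{A, jmat (parts P), S, T} \<subseteq> sqm n" "S * T = 1\<^sub>m n" "T * S = 1\<^sub>m n"
   "A = S * jmat (parts P) * T" and P: "is_partition P"
  using assms similar_matD[of A "jmat (parts P)"] unfolding has_jordan_type_iff by blast
 have "jmat (parts P) \<in> (sqm n :: 'a mat set)" using w(1) by blast
 then have "n = sum_mset P"
  using carrier_matD(1)[OF jmat_carrier[of "parts P"]] carrier_matD(1) by (metis sum_list_parts)
 then show ?thesis using w P that[of S T] by simp
qed

lemma corank_jordan_type:
 fixes A :: "'k::field mat"
 assumes "has_jordan_type A P" and I: "indexing (sum_mset P) I e"
 shows "corank (Vs I) (opk I e I e (A ^\<^sub>m i)) (prof P i)"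
proof -
 let ?n = "sum_mset P"
 obtain S T where w: "A \<in> sqm ?n" "S \<in> sqm ?n" "T \<in> sqm ?n"
   "S * T = 1\<^sub>m ?n" "T * S = 1\<^sub>m ?n" "A = S * jmat (parts P) * T"
  using assms(1) by (elim has_jordan_typeE)
 have J: "(jmat (parts P) :: 'k mat) \<in> sqm ?n" using jmat_carrier[of "parts P"] by simp
 have "similar_mat_wit A (jmat (parts P)) S T"
  using w J by (intro similar_mat_witI[of _ _ ?n]) auto
 then have pow: "A ^\<^sub>m i = S * jmat (parts P) ^\<^sub>m i * T" by (rule similar_mat_wit_pow_id)
 have ix: "indexing ?n (Ix (parts P)) (ix (parts P))" using indexing_ix[of "parts P"] by simp
 show ?thesis
  using corank_jmat[of "parts P" i]
  by (intro corank_similar[OF I ix _ _ w(2-5) pow]) (use w(1) J in "simp_all add: pow_carrier_mat")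
qed

text \<open>A permutation of the blocks permutes the labels, and the resulting permutation matrix
  intertwines the two shifts.\<close>

lemma similar_jmat:
 assumes "mset ps = mset ps'"
 shows "similar_mat (jmat ps) (jmat ps' :: 'k::field mat)"
proof -
 let ?n = "sum_list ps"
 have n: "sum_list ps' = ?n" using assms by (metis sum_mset_sum_list)
 obtain \<pi> where \<pi>: "bij_betw \<pi> {..<length ps} {..<length ps'}" "\<And>i. i < length ps ==> ps ! i = ps' ! \<pi> i"
  using permutation_Ex_bij[OF assms] by blast
 define F where "F = (\<lambda>(s, p :: nat). (\<pi> s, p))"
 have \<pi>_lt: "\<pi> s < length ps'" if "s < length ps" for s using \<pi>(1) that by (auto simp: bij_betw_def)
 have F: "F x \<in> Ix ps'" if "x \<in> Ix ps" for x
  using that \<pi>_lt \<pi>(2) by (auto simp: F_def Ix_def)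
 have inj: "F x = F y \<longleftrightarrow> x = y" if "x \<in> Ix ps" "y \<in> Ix ps" for x y
  using that \<pi>(1) by (auto simp: F_def Ix_def bij_betw_def dest: inj_onD)
 have I: "indexing ?n (Ix ps) (ix ps)" by (rule indexing_ix)
 have I': "indexing ?n (Ix ps') (ix ps')" using indexing_ix[of ps'] n by simp
 have ind: "indep_mod {\<lambda>_. 0} (\<lambda>x. uvec (F x) :: nat \<times> nat => 'k) (Ix ps)"
  unfolding indep_mod_def
 proof (intro allI impI ballI)
  fix \<alpha> :: "nat \<times> nat => 'k" and x
  assume *: "lcomb \<alpha> (\<lambda>x. uvec (F x)) (Ix ps) \<in> {\<lambda>_. 0}" "x \<in> Ix ps"
  have "lcomb \<alpha> (\<lambda>x. uvec (F x)) (Ix ps) (F x) = (\<Sum>y\<in>Ix ps. if y = x then \<alpha> y else 0)"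
   unfolding lcomb_def uvec_def using *(2) inj by (intro sum.cong) auto
  then have "\<alpha> x = lcomb \<alpha> (\<lambda>x. uvec (F x)) (Ix ps) (F x)" using *(2) by simp
  also have "\<dots> = 0" using *(1) by simp
  finally show "\<alpha> x = 0" .
 qed
 obtain S T :: "'k mat" where ST: "S \<in> sqm ?n" "T \<in> sqm ?n" "S * T = 1\<^sub>m ?n" "T * S = 1\<^sub>m ?n"
   and S: "\<forall>z\<in>Ix ps. opk (Ix ps') (ix ps') (Ix ps) (ix ps) S (uvec z) = uvec (F z)"
 proof -
  have "\<exists>S T. S \<in> sqm ?n \<and> T \<in> sqm ?n \<and> S * T = 1\<^sub>m ?n \<and> T * S = 1\<^sub>m ?n \<and>
    (\<forall>z\<in>Ix ps. opk (Ix ps') (ix ps') (Ix ps) (ix ps) S (uvec z) = (uvec (F z) :: nat \<times> nat => 'k))"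
   by (rule basis_matrix[OF I' I _ ind]) (intro uvec_Vs F)
  then show ?thesis by (elim exE conjE) (rule that)
 qed
 have J: "(jmat ps :: 'k mat) \<in> sqm ?n" "(jmat ps' :: 'k mat) \<in> sqm ?n"
  using jmat_carrier[of ps] jmat_carrier[of ps'] n by simp_all
 have "S * jmat ps = jmat ps' * S"
 proof (rule mat_eq_indexing[OF I I'])
  show "S * jmat ps \<in> sqm ?n" "jmat ps' * S \<in> sqm ?n" using ST J by simp_all
  fix x y assume xy: "x \<in> Ix ps" "y \<in> Ix ps'"
  obtain s p where x: "x = (s, p)" by force
  have sh: "shift ps 1 (uvec (s, p) :: _ => 'k) = (if (s, Suc p) \<in> Ix ps then uvec (s, Suc p) else (\<lambda>_. 0))"
   by (auto simp: shift_def uvec_def fun_eq_iff Ix_def)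
  have sh': "shift ps' 1 (uvec (F x) :: _ => 'k) = (if (s, Suc p) \<in> Ix ps then uvec (F (s, Suc p)) else (\<lambda>_. 0))"
   using xy(1) \<pi>_lt \<pi>(2) by (auto simp: shift_def uvec_def fun_eq_iff Ix_def F_def x)
  have "opk (Ix ps') (ix ps') (Ix ps) (ix ps) (S * jmat ps) (uvec x) =
    opk (Ix ps') (ix ps') (Ix ps) (ix ps) (jmat ps' * S) (uvec x)"
   unfolding opk_mult[OF I I I' ST(1) J(1)] opk_mult[OF I I' I' J(2) ST(1)] opk_jmat
   using S xy(1) x sh sh' linD(3)[OF lin_opk, of "Ix ps'" "ix ps'" "Ix ps" "ix ps" S] by auto
  then show "(S * jmat ps) $$ (ix ps' y, ix ps x) = (jmat ps' * S) $$ (ix ps' y, ix ps x)"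
   using opk_uvec[OF finite_Ix xy(1,2)] by metis
 qed
 then have "T * (S * jmat ps) = T * (jmat ps' * S)" by simp
 moreover have "T * (S * jmat ps) = (T * S) * jmat ps"
  by (rule assoc_mult_mat[symmetric, of _ ?n ?n _ ?n _ ?n]) (use ST J in simp_all)
 moreover have "T * (jmat ps' * S) = T * jmat ps' * S"
  by (rule assoc_mult_mat[symmetric, of _ ?n ?n _ ?n _ ?n]) (use ST J in simp_all)
 ultimately have "jmat ps = T * jmat ps' * S" using ST(4) J by simp
 then show ?thesis using ST J by (intro similar_matI[of _ _ T S ?n]) auto
qed

text \<open>To extend the flag, start from a unit vector outside the present span and apply
  \<open>f\<close> until the span is entered; the last iterate outside is the new vector.\<close>

lemma nilpotent_flag:
 fixes f :: "('a => 'k::field) => ('a => 'k)"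
 assumes fin: "finite I" and lin: "lin f" and f: "\<And>v. v \<in> Vs I ==> f v \<in> Vs I"
  and nil: "\<And>v. v \<in> Vs I ==> (f ^^ N) v = (\<lambda>_. 0)" and i: "i <= card I"
 shows "\<exists>w :: nat => 'a => 'k. indep_mod {\<lambda>_. 0} w {..<i} \<and> (\<forall>j<i. w j \<in> Vs I) \<and>
  (\<forall>j<i. \<exists>\<beta>. f (w j) = lcomb \<beta> w {..<j})"
 using i
proof (induction i)
 case 0
 then show ?case by (simp add: indep_mod_def)
next
 case (Suc i)
 then obtain w :: "nat => 'a => 'k" where w: "indep_mod {\<lambda>_. 0} w {..<i}" "\<forall>j<i. w j \<in> Vs I"
   "\<forall>j<i. \<exists>\<beta>. f (w j) = lcomb \<beta> w {..<j}" by auto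
 let ?sp = "\<lambda>v. \<exists>\<beta>. v = lcomb \<beta> w {..<i}"
 have "\<exists>x\<in>I. \<not> ?sp (uvec x)"
 proof (rule ccontr)
  assume "\<not> (\<exists>x\<in>I. \<not> ?sp (uvec x))"
  then have "card I <= card {..<i}"
   by (intro indep_card_le[OF subsp_0 fin _ indep_uvec[OF fin]]) (auto simp: spanned_0_iff)
  then show False using Suc.prems by simp
 qed
 then obtain x where x: "x \<in> I" "\<not> ?sp (uvec x)" by blast
 have V: "(f ^^ m) (uvec x) \<in> Vs I" for m by (induction m) (use x uvec_Vs f in auto)
 define m where "m = (LEAST m. ?sp ((f ^^ m) (uvec x)))"
 have "?sp ((f ^^ N) (uvec x))"
  using nil[OF uvec_Vs[OF x(1)]] by (intro exI[of _ "\<lambda>_. 0"]) (simp add: lcomb_def)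
 then have m: "?sp ((f ^^ m) (uvec x))" unfolding m_def by (rule LeastI)
 have "m \<noteq> 0" using m x(2) by (intro notI) simp
 then obtain m' where m': "m = Suc m'" by (cases m) auto
 define v where "v = (f ^^ m') (uvec x)"
 have v: "v \<in> Vs I" "\<not> ?sp v" "?sp (f v)"
  using V m not_less_Least[of m' "\<lambda>m. ?sp ((f ^^ m) (uvec x))"] unfolding v_def m_def[symmetric] m' by auto
 have lc: "lcomb \<beta> (w(i := v)) {..<j} = lcomb \<beta> w {..<j}" if "j <= i" for \<beta> j
  using that by (auto simp: lcomb_def fun_eq_iff intro!: sum.cong)
 have "indep_mod {\<lambda>_. 0} (w(i := v)) {..<Suc i}"
  unfolding indep_mod_def
 proof (intro allI impI)
  fix \<alpha> assume "lcomb \<alpha> (w(i := v)) {..<Suc i} \<in> {\<lambda>_. 0}"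
  then have "lcomb \<alpha> (w(i := v)) {..<Suc i} x = 0" for x by simp
  then have eq: "lcomb \<alpha> w {..<i} x + \<alpha> i * v x = 0" for x
   using fun_cong[OF lc[of i \<alpha>], of x] by (simp add: lcomb_def)
  have ai: "\<alpha> i = 0"
  proof (rule ccontr)
   assume a: "\<alpha> i \<noteq> 0"
   have "v x = lcomb (\<lambda>j. - \<alpha> j / \<alpha> i) w {..<i} x" for x
   proof -
    have "lcomb (\<lambda>j. - \<alpha> j / \<alpha> i) w {..<i} x = - lcomb \<alpha> w {..<i} x / \<alpha> i"
     by (simp add: lcomb_def sum_divide_distrib sum_negf)
    also have "lcomb \<alpha> w {..<i} x = - (\<alpha> i * v x)" using eq[of x] by (simp add: eq_neg_iff_add_eq_0)
    also have "- (- (\<alpha> i * v x)) / \<alpha> i = v x" using a by simp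
    finally show ?thesis by simp
   qed
   then show False using v(2) by blast
  qed
  then have "lcomb \<alpha> w {..<i} = (\<lambda>_. 0)" using eq by auto
  then have "\<forall>j\<in>{..<i}. \<alpha> j = 0" using w(1) unfolding indep_mod_def by blast
  then show "\<forall>j\<in>{..<Suc i}. \<alpha> j = 0" using ai by (auto simp: less_Suc_eq)
 qed
 moreover have "\<exists>\<beta>. f ((w(i := v)) j) = lcomb \<beta> (w(i := v)) {..<j}" if "j < Suc i" for j
 proof (cases "j = i")
  case True
  then show ?thesis using v(3) lc[of i] by auto
 next
  case False
  then have "j < i" using that by simp
  then show ?thesis using w(3) lc[of j] by auto
 qed
 moreover have "\<forall>j<Suc i. (w(i := v)) j \<in> Vs I" using v(1) w(2) by (simp add: less_Suc_eq)
 ultimately show ?case by blast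
qed

lemma opk_pow:
 assumes I: "indexing n I e" and A: "A \<in> sqm n" and v: "v \<in> Vs I"
 shows "opk I e I e (A ^\<^sub>m i) v = (opk I e I e A ^^ i) v"
 using v
proof (induction i arbitrary: v)
 case 0
 then show ?case using opk_one[OF I] carrier_matD(1)[OF A] by simp
next
 case (Suc i)
 show ?case
  using Suc.IH[OF opk_Vs, of e I e A v]
  by (simp add: opk_mult[OF I I I pow_carrier_mat[OF A] A] funpow_swap1)
qed

lemma nilpotent_similar_strictly_upper:
 fixes A :: "'k::field mat"
 assumes A: "A \<in> sqm n" and nil: "A ^\<^sub>m N = 0\<^sub>m n n"
 shows "\<exists>C S T. C \<in> sqm n \<and> S \<in> sqm n \<and> T \<in> sqm n \<and> S * T = 1\<^sub>m n \<and> T * S = 1\<^sub>m n \<and>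
  A = S * C * T \<and> (\<forall>i<n. \<forall>j<n. j <= i --> C $$ (i, j) = 0)"
proof -
 let ?I = "{..<n}" and ?e = "\<lambda>i::nat. i"
 let ?f = "opk ?I ?e ?I ?e A"
 have I: "indexing n ?I ?e" by (rule indexing_nat)
 have nil': "(?f ^^ N) v = (\<lambda>_. 0)" if "v \<in> Vs ?I" for v
  unfolding opk_pow[OF I A that, symmetric] nil by (auto simp: opk_def)
 have "\<exists>w :: nat => nat => 'k. indep_mod {\<lambda>_. 0} w {..<n} \<and> (\<forall>j<n. w j \<in> Vs ?I) \<and>
   (\<forall>j<n. \<exists>\<beta>. ?f (w j) = lcomb \<beta> w {..<j})"
  by (rule nilpotent_flag[OF _ lin_opk _ nil']) (simp_all add: opk_Vs)
 then obtain w :: "nat => nat => 'k" where w: "indep_mod {\<lambda>_. 0} w {..<n}" "\<forall>j<n. w j \<in> Vs ?I"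
   "\<forall>j<n. \<exists>\<beta>. ?f (w j) = lcomb \<beta> w {..<j}" by blast
 obtain S T :: "'k mat" where ST: "S \<in> sqm n" "T \<in> sqm n" "S * T = 1\<^sub>m n" "T * S = 1\<^sub>m n"
   and S: "\<forall>z\<in>?I. opk ?I ?e ?I ?e S (uvec z) = w z"
 proof -
  have "\<exists>S T. S \<in> sqm n \<and> T \<in> sqm n \<and> S * T = 1\<^sub>m n \<and> T * S = 1\<^sub>m n \<and>
    (\<forall>z\<in>?I. opk ?I ?e ?I ?e S (uvec z) = w z)"
   by (rule basis_matrix[OF I I _ w(1)]) (use w(2) in simp)
  then show ?thesis by (elim exE conjE) (rule that)
 qed
 define C where "C = T * (A * S)"
 have C: "C \<in> sqm n" using ST A by (simp add: C_def)
 have "S * C = (S * T) * (A * S)" unfolding C_def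
  by (rule assoc_mult_mat[symmetric, of _ n n _ n _ n]) (use ST A in simp_all)
 then have SC: "S * C = A * S" using ST A by simp
 have "S * C * T = A * (S * T)" unfolding SC
  by (rule assoc_mult_mat[of _ n n _ n _ n]) (use ST A in simp_all)
 then have AC: "A = S * C * T" using ST A by simp
 have "C $$ (i, j) = 0" if ij: "i < n" "j < n" "j <= i" for i j
 proof -
  obtain \<beta> where \<beta>: "?f (w j) = lcomb \<beta> w {..<j}" using w(3) ij(2) by blast
  have "opk ?I ?e ?I ?e C (uvec j) = opk ?I ?e ?I ?e T (?f (opk ?I ?e ?I ?e S (uvec j)))"
   unfolding C_def using ST A by (simp add: opk_mult[OF I I I])
  also have "\<dots> = opk ?I ?e ?I ?e T (lcomb \<beta> (\<lambda>z. opk ?I ?e ?I ?e S (uvec z)) {..<j})"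
   using S ij(2) \<beta> by (simp add: lcomb_def)
  also have "\<dots> = lcomb \<beta> (\<lambda>z. opk ?I ?e ?I ?e T (opk ?I ?e ?I ?e S (uvec z))) {..<j}"
   by (rule lin_lcomb[OF lin_opk])
  finally have "opk ?I ?e ?I ?e C (uvec j) i =
    lcomb \<beta> (\<lambda>z. opk ?I ?e ?I ?e T (opk ?I ?e ?I ?e S (uvec z))) {..<j} i" by simp
  also have "\<dots> = (\<Sum>z<j. \<beta> z * uvec z i)"
   unfolding lcomb_def using ij
   by (intro sum.cong refl) (simp add: opk_inverse[OF I I ST(2,1,4)] uvec_Vs)
  also have "\<dots> = 0" using ij(3) by (intro sum.neutral) (auto simp: uvec_def)
  finally show ?thesis using opk_uvec[of ?I j i ?I ?e ?e C] ij by simp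
 qed
 then show ?thesis using C ST AC by blast
qed

text \<open>Nilpotent matrices are strictly triangularisable over every field, so the Jordan form of
  triangular matrices applies; its eigenvalues are among the diagonal entries and hence
  zero.\<close>

lemma nilpotent_jordan_type:
 fixes A :: "'k::field mat"
 assumes A: "A \<in> sqm n" and nil: "A ^\<^sub>m N = 0\<^sub>m n n"
 shows "\<exists>P. has_jordan_type A P"
proof -
 obtain C S T where C: "C \<in> sqm n" and ST: "S \<in> sqm n" "T \<in> sqm n"
   "S * T = 1\<^sub>m n" "T * S = 1\<^sub>m n" "A = S * C * T"
   and upper: "\<forall>i<n. \<forall>j<n. j <= i --> C $$ (i, j) = 0"
  using nilpotent_similar_strictly_upper[OF A nil] by (elim exE conjE)
 have ut: "upper_triangular C" using upper C by (intro upper_triangularI) simp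
 obtain n_as where jnf: "jordan_nf C n_as" using triangular_to_jnf_vector[OF C ut] by blast
 have diag: "a = 0" if "a \<in> set (diag_mat C)" for a
  using that upper C by (auto simp: diag_mat_def)
 have zero: "a = 0" if "(m, a) \<in> set n_as" for m a
 proof -
  have "m \<noteq> 0" using jnf that by (force simp: jordan_nf_def)
  have "poly (char_poly C) a = 0"
  proof -
   have "poly (\<Prod>(m, a)\<leftarrow>n_as. [:- a, 1:] ^ m) a = 0"
    using \<open>m \<noteq> 0\<close> unfolding poly_prod_list prod_list_zero_iff map_map set_map o_def
    by (intro image_eqI[OF _ that]) (simp add: poly_power)
   then show ?thesis by (simp add: jordan_nf_char_poly[OF jnf])
  qed
  then have "0 \<in> (\<lambda>b. a - b) ` set (diag_mat C)"
   by (simp add: char_poly_upper_triangular[OF C ut] poly_prod_list prod_list_zero_iff o_def image_iff)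
  then show "a = 0" using diag by auto
 qed
 define ps where "ps = map fst n_as"
 have n_as: "n_as = map (\<lambda>q. (q, 0)) ps"
  unfolding ps_def map_map using zero by (intro map_idI[symmetric]) auto
 have "similar_mat A C" using A C ST by (intro similar_matI[of _ _ S T n]) auto
 moreover have "similar_mat C (jmat ps)" using jnf n_as by (simp add: jordan_nf_def jmat_def)
 moreover have "similar_mat (jmat ps) (jmat (parts (mset ps)) :: 'k mat)" by (rule similar_jmat) simp
 ultimately have "similar_mat A (jmat (parts (mset ps)))" using similar_mat_trans by blast
 moreover have "is_partition (mset ps)" using jnf by (simp add: jordan_nf_def ps_def is_partition_def)
 ultimately show ?thesis unfolding has_jordan_type_iff by blast
qed

text \<open>Some Jordan type exists by nilpotency. Its profile consists of the coranks of the
  powers, and a profile determines its partition.\<close>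

lemma has_jordan_typeI:
 assumes A: "A \<in> sqm n" and nil: "A ^\<^sub>m N = 0\<^sub>m n n" and I: "indexing n I e"
  and P: "is_partition P" and cor: "\<And>i. corank (Vs I) (opk I e I e (A ^\<^sub>m i)) (prof P i)"
 shows "has_jordan_type A P"
proof -
 obtain P' where P': "has_jordan_type A P'" using nilpotent_jordan_type[OF A nil] by blast
 have "A \<in> sqm (sum_mset P')" using P' by (rule has_jordan_typeE)
 then have "sum_mset P' = n" using carrier_matD(1)[OF A] carrier_matD(1) by metis
 then have "prof P i = prof P' i" for i
  using corank_unique[OF lin_opk subsp_Vs cor corank_jordan_type[OF P']] I by blast
 then have "P = P'" using P P' by (intro prof_inject) (simp_all add: has_jordan_type_iff)
 then show ?thesis using P' by simp
qed

section \<open>The nilpotent commutator of a Jordan matrix\<close>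

abbreviation ent :: "nat list => 'k::field mat => nat \<times> nat => nat \<times> nat => 'k" where
 "ent ps B y x \<equiv> B $$ (ix ps y, ix ps x)"

definition comm :: "nat list => 'k::field mat => bool" where
 "comm ps B \<longleftrightarrow> B \<in> sqm (sum_list ps) \<and> B * jmat ps = jmat ps * B"

lemma nilpotent_commutator_iff:
 "B \<in> nilpotent_commutator P \<longleftrightarrow> comm (parts P) B \<and> B ^\<^sub>m sum_mset P = 0\<^sub>m (sum_mset P) (sum_mset P)"
 by (auto simp: nilpotent_commutator_def comm_def Let_def jordan_matrix_blocks)

lemma Ix_lt: "(s, p) \<in> Ix ps ==> ix ps (s, p) < sum_list ps"
 by (rule indexing_lt[OF indexing_ix])

lemma index_mult_Ix:
 assumes "A \<in> sqm (sum_list ps)" "B \<in> sqm (sum_list ps)"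
  "x \<in> Ix ps" "y \<in> Ix ps"
 shows "ent ps (A * B) y x = (\<Sum>z\<in>Ix ps. ent ps A y z * ent ps B z x)"
 by (rule index_mult_indexing[OF indexing_ix assms(1,2)])
  (use assms(3,4) indexing_lt[OF indexing_ix] in auto)

lemma ent_mult_jmat:
 assumes "B \<in> sqm (sum_list ps)" "(s, p) \<in> Ix ps" "y \<in> Ix ps"
 shows "ent ps (B * jmat ps) y (s, p) = (if Suc p < ps ! s then ent ps B y (s, Suc p) else 0)"
proof -
 have "ent ps (B * jmat ps) y (s, p) = (\<Sum>z\<in>Ix ps. if z = (s, Suc p) then ent ps B y z else 0)"
  unfolding index_mult_Ix[OF assms(1) jmat_carrier assms(2,3)]
  by (intro sum.cong refl) (use assms(2) in "auto simp: index_jmat")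
 moreover have "(s, Suc p) \<in> Ix ps \<longleftrightarrow> Suc p < ps ! s" using assms(2) by (simp add: Ix_def)
 ultimately show ?thesis by (simp add: sum.delta)
qed

lemma ent_jmat_mult:
 assumes "B \<in> sqm (sum_list ps)" "x \<in> Ix ps" "(t, q) \<in> Ix ps"
 shows "ent ps (jmat ps * B) (t, q) x = (if 1 <= q then ent ps B (t, q - 1) x else 0)"
proof -
 have "ent ps (jmat ps * B) (t, q) x = (\<Sum>z\<in>Ix ps. if z = (t, q - 1) then (if 1 <= q then ent ps B z x else 0) else 0)"
  unfolding index_mult_Ix[OF jmat_carrier assms(1,2,3)]
  by (intro sum.cong refl) (use assms(3) in "auto simp: index_jmat")
 moreover have "(t, q - 1) \<in> Ix ps" using assms(3) by (auto simp: Ix_def)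
 ultimately show ?thesis by (simp add: sum.delta)
qed

lemma comm_iff:
 "comm ps B \<longleftrightarrow> B \<in> sqm (sum_list ps) \<and>
  (\<forall>s p t q. (s, p) \<in> Ix ps --> (t, q) \<in> Ix ps -->
   (if Suc p < ps ! s then ent ps B (t, q) (s, Suc p) else 0) =
   (if 1 <= q then ent ps B (t, q - 1) (s, p) else 0))" (is "_ \<longleftrightarrow> ?c \<and> ?R")
proof -
 have "B * jmat ps = jmat ps * B \<longleftrightarrow> ?R" if B: ?c
 proof
  assume *: "B * jmat ps = jmat ps * B"
  show ?R
  proof (intro allI impI)
   fix s p t q assume "(s, p) \<in> Ix ps" "(t, q) \<in> Ix ps"
   then show "(if Suc p < ps ! s then ent ps B (t, q) (s, Suc p) else 0) =
     (if 1 <= q then ent ps B (t, q - 1) (s, p) else 0)"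
    using ent_mult_jmat[OF B, of s p "(t, q)"] ent_jmat_mult[OF B, of "(s, p)" t q] * by simp
  qed
 next
  assume R: ?R
  show "B * jmat ps = jmat ps * B"
  proof (rule mat_eq_indexing[OF indexing_ix indexing_ix])
   fix x y assume xy: "x \<in> Ix ps" "y \<in> Ix ps"
   obtain s p t q where "x = (s, p)" "y = (t, q)" by (cases x, cases y)
   then show "ent ps (B * jmat ps) y x = ent ps (jmat ps * B) y x"
    using xy R ent_mult_jmat[OF B, of s p "(t, q)"] ent_jmat_mult[OF B, of "(s, p)" t q] by simp
  qed (use B in simp_all)
 qed
 then show ?thesis unfolding comm_def by blast
qed

lemma commD:
 assumes "comm ps B"
 shows "B \<in> sqm (sum_list ps)" "B * jmat ps = jmat ps * B"
 using assms by (simp_all add: comm_def)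

lemma comm_shift:
 assumes "comm ps B" "(s, p + i) \<in> Ix ps" "(t, q) \<in> Ix ps"
 shows "ent ps B (t, q) (s, p + i) = (if i <= q then ent ps B (t, q - i) (s, p) else 0)"
 using assms(2,3)
proof (induction i arbitrary: q)
 case (Suc i)
 have in': "(s, p + i) \<in> Ix ps" "Suc (p + i) < ps ! s" using Suc.prems by (auto simp: Ix_def)
 have "ent ps B (t, q) (s, Suc (p + i)) = (if 1 <= q then ent ps B (t, q - 1) (s, p + i) else 0)"
  using assms(1) in' Suc.prems(2) unfolding comm_iff by metis
 moreover have "(t, q - 1) \<in> Ix ps" using Suc.prems(2) by (auto simp: Ix_def)
 ultimately show ?case using Suc.IH[OF in'(1), of "q - 1"] by (cases q) auto
qed simp

text \<open>A position cannot move towards the generator. For the second bound, push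
  \<open>p\<close> to the end of its block: the next shift kills the source, so it must kill the
  target, which is impossible if the target block has room left.\<close>

lemma comm_bounds:
 assumes "comm ps B" "(s, p) \<in> Ix ps" "(t, q) \<in> Ix ps" "ent ps B (t, q) (s, p) \<noteq> 0"
 shows "p <= q" "p + ps ! t <= q + ps ! s"
proof -
 show "p <= q" using comm_shift[OF assms(1), of s 0 p t q] assms(2-) by (auto split: if_splits)
 show "p + ps ! t <= q + ps ! s"
 proof (rule ccontr)
  assume *: "\<not> p + ps ! t <= q + ps ! s"
  define i where "i = ps ! s - 1 - p"
  have i: "Suc (p + i) = ps ! s" "Suc (q + i) < ps ! t" using * assms(2) by (auto simp: i_def Ix_def)
  have in': "(s, p + i) \<in> Ix ps" "(t, q + i) \<in> Ix ps" "(t, Suc (q + i)) \<in> Ix ps"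
   using i assms(2,3) by (auto simp: Ix_def)
  have "(if Suc (p + i) < ps ! s then ent ps B (t, Suc (q + i)) (s, Suc (p + i)) else 0) =
    (if 1 <= Suc (q + i) then ent ps B (t, Suc (q + i) - 1) (s, p + i) else 0)"
   using assms(1) in'(1,3) unfolding comm_iff by blast
  then have "ent ps B (t, q + i) (s, p + i) = 0" using i(1) by simp
  then show False using comm_shift[OF assms(1) in'(1,2)] assms(4) by simp
 qed
qed

lemma comm_mult: "comm ps A ==> comm ps B ==> comm ps (A * B)"
proof -
 let ?n = "sum_list ps"
 assume A: "comm ps A" and B: "comm ps B"
 have "A * B * jmat ps = A * (B * jmat ps)"
  by (rule assoc_mult_mat[OF commD(1)[OF A] commD(1)[OF B] jmat_carrier])
 also have "\<dots> = A * jmat ps * B"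
  unfolding commD(2)[OF B] by (rule assoc_mult_mat[OF commD(1)[OF A] jmat_carrier commD(1)[OF B], symmetric])
 also have "\<dots> = jmat ps * (A * B)"
  unfolding commD(2)[OF A] by (rule assoc_mult_mat[OF jmat_carrier commD(1)[OF A] commD(1)[OF B]])
 finally show "comm ps (A * B)" using commD(1)[OF A] commD(1)[OF B] by (simp add: comm_def)
qed

lemma comm_pow: "comm ps A ==> comm ps (A ^\<^sub>m i)"
proof (induction i)
 case 0
 have "(1\<^sub>m (sum_list ps) :: 'a mat) * jmat ps = jmat ps * 1\<^sub>m (sum_list ps)"
  using left_mult_one_mat[OF jmat_carrier, of ps] right_mult_one_mat[OF jmat_carrier, of ps] by metis
 then show ?case using carrier_matD(1)[OF commD(1)[OF 0]] by (simp add: comm_def)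
next
 case (Suc i)
 then show ?case by (simp add: comm_mult)
qed

text \<open>Between blocks of equal size the entries at the generators multiply among themselves: by
  \<open>comm_bounds\<close>, an intermediate position contributes only if it is the generator of a
  block of the same size.\<close>

lemma ent_mult_base:
 assumes "comm ps A" "comm ps B" "(s, 0) \<in> Ix ps" "(t, 0) \<in> Ix ps" "ps ! s = ps ! t"
 shows "ent ps (A * B) (t, 0) (s, 0) =
  (\<Sum>v | v < length ps \<and> ps ! v = ps ! s. ent ps A (t, 0) (v, 0) * ent ps B (v, 0) (s, 0))"
proof -
 let ?V = "{v. v < length ps \<and> ps ! v = ps ! s}"
 have "(\<Sum>z\<in>Ix ps. ent ps A (t, 0) z * ent ps B z (s, 0)) =
   (\<Sum>z\<in>(\<lambda>v. (v, 0)) ` ?V. ent ps A (t, 0) z * ent ps B z (s, 0))"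
 proof (rule sum.mono_neutral_right)
  show "\<forall>z\<in>Ix ps - (\<lambda>v. (v, 0)) ` ?V. ent ps A (t, 0) z * ent ps B z (s, 0) = 0"
  proof
   fix z assume z: "z \<in> Ix ps - (\<lambda>v. (v, 0)) ` ?V"
   obtain v w where vw: "z = (v, w)" by (cases z)
   show "ent ps A (t, 0) z * ent ps B z (s, 0) = 0"
   proof (rule ccontr)
    assume "ent ps A (t, 0) z * ent ps B z (s, 0) \<noteq> 0"
    then have "ent ps A (t, 0) (v, w) \<noteq> 0" "ent ps B (v, w) (s, 0) \<noteq> 0" by (auto simp: vw)
    moreover have "(v, w) \<in> Ix ps" using z vw by simp
    ultimately have "w = 0" "ps ! v = ps ! s"
     using comm_bounds[OF assms(1), of v w t 0] comm_bounds[OF assms(2), of s 0 v w] assms by auto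
    then show False using z vw by (auto simp: Ix_def)
   qed
  qed
  show "(\<lambda>v. (v, 0)) ` ?V \<subseteq> Ix ps" using assms(3) by (auto simp: Ix_def)
 qed simp
 also have "\<dots> = (\<Sum>v\<in>?V. ent ps A (t, 0) (v, 0) * ent ps B (v, 0) (s, 0))"
  by (subst sum.reindex) (auto simp: inj_on_def)
 finally show ?thesis
  using index_mult_Ix[OF commD(1)[OF assms(1)] commD(1)[OF assms(2)] assms(3,4)] by simp
qed

definition T_form :: "nat list => 'k::field mat => bool" where
 "T_form ps C \<longleftrightarrow> comm ps C \<and> (\<forall>s p t q. (s, p) \<in> Ix ps --> (t, q) \<in> Ix ps --> ent ps C (t, q) (s, p) \<noteq> 0 -->
  T_move ((!) ps) s p t q)"

lemma level_nilpotent: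
 assumes I: "indexing n I e" and C: "C \<in> sqm n"
  and lev: "\<And>x y. x \<in> I ==> y \<in> I ==> C $$ (e y, e x) \<noteq> 0 ==> lev x < (lev y :: nat)"
  and lt: "\<And>x. x \<in> I ==> lev x < N"
 shows "C ^\<^sub>m N = 0\<^sub>m n n"
proof -
 have P: "lev x + i <= lev y" if "x \<in> I" "y \<in> I" "(C ^\<^sub>m i) $$ (e y, e x) \<noteq> 0" for x y i
  using that
 proof (induction i arbitrary: x)
  case 0
  then have "e y = e x" using indexing_lt[OF I] carrier_matD[OF C] by (auto split: if_splits)
  then have "x = y" using 0 I by (auto simp: indexing_def bij_betw_def inj_on_def)
  then show ?case by simp
 next
  case (Suc i)
  have eq: "(C ^\<^sub>m i * C) $$ (e y, e x) = (\<Sum>z\<in>I. (C ^\<^sub>m i) $$ (e y, e z) * C $$ (e z, e x))"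
   by (rule index_mult_indexing[OF I pow_carrier_mat[OF C] C]) (use Suc.prems indexing_lt[OF I] in auto)
  have "\<exists>z\<in>I. (C ^\<^sub>m i) $$ (e y, e z) * C $$ (e z, e x) \<noteq> 0"
  proof (rule ccontr)
   assume "\<not> ?thesis"
   then have "(\<Sum>z\<in>I. (C ^\<^sub>m i) $$ (e y, e z) * C $$ (e z, e x)) = 0" by (intro sum.neutral) blast
   then show False using eq Suc.prems(3) by simp
  qed
  then obtain z where z: "z \<in> I" "(C ^\<^sub>m i) $$ (e y, e z) \<noteq> 0" "C $$ (e z, e x) \<noteq> 0"
   by (metis mult_zero_left mult_zero_right)
  have "lev z + i <= lev y" by (rule Suc.IH[OF z(1) Suc.prems(2) z(2)])
  moreover have "lev x < lev z" by (rule lev[OF Suc.prems(1) z(1,3)])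
  ultimately show ?case by simp
 qed
 show ?thesis
 proof (rule mat_eq_indexing[OF I I])
  fix x y assume "x \<in> I" "y \<in> I"
  then show "(C ^\<^sub>m N) $$ (e y, e x) = 0\<^sub>m n n $$ (e y, e x)"
   using P[of x y N] lt[of y] indexing_lt[OF I] by fastforce
 qed (use C in simp_all)
qed

lemma T_move_trans:
 assumes "\<And>s t. s <= t ==> t < b ==> sz t <= sz s" "s < b" "t < b" "v < b"
  "T_move sz s p t q" "T_move sz t q v w"
 shows "T_move sz s p v w"
proof -
 have le: "s < t ==> sz t <= sz s" "t < v ==> sz v <= sz t" using assms(1-4) by simp_all
 show ?thesis
 proof (cases "s < v")
  case True
  have "p <= q" "q <= w" using assms(5,6) unfolding T_move_def by (auto split: if_splits)
  then show ?thesis using True by (simp add: T_move_def)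
 next
  case False
  then show ?thesis using le assms(5,6) unfolding T_move_def by (auto split: if_splits)
 qed
qed

lemma parts_sorted: "s <= t ==> t < length (parts P) ==> parts P ! t <= parts P ! s"
 unfolding parts_def by (rule sorted_rev_nth_mono) auto

text \<open>As the blocks are listed by decreasing size, the moves form a strict partial order, and
  the number of predecessors of a position is a level that every move raises.\<close>

lemma T_form_nilpotent:
 assumes C: "T_form (parts P) C"
 shows "C ^\<^sub>m sum_mset P = 0\<^sub>m (sum_mset P) (sum_mset P)"
proof -
 let ?ps = "parts P"
 let ?I = "Ix ?ps"
 let ?mv = "\<lambda>x y. T_move ((!) ?ps) (fst x) (snd x) (fst y) (snd y)"
 define lev where "lev = (\<lambda>y. card {x \<in> ?I. ?mv x y})"
 have I: "indexing (sum_mset P) ?I (ix ?ps)" using indexing_ix[of ?ps] by simp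
 have irr: "\<not> ?mv x x" for x by (simp add: T_move_def)
 have tr: "?mv x z" if "x \<in> ?I" "y \<in> ?I" "z \<in> ?I" "?mv x y" "?mv y z" for x y z
  by (rule T_move_trans[OF parts_sorted _ _ _ that(4,5)]) (use that(1-3) in "auto simp: Ix_def")
 show ?thesis
 proof (rule level_nilpotent[OF I])
  show "C \<in> sqm (sum_mset P)" using C commD(1)[of ?ps C] by (simp add: T_form_def)
  fix x y assume xy: "x \<in> ?I" "y \<in> ?I" "ent ?ps C y x \<noteq> 0"
  then have mv: "?mv x y" using C unfolding T_form_def by (metis prod.collapse)
  show "lev x < lev y"
   unfolding lev_def
  proof (rule psubset_card_mono)
   show "{z \<in> ?I. ?mv z x} \<subset> {z \<in> ?I. ?mv z y}"
    using tr[of _ x y] xy mv irr[of x] by blast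
  qed simp
 next
  fix x assume x: "x \<in> ?I"
  have "lev x < card ?I"
   unfolding lev_def by (rule psubset_card_mono) (use x irr[of x] in auto)
  then show "lev x < sum_mset P" using card_indexing[OF I] by simp
 qed
qed

text \<open>The enumeration is decreasing. Thus a strictly upper triangular matrix has nonzero
  entries only from a block to a later one, which is the direction in which \<open>T_move\<close>
  permits \<open>p = q\<close>.\<close>

lemma indexing_rev:
 assumes "finite (S :: nat set)"
 shows "indexing (card S) S (\<lambda>s. card {t \<in> S. s < t})"
proof -
 let ?e = "\<lambda>s. card {t \<in> S. s < t}"
 have less: "?e t < ?e s" if "t \<in> S" "s < t" for s t
  by (rule psubset_card_mono) (use assms that in auto)
 have inj: "inj_on ?e S"
 proof (rule inj_onI)
  fix s t assume "s \<in> S" "t \<in> S" "?e s = ?e t"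
  then show "s = t" using less[of s t] less[of t s] by (cases s t rule: linorder_cases) auto
 qed
 have "?e ` S \<subseteq> {..<card S}"
 proof
  fix i assume "i \<in> ?e ` S"
  then obtain s where s: "s \<in> S" "i = ?e s" by blast
  have "?e s < card S" by (rule psubset_card_mono[OF assms]) (use s in auto)
  then show "i \<in> {..<card S}" using s by simp
 qed
 moreover have "card (?e ` S) = card {..<card S}" using card_image[OF inj] by simp
 ultimately have "?e ` S = {..<card S}" by (intro card_subset_eq) auto
 then show ?thesis using inj assms by (simp add: indexing_def bij_betw_def)
qed

section \<open>The commutator algebra modulo its radical\<close>

definition cls :: "nat list => nat => nat set" where
 "cls ps i = {s. s < length ps \<and> ps ! s = i}"

definition cl_ix :: "nat list => nat => nat" where
 "cl_ix ps s = card {t \<in> cls ps (ps ! s). s < t}"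

text \<open>For positive \<open>i\<close> this is the component of a commuting matrix in the
  endomorphisms of the multiplicity space of size \<open>i\<close>; together these components are
  the semisimple quotient of the commutator algebra, and \<open>lft\<close> provides a
  section.\<close>

definition bar :: "nat list => nat => 'k::field mat => 'k mat" where
 "bar ps i B = mkm (card (cls ps i)) (cls ps i) (cl_ix ps) (cls ps i) (cl_ix ps) (\<lambda>t s. ent ps B (t, 0) (s, 0))"

definition lft :: "nat list => (nat => 'k::field mat) => 'k mat" where
 "lft ps G = mkm (sum_list ps) (Ix ps) (ix ps) (Ix ps) (ix ps)
  (\<lambda>(t, q) (s, p). if q = p \<and> ps ! t = ps ! s then G (ps ! s) $$ (cl_ix ps t, cl_ix ps s) else 0)"

lemma indexing_cl: "indexing (card (cls ps i)) (cls ps i) (cl_ix ps)"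
proof -
 have fin: "finite (cls ps i)" by (simp add: cls_def)
 have "cl_ix ps s = card {t \<in> cls ps i. s < t}" if "s \<in> cls ps i" for s
  using that by (simp add: cl_ix_def cls_def)
 then have "bij_betw (cl_ix ps) (cls ps i) {..<card (cls ps i)} \<longleftrightarrow>
   bij_betw (\<lambda>s. card {t \<in> cls ps i. s < t}) (cls ps i) {..<card (cls ps i)}"
  by (rule bij_betw_cong)
 then show ?thesis using indexing_rev[OF fin] fin by (simp add: indexing_def)
qed

lemma cl_ix_less:
 assumes "s \<in> cls ps i" "t \<in> cls ps i" "cl_ix ps t < cl_ix ps s"
 shows "s < t"
proof (rule ccontr)
 assume "\<not> s < t"
 have "finite (cls ps i)" by (simp add: cls_def)
 then have "card {v \<in> cls ps i. s < v} <= card {v \<in> cls ps i. t < v}"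
  using \<open>\<not> s < t\<close> by (intro card_mono) auto
 then show False using assms by (simp add: cl_ix_def cls_def)
qed

lemma bar_carrier [simp]: "bar ps i B \<in> sqm (card (cls ps i))"
 by (simp add: bar_def)

lemma index_bar:
 assumes "s \<in> cls ps i" "t \<in> cls ps i"
 shows "bar ps i B $$ (cl_ix ps t, cl_ix ps s) = ent ps B (t, 0) (s, 0)"
 unfolding bar_def using assms by (rule index_mkm[OF indexing_cl indexing_cl])

lemma bar_mult:
 assumes "comm ps A" "comm ps B" "0 < i"
 shows "bar ps i (A * B) = bar ps i A * bar ps i B"
proof (rule mat_eq_indexing[OF indexing_cl indexing_cl])
 fix s t assume st: "s \<in> cls ps i" "t \<in> cls ps i"
 then have *: "(s, 0) \<in> Ix ps" "(t, 0) \<in> Ix ps" "ps ! s = ps ! t" "ps ! s = i"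
  using assms(3) by (auto simp: cls_def Ix_def)
 have "(bar ps i A * bar ps i B) $$ (cl_ix ps t, cl_ix ps s) =
   (\<Sum>v\<in>cls ps i. bar ps i A $$ (cl_ix ps t, cl_ix ps v) * bar ps i B $$ (cl_ix ps v, cl_ix ps s))"
  by (rule index_mult_indexing[OF indexing_cl bar_carrier bar_carrier])
   (use st indexing_lt[OF indexing_cl] in auto)
 also have "\<dots> = (\<Sum>v\<in>cls ps i. ent ps A (t, 0) (v, 0) * ent ps B (v, 0) (s, 0))"
  by (intro sum.cong refl) (simp add: index_bar st)
 also have "\<dots> = ent ps (A * B) (t, 0) (s, 0)"
  unfolding ent_mult_base[OF assms(1,2) *(1-3)] *(4) cls_def ..
 finally show "bar ps i (A * B) $$ (cl_ix ps t, cl_ix ps s) = (bar ps i A * bar ps i B) $$ (cl_ix ps t, cl_ix ps s)"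
  using index_bar[OF st] by simp
qed simp_all

lemma bar_one:
 assumes "0 < i"
 shows "bar ps i (1\<^sub>m (sum_list ps)) = 1\<^sub>m (card (cls ps i))"
proof (rule mat_eq_indexing[OF indexing_cl indexing_cl])
 fix s t assume st: "s \<in> cls ps i" "t \<in> cls ps i"
 then have *: "(s, 0) \<in> Ix ps" "(t, 0) \<in> Ix ps" using assms by (auto simp: cls_def Ix_def)
 have "ix ps (t, 0) = ix ps (s, 0) \<longleftrightarrow> t = s"
  using * indexing_ix[of ps] by (auto simp: indexing_def bij_betw_def inj_on_def)
 moreover have "cl_ix ps t = cl_ix ps s \<longleftrightarrow> t = s"
  using st indexing_cl[of ps i] by (auto simp: indexing_def bij_betw_def inj_on_def)
 ultimately show "bar ps i (1\<^sub>m (sum_list ps)) $$ (cl_ix ps t, cl_ix ps s) = 1\<^sub>m (card (cls ps i)) $$ (cl_ix ps t, cl_ix ps s)"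
  unfolding index_bar[OF st] using Ix_lt[OF *(1)] Ix_lt[OF *(2)] indexing_lt[OF indexing_cl st(1)] indexing_lt[OF indexing_cl st(2)]
  by simp
qed simp_all

lemma bar_pow:
 assumes "comm ps B" "0 < i"
 shows "bar ps i (B ^\<^sub>m j) = bar ps i B ^\<^sub>m j"
proof (induction j)
 case 0
 then show ?case
  using bar_one[OF assms(2)] carrier_matD(1)[OF commD(1)[OF assms(1)]] carrier_matD(1)[OF bar_carrier[of ps i B]] by simp
next
 case (Suc j)
 then show ?case using bar_mult[OF comm_pow[OF assms(1)] assms] by simp
qed

lemma lft_carrier [simp]: "lft ps G \<in> sqm (sum_list ps)"
 by (simp add: lft_def)

lemma ent_lft:
 assumes "(s, p) \<in> Ix ps" "(t, q) \<in> Ix ps"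
 shows "ent ps (lft ps G) (t, q) (s, p) =
  (if q = p \<and> ps ! t = ps ! s then G (ps ! s) $$ (cl_ix ps t, cl_ix ps s) else 0)"
 unfolding lft_def by (subst index_mkm[OF indexing_ix indexing_ix assms]) simp

lemma comm_lft: "comm ps (lft ps G)"
 unfolding comm_iff
proof (intro conjI allI impI)
 fix s p t q assume st: "(s, p) \<in> Ix ps" "(t, q) \<in> Ix ps"
 have 1: "(s, Suc p) \<in> Ix ps" if "Suc p < ps ! s" using st that by (simp add: Ix_def)
 have 2: "(t, q - 1) \<in> Ix ps" using st by (auto simp: Ix_def)
 show "(if Suc p < ps ! s then ent ps (lft ps G) (t, q) (s, Suc p) else 0) =
   (if 1 <= q then ent ps (lft ps G) (t, q - 1) (s, p) else 0)"
  using 1 ent_lft[OF _ st(2), of s "Suc p" G] ent_lft[OF st(1) 2, of G] st(2) by (cases q) (auto simp: Ix_def)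
qed simp

lemma bar_lft:
 assumes "0 < i" "G i \<in> sqm (card (cls ps i))"
 shows "bar ps i (lft ps G) = G i"
proof (rule mat_eq_indexing[OF indexing_cl indexing_cl _ assms(2)])
 fix s t assume st: "s \<in> cls ps i" "t \<in> cls ps i"
 then have *: "(s, 0) \<in> Ix ps" "(t, 0) \<in> Ix ps" "ps ! s = i" "ps ! t = i" using assms by (auto simp: cls_def Ix_def)
 show "bar ps i (lft ps G) $$ (cl_ix ps t, cl_ix ps s) = G i $$ (cl_ix ps t, cl_ix ps s)"
  unfolding index_bar[OF st] ent_lft[OF *(1,2)] using * by simp
qed simp

lemma lft_mult:
 assumes "\<And>i. G i \<in> sqm (card (cls ps i))" "\<And>i. H i \<in> sqm (card (cls ps i))"
  "\<And>i. G i * H i = 1\<^sub>m (card (cls ps i))"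
 shows "lft ps G * lft ps H = 1\<^sub>m (sum_list ps)"
proof (rule mat_eq_indexing[OF indexing_ix indexing_ix])
 fix x y assume xy: "x \<in> Ix ps" "y \<in> Ix ps"
 obtain s p t q where x: "x = (s, p)" and y: "y = (t, q)" by (cases x, cases y)
 let ?i = "ps ! s"
 have cl: "s \<in> cls ps ?i" using xy by (simp add: x cls_def Ix_def)
 have "ent ps (lft ps G * lft ps H) y x = (\<Sum>z\<in>Ix ps. ent ps (lft ps G) y z * ent ps (lft ps H) z x)"
  by (rule index_mult_Ix[OF lft_carrier lft_carrier xy])
 also have "\<dots> = (\<Sum>z\<in>(\<lambda>v. (v, p)) ` cls ps ?i. ent ps (lft ps G) y z * ent ps (lft ps H) z x)"
 proof (rule sum.mono_neutral_right)
  show "\<forall>z\<in>Ix ps - (\<lambda>v. (v, p)) ` cls ps ?i. ent ps (lft ps G) y z * ent ps (lft ps H) z x = 0"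
  proof
   fix z assume z: "z \<in> Ix ps - (\<lambda>v. (v, p)) ` cls ps ?i"
   obtain v w where vw: "z = (v, w)" by (cases z)
   have "\<not> (w = p \<and> ps ! v = ps ! s)" using z by (auto simp: vw cls_def Ix_def)
   then show "ent ps (lft ps G) y z * ent ps (lft ps H) z x = 0"
    using ent_lft[of s p ps v w H] xy(1) z unfolding x vw by auto
  qed
  show "(\<lambda>v. (v, p)) ` cls ps ?i \<subseteq> Ix ps" using xy by (auto simp: x cls_def Ix_def)
 qed simp
 also have "\<dots> = (\<Sum>v\<in>cls ps ?i. ent ps (lft ps G) y (v, p) * ent ps (lft ps H) (v, p) x)"
  by (subst sum.reindex) (auto simp: inj_on_def)
 also have "\<dots> = (\<Sum>v\<in>cls ps ?i. if q = p \<and> ps ! t = ?i then G ?i $$ (cl_ix ps t, cl_ix ps v) * H ?i $$ (cl_ix ps v, cl_ix ps s) else 0)"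
 proof (rule sum.cong[OF refl])
  fix v assume v: "v \<in> cls ps ?i"
  then have vp: "(v, p) \<in> Ix ps" "ps ! v = ?i" using xy by (auto simp: x cls_def Ix_def)
  show "ent ps (lft ps G) y (v, p) * ent ps (lft ps H) (v, p) x =
    (if q = p \<and> ps ! t = ?i then G ?i $$ (cl_ix ps t, cl_ix ps v) * H ?i $$ (cl_ix ps v, cl_ix ps s) else 0)"
   using ent_lft[OF vp(1), of t q G] ent_lft[OF _ vp(1), of s p H] xy vp(2) by (simp add: x y)
 qed
 also have "\<dots> = (if q = p \<and> ps ! t = ?i then (G ?i * H ?i) $$ (cl_ix ps t, cl_ix ps s) else 0)"
 proof (cases "q = p \<and> ps ! t = ?i")
  case True
  then have "t \<in> cls ps ?i" using xy by (simp add: y cls_def Ix_def)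
  then show ?thesis
   using True cl indexing_lt[OF indexing_cl]
   by (subst index_mult_indexing[OF indexing_cl assms(1,2)]) auto
 qed (simp only: if_False sum.neutral_const)
 also have "\<dots> = 1\<^sub>m (sum_list ps) $$ (ix ps y, ix ps x)"
 proof (cases "q = p \<and> ps ! t = ?i")
  case True
  then have t: "t \<in> cls ps ?i" using xy by (simp add: y cls_def Ix_def)
  have "cl_ix ps t = cl_ix ps s \<longleftrightarrow> t = s"
   using t cl indexing_cl[of ps ?i] by (auto simp: indexing_def bij_betw_def inj_on_def)
  moreover have "ix ps y = ix ps x \<longleftrightarrow> y = x"
   using xy indexing_ix[of ps] by (auto simp: indexing_def bij_betw_def inj_on_def)
  ultimately show ?thesis
   unfolding assms(3) using True x y indexing_lt[OF indexing_cl t] indexing_lt[OF indexing_cl cl]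
    indexing_lt[OF indexing_ix xy(1)] indexing_lt[OF indexing_ix xy(2)] by simp
 next
  case False
  then have "y \<noteq> x" by (auto simp: x y)
  then have "ix ps y \<noteq> ix ps x"
   using xy indexing_ix[of ps] by (auto simp: indexing_def bij_betw_def inj_on_def)
  then show ?thesis
   using False indexing_lt[OF indexing_ix xy(1)] indexing_lt[OF indexing_ix xy(2)] by (auto simp: if_not_P)
 qed
 finally show "ent ps (lft ps G * lft ps H) y x = 1\<^sub>m (sum_list ps) $$ (ix ps y, ix ps x)" .
qed simp_all

text \<open>Every \<open>bar\<close> of a nilpotent matrix is nilpotent and can be made strictly
  triangular; the base changes lift to an invertible element of the commutator. Everything required
  by \<open>T_form\<close> is then contained in \<open>comm_bounds\<close>, except that
  \<open>p = q\<close> must be excluded for \<open>s >= t\<close>; there the block sizes are equal,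
  and triangularity applies.\<close>

lemma T_form_conj:
 fixes B :: "'k::field mat"
 assumes B: "comm ps B" and nil: "B ^\<^sub>m N = 0\<^sub>m (sum_list ps) (sum_list ps)"
  and sorted: "\<And>s t. s <= t ==> t < length ps ==> ps ! t <= ps ! s"
 shows "\<exists>g h. comm ps g \<and> comm ps h \<and> g * h = 1\<^sub>m (sum_list ps) \<and> h * g = 1\<^sub>m (sum_list ps) \<and> T_form ps (h * (B * g))"
proof -
 let ?m = "\<lambda>i. card (cls ps i)"
 have "\<exists>S T. S \<in> sqm (?m i) \<and> T \<in> sqm (?m i) \<and> S * T = 1\<^sub>m (?m i) \<and> T * S = 1\<^sub>m (?m i) \<and>
   (0 < i --> (\<forall>s\<in>cls ps i. \<forall>t\<in>cls ps i. (T * (bar ps i B * S)) $$ (cl_ix ps t, cl_ix ps s) \<noteq> 0 --> s < t))" for i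
 proof (cases "0 < i")
  case True
  have nilp: "bar ps i B ^\<^sub>m N = 0\<^sub>m (?m i) (?m i)"
  proof (rule mat_eq_indexing[OF indexing_cl indexing_cl])
   fix s t assume st: "s \<in> cls ps i" "t \<in> cls ps i"
   then have *: "(s, 0) \<in> Ix ps" "(t, 0) \<in> Ix ps" using True by (auto simp: cls_def Ix_def)
   show "(bar ps i B ^\<^sub>m N) $$ (cl_ix ps t, cl_ix ps s) = 0\<^sub>m (?m i) (?m i) $$ (cl_ix ps t, cl_ix ps s)"
    unfolding bar_pow[OF B True, symmetric] index_bar[OF st] nil
    using Ix_lt[OF *(1)] Ix_lt[OF *(2)] indexing_lt[OF indexing_cl st(1)] indexing_lt[OF indexing_cl st(2)] by simp
  qed simp_all
  obtain C S T where CST: "C \<in> sqm (?m i)" "S \<in> sqm (?m i)" "T \<in> sqm (?m i)"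
    "S * T = 1\<^sub>m (?m i)" "T * S = 1\<^sub>m (?m i)" "bar ps i B = S * C * T" "\<forall>a<?m i. \<forall>b<?m i. b <= a --> C $$ (a, b) = 0"
  proof -
   note * = nilpotent_similar_strictly_upper[OF bar_carrier nilp]
   show ?thesis by (insert *) (elim exE conjE, rule that)
  qed
  have "T * (bar ps i B * S) = T * (S * C * (T * S))"
   unfolding CST(6) by (subst assoc_mult_mat[of _ "?m i" "?m i" _ "?m i" _ "?m i"]) (use CST in simp_all)
  also have "\<dots> = (T * S) * C"
   using CST assoc_mult_mat[OF CST(3,2,1)] by simp
  also have "\<dots> = C" using CST by simp
  finally have C: "T * (bar ps i B * S) = C" .
  have "s < t" if st: "s \<in> cls ps i" "t \<in> cls ps i" "C $$ (cl_ix ps t, cl_ix ps s) \<noteq> 0" for s t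
   using CST(7) st indexing_lt[OF indexing_cl st(1)] indexing_lt[OF indexing_cl st(2)]
   by (intro cl_ix_less[OF st(1,2)]) (meson not_le)
  then show ?thesis using CST(2-5) C by (intro exI[of _ S] exI[of _ T]) auto
 next
  case False
  then show ?thesis by (intro exI[of _ "1\<^sub>m (?m i)"]) simp
 qed
 then obtain S T where ST: "\<And>i. S i \<in> sqm (?m i)" "\<And>i. T i \<in> sqm (?m i)"
   "\<And>i. S i * T i = 1\<^sub>m (?m i)" "\<And>i. T i * S i = 1\<^sub>m (?m i)"
   "\<And>i s t. 0 < i ==> s \<in> cls ps i ==> t \<in> cls ps i ==> (T i * (bar ps i B * S i)) $$ (cl_ix ps t, cl_ix ps s) \<noteq> 0 ==> s < t"
  by metis
 let ?g = "lft ps S" and ?h = "lft ps T"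
 let ?C = "?h * (B * ?g)"
 have gh: "?g * ?h = 1\<^sub>m (sum_list ps)" "?h * ?g = 1\<^sub>m (sum_list ps)"
  using lft_mult[of S ps T] lft_mult[of T ps S] ST(1-4) by simp_all
 have Bg: "comm ps (B * ?g)" by (rule comm_mult[OF B comm_lft])
 have C: "comm ps ?C" by (rule comm_mult[OF comm_lft Bg])
 have bar: "bar ps i ?C = T i * (bar ps i B * S i)" if "0 < i" for i
  unfolding bar_mult[OF comm_lft Bg that] bar_mult[OF B comm_lft that] using ST(1,2) that by (simp add: bar_lft)
 have "T_move ((!) ps) s p t q"
  if st: "(s, p) \<in> Ix ps" "(t, q) \<in> Ix ps" and nz: "ent ps ?C (t, q) (s, p) \<noteq> 0" for s p t q
 proof (cases "s < t")
  case True
  then show ?thesis using comm_bounds(1)[OF C st nz] by (simp add: T_move_def)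
 next
  case False
  have "p \<noteq> q"
  proof
   assume pq: "p = q"
   have le: "ps ! t <= ps ! s" using comm_bounds(2)[OF C st nz] pq by simp
   moreover have "ps ! s <= ps ! t" using False st by (intro sorted) (auto simp: Ix_def)
   ultimately have cl: "s \<in> cls ps (ps ! s)" "t \<in> cls ps (ps ! s)" "0 < ps ! s"
    using st by (auto simp: cls_def Ix_def)
   have "ent ps ?C (t, 0) (s, 0) \<noteq> 0"
    using comm_shift[OF C, of s 0 p t q] st nz pq by simp
   then show False
    using ST(5)[OF cl(3,1,2)] False unfolding bar[OF cl(3), symmetric] index_bar[OF cl(1,2)] by blast
  qed
  then show ?thesis using comm_bounds[OF C st nz] False by (simp add: T_move_def)
 qed
 then show ?thesis using C comm_lft gh unfolding T_form_def by blast
qed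

lemma similar_pow_zero:
 assumes c: "g \<in> sqm n" "h \<in> sqm n" "C \<in> sqm n"
  and gh: "g * h = 1\<^sub>m n" "h * g = 1\<^sub>m n"
 shows "(g * C * h) ^\<^sub>m i = 0\<^sub>m n n \<longleftrightarrow> C ^\<^sub>m i = 0\<^sub>m n n"
proof -
 have gC: "g * C * h \<in> sqm n" using c by simp
 have eq1: "similar_mat_wit (g * C * h) C g h"
  using c gh gC by (intro similar_mat_witI[of _ _ n]) auto
 have eq: "(g * C * h) ^\<^sub>m i = g * C ^\<^sub>m i * h"
  by (rule similar_mat_wit_pow_id[OF eq1])
 have eq': "C ^\<^sub>m i = h * ((g * C * h) ^\<^sub>m i) * g"
  by (rule similar_mat_wit_pow_id[OF similar_mat_wit_sym[OF eq1]])
 show ?thesis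
 proof
  assume *: "(g * C * h) ^\<^sub>m i = 0\<^sub>m n n"
  show "C ^\<^sub>m i = 0\<^sub>m n n" unfolding eq' unfolding * using c by simp
 next
  assume *: "C ^\<^sub>m i = 0\<^sub>m n n"
  show "(g * C * h) ^\<^sub>m i = 0\<^sub>m n n" unfolding eq * using c by simp
 qed
qed

lemma conj_conj:
 assumes c: "g \<in> sqm n" "h \<in> sqm n" "B \<in> sqm n"
  and gh: "g * h = 1\<^sub>m n"
 shows "g * (h * (B * g)) * h = (B :: 'k::field mat)"
proof -
 have "g * (h * (B * g)) = (g * h) * (B * g)"
  by (rule assoc_mult_mat[symmetric, of _ n n _ n _ n]) (use c in simp_all)
 also have "\<dots> = B * g" using gh c by simp
 finally have "g * (h * (B * g)) * h = B * g * h" by simp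
 also have "\<dots> = B * (g * h)" by (rule assoc_mult_mat[of _ n n _ n _ n]) (use c in simp_all)
 finally show ?thesis using gh c by simp
qed

section \<open>The generic nilpotency index\<close>

definition polymat :: "nat => ('k::field => 'k mat) => bool" where
 "polymat n M \<longleftrightarrow> (\<forall>t. M t \<in> sqm n) \<and> (\<forall>i<n. \<forall>j<n. \<exists>q. \<forall>t. poly q t = M t $$ (i, j))"

lemma polymat_const: "A \<in> sqm n ==> polymat n (\<lambda>_. A)"
 unfolding polymat_def by (metis poly_0 poly_pCons mult_zero_right add.right_neutral)

lemma polymat_mult:
 assumes "polymat n M" "polymat n N"
 shows "polymat n (\<lambda>t. M t * N t)"
 unfolding polymat_def
proof (intro conjI allI impI)
 have c: "M t \<in> sqm n" "N t \<in> sqm n" for t using assms by (simp_all add: polymat_def)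
 show "M t * N t \<in> sqm n" for t using c by simp
 fix i j assume ij: "i < n" "j < n"
 have "\<forall>k<n. \<exists>q. \<forall>t. poly q t = M t $$ (i, k)" "\<forall>k<n. \<exists>q. \<forall>t. poly q t = N t $$ (k, j)"
  using assms ij unfolding polymat_def by blast+
 then obtain f g where fg: "\<And>k t. k < n ==> poly (f k) t = M t $$ (i, k)" "\<And>k t. k < n ==> poly (g k) t = N t $$ (k, j)"
  by metis
 have "poly (\<Sum>k<n. f k * g k) t = (M t * N t) $$ (i, j)" for t
  unfolding index_mult_indexing[OF indexing_nat c ij] poly_sum by (intro sum.cong) (auto simp: fg)
 then show "\<exists>q. \<forall>t. poly q t = (M t * N t) $$ (i, j)" by blast
qed

lemma polymat_pow:
 assumes "polymat n M"
 shows "polymat n (\<lambda>t. M t ^\<^sub>m i)"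
proof (induction i)
 case 0
 have "dim_row (M t) = n" for t using assms carrier_matD(1) unfolding polymat_def by blast
 then show ?case using polymat_const[of "1\<^sub>m n" n] by simp
next
 case (Suc i)
 then show ?case using polymat_mult[OF Suc assms] by simp
qed

lemma mon_eval_poly: "\<exists>q. \<forall>t. poly q t = mon_eval (\<lambda>x. poly (e x) t) m"
 by (intro exI[of _ "mon_eval e m"] allI) (simp add: mon_eval_def poly_prod)

lemma meval_poly: "\<exists>q. \<forall>t. poly q t = meval (\<lambda>x. poly (e x) t) (p :: ('x, 'k::field) mpol)"
proof (induction p rule: mpol_induct)
 case zero
 then show ?case by (intro exI[of _ 0]) simp
next
 case (add m a p)
 then obtain q where q: "\<And>t. poly q t = meval (\<lambda>x. poly (e x) t) p" by blast
 obtain q' where q': "\<And>t. poly q' t = mon_eval (\<lambda>x. poly (e x) t) m" using mon_eval_poly by metis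
 show ?case by (intro exI[of _ "[:a:] * q' + q"]) (simp add: meval_add meval_single q q')
qed

lemma meval_polymat:
 assumes "polymat n M"
 shows "\<exists>q. \<forall>t. poly q t = meval (entry (M t)) p"
proof -
 have "\<exists>q. \<forall>t. poly q t = entry (M t) x" for x
 proof (cases "fst x < n \<and> snd x < n")
  case True
  moreover have "dim_row (M t) = n" "dim_col (M t) = n" for t
   using assms carrier_matD unfolding polymat_def by blast+
  ultimately show ?thesis using assms unfolding polymat_def entry_def by (cases x) simp
 next
  case False
  have "dim_row (M t) = n" "dim_col (M t) = n" for t
   using assms carrier_matD unfolding polymat_def by blast+
  then show ?thesis using False by (intro exI[of _ 0]) (auto simp: entry_def split: prod.split)
 qed
 then obtain e where e: "\<And>x t. poly (e x) t = entry (M t) x" by metis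
 have "(\<lambda>x. poly (e x) t) = entry (M t)" for t using e by auto
 then show ?thesis using meval_poly[of e p] by simp
qed

lemma poly_eq_0_infinite:
 assumes "infinite (UNIV :: 'k::field set)" "\<And>t. poly q t = (0 :: 'k)"
 shows "q = 0"
 using poly_roots_finite[of q] assms by auto

text \<open>The product of the polynomial for \<open>p\<close> with the one for an entry of
  \<open>N\<close> vanishes on an infinite field, and the first factor is nonzero because of
  \<open>t0\<close>.\<close>

lemma line_vanish:
 assumes inf: "infinite (UNIV :: 'k::field set)" and M: "polymat n M" and N: "polymat n N"
  and p: "meval (entry (M t0)) p \<noteq> 0"
  and z: "\<And>t. meval (entry (M t)) p \<noteq> 0 ==> N t = 0\<^sub>m n n"
 shows "N (t :: 'k) = 0\<^sub>m n n"
proof (rule eq_matI)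
 have c: "N t \<in> sqm n" for t using N by (simp add: polymat_def)
 fix i j assume "i < dim_row (0\<^sub>m n n :: 'k mat)" "j < dim_col (0\<^sub>m n n :: 'k mat)"
 then have ij: "i < n" "j < n" by simp_all
 obtain q where q: "\<And>t. poly q t = meval (entry (M t)) p" using meval_polymat[OF M] by metis
 obtain q' where q': "\<And>t. poly q' t = N t $$ (i, j)" using N ij unfolding polymat_def by metis
 have "poly (q * q') t = 0" for t
  using z[of t] ij by (cases "meval (entry (M t)) p = 0") (simp_all add: q q')
 then have "q * q' = 0" by (rule poly_eq_0_infinite[OF inf])
 moreover have "q \<noteq> 0" using q[of t0] p by auto
 ultimately have "q' = 0" by simp
 then show "N t $$ (i, j) = 0\<^sub>m n n $$ (i, j)" using q'[of t] ij by simp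
qed (use N in "auto simp: polymat_def dest: carrier_matD")

lemma T_form_line:
 assumes "T_form ps C0" "T_form ps C1"
 shows "T_form ps (C0 + t \<cdot>\<^sub>m (C1 - C0))"
proof -
 let ?C = "C0 + t \<cdot>\<^sub>m (C1 - C0)"
 have c: "C0 \<in> sqm (sum_list ps)" "C1 \<in> sqm (sum_list ps)"
  using assms commD(1) by (auto simp: T_form_def)
 have C: "ent ps ?C y x = ent ps C0 y x + t * (ent ps C1 y x - ent ps C0 y x)" if "x \<in> Ix ps" "y \<in> Ix ps" for x y
  using c indexing_lt[OF indexing_ix that(1)] indexing_lt[OF indexing_ix that(2)] by simp
 have "comm ps ?C"
  unfolding comm_iff
 proof (intro conjI allI impI)
  fix s p v q assume st: "(s, p) \<in> Ix ps" "(v, q) \<in> Ix ps"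
  have 1: "(s, Suc p) \<in> Ix ps" if "Suc p < ps ! s" using st that by (simp add: Ix_def)
  have 2: "(v, q - 1) \<in> Ix ps" using st by (auto simp: Ix_def)
  have "(if Suc p < ps ! s then ent ps D (v, q) (s, Suc p) else 0) =
    (if 1 <= q then ent ps D (v, q - 1) (s, p) else 0)" if "D = C0 \<or> D = C1" for D
   using assms st that unfolding T_form_def comm_iff by blast
  from this[of C0] this[of C1] show "(if Suc p < ps ! s then ent ps ?C (v, q) (s, Suc p) else 0) =
    (if 1 <= q then ent ps ?C (v, q - 1) (s, p) else 0)"
   using 1 2 st C by (auto split: if_splits)
 qed (intro add_carrier_mat smult_carrier_mat minus_carrier_mat c)
 moreover have "T_move ((!) ps) s p v q"
  if "(s, p) \<in> Ix ps" "(v, q) \<in> Ix ps" "ent ps ?C (v, q) (s, p) \<noteq> 0" for s p v q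
 proof -
  have "ent ps C0 (v, q) (s, p) \<noteq> 0 \<or> ent ps C1 (v, q) (s, p) \<noteq> 0" using that C by auto
  then show ?thesis using assms that(1,2) unfolding T_form_def by blast
 qed
 ultimately show ?thesis unfolding T_form_def by blast
qed

lemma nilpotent_commutator_conj:
 assumes "B \<in> nilpotent_commutator P"
 obtains g h where "comm (parts P) g" "comm (parts P) h" "g * h = 1\<^sub>m (sum_mset P)" "h * g = 1\<^sub>m (sum_mset P)"
  "T_form (parts P) (h * (B * g))"
proof -
 have "comm (parts P) B" "B ^\<^sub>m sum_mset P = 0\<^sub>m (sum_list (parts P)) (sum_list (parts P))"
  using assms unfolding nilpotent_commutator_iff by simp_all
 then show ?thesis using T_form_conj[of "parts P" B, OF _ _ parts_sorted] that by (metis sum_list_parts)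
qed

text \<open>Matrices in triangular form make up a linear space of nilpotent matrices, but
  \<open>B0\<close> and \<open>B1\<close> are brought into it by different conjugations. The line
  joining the two forms is carried back by the conjugation of \<open>B0\<close> alone: it starts at
  the point \<open>B0\<close> of the open set and ends at a conjugate of \<open>B1\<close>, which
  has the same index.\<close>

lemma generic_index:
 fixes P :: "nat multiset" and B1 :: "'k::field mat"
 assumes inf: "infinite (UNIV :: 'k::field set)"
  and U: "openin (zariski (nilpotent_commutator P :: 'k mat set)) U" "U \<noteq> {}"
  and z: "\<And>B. B \<in> U ==> B ^\<^sub>m u = 0\<^sub>m (sum_mset P) (sum_mset P)"
  and B1: "B1 \<in> nilpotent_commutator P"
 shows "B1 ^\<^sub>m u = 0\<^sub>m (sum_mset P) (sum_mset P)"
proof -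
 let ?n = "sum_mset P" and ?ps = "parts P"
 obtain S where S: "U = nilpotent_commutator P - {B \<in> nilpotent_commutator P. \<forall>p\<in>S. meval (entry B) p = 0}"
  using U(1) unfolding openin_zariski by blast
 obtain B0 p where B0: "B0 \<in> nilpotent_commutator P" "p \<in> S" "meval (entry B0) p \<noteq> 0" using U(2) S by blast
 obtain g h where gh: "comm ?ps g" "comm ?ps h" "g * h = 1\<^sub>m ?n" "h * g = 1\<^sub>m ?n" "T_form ?ps (h * (B0 * g))"
  using nilpotent_commutator_conj[OF B0(1)] .
 obtain g1 h1 where gh1: "comm ?ps g1" "comm ?ps h1" "g1 * h1 = 1\<^sub>m ?n" "h1 * g1 = 1\<^sub>m ?n" "T_form ?ps (h1 * (B1 * g1))"
  using nilpotent_commutator_conj[OF B1] .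
 have c: "X \<in> sqm ?n" if "comm ?ps X" for X :: "'k mat" using commD(1)[OF that] by simp
 have cB: "B0 \<in> sqm ?n" "B1 \<in> sqm ?n"
  using c[of B0] c[of B1] B0(1) B1 by (simp_all add: nilpotent_commutator_iff)
 define C0 C1 where "C0 = h * (B0 * g)" and "C1 = h1 * (B1 * g1)"
 have C: "T_form ?ps C0" "T_form ?ps C1" "C0 \<in> sqm ?n" "C1 \<in> sqm ?n"
  using gh(5) gh1(5) c[of C0] c[of C1] unfolding C0_def[symmetric] C1_def[symmetric] by (auto simp: T_form_def)
 define D where "D = (\<lambda>t. C0 + t \<cdot>\<^sub>m (C1 - C0))"
 have D: "D t \<in> sqm ?n" "D 0 = C0" "D 1 = C1" for t
  using C(3,4) by (auto simp: D_def intro!: eq_matI)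
 have "polymat ?n D"
  unfolding polymat_def
 proof (intro conjI allI impI)
  fix i j assume "i < ?n" "j < ?n"
  then show "\<exists>q. \<forall>t. poly q t = D t $$ (i, j)"
   using C(3,4) by (intro exI[of _ "[:C0 $$ (i, j), C1 $$ (i, j) - C0 $$ (i, j):]"]) (simp add: D_def)
 qed (rule D)
 define M where "M = (\<lambda>t. g * D t * h)"
 have M: "polymat ?n M"
  unfolding M_def by (intro polymat_mult polymat_const c gh \<open>polymat ?n D\<close>)
 have M0: "M 0 = B0" unfolding M_def D(2) C0_def by (rule conj_conj[OF _ _ cB(1) gh(3)]) (intro c gh)+
 have MN: "M t \<in> nilpotent_commutator P" for t
 proof -
  have T: "T_form ?ps (D t)" unfolding D_def by (rule T_form_line[OF C(1,2)])
  then have "comm ?ps (M t)" unfolding M_def T_form_def by (intro comm_mult gh) blast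
  moreover have "M t ^\<^sub>m ?n = 0\<^sub>m ?n ?n"
   unfolding M_def using similar_pow_zero[OF c[OF gh(1)] c[OF gh(2)] D(1) gh(3,4)] T_form_nilpotent[OF T] by simp
  ultimately show ?thesis by (simp add: nilpotent_commutator_iff)
 qed
 have "M 1 ^\<^sub>m u = 0\<^sub>m ?n ?n"
 proof (rule line_vanish[OF inf M polymat_pow[OF M]])
  show "meval (entry (M 0)) p \<noteq> 0" using M0 B0(3) by simp
  show "M t ^\<^sub>m u = 0\<^sub>m ?n ?n" if "meval (entry (M t)) p \<noteq> 0" for t
   using that B0(2) MN S by (intro z) blast
 qed
 then have "C1 ^\<^sub>m u = 0\<^sub>m ?n ?n"
  using similar_pow_zero[OF c[OF gh(1)] c[OF gh(2)] D(1) gh(3,4), of 1] D(3) by (simp add: M_def)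
 then have "(g1 * C1 * h1) ^\<^sub>m u = 0\<^sub>m ?n ?n"
  using similar_pow_zero[OF c[OF gh1(1)] c[OF gh1(2)] C(4) gh1(3,4)] by simp
 then show ?thesis
  using conj_conj[OF c[OF gh1(1)] c[OF gh1(2)] cB(2) gh1(3)] by (simp add: C1_def)
qed

text \<open>The three base points form an antichain for the order generated by the possible moves, so the
 quotient by the strictly larger positions has corank at least three.\<close>

lemma T_form_corank_ge_3:
 fixes C :: "'k::field mat"
 assumes C: "T_form ps C" and sorted: "\<And>s t. s <= t ==> t < length ps ==> ps ! t <= ps ! s"
  and s: "s1 < length ps" "s2 < length ps" "s3 < length ps"
  and gap: "1 <= ps ! s3" "ps ! s3 + 2 <= ps ! s2" "ps ! s2 + 2 <= ps ! s1"
 shows "\<not> corank (Vs (Ix ps)) (opk (Ix ps) (ix ps) (Ix ps) (ix ps) C) 2"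
proof
 let ?I = "Ix ps" and ?f = "opk (Ix ps) (ix ps) (Ix ps) (ix ps) C"
 let ?mv = "\<lambda>x y. T_move ((!) ps) (fst x) (snd x) (fst y) (snd y)"
 assume "corank (Vs ?I) ?f 2"
 then obtain w :: "nat => nat \<times> nat => 'k" where w: "\<forall>v\<in>Vs ?I. spanned_mod (?f ` Vs ?I) w {..<2} v"
  unfolding corank_def by blast
 \<comment> \<open>A move from a smaller block to a larger one must gain at least the difference of
   their sizes, which is two or more for each pair; so offsets by one from block to block keep the
   three positions incomparable in both directions.\<close>
 define S where "S = {(s1, 2 :: nat), (s2, 1), (s3, 0)}"
 define X' where "X' = {y \<in> ?I. \<exists>x\<in>S. ?mv x y}"
 have SI: "S \<subseteq> ?I" using s gap by (auto simp: S_def Ix_def)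
 have order: "s1 < s2" "s2 < s3" using sorted[of s2 s1] sorted[of s3 s2] s gap by (force simp: not_less[symmetric])+
 have ndisj: "S \<inter> X' = {}"
  using gap order unfolding S_def X'_def T_move_def by auto
 have cardS: "card S = 3" using order by (simp add: S_def)
 have tr: "?mv x z" if "x \<in> ?I" "y \<in> ?I" "z \<in> ?I" "?mv x y" "?mv y z" for x y z
  by (rule T_move_trans[OF sorted _ _ _ that(4,5)]) (use that(1-3) in "auto simp: Ix_def")
 have up: "y \<in> X'" if xy: "x \<in> S \<union> X'" "x \<in> ?I" "y \<in> ?I" "C $$ (ix ps y, ix ps x) \<noteq> 0" for x y
 proof -
  have "?mv x y" using C xy(2-4) unfolding T_form_def by (metis prod.collapse)
  then show ?thesis using xy tr SI unfolding X'_def by blast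
 qed
 define W :: "(nat \<times> nat => 'k) set" where "W = {v. \<forall>x\<in>?I - X'. v x = 0}"
 have W: "subsp W" by (auto simp: W_def subsp_def)
 have fW: "?f v \<in> W" if v: "\<forall>x\<in>?I - (S \<union> X'). v x = 0" for v
  unfolding W_def
 proof (intro CollectI ballI)
  fix y assume y: "y \<in> ?I - X'"
  have "C $$ (ix ps y, ix ps x) * v x = 0" if "x \<in> ?I" for x
   using up[of x y] v that y by (cases "x \<in> S \<union> X'") auto
  then show "?f v y = 0" by (simp add: opk_def)
 qed
 let ?J = "?I - (S \<union> X')"
 define v where "v = case_sum (\<lambda>i. w i) (\<lambda>z. ?f (uvec z))"
 have fin: "finite ?I" by simp
 have ind: "indep_mod W uvec (?I - X')"
  unfolding indep_mod_def
 proof (intro allI impI ballI)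
  fix \<alpha> x assume *: "lcomb \<alpha> uvec (?I - X') \<in> W" "x \<in> ?I - X'"
  have "lcomb \<alpha> uvec (?I - X') x = \<alpha> x"
   using *(2) fin by (simp add: lcomb_def uvec_def if_distrib cong: if_cong)
  then show "\<alpha> x = 0" using * by (auto simp: W_def)
 qed
 \<comment> \<open>Functions modulo \<open>W\<close> have dimension \<open>card S + card ?J\<close>
   with three positions in \<open>S\<close>. The images of the unit vectors in \<open>S\<close> and
   \<open>X'\<close> vanish there, so two generators modulo the image would leave only
   \<open>2 + card ?J\<close> spanning vectors.\<close>
 have "card (?I - X') <= card ({..<2::nat} <+> ?J)"
 proof (rule indep_card_le[OF W _ _ ind])
  fix y assume y: "y \<in> ?I - X'"
  have "spanned_mod (?f ` Vs ?I) w {..<2} (uvec y)" using bspec[OF w uvec_Vs] y by blast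
  then obtain \<beta> z where z: "z \<in> Vs ?I" "(\<lambda>x. uvec y x - lcomb \<beta> w {..<2} x) = ?f z"
   unfolding spanned_mod_def by blast
  have z0: "z x = 0" if "x \<notin> ?I" for x using z(1) that unfolding Vs_def by blast
  define z' where "z' = (\<lambda>x. if x \<in> S \<union> X' then z x else 0)"
  have zz: "z = (\<lambda>x. z' x + lcomb z uvec ?J x)"
  proof
   fix x
   have "lcomb z uvec ?J x = (\<Sum>y\<in>?J. if x = y then z y else 0)"
    unfolding lcomb_def uvec_def by (intro sum.cong) auto
   also have "\<dots> = (if x \<in> ?J then z x else 0)" using fin by (intro sum.delta') simp
   finally show "z x = z' x + lcomb z uvec ?J x"
    using z0 by (cases "x \<in> ?I"; cases "x \<in> S \<union> X'") (auto simp: z'_def)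
  qed
  have "?f z = (\<lambda>x. ?f z' x + lcomb z (\<lambda>x. ?f (uvec x)) ?J x)"
   by (subst zz) (simp only: linD(1)[OF lin_opk] lin_lcomb[OF lin_opk])
  moreover have "lcomb (case_sum \<beta> z) v ({..<2::nat} <+> ?J) x = lcomb \<beta> w {..<2} x + lcomb z (\<lambda>x. ?f (uvec x)) ?J x" for x
   unfolding lcomb_def v_def by (subst sum.Plus) (use fin in simp_all)
  ultimately have "(\<lambda>x. uvec y x - lcomb (case_sum \<beta> z) v ({..<2::nat} <+> ?J) x) = ?f z'"
   using z(2) by (simp add: fun_eq_iff algebra_simps)
  moreover have "?f z' \<in> W" by (rule fW) (simp add: z'_def)
  ultimately show "spanned_mod W v ({..<2::nat} <+> ?J) (uvec y)" unfolding spanned_mod_def by metis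
 qed (use fin in auto)
 also have "\<dots> = 2 + card ?J" using fin by (simp add: card_Plus)
 finally have le: "card (?I - X') <= 2 + card ?J" .
 have "?I - X' = S \<union> ?J" using SI ndisj by blast
 moreover have "finite S" by (simp add: S_def)
 ultimately have "card (?I - X') = card S + card ?J"
  by (simp only:) (rule card_Un_disjoint, use fin in auto)
 then show False using le cardS by simp
qed

text \<open>The largest part heads the upper cluster, and the largest part at distance at least two
  from it heads the lower one. A part belonging to neither would complete a forbidden
  triple.\<close>

lemma partition_clusters:
 assumes P: "is_partition P" "P \<noteq> {#}"
  and no3: "\<And>a b c. a \<in># P ==> b \<in># P ==> c \<in># P ==> c + 2 <= b ==> b + 2 <= a ==> False"
 shows "(\<exists>j x y. 1 <= j \<and> 1 <= x \<and> (j = 1 --> y = 0) \<and> P = replicate_mset x j + replicate_mset y (j - 1)) \<or>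
  (\<exists>j j' x y z w. two_clusters j j' x z w \<and>
   P = replicate_mset x j + replicate_mset y (j - 1) + replicate_mset z j' + replicate_mset w (j' - 1))"
proof -
 define j where "j = Max (set_mset P)"
 have j: "j \<in># P" "\<And>p. p \<in># P ==> p <= j" using P(2) by (simp_all add: j_def)
 have pos: "1 <= p" if "p \<in># P" for p using P(1) that by (cases p) (auto simp: is_partition_def)
 have c0: "count P 0 = 0" using P(1) by (simp add: is_partition_def not_in_iff)
 show ?thesis
 proof (cases "\<exists>p. p \<in># P \<and> p + 2 <= j")
  case False
  have mem: "p = j \<or> p = j - 1" if "p \<in># P" for p
  proof -
   have "p <= j" "\<not> p + 2 <= j" using j(2)[OF that] that False by blast+
   then show ?thesis by linarith
  qed
  have d: "j \<noteq> j - 1" using pos[OF j(1)] by simp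
  have "count P p = count (replicate_mset (count P j) j + replicate_mset (count P (j - 1)) (j - 1)) p" for p
  proof (cases "p \<in># P")
   case True
   then show ?thesis using mem[OF True] d by (elim disjE) simp_all
  next
   case False
   then show ?thesis by (auto simp: not_in_iff)
  qed
  then have "P = replicate_mset (count P j) j + replicate_mset (count P (j - 1)) (j - 1)" by (rule multiset_eqI)
  moreover have "1 <= count P j" using j(1) by (simp add: Suc_le_eq)
  moreover have "1 <= j" "j = 1 --> count P (j - 1) = 0" using pos[OF j(1)] c0 by auto
  ultimately show ?thesis by blast
 next
  case True
  let ?A = "{p \<in> set_mset P. p + 2 <= j}"
  define j' where "j' = Max ?A"
  have "finite ?A" "?A \<noteq> {}" using True by auto
  then have "j' \<in> ?A" "\<And>p. p \<in> ?A ==> p <= j'" unfolding j'_def using Max_in Max_ge by blast+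
  then have j': "j' \<in># P" "j' + 2 <= j" "\<And>p. p \<in># P ==> p + 2 <= j ==> p <= j'" by auto
  have mem: "p = j \<or> p = j - 1 \<or> p = j' \<or> p = j' - 1" if p: "p \<in># P" for p
  proof (cases "p + 2 <= j")
   case True
   then have "p <= j'" by (rule j'(3)[OF p])
   moreover have "\<not> p + 2 <= j'" using no3[OF j(1) j'(1) p] j'(2) by blast
   ultimately show ?thesis by linarith
  next
   case False
   then show ?thesis using j(2)[OF p] by linarith
  qed
  have "1 <= j'" by (rule pos[OF j'(1)])
  then have d: "j \<noteq> j - 1" "j \<noteq> j'" "j \<noteq> j' - 1" "j - 1 \<noteq> j'" "j - 1 \<noteq> j' - 1" "j' \<noteq> j' - 1" using j'(2) by auto
  let ?R = "replicate_mset (count P j) j + replicate_mset (count P (j - 1)) (j - 1) + replicate_mset (count P j') j' +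
   replicate_mset (count P (j' - 1)) (j' - 1)"
  have "count P p = count ?R p" for p
  proof (cases "p \<in># P")
   case True
   then show ?thesis using mem[OF True] d by (elim disjE) simp_all
  next
   case False
   then show ?thesis by (auto simp: not_in_iff)
  qed
  then have "P = ?R" by (rule multiset_eqI)
  moreover have "two_clusters j j' (count P j) (count P j') (count P (j' - 1))"
  proof
   show "1 <= count P j" "1 <= count P j'" using j(1) j'(1) by (simp_all add: Suc_le_eq)
   show "count P (j' - 1) = 0" if "j' = 1" using c0 that by simp
  qed (use j'(2) \<open>1 <= j'\<close> in auto)
  ultimately show ?thesis by blast
 qed
qed

lemma parts_eqI: "sorted (rev l) ==> mset l = P ==> parts P = l"
 unfolding parts_def by (metis mset_rev rev_rev_ident sorted_list_of_multiset_mset sorted_sort_id)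

lemma prof_replicate [simp]: "prof (replicate_mset x j) i = x * min i j"
 by (induction x) simp_all

lemma corank_2_no_3:
 fixes B :: "'k::field mat"
 assumes B: "B \<in> nilpotent_commutator P" and P: "is_partition P" and I: "indexing (sum_mset P) I e"
  and cor: "corank (Vs I) (opk I e I e B) 2"
  and abc: "a \<in># P" "b \<in># P" "c \<in># P" "c + 2 <= b" "b + 2 <= a"
 shows False
proof -
 let ?n = "sum_mset P" and ?ps = "parts P"
 obtain g h where gh: "comm ?ps g" "comm ?ps h" "g * h = 1\<^sub>m ?n" "h * g = 1\<^sub>m ?n" "T_form ?ps (h * (B * g))"
  using nilpotent_commutator_conj[OF B] .
 have c: "g \<in> sqm ?n" "h \<in> sqm ?n" "B \<in> sqm ?n"
  using commD(1)[OF gh(1)] commD(1)[OF gh(2)] B commD(1)[of ?ps B] by (simp_all add: nilpotent_commutator_iff)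
 have ix: "indexing ?n (Ix ?ps) (ix ?ps)" using indexing_ix[of ?ps] by simp
 have "h * (B * g) = h * B * g" by (rule assoc_mult_mat[symmetric, of _ ?n ?n _ ?n _ ?n]) (use c in simp_all)
 then have cor': "corank (Vs (Ix ?ps)) (opk (Ix ?ps) (ix ?ps) (Ix ?ps) (ix ?ps) (h * (B * g))) 2"
  using c gh(3,4) by (intro corank_similar[OF ix I _ _ c(2,1) _ _ _ cor]) simp_all
 have "set ?ps = set_mset P" by (metis mset_parts set_mset_mset)
 then obtain s1 s2 s3 where s: "s1 < length ?ps" "?ps ! s1 = a" "s2 < length ?ps" "?ps ! s2 = b" "s3 < length ?ps" "?ps ! s3 = c"
  using abc(1-3) by (metis in_set_conv_nth)
 have "1 <= c" using P abc(3) by (cases c) (auto simp: is_partition_def)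
 then show False using T_form_corank_ge_3[OF gh(5) parts_sorted s(1,3,5)] s abc cor' by simp
qed

context two_clusters begin

definition "Pt = replicate_mset x j + replicate_mset y (j - 1) + replicate_mset z j' + replicate_mset w (j' - 1)"

lemma parts_Pt: "length (parts Pt) = m + m'" "s < m + m' ==> parts Pt ! s = sz s"
proof -
 have *: "parts Pt = replicate x j @ replicate y (j - 1) @ replicate z j' @ replicate w (j' - 1)"
  using gap by (intro parts_eqI) (auto simp: Pt_def sorted_append)
 show "length (parts Pt) = m + m'" unfolding * by (simp add: m_def m'_def)
 show "parts Pt ! s = sz s" if "s < m + m'"
 proof -
  consider "s < x" | "x <= s" "s < x + y" | "x + y <= s" "s < x + y + z" | "x + y + z <= s" by linarith
  then show ?thesis
   using that unfolding * sz_def m_def m'_def by cases (auto simp: nth_append)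
 qed
qed

lemma prof_Pt: "prof Pt i = pf i"
 by (simp add: Pt_def pf_def)

lemma sum_Pt: "sum_mset Pt = N + N'"
 using N_alt N'_alt by (simp add: Pt_def)

end

text \<open>The common ground of the two descriptions of the partitions in question:
  \<open>generic_type_leveled\<close> arrives here from the generic type,
  \<open>box_partition_leveled\<close> from the Burge code.\<close>

definition leveled :: "nat multiset => nat => nat => nat => nat => bool" where
 "leveled P u r k l \<longleftrightarrow> sum_mset P + r = 2 * u \<and> 1 <= k \<and> k < r \<and> 1 <= l \<and> l <= u - r \<and> r < u \<and>
  (\<forall>i. prof P i = nu u r k l i) \<and> (\<exists>lev. good_levels (length (parts P)) ((!) (parts P)) u r k l lev) \<and> length (parts P) = k + l"

lemma good_levels_cong:
 assumes "\<And>s. s < b ==> sz s = sz' s" "min l (r - k) <= b"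
 shows "good_levels b sz u r k l lev \<longleftrightarrow> good_levels b sz' u r k l lev"
proof -
 have T: "T_move sz s p t q = T_move sz' s p t q" if "s < b" "t < b" for s p t q
  using assms(1) that by (simp add: T_move_def)
 have M: "sz s = sz' s" if "s < l \<and> s < r - k" for s 
 proof -
  have "s < min l (r - k)" using that by simp
  then show ?thesis using assms(2) by (intro assms(1)) (rule less_le_trans)
 qed
 have C: "{(s, p). s < b \<and> p < sz s \<and> u <= lev s p + k + 1} = {(s, p). s < b \<and> p < sz' s \<and> u <= lev s p + k + 1}"
  using assms(1) by auto
 show ?thesis
  unfolding good_levels_def C
  by (intro conj_cong if_cong all_cong ex_cong refl) (use assms(1) T M in simp_all)
qed

lemma cluster_cases:
 fixes B :: "'k::field mat"
 assumes "B \<in> nilpotent_commutator P" "is_partition P" "P \<noteq> {#}" "indexing (sum_mset P) I e"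
  "corank (Vs I) (opk I e I e B) 2"
 shows "(\<exists>j x y. 1 <= j \<and> 1 <= x \<and> (j = 1 --> y = 0) \<and> P = replicate_mset x j + replicate_mset y (j - 1)) \<or>
  (\<exists>u r k l. leveled P u r k l)"
proof -
 have "(\<exists>j x y. 1 <= j \<and> 1 <= x \<and> (j = 1 --> y = 0) \<and> P = replicate_mset x j + replicate_mset y (j - 1)) \<or>
  (\<exists>j j' x y z w. two_clusters j j' x z w \<and>
   P = replicate_mset x j + replicate_mset y (j - 1) + replicate_mset z j' + replicate_mset w (j' - 1))"
  by (rule partition_clusters[OF assms(2,3)]) (rule corank_2_no_3[OF assms(1,2,4,5)])
 then consider (one) "\<exists>j x y. 1 <= j \<and> 1 <= x \<and> (j = 1 --> y = 0) \<and> P = replicate_mset x j + replicate_mset y (j - 1)"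
  | (two) j j' x y z w where "two_clusters j j' x z w"
   "P = replicate_mset x j + replicate_mset y (j - 1) + replicate_mset z j' + replicate_mset w (j' - 1)"
  by (elim disjE exE conjE) blast+
 then show ?thesis
 proof cases
  case two
  then interpret two_clusters j j' x y z w by simp
  have P: "P = Pt" using two(2) by (simp add: Pt_def)
  obtain u r k l lev where d: "N + N' + r = 2 * u" "1 <= k" "k < r" "1 <= l" "l <= u - r" "r < u" "k + l = m + m'"
    "\<forall>i. pf i = nu u r k l i" "good_levels (m + m') sz u r k l lev"
   using box_data unfolding box_data_def by (elim exE conjE) (rule that)
  have "good_levels (m + m') ((!) (parts Pt)) u r k l lev"
   using d(9) by (subst good_levels_cong[of _ _ sz]) (use d(7) parts_Pt in auto)
  then have "leveled P u r k l"
   unfolding leveled_def P using d parts_Pt(1) prof_Pt sum_Pt by auto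
  then show ?thesis by blast
 qed blast
qed

no_notation vec_index (infixl "$" 100)
unbundle fps_syntax

section \<open>Submodules of a free module of rank two over power series\<close>

lemma fps_X_power_dvd_iff: "fps_X ^ n dvd f \<longleftrightarrow> (\<forall>i<n. f $ i = (0 :: 'k::field))"
proof
 assume "fps_X ^ n dvd f"
 then obtain g where "f = fps_X ^ n * g" by (elim dvdE)
 then show "\<forall>i<n. f $ i = 0" by (simp add: fps_X_power_mult_nth)
next
 assume *: "\<forall>i<n. f $ i = 0"
 then have "f = fps_X ^ n * fps_shift n f"
  by (intro fps_ext) (simp add: fps_X_power_mult_nth)
 then show "fps_X ^ n dvd f" by (metis dvd_triv_left)
qed

lemma fps_exact_dvd:
 assumes "\<forall>i<s. p $ i = 0" "p $ s \<noteq> (0 :: 'k::field)" "\<forall>i<s. f $ i = 0"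
 shows "p dvd f"
proof (cases "f = 0")
 case False
 have "p \<noteq> 0" using assms(2) by auto
 moreover have "subdegree p <= s" using assms(2) by (rule subdegree_leI)
 moreover have "s <= subdegree f" using False assms(3) by (intro subdegree_geI) auto
 ultimately show ?thesis using False by (simp add: fps_dvd_iff)
qed simp

lemma fps_mult_low_zero:
 assumes "\<forall>i<s. p $ i = (0 :: 'k::field)"
 shows "\<forall>i<s. (p * f) $ i = 0"
 using assms unfolding fps_X_power_dvd_iff[symmetric] by (rule dvd_mult2)

lemma fps_mult_exact:
 assumes p: "\<forall>i<s. p $ i = 0" "p $ s \<noteq> (0 :: 'k::field)" and d: "\<forall>i<s + t. (p * y) $ i = 0"
 shows "\<forall>i<t. y $ i = 0" and "(p * y) $ (s + t) = p $ s * y $ t"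
proof -
 define e where "e = fps_shift s p"
 have pe: "p = fps_X ^ s * e" using p(1) unfolding e_def by (intro fps_ext) (simp add: fps_X_power_mult_nth)
 have e0: "e $ 0 = p $ s" by (simp add: e_def)
 have 1: "(e * y) $ i = (p * y) $ (s + i)" for i
  unfolding pe mult.assoc by (simp add: fps_X_power_mult_nth)
 then have "\<forall>i<t. (e * y) $ i = 0" using d by simp
 then have "\<forall>i<t. (inverse e * (e * y)) $ i = 0"
  using fps_mult_low_zero[of t "e * y" "inverse e"] by (simp add: mult.commute)
 moreover have "inverse e * (e * y) = y" using e0 p(2) inverse_mult_eq_1[of e] by (simp add: mult.assoc[symmetric])
 ultimately show y: "\<forall>i<t. y $ i = 0" by simp
 have "(p * y) $ (s + t) = (e * y) $ t" using 1 by simp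
 also have "\<dots> = (\<Sum>i=0..t. e $ i * y $ (t - i))" by (simp add: fps_mult_nth)
 also have "\<dots> = (\<Sum>i\<in>{0}. e $ i * y $ (t - i))"
  using y by (intro sum.mono_neutral_right) auto
 finally show "(p * y) $ (s + t) = p $ s * y $ t" using e0 by simp
qed

definition submod :: "('k::field fps \<times> 'k fps) set => bool" where
 "submod L \<longleftrightarrow> (\<forall>p q p' q' e. (p, q) \<in> L --> (p', q') \<in> L --> (p + e * p', q + e * q') \<in> L)"

definition det2 :: "'k::field fps \<times> 'k fps => 'k fps \<times> 'k fps => 'k fps" where
 "det2 v w = fst v * snd w - snd v * fst w"

text \<open>Pairs of polynomials of degrees below \<open>s\<close> and below \<open>t\<close>
  represent the quotient by \<open>L\<close> uniquely, so its dimension is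
  \<open>s + t\<close>.\<close>

definition complement :: "('k::field fps \<times> 'k fps) set => nat => nat => bool" where
 "complement L s t \<longleftrightarrow>
  (\<forall>p q. (p, q) \<in> L --> (\<forall>i\<ge>s. p $ i = 0) --> (\<forall>i\<ge>t. q $ i = 0) --> p = 0 \<and> q = 0) \<and>
  (\<forall>p q. \<exists>p' q'. (p - p', q - q') \<in> L \<and> (\<forall>i\<ge>s. p' $ i = 0) \<and> (\<forall>i\<ge>t. q' $ i = 0))"

lemma fps_remainder:
 assumes "\<forall>i<s. p $ i = 0" "p $ s \<noteq> (0 :: 'k::field)"
 shows "\<exists>f' e. f = f' + e * p \<and> (\<forall>i\<ge>s. f' $ i = 0)"
proof -
 define f' where "f' = Abs_fps (\<lambda>i. if i < s then f $ i else 0)"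
 have "p dvd f - f'" by (rule fps_exact_dvd[OF assms]) (simp add: f'_def)
 then obtain e where "f - f' = p * e" by (elim dvdE)
 then have "f = f' + e * p" by (simp add: algebra_simps)
 then show ?thesis by (intro exI[of _ f'] exI[of _ e]) (simp add: f'_def)
qed

text \<open>Hermite normal form over a discrete valuation ring. The vector \<open>(p0, q0)\<close>
  has an entry of least order \<open>s\<close> in first place, the second generator is
  \<open>(0, yy)\<close>, and the least order \<open>d\<close> of a minor splits into
  \<open>s\<close> for \<open>p0\<close> and \<open>d - s\<close> for \<open>yy\<close>.\<close>

lemma complement_exists_aux:
 fixes L :: "('k::field fps \<times> 'k fps) set"
 assumes L: "submod L" and low: "\<And>v w i. v \<in> L ==> w \<in> L ==> i < d ==> det2 v w $ i = 0"
  and att: "v1 \<in> L" "v2 \<in> L" "det2 v1 v2 $ d \<noteq> 0"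
  and v: "(p0, q0) \<in> L" "p0 $ s \<noteq> 0" and s: "\<And>p q i. (p, q) \<in> L ==> i < s ==> p $ i = 0 \<and> q $ i = 0"
 shows "s <= d \<and> complement L s (d - s)"
proof -
 have p0: "\<forall>i<s. p0 $ i = 0" "p0 $ s \<noteq> 0" using v s by blast+
 have dec: "\<exists>e y. (p, q) = (e * p0, e * q0 + y) \<and> (0, y) \<in> L" if w: "(p, q) \<in> L" for p q
 proof -
  have "p0 dvd p" by (rule fps_exact_dvd[OF p0]) (use s w in blast)
  then obtain e where e: "p = p0 * e" by (elim dvdE)
  have "(p + (- e) * p0, q + (- e) * q0) \<in> L" using L w v(1) unfolding submod_def by blast
  then show ?thesis using e by (intro exI[of _ e] exI[of _ "q - e * q0"]) (simp add: mult.commute)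
 qed
 have sd: "s <= d"
 proof (rule ccontr)
  assume "\<not> s <= d"
  then have "\<forall>i<s. fst v1 $ i = 0" "\<forall>i<s. snd v1 $ i = 0" using s[of "fst v1" "snd v1"] att(1) by simp_all
  then have "det2 v1 v2 $ d = 0"
   using fps_mult_low_zero[of s "fst v1" "snd v2"] fps_mult_low_zero[of s "snd v1" "fst v2"] \<open>\<not> s <= d\<close>
   by (simp add: det2_def)
  then show False using att(3) by simp
 qed
 define t where "t = d - s"
 have dst: "d = s + t" using sd by (simp add: t_def)
 have y0: "\<forall>i<t. y $ i = 0" if "(0, y) \<in> L" for y
 proof (rule fps_mult_exact(1)[OF p0])
  show "\<forall>i<s + t. (p0 * y) $ i = 0" using low[OF v(1) that] by (simp add: det2_def dst)
 qed
 obtain e1 y1 e2 y2 where v12: "v1 = (e1 * p0, e1 * q0 + y1)" "(0, y1) \<in> L" "v2 = (e2 * p0, e2 * q0 + y2)" "(0, y2) \<in> L"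
  using dec[of "fst v1" "snd v1"] dec[of "fst v2" "snd v2"] att(1,2) by auto
 \<comment> \<open>Cross-elimination of the first components of \<open>v1\<close> and
   \<open>v2\<close>. The product of \<open>p0\<close> with \<open>yy\<close> is the minor
   \<open>det2 v1 v2\<close>, so \<open>yy\<close> has order exactly \<open>d - s\<close>.\<close>
 define yy where "yy = e1 * y2 - e2 * y1"
 have zero: "(0, 0) \<in> L"
 proof -
  have "(p0 + (- 1) * p0, q0 + (- 1) * q0) \<in> L" using L v(1) unfolding submod_def by blast
  then show ?thesis by simp
 qed
 have "(0 + e1 * 0, 0 + e1 * y2) \<in> L" using L zero v12(4) unfolding submod_def by blast
 then have "((0 + e1 * 0) + (- e2) * 0, (0 + e1 * y2) + (- e2) * y1) \<in> L" using L v12(2) unfolding submod_def by blast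
 then have yyL: "(0, yy) \<in> L" by (simp add: yy_def)
 have "p0 * yy = det2 v1 v2" by (simp add: det2_def v12 yy_def algebra_simps)
 moreover have "(p0 * yy) $ d = p0 $ s * yy $ t"
  unfolding dst by (rule fps_mult_exact(2)[OF p0]) (use low[OF v(1) yyL] in "simp add: det2_def dst")
 ultimately have yyt: "yy $ t \<noteq> 0" using att(3) by auto
 have "complement L s t"
  unfolding complement_def
 proof (intro conjI allI impI)
  fix p q assume w: "(p, q) \<in> L" "\<forall>i\<ge>s. p $ i = 0" "\<forall>i\<ge>t. q $ i = 0"
  show p: "p = 0"
  proof (rule fps_ext)
   show "p $ i = 0 $ i" for i using w(2) s[OF w(1), of i] by (cases "i < s") auto
  qed
  show "q = 0"
  proof (rule fps_ext)
   show "q $ i = 0 $ i" for i using w(3) y0[of q] w(1) p by (cases "i < t") auto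
  qed
 next
  fix p q
  obtain p' e where p': "p = p' + e * p0" "\<forall>i\<ge>s. p' $ i = 0" using fps_remainder[OF p0] by blast
  obtain q' e' where q': "q - e * q0 = q' + e' * yy" "\<forall>i\<ge>t. q' $ i = 0"
   using fps_remainder[OF y0[OF yyL] yyt] by blast
  have "(0 + e * p0, 0 + e * q0) \<in> L" using L zero v(1) unfolding submod_def by blast
  then have "((0 + e * p0) + e' * 0, (0 + e * q0) + e' * yy) \<in> L" using L yyL unfolding submod_def by blast
  then have "(p - p', q - q') \<in> L" using p'(1) q'(1) by (simp add: algebra_simps)
  then show "\<exists>p' q'. (p - p', q - q') \<in> L \<and> (\<forall>i\<ge>s. p' $ i = 0) \<and> (\<forall>i\<ge>t. q' $ i = 0)" using p'(2) q'(2) by blast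
 qed
 then show ?thesis using sd by (simp add: t_def)
qed

lemma complement_swap: "complement (prod.swap ` L) t s \<longleftrightarrow> complement L s t"
proof -
 have m: "(a, b) \<in> prod.swap ` L \<longleftrightarrow> (b, a) \<in> L" for a b by force
 show ?thesis unfolding complement_def m by blast
qed

text \<open>The entry of least order may sit in second place; swapping the components negates the
  minors and exchanges \<open>s\<close> and \<open>t\<close>.\<close>

lemma complement_exists:
 fixes L :: "('k::field fps \<times> 'k fps) set"
 assumes L: "submod L" and low: "\<And>v w i. v \<in> L ==> w \<in> L ==> i < d ==> det2 v w $ i = 0"
  and att: "v1 \<in> L" "v2 \<in> L" "det2 v1 v2 $ d \<noteq> 0"
 shows "\<exists>s t. s + t = d \<and> complement L s t"
proof -
 let ?P = "\<lambda>n. \<exists>p q. (p, q) \<in> L \<and> (p $ n \<noteq> 0 \<or> q $ n \<noteq> 0)"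
 have "fst v1 \<noteq> 0 \<or> snd v1 \<noteq> 0" using att(3) by (auto simp: det2_def)
 then have "\<exists>n. ?P n" using att(1) by (metis fps_nonzero_nth prod.collapse)
 define s where "s = (LEAST n. ?P n)"
 obtain p0 q0 where v: "(p0, q0) \<in> L" "p0 $ s \<noteq> 0 \<or> q0 $ s \<noteq> 0"
  using LeastI_ex[OF \<open>\<exists>n. ?P n\<close>] unfolding s_def by blast
 have s: "p $ i = 0 \<and> q $ i = 0" if "(p, q) \<in> L" "i < s" for p q i
  using not_less_Least[of i ?P] that unfolding s_def by blast
 show ?thesis
 proof (cases "p0 $ s \<noteq> 0")
  case True
  have "s <= d \<and> complement L s (d - s)" by (rule complement_exists_aux[OF L low att v(1) True s])
  then show ?thesis by (intro exI[of _ s] exI[of _ "d - s"]) simp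
 next
  case False
  then have v': "q0 $ s \<noteq> 0" using v(2) by simp
  let ?L = "prod.swap ` L"
  have m: "(a, b) \<in> ?L \<longleftrightarrow> (b, a) \<in> L" for a b by force
  have ds: "det2 (prod.swap v) (prod.swap w) = - det2 v w" for v w :: "'k fps \<times> 'k fps"
   by (cases v; cases w) (simp add: det2_def algebra_simps)
  have "s <= d \<and> complement ?L s (d - s)"
  proof (rule complement_exists_aux)
   show "submod ?L" using L unfolding submod_def m by blast
   show "det2 v w $ i = 0" if "v \<in> ?L" "w \<in> ?L" "i < d" for v w i
    using that by (elim imageE) (simp add: ds low)
   show "prod.swap v1 \<in> ?L" "prod.swap v2 \<in> ?L" "det2 (prod.swap v1) (prod.swap v2) $ d \<noteq> 0" using att ds by auto
   show "(q0, p0) \<in> ?L" "q0 $ s \<noteq> 0" using v(1) v' m by auto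
   show "p $ i = 0 \<and> q $ i = 0" if "(p, q) \<in> ?L" "i < s" for p q i using s[of q p i] that m by blast
  qed
  then have "s <= d \<and> complement L (d - s) s" unfolding complement_swap .
  then show ?thesis by (intro exI[of _ "d - s"] exI[of _ s]) simp
 qed
qed

section \<open>Power series coordinates on the nilpotent commutator\<close>

text \<open>The argument \<open>c\<close> is total on \<open>coord\<close>. The matrix depends only
  on the coordinates in \<open>coords u r\<close>, whereas the power series below use all values;
  \<open>generic_point\<close> exploits this freedom.\<close>

definition cmat :: "nat => nat => (coord => 'k) => 'k::field mat" where
 "cmat u r c = mkm (u + (u - r)) (Ix [u, u - r]) (ix [u, u - r]) (Ix [u, u - r]) (ix [u, u - r])
  (\<lambda>(t, q) (s, p).
   if t = 0 \<and> s = 0 then (if p < q then c (Ca (q - p)) else 0)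
   else if t = 0 then (if p + r <= q then c (Cg (q - p - r)) else 0)
   else if s = 0 then (if p <= q then c (Ch (q - p)) else 0)
   else (if p < q then c (Cb (q - p)) else 0))"

definition pvec :: "nat => nat => 'k::field fps \<times> 'k fps => nat \<times> nat => 'k" where
 "pvec u r v = (\<lambda>x. if x \<in> Ix [u, u - r] then (if fst x = 0 then fst v else snd v) $ snd x else 0)"

definition sa :: "(coord => 'k::field) => 'k fps" where "sa c = Abs_fps (\<lambda>i. if i = 0 then 0 else c (Ca i))"
definition sb :: "(coord => 'k::field) => 'k fps" where "sb c = Abs_fps (\<lambda>i. if i = 0 then 0 else c (Cb i))"
definition sg :: "(coord => 'k::field) => 'k fps" where "sg c = Abs_fps (\<lambda>i. c (Cg i))"
definition sh :: "(coord => 'k::field) => 'k fps" where "sh c = Abs_fps (\<lambda>i. c (Ch i))"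

definition stp :: "nat => (coord => 'k::field) => 'k fps \<times> 'k fps => 'k fps \<times> 'k fps" where
 "stp r c v = (sa c * fst v + fps_X ^ r * sg c * snd v, sh c * fst v + sb c * snd v)"

abbreviation qop :: "nat => nat => 'k::field mat => (nat \<times> nat => 'k) => nat \<times> nat => 'k" where
 "qop u r \<equiv> opk (Ix [u, u - r]) (ix [u, u - r]) (Ix [u, u - r]) (ix [u, u - r])"

lemma mem_Ix2: "(s, p) \<in> Ix [u, u'] \<longleftrightarrow> s = 0 \<and> p < u \<or> s = 1 \<and> p < u'"
 by (cases s) (auto simp: Ix_def less_Suc_eq)

lemma sum_Ix2: "(\<Sum>x\<in>Ix [u, u']. F x) = (\<Sum>p<u. F (0, p)) + (\<Sum>p<u'. F (Suc 0, p))"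
proof -
 have "Ix [u, u'] = Pair 0 ` {..<u} \<union> Pair 1 ` {..<u'}" by (auto simp: mem_Ix2)
 moreover have "Pair (0::nat) ` {..<u} \<inter> Pair 1 ` {..<u'} = {}" by auto
 ultimately have "(\<Sum>x\<in>Ix [u, u']. F x) = sum F (Pair 0 ` {..<u}) + sum F (Pair 1 ` {..<u'})"
  by (simp only: sum.union_disjoint finite_imageI finite_lessThan)
 then show ?thesis by (simp add: sum.reindex inj_on_def)
qed

lemma indexing_ix2: "indexing (u + u') (Ix [u, u']) (ix [u, u'])"
 using indexing_ix[of "[u, u']"] by simp

lemma cmat_carrier [simp]: "cmat u r c \<in> sqm (u + (u - r))"
 by (simp add: cmat_def)

lemma ent_cmat:
 assumes "(s, p) \<in> Ix [u, u - r]" "(t, q) \<in> Ix [u, u - r]"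
 shows "ent [u, u - r] (cmat u r c) (t, q) (s, p) =
   (if t = 0 \<and> s = 0 then (if p < q then c (Ca (q - p)) else 0)
   else if t = 0 then (if p + r <= q then c (Cg (q - p - r)) else 0)
   else if s = 0 then (if p <= q then c (Ch (q - p)) else 0)
   else (if p < q then c (Cb (q - p)) else 0))"
 unfolding cmat_def by (subst index_mkm[OF indexing_ix2 indexing_ix2 assms]) simp

lemma sum_le_conv:
 assumes "q < (n :: nat)"
 shows "(\<Sum>p<n. if p <= q then A p else 0) = (\<Sum>p=0..q. A p :: 'k::comm_monoid_add)"
proof -
 have "(\<Sum>p=0..q. A p) = (\<Sum>p=0..q. if p <= q then A p else 0)" by (intro sum.cong) auto
 also have "\<dots> = (\<Sum>p<n. if p <= q then A p else 0)"
  using assms by (intro sum.mono_neutral_left) auto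
 finally show ?thesis by simp
qed

lemma sum_fps_conv:
 assumes "q < (n :: nat)" "\<And>p. p < n ==> A p = (if p <= q then F $ (q - p) * (f $ p :: 'k::field) else 0)"
 shows "(\<Sum>p<n. A p) = (F * f) $ q"
proof -
 have "(\<Sum>p<n. A p) = (\<Sum>p<n. if p <= q then F $ (q - p) * f $ p else 0)" using assms(2) by simp
 also have "\<dots> = (\<Sum>p=0..q. f $ p * F $ (q - p))" by (subst sum_le_conv[OF assms(1)]) (simp add: mult.commute)
 also have "\<dots> = (F * f) $ q" by (simp only: fps_mult_nth mult.commute[of F f])
 finally show ?thesis .
qed

lemma qop_cmat:
 assumes "r < u"
 shows "qop u r (cmat u r c) (pvec u r v) = pvec u r (stp r c v)"
proof (rule ext, clarify)
 fix t q
 show "qop u r (cmat u r c) (pvec u r v) (t, q) = pvec u r (stp r c v) (t, q)"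
 proof (cases "(t, q) \<in> Ix [u, u - r]")
  case True
  have "qop u r (cmat u r c) (pvec u r v) (t, q) =
    (\<Sum>p<u. ent [u, u - r] (cmat u r c) (t, q) (0, p) * fst v $ p) +
    (\<Sum>p<u - r. ent [u, u - r] (cmat u r c) (t, q) (Suc 0, p) * snd v $ p)"
   using True by (simp add: opk_def sum_Ix2 pvec_def mem_Ix2)
  also have "\<dots> = (if t = 0 then fst (stp r c v) else snd (stp r c v)) $ q"
  proof (cases "t = 0")
   case t: True
   then have q: "q < u" using True by (simp add: mem_Ix2)
   have 1: "(\<Sum>p<u. ent [u, u - r] (cmat u r c) (t, q) (0, p) * fst v $ p) = (sa c * fst v) $ q"
    by (rule sum_fps_conv[OF q]) (use True t in "auto simp: ent_cmat mem_Ix2 sa_def")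
   have 2: "(\<Sum>p<u - r. ent [u, u - r] (cmat u r c) (t, q) (Suc 0, p) * snd v $ p) =
     (fps_X ^ r * sg c * snd v) $ q"
   proof (cases "r <= q")
    case le: True
    have "(\<Sum>p<u - r. ent [u, u - r] (cmat u r c) (t, q) (Suc 0, p) * snd v $ p) = (sg c * snd v) $ (q - r)"
    proof (rule sum_fps_conv)
     show "q - r < u - r" using q le by simp
     fix p assume p: "p < u - r"
     have "p + r <= q \<longleftrightarrow> p <= q - r" "q - p - r = q - r - p" using le by auto
     then show "ent [u, u - r] (cmat u r c) (t, q) (Suc 0, p) * snd v $ p =
       (if p <= q - r then sg c $ (q - r - p) * snd v $ p else 0)"
      using p True t by (simp add: ent_cmat mem_Ix2 sg_def)
    qed
    then show ?thesis using le by (simp add: mult.assoc fps_X_power_mult_nth)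
   next
    case False
    have "(\<Sum>p<u - r. ent [u, u - r] (cmat u r c) (t, q) (Suc 0, p) * snd v $ p) = 0"
     using False True t by (intro sum.neutral) (auto simp: ent_cmat mem_Ix2)
    then show ?thesis using False by (simp add: mult.assoc fps_X_power_mult_nth)
   qed
   show ?thesis unfolding 1 2 using t by (simp add: stp_def)
  next
   case t: False
   then have q: "q < u - r" "t = 1" using True by (auto simp: mem_Ix2)
   have 1: "(\<Sum>p<u. ent [u, u - r] (cmat u r c) (t, q) (0, p) * fst v $ p) = (sh c * fst v) $ q"
    by (rule sum_fps_conv) (use True q in "auto simp: ent_cmat mem_Ix2 sh_def")
   have 2: "(\<Sum>p<u - r. ent [u, u - r] (cmat u r c) (t, q) (Suc 0, p) * snd v $ p) = (sb c * snd v) $ q"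
    by (rule sum_fps_conv[OF q(1)]) (use True q in "auto simp: ent_cmat mem_Ix2 sb_def")
   show ?thesis unfolding 1 2 using t by (simp add: stp_def)
  qed
  finally show ?thesis using True by (simp add: pvec_def)
 qed (simp add: opk_def pvec_def)
qed

lemma pvec_Vs: "pvec u r v \<in> Vs (Ix [u, u - r])"
 by (simp add: pvec_def Vs_def)

lemma pvec_surj:
 assumes "v \<in> Vs (Ix [u, u - r])"
 obtains w where "v = pvec u r w"
proof
 show "v = pvec u r (Abs_fps (\<lambda>i. v (0, i)), Abs_fps (\<lambda>i. v (1, i)))"
  using assms by (auto simp: pvec_def Vs_def fun_eq_iff mem_Ix2)
qed

lemma pvec_eq_0_iff:
 "pvec u r v = (\<lambda>_. 0) \<longleftrightarrow> (\<forall>i<u. fst v $ i = 0) \<and> (\<forall>i<u - r. snd v $ i = 0)"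
proof
 assume "pvec u r v = (\<lambda>_. 0)"
 then have "pvec u r v (0, i) = 0" "pvec u r v (1, i) = 0" for i by simp_all
 moreover have "pvec u r v (0, i) = fst v $ i" if "i < u" for i using that by (simp add: pvec_def mem_Ix2)
 moreover have "pvec u r v (1, i) = snd v $ i" if "i < u - r" for i using that by (simp add: pvec_def mem_Ix2)
 ultimately show "(\<forall>i<u. fst v $ i = 0) \<and> (\<forall>i<u - r. snd v $ i = 0)" by metis
next
 assume "(\<forall>i<u. fst v $ i = 0) \<and> (\<forall>i<u - r. snd v $ i = 0)"
 then show "pvec u r v = (\<lambda>_. 0)" by (auto simp: pvec_def mem_Ix2 fun_eq_iff)
qed

lemma pvec_lin:
 "(\<lambda>x. pvec u r v x + pvec u r w x) = pvec u r (fst v + fst w, snd v + snd w)"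
 "(\<lambda>x. pvec u r v x - pvec u r w x) = pvec u r (fst v - fst w, snd v - snd w)"
 "(\<lambda>x. e * pvec u r v x) = pvec u r (fps_const e * fst v, fps_const e * snd v)"
 by (auto simp: pvec_def fun_eq_iff)

lemma qop_cmat_pow:
 assumes "r < u"
 shows "qop u r (cmat u r c ^\<^sub>m i) (pvec u r v) = pvec u r ((stp r c ^^ i) v)"
proof -
 have "(qop u r (cmat u r c) ^^ i) (pvec u r v) = pvec u r ((stp r c ^^ i) v)"
  by (induction i) (simp_all add: qop_cmat[OF assms])
 then show ?thesis unfolding opk_pow[OF indexing_ix2 cmat_carrier pvec_Vs] .
qed

lemma shift_pvec: "shift [u, u - r] i (pvec u r v) = pvec u r (fps_X ^ i * fst v, fps_X ^ i * snd v)"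
 by (auto simp: shift_def pvec_def fun_eq_iff fps_X_power_mult_nth mem_Ix2)

lemma mem_coords [simp]:
 "Ca i \<in> coords u r \<longleftrightarrow> 1 <= i \<and> i < u" "Cb i \<in> coords u r \<longleftrightarrow> 1 <= i \<and> i < u - r"
 "Cg i \<in> coords u r \<longleftrightarrow> i < u - r" "Ch i \<in> coords u r \<longleftrightarrow> i < u - r"
 by (auto simp: coords_def)

lemma ix2: "i < u ==> ix [u, u'] (0, u - Suc i) = i" "i < u' ==> ix [u, u'] (Suc 0, u' - Suc i) = u + i"
 by (auto simp: ix_def)

lemma coord_val_ent:
 assumes B: "comm [u, u - r] B" and x: "x \<in> coords u r" and r: "r < u"
 shows "coord_val u r B x = ent [u, u - r] B
  (case x of Ca i => (0, i) | Cb i => (1, i) | Cg i => (0, r + i) | Ch i => (1, i))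
  (case x of Ca i => (0, 0) | Cb i => (1, 0) | Cg i => (1, 0) | Ch i => (0, 0))"
proof -
 note sh = comm_shift[OF B, where p = 0, unfolded add_0]
 note i0 = ix2(1)[of 0 u "u - r", simplified] ix2(2)[of 0 "u - r" u, simplified]
 show ?thesis
 proof (cases x)
  case (Ca i)
  then have "i < u" using x by simp
  then show ?thesis
   using sh[of 0 "u - Suc i" 0 "u - 1"] ix2(1)[of i u "u - r"] i0(1) Ca r by (simp add: mem_Ix2)
 next
  case (Cb i)
  then have "i < u - r" using x by simp
  then show ?thesis
   using sh[of 1 "u - r - Suc i" 1 "u - r - 1"] ix2(2)[of i "u - r" u] i0(2) Cb r by (simp add: mem_Ix2)
 next
  case (Cg i)
  then have "i < u - r" using x by simp
  then show ?thesis
   using sh[of 1 "u - r - Suc i" 0 "u - 1"] ix2(2)[of i "u - r" u] i0(1) Cg r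
   by (simp add: mem_Ix2)
 next
  case (Ch i)
  then have i: "i < u - r" using x by simp
  then have "r + i < u" by simp
  then show ?thesis
   using i sh[of 0 "u - Suc (r + i)" 1 "u - r - 1"] ix2(1)[of "r + i" u "u - r"] i0(2) Ch r
   by (simp add: mem_Ix2)
 qed
qed

lemma parts_two: "parts {#u, u - r#} = [u, u - r]"
 by (rule parts_eqI) simp_all

lemma cmat_T_form:
 assumes "1 <= r" "r < u"
 shows "T_form [u, u - r] (cmat u r c)"
proof -
 have "comm [u, u - r] (cmat u r c)"
  unfolding comm_iff
 proof (intro conjI allI impI)
  fix s p t q assume st: "(s, p) \<in> Ix [u, u - r]" "(t, q) \<in> Ix [u, u - r]"
  have 1: "(s, Suc p) \<in> Ix [u, u - r]" if "Suc p < [u, u - r] ! s" using st that by (simp add: Ix_def)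
  have 2: "(t, q - 1) \<in> Ix [u, u - r]" using st by (auto simp: Ix_def)
  consider "s = 0" "t = 0" | "s = 0" "t = 1" | "s = 1" "t = 0" | "s = 1" "t = 1" using st by (auto simp: mem_Ix2)
  then show "(if Suc p < [u, u - r] ! s then ent [u, u - r] (cmat u r c) (t, q) (s, Suc p) else 0) =
    (if 1 <= q then ent [u, u - r] (cmat u r c) (t, q - 1) (s, p) else 0)"
   by cases (use 1 2 st in "auto simp: ent_cmat mem_Ix2")
 qed simp
 moreover have "T_move ((!) [u, u - r]) s p t q"
  if "(s, p) \<in> Ix [u, u - r]" "(t, q) \<in> Ix [u, u - r]" "ent [u, u - r] (cmat u r c) (t, q) (s, p) \<noteq> 0" for s p t q
  using that assms by (auto simp: ent_cmat mem_Ix2 T_move_def split: if_splits)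
 ultimately show ?thesis unfolding T_form_def by blast
qed

lemma cmat_mem:
 assumes "1 <= r" "r < u"
 shows "cmat u r c \<in> nilpotent_commutator {#u, u - r#}"
 unfolding nilpotent_commutator_iff
 using cmat_T_form[OF assms, of c] T_form_nilpotent[of "{#u, u - r#}" "cmat u r c"]
 by (simp add: parts_two T_form_def)

lemma coord_val_cmat:
 assumes "1 <= r" "r < u" "x \<in> coords u r"
 shows "coord_val u r (cmat u r c) x = c x"
proof -
 have "comm [u, u - r] (cmat u r c)" using cmat_T_form[OF assms(1,2), of c] by (simp add: T_form_def)
 note * = coord_val_ent[OF this assms(3,2)]
 show ?thesis unfolding * using assms by (cases x) (auto simp: ent_cmat mem_Ix2)
qed

text \<open>The two blocks have different sizes, so \<open>ent_mult_base\<close> has a single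
  summand and the diagonal entry at a generator is multiplicative along powers; nilpotency makes it
  zero. The other entries follow from constancy along diagonals and
  \<open>comm_bounds\<close>.\<close>

lemma nilpotent_commutator_cmat:
 assumes r: "1 <= r" "r < u" and B: "B \<in> nilpotent_commutator {#u, u - r#}"
 shows "B = cmat u r (coord_val u r B)"
proof -
 let ?Q = "[u, u - r]"
 have cB: "comm ?Q B" and nil: "B ^\<^sub>m (u + (u - r)) = 0\<^sub>m (u + (u - r)) (u + (u - r))"
  using B by (simp_all add: nilpotent_commutator_iff parts_two)
 have diag: "ent ?Q B (s, 0) (s, 0) = 0" if s: "(s, 0) \<in> Ix ?Q" for s
 proof -
  have V: "{v. v < length ?Q \<and> ?Q ! v = ?Q ! s} = {s}" using s r
   by (auto simp: mem_Ix2 less_Suc_eq)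
  have "ent ?Q (B ^\<^sub>m i) (s, 0) (s, 0) = ent ?Q B (s, 0) (s, 0) ^ i" for i
  proof (induction i)
   case 0
   then show ?case using commD(1)[OF cB] Ix_lt[OF s] by simp
  next
   case (Suc i)
   then show ?case using ent_mult_base[OF comm_pow[OF cB] cB s s refl, of i] unfolding V by simp
  qed
  from this[of "u + (u - r)"] show ?thesis using nil Ix_lt[OF s] r by simp
 qed
 show ?thesis
 proof (rule mat_eq_indexing[OF indexing_ix2 indexing_ix2])
  fix x y assume xy: "x \<in> Ix ?Q" "y \<in> Ix ?Q"
  obtain s p t q where x: "x = (s, p)" and y: "y = (t, q)" by (cases x, cases y)
  have E: "ent ?Q B (t, q) (s, p) = (if p <= q then ent ?Q B (t, q - p) (s, 0) else 0)"
   using comm_shift[OF cB, of s 0 p t q] xy by (simp add: x y)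
  have bd: "ent ?Q B (t, q) (s, p) = 0" if "\<not> p + ?Q ! t <= q + ?Q ! s"
   using comm_bounds(2)[OF cB, of s p t q] xy that by (auto simp: x y)
  consider "s = 0" "t = 0" | "s = 0" "t = 1" | "s = 1" "t = 0" | "s = 1" "t = 1" using xy by (auto simp: mem_Ix2 x y)
  then show "ent ?Q B y x = ent ?Q (cmat u r (coord_val u r B)) y x"
  proof cases
   case 1
   have "Ca (q - p) \<in> coords u r" if "p < q" using xy 1 that by (auto simp: x y mem_Ix2)
   then show ?thesis
    using 1 xy E diag[of 0] r by (cases "p < q"; cases "p = q") (simp_all add: x y ent_cmat mem_Ix2 coord_val_ent[OF cB _ r(2)] del: coord_val.simps)
  next
   case 2
   have "Ch (q - p) \<in> coords u r" using xy 2 by (auto simp: x y mem_Ix2)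
   then show ?thesis
    using 2 xy E by (simp add: x y ent_cmat mem_Ix2 coord_val_ent[OF cB _ r(2)] del: coord_val.simps)
  next
   case 3
   show ?thesis
   proof (cases "p + r <= q")
    case True
    then have "Cg (q - p - r) \<in> coords u r" using xy 3 by (auto simp: x y mem_Ix2)
    then show ?thesis
     using 3 xy E True by (simp add: x y ent_cmat mem_Ix2 coord_val_ent[OF cB _ r(2)] del: coord_val.simps)
   next
    case False
    then show ?thesis using 3 xy bd r by (simp add: x y ent_cmat mem_Ix2)
   qed
  next
   case 4
   have "Cb (q - p) \<in> coords u r" if "p < q" using xy 4 that by (auto simp: x y mem_Ix2)
   then show ?thesis
    using 4 xy E diag[of 1] r by (cases "p < q"; cases "p = q") (simp_all add: x y ent_cmat mem_Ix2 coord_val_ent[OF cB _ r(2)] del: coord_val.simps)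
  qed
 qed (use commD(1)[OF cB] in simp_all)
qed

section \<open>Jordan types and minors\<close>

text \<open>The entries of the \<open>i\<close>-th power of the matrix with rows \<open>(a, X\<^sup>r g)\<close> and \<open>(h, b)\<close>.\<close>

definition al where "al r c i = fst ((stp r c ^^ i) (1, 0))"
definition ga where "ga r c i = snd ((stp r c ^^ i) (1, 0))"
definition be where "be r c i = fst ((stp r c ^^ i) (0, 1))"
definition de where "de r c i = snd ((stp r c ^^ i) (0, 1))"
definition dd :: "nat => (coord => 'k::field) => 'k fps" where
 "dd r c = sa c * sb c - fps_X ^ r * sg c * sh c"

lemma minor_rec [simp]:
 "al r c 0 = 1" "ga r c 0 = 0" "be r c 0 = 0" "de r c 0 = 1"
 "al r c (Suc i) = sa c * al r c i + fps_X ^ r * sg c * ga r c i"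
 "ga r c (Suc i) = sh c * al r c i + sb c * ga r c i"
 "be r c (Suc i) = sa c * be r c i + fps_X ^ r * sg c * de r c i"
 "de r c (Suc i) = sh c * be r c i + sb c * de r c i"
 by (simp_all add: al_def ga_def be_def de_def stp_def)

lemma stp_pow:
 "(stp r c ^^ i) v = (al r c i * fst v + be r c i * snd v, ga r c i * fst v + de r c i * snd v)"
 by (induction i) (simp_all add: stp_def algebra_simps)

lemma minor_det: "al r c i * de r c i - be r c i * ga r c i = dd r c ^ i"
proof (induction i)
 case (Suc i)
 have "al r c (Suc i) * de r c (Suc i) - be r c (Suc i) * ga r c (Suc i) =
   dd r c * (al r c i * de r c i - be r c i * ga r c i)"
  by (simp add: dd_def algebra_simps)
 then show ?case using Suc by simp
qed simp

text \<open>The preimage, among pairs of power series, of the image of the \<open>i\<close>-th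
  power: it is generated by the two columns of that power and by the relations \<open>X^u\<close>
  and \<open>X^(u - r)\<close> of the module.\<close>

definition imod :: "nat => nat => (coord => 'k::field) => nat => ('k fps \<times> 'k fps) set" where
 "imod u r c i = {v. \<exists>f g s t. v = (al r c i * f + be r c i * g + fps_X ^ u * s,
  ga r c i * f + de r c i * g + fps_X ^ (u - r) * t)}"

lemma det2_columns: "det2 (al r c i, ga r c i) (be r c i, de r c i) = dd r c ^ i"
 unfolding minor_det[symmetric] by (simp add: det2_def)

lemma det2_units: "det2 (fps_X ^ u, 0) (0, fps_X ^ v) $ (u + v) = (1 :: 'k::field)"
 by (simp add: det2_def power_add[symmetric])

lemma submod_imod: "submod (imod u r c i)"
 unfolding submod_def
proof (intro allI impI)
 fix p q p' q' e assume "(p, q) \<in> imod u r c i" "(p', q') \<in> imod u r c i"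
 then obtain f g s t f' g' s' t' where
  1: "p = al r c i * f + be r c i * g + fps_X ^ u * s" "q = ga r c i * f + de r c i * g + fps_X ^ (u - r) * t" and
  2: "p' = al r c i * f' + be r c i * g' + fps_X ^ u * s'" "q' = ga r c i * f' + de r c i * g' + fps_X ^ (u - r) * t'"
  unfolding imod_def by blast
 show "(p + e * p', q + e * q') \<in> imod u r c i"
  unfolding imod_def mem_Collect_eq 1 2
  by (rule exI[of _ "f + e * f'"], rule exI[of _ "g + e * g'"], rule exI[of _ "s + e * s'"], rule exI[of _ "t + e * t'"])
   (simp add: algebra_simps)
qed

lemma imod_generators:
 "(al r c i, ga r c i) \<in> imod u r c i" "(be r c i, de r c i) \<in> imod u r c i"
 "(fps_X ^ u, 0) \<in> imod u r c i" "(0, fps_X ^ (u - r)) \<in> imod u r c i"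
proof -
 have m: "(al r c i * f + be r c i * g + fps_X ^ u * s, ga r c i * f + de r c i * g + fps_X ^ (u - r) * t) \<in> imod u r c i"
  for f g s t unfolding imod_def by blast
 show "(al r c i, ga r c i) \<in> imod u r c i" using m[of 1 0 0 0] by simp
 show "(be r c i, de r c i) \<in> imod u r c i" using m[of 0 1 0 0] by simp
 show "(fps_X ^ u, 0) \<in> imod u r c i" using m[of 0 0 1 0] by simp
 show "(0, fps_X ^ (u - r)) \<in> imod u r c i" using m[of 0 0 0 1] by simp
qed

lemma pvec_image_iff:
 assumes "r < u"
 shows "pvec u r v \<in> qop u r (cmat u r c ^\<^sub>m i) ` Vs (Ix [u, u - r]) \<longleftrightarrow> v \<in> imod u r c i"
proof
 assume "pvec u r v \<in> qop u r (cmat u r c ^\<^sub>m i) ` Vs (Ix [u, u - r])"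
 then obtain w where "pvec u r v = qop u r (cmat u r c ^\<^sub>m i) (pvec u r w)" by (auto elim: pvec_surj)
 then have "(\<lambda>x. pvec u r v x - pvec u r ((stp r c ^^ i) w) x) = (\<lambda>_. 0)"
  by (simp add: qop_cmat_pow[OF assms])
 then have "fps_X ^ u dvd fst v - fst ((stp r c ^^ i) w)" "fps_X ^ (u - r) dvd snd v - snd ((stp r c ^^ i) w)"
  unfolding pvec_lin pvec_eq_0_iff fps_X_power_dvd_iff by simp_all
 then obtain s t where "fst v - fst ((stp r c ^^ i) w) = fps_X ^ u * s" "snd v - snd ((stp r c ^^ i) w) = fps_X ^ (u - r) * t"
  by (elim dvdE)
 then have "v = (al r c i * fst w + be r c i * snd w + fps_X ^ u * s, ga r c i * fst w + de r c i * snd w + fps_X ^ (u - r) * t)"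
  unfolding stp_pow by (cases v) (simp add: algebra_simps)
 then show "v \<in> imod u r c i" unfolding imod_def by blast
next
 assume "v \<in> imod u r c i"
 then obtain f g s t where v: "v = (al r c i * f + be r c i * g + fps_X ^ u * s, ga r c i * f + de r c i * g + fps_X ^ (u - r) * t)"
  unfolding imod_def by blast
 have "(\<lambda>x. pvec u r v x - pvec u r ((stp r c ^^ i) (f, g)) x) = (\<lambda>_. 0)"
  unfolding pvec_lin pvec_eq_0_iff stp_pow by (simp add: v fps_X_power_mult_nth)
 then have "pvec u r v = qop u r (cmat u r c ^\<^sub>m i) (pvec u r (f, g))"
  unfolding qop_cmat_pow[OF assms] by (simp add: fun_eq_iff)
 then show "pvec u r v \<in> qop u r (cmat u r c ^\<^sub>m i) ` Vs (Ix [u, u - r])" using pvec_Vs by blast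
qed

lemma complement_unique:
 assumes "complement L s t" "(p, q) \<in> L" "\<And>i. s <= i ==> p $ i = 0" "\<And>i. t <= i ==> q $ i = 0"
 shows "p = 0 \<and> q = 0"
 using assms unfolding complement_def by blast

lemma corank_complement:
 fixes c :: "coord => 'k::field"
 assumes "r < u" and L: "complement (imod u r c i) s t"
 shows "corank (Vs (Ix [u, u - r])) (qop u r (cmat u r c ^\<^sub>m i)) (s + t)"
proof -
 let ?I = "Pair 0 ` {..<s} \<union> Pair 1 ` {..<t} :: (nat \<times> nat) set"
 let ?f = "qop u r (cmat u r c ^\<^sub>m i)" and ?V = "Vs (Ix [u, u - r]) :: (nat \<times> nat => 'k) set"
 have "s <= u"
 proof (rule ccontr)
  assume "\<not> s <= u"
  then have "(fps_X ^ u :: 'k fps) = 0 \<and> (0 :: 'k fps) = 0"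
   by (intro complement_unique[OF L imod_generators(3)]) (simp_all add: fps_X_power_iff)
  then show False by simp
 qed
 have "t <= u - r"
 proof (rule ccontr)
  assume "\<not> t <= u - r"
  then have "(0 :: 'k fps) = 0 \<and> (fps_X ^ (u - r) :: 'k fps) = 0"
   by (intro complement_unique[OF L imod_generators(4)]) (simp_all add: fps_X_power_iff)
  then show False by simp
 qed
 have sub: "?I \<subseteq> Ix [u, u - r]" using \<open>s <= u\<close> \<open>t <= u - r\<close> by (auto simp: mem_Ix2)
 define P where "P = (\<lambda>\<alpha> :: nat \<times> nat => 'k. (Abs_fps (\<lambda>i. if i < s then \<alpha> (0, i) else 0), Abs_fps (\<lambda>i. if i < t then \<alpha> (1, i) else 0)))"
 have lc: "lcomb \<alpha> uvec ?I = pvec u r (P \<alpha>)" for \<alpha>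
 proof
  fix x :: "nat \<times> nat"
  obtain a p where x: "x = (a, p)" by (cases x)
  have "lcomb \<alpha> uvec ?I x = (\<Sum>y\<in>?I. if x = y then \<alpha> y else 0)"
   unfolding lcomb_def uvec_def by (intro sum.cong) auto
  also have "\<dots> = (if x \<in> ?I then \<alpha> x else 0)" by (intro sum.delta') simp
  also have "x \<in> ?I \<longleftrightarrow> a = 0 \<and> p < s \<or> a = 1 \<and> p < t" by (auto simp: x)
  also have "(if a = 0 \<and> p < s \<or> a = 1 \<and> p < t then \<alpha> x else 0) = pvec u r (P \<alpha>) x"
  proof -
   have "p < s ==> p < u" "p < t ==> p < u - r" using \<open>s <= u\<close> \<open>t <= u - r\<close> by linarith+
   then show ?thesis by (simp add: x pvec_def P_def mem_Ix2)
  qed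
  finally show "lcomb \<alpha> uvec ?I x = pvec u r (P \<alpha>) x" .
 qed
 have "corank ?V ?f (card ?I)"
 proof (rule corankI[of _ uvec])
  show "finite ?I" by simp
  show "uvec x \<in> ?V" if "x \<in> ?I" for x by (intro uvec_Vs subsetD[OF sub] that)
  show "indep_mod (?f ` ?V) uvec ?I"
   unfolding indep_mod_def
  proof (intro allI impI)
   fix \<alpha> :: "nat \<times> nat => 'k" assume "lcomb \<alpha> uvec ?I \<in> ?f ` ?V"
   then have "P \<alpha> \<in> imod u r c i" unfolding lc pvec_image_iff[OF assms(1)] .
   then have "fst (P \<alpha>) = 0 \<and> snd (P \<alpha>) = 0"
    by (intro complement_unique[OF L]) (simp_all add: P_def)
   then have "fst (P \<alpha>) $ i = 0" "snd (P \<alpha>) $ i = 0" for i by simp_all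
   then have 1: "(if i < s then \<alpha> (0, i) else 0) = 0" "(if i < t then \<alpha> (1, i) else 0) = 0" for i
    by (simp_all add: P_def)
   have "\<alpha> (0, i) = 0" if "i < s" for i using 1(1)[of i] that by simp
   moreover have "\<alpha> (1, i) = 0" if "i < t" for i using 1(2)[of i] that by simp
   ultimately show "\<forall>i\<in>?I. \<alpha> i = 0" by blast
  qed
  fix v assume "v \<in> ?V"
  then obtain w where w: "v = pvec u r w" by (rule pvec_surj)
  obtain p' q' where pq: "(fst w - p', snd w - q') \<in> imod u r c i" "\<forall>i\<ge>s. p' $ i = 0" "\<forall>i\<ge>t. q' $ i = 0"
   using L unfolding complement_def by blast
  define \<beta> where "\<beta> = (\<lambda>(a :: nat, i). if a = 0 then p' $ i else q' $ i)"
  have "P \<beta> = (p', q')" using pq(2,3) by (auto simp: P_def \<beta>_def fps_eq_iff)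
  then have eq: "(\<lambda>x. v x - lcomb \<beta> uvec ?I x) = pvec u r (fst w - p', snd w - q')"
   unfolding lc w by (simp add: pvec_lin)
  have "pvec u r (fst w - p', snd w - q') \<in> ?f ` ?V" unfolding pvec_image_iff[OF assms(1)] by (rule pq(1))
  then show "spanned_mod (?f ` ?V) uvec ?I v"
   unfolding spanned_mod_def by (intro exI[of _ \<beta>]) (subst eq)
 qed
 moreover have "card ?I = s + t"
  by (subst card_Un_disjoint) (auto simp: card_image inj_on_def)
 ultimately show ?thesis by simp
qed

text \<open>The colength of a submodule of rank two is the least order of its minors; the hypotheses
  say that this order is \<open>d\<close>.\<close>

lemma corank_minors:
 assumes "r < u" and low: "\<And>v w j. v \<in> imod u r c i ==> w \<in> imod u r c i ==> j < d ==> det2 v w $ j = 0"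
  and "v1 \<in> imod u r c i" "v2 \<in> imod u r c i" "det2 v1 v2 $ d \<noteq> 0"
 shows "corank (Vs (Ix [u, u - r])) (qop u r (cmat u r c ^\<^sub>m i)) d"
proof -
 obtain s t where st: "s + t = d" "complement (imod u r c i) s t"
  using complement_exists[OF submod_imod low assms(3-5)] by blast
 show ?thesis using corank_complement[OF assms(1) st(2)] unfolding st(1) .
qed

text \<open>The determinant is the minor of the two columns, so its order is at least the least
  order of all minors, which is the corank.\<close>

lemma corank_dvd_dd:
 assumes "r < u" "corank (Vs (Ix [u, u - r])) (qop u r (cmat u r c)) d"
 shows "fps_X ^ d dvd dd r c"
proof -
 let ?P = "\<lambda>n. \<exists>v w. v \<in> imod u r c 1 \<and> w \<in> imod u r c 1 \<and> det2 v w $ n \<noteq> 0"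
 have "det2 (fps_X ^ u, 0) (0, fps_X ^ (u - r)) $ (u + (u - r)) \<noteq> (0 :: 'a)"
  unfolding det2_units by simp
 then have "\<exists>n. ?P n" using imod_generators(3,4)[where u = u and r = r and c = c and i = 1] by blast
 define n where "n = (LEAST n. ?P n)"
 have low: "det2 v w $ j = 0" if "v \<in> imod u r c 1" "w \<in> imod u r c 1" "j < n" for v w j
  using not_less_Least[of j ?P] that unfolding n_def by blast
 obtain v1 v2 where "v1 \<in> imod u r c 1" "v2 \<in> imod u r c 1" "det2 v1 v2 $ n \<noteq> 0"
  using LeastI_ex[OF \<open>\<exists>n. ?P n\<close>] unfolding n_def by blast
 then have "corank (Vs (Ix [u, u - r])) (qop u r (cmat u r c ^\<^sub>m 1)) n"
  by (intro corank_minors[OF assms(1) low])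
 moreover have "cmat u r c ^\<^sub>m 1 = cmat u r c"
  using left_mult_one_mat[OF cmat_carrier[of u r c]] carrier_matD(1)[OF cmat_carrier[of u r c]] by simp
 ultimately have "n = d" using corank_unique[OF lin_opk subsp_Vs _ assms(2)] by metis
 moreover have "\<forall>j<n. dd r c $ j = 0"
  using low[OF imod_generators(1,2)] unfolding det2_columns power_one_right by blast
 ultimately show ?thesis by (simp add: fps_X_power_dvd_iff)
qed

text \<open>The exponent \<open>min l (r - k)\<close> merges the two forms of the equations. It is
  \<open>l\<close> if \<open>k + l <= r\<close>. Otherwise it is \<open>r - k\<close>, so that
  \<open>X^r\<close> divides both products in the determinant and the third condition concerns the
  quotient.\<close>

definition in_box :: "nat => nat => nat => (coord => 'k::field) => bool" where
 "in_box r k l c \<longleftrightarrow> fps_X ^ k dvd sa c \<and> fps_X ^ min l (r - k) dvd sb c \<and> fps_X ^ (k + l) dvd dd r c"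

lemma xdvd_mult:
 fixes f g :: "'k::field fps"
 assumes "fps_X ^ p dvd f" "fps_X ^ q dvd g" "n <= p + q"
 shows "fps_X ^ n dvd f * g"
proof -
 have "(fps_X ^ n :: 'k fps) dvd fps_X ^ (p + q)" using assms(3) by (rule le_imp_power_dvd)
 also have "\<dots> dvd f * g" unfolding power_add using assms(1,2) by (rule mult_dvd_mono)
 finally show ?thesis .
qed

lemma xdvd_le:
 fixes f :: "'k::field fps"
 shows "fps_X ^ p dvd f ==> n <= p ==> fps_X ^ n dvd f"
 using xdvd_mult[of p f 0 1 n] by simp

text \<open>The weights of walks of \<open>i\<close> steps between the two summands: a loop at the
  first one costs \<open>k\<close>, at the second one \<open>e\<close>, and a round trip costs
  \<open>r\<close>. As \<open>e <= k\<close> and \<open>2 * e <= r\<close>, the cheapest walks stay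
  at the second summand whenever they can get there. The bounds are written additively to avoid
  truncated subtraction.\<close>

lemma minor_orders:
 assumes a: "fps_X ^ k dvd sa c" "fps_X ^ e dvd sb c" and e: "e <= k" "2 * e <= r"
 shows "(\<forall>n. n <= i * k --> n + 2 * e <= r + i * e --> fps_X ^ n dvd al r c i) \<and>
  (\<forall>n. n = 0 \<or> n + e <= i * e --> fps_X ^ n dvd ga r c i) \<and>
  (\<forall>n. n + e <= r + i * e --> fps_X ^ n dvd be r c i) \<and> (\<forall>n. n <= i * e --> fps_X ^ n dvd de r c i)"
proof (induction i)
 case 0
 then show ?case using e by simp
next
 case (Suc i)
 then have al: "n <= i * k ==> n + 2 * e <= r + i * e ==> fps_X ^ n dvd al r c i"
  and ga: "n = 0 \<or> n + e <= i * e ==> fps_X ^ n dvd ga r c i"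
  and be: "n + e <= r + i * e ==> fps_X ^ n dvd be r c i"
  and de: "n <= i * e ==> fps_X ^ n dvd de r c i" for n by blast+
 have S: "Suc i * k = i * k + k" "Suc i * e = i * e + e" by simp_all
 have ik: "i * e <= i * k" using e by simp
 have X: "fps_X ^ n dvd fps_X ^ r * sg c * f" if "fps_X ^ m dvd f" "n <= r + m" for n m f
  unfolding mult.assoc by (rule xdvd_mult[OF _ dvd_mult]) (use that in auto)
 have H: "fps_X ^ n dvd sh c * f" if "fps_X ^ n dvd f" for n f using that by (rule dvd_mult)
 show ?case
  unfolding minor_rec S
 proof (intro conjI allI impI)
  fix n assume n: "n <= i * k + k" "n + 2 * e <= r + (i * e + e)"
  show "fps_X ^ n dvd sa c * al r c i + fps_X ^ r * sg c * ga r c i"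
  proof (rule dvd_add)
   show "fps_X ^ n dvd sa c * al r c i" by (rule xdvd_mult[OF a(1) al[of "n - k"]]) (use n e in linarith)+
   show "fps_X ^ n dvd fps_X ^ r * sg c * ga r c i" by (rule X[OF ga[of "n - r"]]) (use n in linarith)+
  qed
 next
  fix n assume n: "n = 0 \<or> n + e <= i * e + e"
  show "fps_X ^ n dvd sh c * al r c i + sb c * ga r c i"
  proof (rule dvd_add)
   show "fps_X ^ n dvd sh c * al r c i" by (rule H[OF al]) (use n e ik in linarith)+
   show "fps_X ^ n dvd sb c * ga r c i" by (rule xdvd_mult[OF a(2) ga[of "n - e"]]) (use n in linarith)+
  qed
 next
  fix n assume n: "n + e <= r + (i * e + e)"
  show "fps_X ^ n dvd sa c * be r c i + fps_X ^ r * sg c * de r c i"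
  proof (rule dvd_add)
   show "fps_X ^ n dvd sa c * be r c i" by (rule xdvd_mult[OF a(1) be[of "n - k"]]) (use n e in linarith)+
   show "fps_X ^ n dvd fps_X ^ r * sg c * de r c i" by (rule X[OF de[of "n - r"]]) (use n in linarith)+
  qed
 next
  fix n assume n: "n <= i * e + e"
  show "fps_X ^ n dvd sh c * be r c i + sb c * de r c i"
  proof (rule dvd_add)
   show "fps_X ^ n dvd sh c * be r c i" by (rule H[OF be]) (use n e in linarith)
   show "fps_X ^ n dvd sb c * de r c i" by (rule xdvd_mult[OF a(2) de[of "n - e"]]) (use n in linarith)+
  qed
 qed
qed

text \<open>By bilinearity every minor is a combination of the minors of the four generators of
  \<open>imod\<close>, and these are the quantities listed in the assumptions.\<close>

lemma det2_imod_dvd: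
 assumes v: "v \<in> imod u r c i" "w \<in> imod u r c i"
  and d: "fps_X ^ n dvd dd r c ^ i" "fps_X ^ n dvd fps_X ^ (u - r) * al r c i" "fps_X ^ n dvd fps_X ^ (u - r) * be r c i"
   "fps_X ^ n dvd fps_X ^ u * ga r c i" "fps_X ^ n dvd fps_X ^ u * de r c i" "n <= u + (u - r)"
 shows "fps_X ^ n dvd det2 v w"
proof -
 obtain f g s t f' g' s' t' where
  1: "v = (al r c i * f + be r c i * g + fps_X ^ u * s, ga r c i * f + de r c i * g + fps_X ^ (u - r) * t)" and
  2: "w = (al r c i * f' + be r c i * g' + fps_X ^ u * s', ga r c i * f' + de r c i * g' + fps_X ^ (u - r) * t')"
  using v unfolding imod_def by blast
 have "det2 v w = (f * g' - g * f') * dd r c ^ i + (f * t' - t * f') * (fps_X ^ (u - r) * al r c i) +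
   (g * t' - t * g') * (fps_X ^ (u - r) * be r c i) + (s * f' - f * s') * (fps_X ^ u * ga r c i) +
   (s * g' - g * s') * (fps_X ^ u * de r c i) + (s * t' - t * s') * (fps_X ^ u * fps_X ^ (u - r))"
  unfolding minor_det[symmetric] 1 2 det2_def by (simp add: algebra_simps)
 also have "fps_X ^ n dvd \<dots>"
 proof (rule dvd_add, rule dvd_add, rule dvd_add, rule dvd_add, rule dvd_add; rule dvd_mult)
  show "fps_X ^ n dvd (fps_X ^ u * fps_X ^ (u - r) :: 'a fps)" unfolding power_add[symmetric] using d(6) by (rule le_imp_power_dvd)
 qed (use d in blast)+
 finally show ?thesis .
qed

lemma in_box_det2_dvd:
 assumes p: "1 <= k" "k < r" "1 <= l" "r < u" and c: "in_box r k l c"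
  and v: "v \<in> imod u r c i" "w \<in> imod u r c i"
 shows "fps_X ^ nu u r k l i dvd det2 v w"
proof (cases "i = 0")
 case True
 then show ?thesis by (simp add: nu_def)
next
 case False
 then have "1 <= i" by simp
 define m where "m = min l (r - k)"
 \<comment> \<open>\<open>minor_orders\<close> asks for an exponent at most \<open>k\<close>. If
   \<open>k <= m\<close>, the estimate \<open>ne\<close> for \<open>e = k\<close> comes from the
   entry \<open>u - r + i * k\<close> of \<open>nu\<close>; otherwise it comes from the third
   entry.\<close>
 define e where "e = min k m"
 define n where "n = nu u r k l i"
 have "e <= k" "e <= m" "m <= r - k" by (auto simp: e_def m_def)
 then have e: "e <= k" "2 * e <= r" using p(2) by linarith+
 have n: "n <= i * (k + l)" "n <= u - r + i * k" "n <= u + i * m - 2 * m" "n <= 2 * u - r"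
  using False unfolding n_def m_def nu_eq[of i u r k l, OF \<open>1 <= i\<close>]
  by (simp_all only: min_le_iff_disj order_refl simp_thms)
 have ne: "n + 2 * e <= u + i * e"
 proof (cases "k <= m")
  case True
  then have ek: "e = k" by (simp add: e_def)
  show ?thesis using n(2) e(2) p(4) unfolding ek by linarith
 next
  case F: False
  then have em: "e = m" by (simp add: e_def)
  show ?thesis using n(3) e(2) p(4) unfolding em by linarith
 qed
 have "fps_X ^ k dvd sa c" using c by (simp add: in_box_def)
 moreover have "fps_X ^ e dvd sb c" using c \<open>e <= m\<close> unfolding in_box_def m_def[symmetric] by (blast intro: xdvd_le)
 ultimately have ords: "(\<forall>n. n <= i * k --> n + 2 * e <= r + i * e --> fps_X ^ n dvd al r c i) \<and>
  (\<forall>n. n = 0 \<or> n + e <= i * e --> fps_X ^ n dvd ga r c i) \<and>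
  (\<forall>n. n + e <= r + i * e --> fps_X ^ n dvd be r c i) \<and> (\<forall>n. n <= i * e --> fps_X ^ n dvd de r c i)"
  using e by (rule minor_orders)
 have ord1: "fps_X ^ n dvd al r c i" if "n <= i * k" "n + 2 * e <= r + i * e" for n using ords that by blast
 have ord2: "fps_X ^ n dvd ga r c i" if "n = 0 \<or> n + e <= i * e" for n using ords that by blast
 have ord3: "fps_X ^ n dvd be r c i" if "n + e <= r + i * e" for n using ords that by blast
 have ord4: "fps_X ^ n dvd de r c i" if "n <= i * e" for n using ords that by blast
 have "fps_X ^ n dvd det2 v w"
 proof (rule det2_imod_dvd[OF v])
  have "fps_X ^ (k + l) dvd dd r c" using c by (simp add: in_box_def)
  then have "(fps_X ^ (k + l)) ^ i dvd dd r c ^ i" by (rule dvd_power_same)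
  then have "fps_X ^ ((k + l) * i) dvd dd r c ^ i" by (simp add: power_mult)
  then show "fps_X ^ n dvd dd r c ^ i" by (rule xdvd_le) (use n(1) in "simp add: mult.commute")
  show "fps_X ^ n dvd fps_X ^ (u - r) * al r c i"
   by (rule xdvd_mult[OF dvd_refl ord1[of "n - (u - r)"]]) (use n(2) ne p(4) e in linarith)+
  show "fps_X ^ n dvd fps_X ^ (u - r) * be r c i"
   by (rule xdvd_mult[OF dvd_refl ord3[of "n - (u - r)"]]) (use ne p(4) e in linarith)+
  show "fps_X ^ n dvd fps_X ^ u * ga r c i"
   by (rule xdvd_mult[OF dvd_refl ord2[of "n - u"]]) (use ne e in linarith)+
  show "fps_X ^ n dvd fps_X ^ u * de r c i"
   by (rule xdvd_mult[OF dvd_refl ord4[of "n - u"]]) (use ne e in linarith)+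
  show "n <= u + (u - r)" using n(4) p(4) by linarith
 qed
 then show ?thesis by (simp add: n_def)
qed

text \<open>The coefficient whose nonvanishing makes the corank of the \<open>i\<close>-th power as small as possible.\<close>

definition good :: "nat => nat => nat => nat => nat => (coord => 'k::field) => 'k" where
 "good u r k l i c = (if nu u r k l i = 2 * u - r then 1
  else if nu u r k l i = i * (k + l) then (dd r c ^ i) $ nu u r k l i
  else al r c i $ (nu u r k l i - (u - r)))"

lemma nu_ge:
 assumes "1 <= k" "k < r" "1 <= l" "l <= u - r" "r < u" "1 <= i" "nu u r k l i \<noteq> i * (k + l)" 
 shows "u - r <= nu u r k l i"
proof -
 define m where "m = min l (r - k)"
 have "2 * m <= u + i * m" "m <= r" using assms(2,3,4) by (auto simp: m_def)
 then have "u - r <= u + i * m - 2 * m" if "1 <= i"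
 proof -
  have "1 * m <= i * m" using that by (intro mult_le_mono1)
  then show ?thesis using \<open>m <= r\<close> \<open>2 * m <= u + i * m\<close> by linarith
 qed
 then have "u - r <= u + i * m - 2 * m" using assms(6) .
 moreover have "u - r <= 2 * u - r" by simp
 moreover have "u - r <= u - r + i * k" by simp
 moreover have "min A Z \<noteq> A ==> min A Z = Z" for A Z :: nat by (simp add: min_def split: if_splits)
 ultimately show ?thesis
  using assms(7) unfolding nu_eq[OF assms(6)] m_def by (metis min.boundedI)
qed

text \<open>On the box locus all minors have order at least \<open>nu\<close>; a nonzero
  \<open>good\<close> coefficient exhibits one of exactly this order.\<close>

lemma corank_good:
 assumes p: "1 <= k" "k < r" "1 <= l" "l <= u - r" "r < u" and c: "in_box r k l c"
  and good: "1 <= i ==> good u r k l i c \<noteq> 0"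
 shows "corank (Vs (Ix [u, u - r])) (qop u r (cmat u r c ^\<^sub>m i)) (nu u r k l i)"
proof -
 let ?n = "nu u r k l i"
 have "\<exists>v1 v2. v1 \<in> imod u r c i \<and> v2 \<in> imod u r c i \<and> det2 v1 v2 $ ?n \<noteq> 0"
 proof (cases "i = 0")
  case True
  then show ?thesis
   using imod_generators(1,2)[of r c 0 u] by (intro exI[of _ "(1, 0)"] exI[of _ "(0, 1)"]) (simp add: det2_def nu_def)
 next
  case False
  then have g: "good u r k l i c \<noteq> 0" using good by simp
  consider (1) "?n = 2 * u - r" | (2) "?n \<noteq> 2 * u - r" "?n = i * (k + l)" | (3) "?n \<noteq> 2 * u - r" "?n \<noteq> i * (k + l)" by blast
  then show ?thesis
  proof cases
   case 1
   then have n: "?n = u + (u - r)" using p(5) by linarith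
   have "det2 (fps_X ^ u, 0) (0, fps_X ^ (u - r)) $ ?n \<noteq> (0 :: 'a)" unfolding n det2_units by simp
   then show ?thesis using imod_generators(3,4)[where u = u and r = r and c = c and i = i] by blast
  next
   case 2
   then have "det2 (al r c i, ga r c i) (be r c i, de r c i) $ ?n \<noteq> 0"
    using g 2 unfolding det2_columns by (simp add: good_def)
   then show ?thesis using imod_generators(1,2) by blast
  next
   case 3
   have "u - r <= ?n" by (rule nu_ge[OF p _ 3(2)]) (use False in simp)
   then have "det2 (al r c i, ga r c i) (0, fps_X ^ (u - r)) $ ?n \<noteq> 0"
    using g 3 by (simp add: det2_def good_def fps_X_power_mult_right_nth)
   then show ?thesis using imod_generators(1,4) by blast
  qed
 qed
 then obtain v1 v2 where "v1 \<in> imod u r c i" "v2 \<in> imod u r c i" "det2 v1 v2 $ ?n \<noteq> 0" by blast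
 then show ?thesis
  using in_box_det2_dvd[OF p(1-3,5) c] by (intro corank_minors[OF p(5)]) (auto simp: fps_X_power_dvd_iff)
qed

lemma good_type:
 assumes p: "1 <= k" "k < r" "1 <= l" "l <= u - r" "r < u" and c: "in_box r k l c"
  and good: "\<And>i. 1 <= i ==> good u r k l i c \<noteq> 0"
 shows "\<exists>P. has_jordan_type (cmat u r c) P \<and> (\<forall>i. prof P i = nu u r k l i)"
proof -
 have "cmat u r c \<in> nilpotent_commutator {#u, u - r#}" using p by (intro cmat_mem) auto
 then have nil: "cmat u r c ^\<^sub>m (u + (u - r)) = 0\<^sub>m (u + (u - r)) (u + (u - r))" by (simp add: nilpotent_commutator_iff)
 obtain P where P: "has_jordan_type (cmat u r c) P" using nilpotent_jordan_type[OF cmat_carrier nil] by blast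
 have "cmat u r c \<in> sqm (sum_mset P)" using P by (rule has_jordan_typeE)
 then have n: "sum_mset P = u + (u - r)" using carrier_matD(1)[OF cmat_carrier[of u r c]] carrier_matD(1) by metis
 have "prof P i = nu u r k l i" for i
  using corank_unique[OF lin_opk subsp_Vs corank_jordan_type[OF P, unfolded n, OF indexing_ix2] corank_good[OF p c good]] by simp
 then show ?thesis using P by blast
qed

definition diag_point :: "nat => nat => coord => 'k::field" where
 "diag_point a b x = (case x of Ca j => of_bool (j = a) | Cb j => of_bool (j = b) | _ => 0)"

text \<open>The product of the column \<open>(X\<^sup>a, 1)\<close> and the row \<open>(1, X\<^sup>b)\<close>, where \<open>a + b = r\<close>.\<close>

definition rank_one_point :: "nat => nat => coord => 'k::field" where
 "rank_one_point a b x =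
  (case x of Ca j => of_bool (j = a) | Cb j => of_bool (j = b) | Cg j => of_bool (j = 0) | Ch j => of_bool (j = 0))"

lemma diag_point_series:
 assumes "1 <= a" "1 <= b"
 shows "sa (diag_point a b) = fps_X ^ a" "sb (diag_point a b) = fps_X ^ b" "sg (diag_point a b) = 0"
  "sh (diag_point a b) = 0" "dd r (diag_point a b) = fps_X ^ (a + b)"
proof -
 show 1: "sa (diag_point a b) = fps_X ^ a" "sb (diag_point a b) = fps_X ^ b" "sg (diag_point a b) = 0"
  "sh (diag_point a b) = 0"
  using assms by (auto simp: sa_def sb_def sg_def sh_def diag_point_def fps_X_power_iff fps_eq_iff)
 show "dd r (diag_point a b) = fps_X ^ (a + b)" unfolding dd_def 1 by (simp add: power_add)
qed

lemma rank_one_point_series: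
 assumes "1 <= a" "1 <= b" "r = a + b"
 shows "sa (rank_one_point a b) = fps_X ^ a" "sb (rank_one_point a b) = fps_X ^ b" "sg (rank_one_point a b) = 1"
  "sh (rank_one_point a b) = 1" "dd r (rank_one_point a b) = 0"
proof -
 show 1: "sa (rank_one_point a b) = fps_X ^ a" "sb (rank_one_point a b) = fps_X ^ b" "sg (rank_one_point a b) = 1"
  "sh (rank_one_point a b) = 1"
  using assms by (auto simp: sa_def sb_def sg_def sh_def rank_one_point_def fps_X_power_iff fps_eq_iff)
 show "dd r (rank_one_point a b) = 0" unfolding dd_def 1 by (simp add: power_add assms(3))
qed

lemma diag_point_al:
 assumes "1 <= a" "1 <= b"
 shows "al r (diag_point a b) i = fps_X ^ (i * a)"
 by (induction i) (simp_all add: diag_point_series[OF assms] power_add)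

lemma rank_one_point_al:
 assumes "1 <= a" "1 <= b" "r = a + b"
 shows "al r (rank_one_point a b :: coord => 'k::field) (Suc i) = fps_X ^ a * (fps_X ^ a + fps_X ^ b) ^ i \<and>
  ga r (rank_one_point a b :: coord => 'k) (Suc i) = (fps_X ^ a + fps_X ^ b) ^ i"
proof (induction i)
 case 0
 then show ?case by (simp add: rank_one_point_series[OF assms])
next
 case (Suc i)
 let ?p = "rank_one_point a b :: coord => 'k" and ?w = "fps_X ^ a + fps_X ^ b :: 'k fps"
 note 1 = Suc[THEN conjunct1] and 2 = Suc[THEN conjunct2]
 have "al r ?p (Suc (Suc i)) = fps_X ^ a * (fps_X ^ a * ?w ^ i) + fps_X ^ r * 1 * ?w ^ i"
  using minor_rec(5)[of r ?p "Suc i"] unfolding 1 2 rank_one_point_series[OF assms] .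
 moreover have "ga r ?p (Suc (Suc i)) = 1 * (fps_X ^ a * ?w ^ i) + fps_X ^ b * ?w ^ i"
  using minor_rec(6)[of r ?p "Suc i"] unfolding 1 2 rank_one_point_series[OF assms] .
 ultimately show ?case by (simp only: assms(3) power_add power_Suc mult_1_left mult_1_right algebra_simps)
qed

text \<open>The powers of a rank one matrix are its multiples by powers of the trace. Here the trace
  \<open>X^a + X^b\<close> has order \<open>b\<close>, whence the order \<open>a + i * b\<close>
  with leading coefficient 1.\<close>

lemma rank_one_point_coeff:
 assumes "1 <= b" "b < a" "r = a + b"
 shows "al r (rank_one_point a b) (Suc i) $ (a + i * b) = (1 :: 'k::field)"
proof -
 have "(fps_X :: 'k fps) ^ a = fps_X ^ b * fps_X ^ (a - b)" using assms(2) by (simp add: power_add[symmetric])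
 then have "(fps_X ^ a + fps_X ^ b :: 'k fps) = fps_X ^ b * (1 + fps_X ^ (a - b))" by (simp add: algebra_simps)
 then have "(fps_X ^ a + fps_X ^ b :: 'k fps) ^ i = fps_X ^ (i * b) * (1 + fps_X ^ (a - b)) ^ i"
  by (simp add: power_mult_distrib power_mult[symmetric] mult.commute)
 moreover have "al r (rank_one_point a b) (Suc i) = fps_X ^ a * ((fps_X ^ a + fps_X ^ b) ^ i :: 'k fps)"
  using rank_one_point_al[of a b r i, THEN conjunct1] assms by simp
 ultimately have "al r (rank_one_point a b) (Suc i) = fps_X ^ (a + i * b) * ((1 + fps_X ^ (a - b)) ^ i :: 'k fps)"
  by (simp only: power_add mult.assoc)
 then have "al r (rank_one_point a b) (Suc i) $ (a + i * b) = ((1 + fps_X ^ (a - b)) ^ i :: 'k fps) $ 0"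
  by (simp only: fps_X_power_mult_nth) simp
 then show ?thesis using assms(2) by (simp add: fps_power_zeroth fps_X_power_iff)
qed

lemma diag_point_in_box:
 assumes "1 <= k" "1 <= l"
 shows "in_box r k l (diag_point k l)"
 unfolding in_box_def diag_point_series[OF assms] by (simp add: le_imp_power_dvd)

text \<open>The diagonal point attains three of the four entries of \<open>nu\<close>. If only
  \<open>u + i * m - 2 * m\<close> is attained, then \<open>m < k\<close>, and a point is needed at
  which walks through the second summand are cheapest: the rank one point with orders
  \<open>r - m\<close> and \<open>m\<close>.\<close>

lemma good_nonempty:
 assumes p: "1 <= k" "k < r" "1 <= l" "l <= u - r" "r < u" and i: "1 <= i"
 shows "\<exists>c :: coord => 'k::field. in_box r k l c \<and> good u r k l i c \<noteq> 0"
proof -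
 define m where "m = min l (r - k)"
 let ?n = "nu u r k l i"
 have m: "1 <= m" "m <= l" "m + k <= r" using p by (auto simp: m_def)
 have "?n = i * (k + l) \<or> ?n = u - r + i * k \<or> ?n = u + i * m - 2 * m \<or> ?n = 2 * u - r"
 proof -
  have "min a b = a \<or> min a b = b" for a b :: nat by linarith
  then show ?thesis unfolding nu_eq[OF i] m_def by metis
 qed
 then consider (a) "?n = 2 * u - r \<or> ?n = i * (k + l) \<or> ?n = u - r + i * k"
  | (b) "?n = u + i * m - 2 * m" "?n \<noteq> 2 * u - r" "?n \<noteq> i * (k + l)" "?n \<noteq> u - r + i * k" by blast
 then show ?thesis
 proof cases
  case a
  then have "good u r k l i (diag_point k l :: coord => 'k) \<noteq> 0"
   unfolding good_def diag_point_al[OF p(1,3)] diag_point_series[OF p(1,3)] power_mult[symmetric]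
   by (auto simp: fps_X_power_iff mult.commute)
  then show ?thesis using diag_point_in_box[OF p(1,3)] by blast
 next
  case b
  have le: "?n <= u - r + i * k" unfolding nu_eq[OF i] by (simp only: min_le_iff_disj order_refl simp_thms)
  have mk: "m < k"
  proof (rule ccontr)
   assume "\<not> m < k"
   then have "(i - 1) * k <= (i - 1) * m" by simp
   moreover have "i * k = (i - 1) * k + k" "i * m = (i - 1) * m + m" using i by (cases i; simp)+
   ultimately show False using b(1,4) le m(3) p(5) by linarith
  qed
  have ar: "1 <= r - m" "m < r - m" "r = r - m + m" using m mk by auto
  obtain j where j: "i = Suc j" using i by (cases i) auto
  have n: "?n - (u - r) = r - m + j * m" 
  proof -
   have "i * m = j * m + m" by (simp add: j)
   then show ?thesis using b(1) p(5) m p(2) by linarith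
  qed
  have "good u r k l i (rank_one_point (r - m) m :: coord => 'k) = 1"
   unfolding good_def using b(2,3) rank_one_point_coeff[OF m(1) ar(2,3), of j] unfolding n by (simp add: j)
  moreover have "in_box r k l (rank_one_point (r - m) m :: coord => 'k)"
   unfolding in_box_def rank_one_point_series[OF ar(1) m(1) ar(3)] m_def[symmetric] using m by (simp add: le_imp_power_dvd)
  ultimately show ?thesis by (intro exI[of _ "rank_one_point (r - m) m"]) simp
 qed
qed

section \<open>Levels force the box equations\<close>

text \<open>On the truncated module a power series acts through its first \<open>u\<close> terms,
  and these are combinations of iterated shifts.\<close>

lemma pvec_fps_mult:
 assumes W: "subsp W" and sh: "\<And>v. v \<in> W ==> shift [u, u - r] 1 v \<in> W" and w: "pvec u r w \<in> W"
 shows "pvec u r (e * fst w, e * snd w) \<in> W"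
proof -
 have X: "pvec u r (fps_X ^ i * fst w, fps_X ^ i * snd w) \<in> W" for i
 proof -
  have "pvec u r (fps_X ^ i * fst w, fps_X ^ i * snd w) = shift [u, u - r] i (pvec u r w)" by (simp add: shift_pvec)
  also have "\<dots> \<in> W"
  proof (induction i)
   case 0
   have "shift [u, u - r] 0 (pvec u r w) = pvec u r w" by (simp add: shift_pvec)
   then show ?case using w by simp
  next
   case (Suc i)
   then show ?case using sh[OF Suc] by (simp add: shift_shift)
  qed
  finally show ?thesis .
 qed
 define e' where "e' = (\<lambda>n. \<Sum>i<n. fps_const (e $ i) * fps_X ^ i)"
 have "pvec u r (e' n * fst w, e' n * snd w) \<in> W" for n
 proof (induction n)
  case 0
  have z: "pvec u r (0, 0) = (\<lambda>_. 0 :: 'a)" unfolding pvec_eq_0_iff by simp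
  have "pvec u r (0, 0) \<in> W" unfolding z by (rule subspD(1)[OF W])
  then show ?case by (simp add: e'_def)
 next
  case (Suc n)
  have "(\<lambda>x. e $ n * pvec u r (fps_X ^ n * fst w, fps_X ^ n * snd w) x) \<in> W" by (rule subspD(3)[OF W X])
  from subspD(2)[OF W Suc this[unfolded pvec_lin(3)]] show ?case
   unfolding pvec_lin(1) by (simp add: e'_def algebra_simps)
 qed
 moreover have "pvec u r (e' u * fst w, e' u * snd w) = pvec u r (e * fst w, e * snd w)"
 proof -
  have e': "e' u $ i = e $ i" if "i < u" for i
   using that by (simp add: e'_def fps_sum_nth fps_X_power_iff if_distrib cong: if_cong)
  have "fps_X ^ u dvd e - e' u" unfolding fps_X_power_dvd_iff using e' by simp
  then have "fps_X ^ u dvd e * f - e' u * f" for f unfolding left_diff_distrib[symmetric] by (rule dvd_mult2)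
  then have "(\<lambda>x. pvec u r (e * fst w, e * snd w) x - pvec u r (e' u * fst w, e' u * snd w) x) = (\<lambda>_. 0)"
   unfolding pvec_lin pvec_eq_0_iff fps_X_power_dvd_iff by simp
  then show ?thesis by (simp add: fun_eq_iff)
 qed
 ultimately show ?thesis by metis
qed

text \<open>The map \<open>\<psi>\<close> identifies functions on the labels of a Jordan basis of
  \<open>A\<close> with the module of type \<open>(u, u - r)\<close>; \<open>sA\<close> and
  \<open>sC\<close> are \<open>A\<close> and multiplication by \<open>X\<close> seen in that basis.
  By \<open>raise\<close> and \<open>lev\<close>, the level filtration consists of submodules
  \<open>F j\<close> with \<open>X\<close> mapping \<open>F j\<close> into \<open>F (j + 1)\<close>,
  and \<open>F u\<close> is zero.\<close>

locale level_flag =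
 fixes u r :: nat and c :: "coord => 'k::field" and I :: "'i set" and lev :: "'i => nat"
  and \<psi> :: "('i => 'k) => nat \<times> nat => 'k" and sA sC :: "('i => 'k) => 'i => 'k"
 assumes ru: "r < u" and fin: "finite I" and lin: "lin \<psi>" and surj: "\<psi> ` Vs I = Vs (Ix [u, u - r])"
  and inj: "inj_on \<psi> (Vs I)"
  and A: "\<And>v. v \<in> Vs I ==> qop u r (cmat u r c) (\<psi> v) = \<psi> (sA v)" "\<And>v. sA v \<in> Vs I"
  and C: "\<And>v. v \<in> Vs I ==> shift [u, u - r] 1 (\<psi> v) = \<psi> (sC v)" "\<And>v. sC v \<in> Vs I"
  and raise: "\<And>v x j. v \<in> Vs I ==> (\<And>y. v y \<noteq> 0 ==> j <= lev y) ==> sC v x \<noteq> 0 ==> j + 1 <= lev x"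
  and lev: "\<And>x. x \<in> I ==> lev x < u"
begin

definition "E j = {v \<in> Vs I. \<forall>x. v x \<noteq> 0 --> j <= lev x}"
definition "F j = \<psi> ` E j"

lemma subsp_F: "subsp (F j)"
 unfolding F_def
proof (rule subsp_image[OF lin])
 show "subsp (E j)" unfolding subsp_def E_def Vs_def by auto (metis add_0)
qed

lemma F_mono: "i <= j ==> F j \<subseteq> F i"
 unfolding F_def E_def by (intro image_mono) auto

lemma shift_F: "v \<in> F j ==> shift [u, u - r] 1 v \<in> F (j + 1)"
proof -
 assume "v \<in> F j"
 then obtain w where w: "w \<in> E j" "v = \<psi> w" unfolding F_def by blast
 then have "sC w \<in> E (j + 1)" using C(2) raise[of w j] unfolding E_def by blast
 then show ?thesis using w C(1) unfolding F_def E_def by blast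
qed

lemma shift_F_pow: "v \<in> F j ==> v \<in> Vs (Ix [u, u - r]) ==> shift [u, u - r] i v \<in> F (j + i)"
proof (induction i)
 case 0
 have "shift [u, u - r] 0 v = v" using 0(2) by (auto simp: shift_def Vs_def fun_eq_iff)
 then show ?case using 0 by simp
next
 case (Suc i)
 then show ?case using shift_F[of "shift [u, u - r] i v" "j + i"] by (simp add: shift_shift)
qed

lemma F_0: "v \<in> Vs (Ix [u, u - r]) ==> v \<in> F 0"
 using surj unfolding F_def E_def by auto

lemma F_top: "v \<in> F u ==> v = (\<lambda>_. 0)"
proof -
 assume "v \<in> F u"
 then obtain w where w: "w \<in> E u" "v = \<psi> w" unfolding F_def by blast
 have "w = (\<lambda>_. 0)" using w(1) lev unfolding E_def Vs_def by (auto simp: fun_eq_iff) (meson leD)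
 then show ?thesis using w(2) linD(3)[OF lin] by simp
qed

lemma F_mult: "pvec u r (f, y) \<in> F j ==> pvec u r (e * f, e * y) \<in> F j"
 using pvec_fps_mult[where W = "F j" and u = u and r = r and w = "(f, y)" and e = e, OF subsp_F] shift_F F_mono[of j "j + 1"] by auto

lemma F_X_mult: "pvec u r (fps_X ^ j * f, fps_X ^ j * y) \<in> F j"
 using shift_F_pow[OF F_0[OF pvec_Vs[of u r "(f, y)"]] pvec_Vs, of j] by (simp add: shift_pvec)

lemma F_add: "pvec u r (f, y) \<in> F j ==> pvec u r (f', y') \<in> F j ==> pvec u r (f + f', y + y') \<in> F j"
 using subspD(2)[OF subsp_F, of "pvec u r (f, y)" j "pvec u r (f', y')"] unfolding pvec_lin by simp

text \<open>Multiplication by \<open>X^(u - j)\<close> maps \<open>F j\<close> into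
  \<open>F u\<close>, which is zero, and the first component lives modulo
  \<open>X^u\<close>.\<close>

lemma F_order1:
 assumes "pvec u r (f, y) \<in> F j" "j <= u"
 shows "fps_X ^ j dvd f"
proof -
 have "shift [u, u - r] (u - j) (pvec u r (f, y)) \<in> F u"
  using shift_F_pow[OF assms(1) pvec_Vs, of "u - j"] assms(2) by simp
 then have "pvec u r (fps_X ^ (u - j) * f, fps_X ^ (u - j) * y) = (\<lambda>_. 0)"
  unfolding shift_pvec by (auto dest: F_top)
 then have *: "(fps_X ^ (u - j) * f) $ i = 0" if "i < u" for i unfolding pvec_eq_0_iff using that by simp
 show ?thesis
  unfolding fps_X_power_dvd_iff
 proof (intro allI impI)
  fix i assume "i < j"
  have "(fps_X ^ (u - j) * f) $ (u - j + i) = f $ i" by (simp only: fps_X_power_mult_nth) simp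
  then show "f $ i = 0" using *[of "u - j + i"] assms(2) \<open>i < j\<close> by simp
 qed
qed

lemma indep_low: "indep_mod (F j) (\<lambda>x. \<psi> (uvec x)) {x \<in> I. lev x < j}"
 unfolding indep_mod_def
proof (intro allI impI ballI)
 fix \<alpha> x assume *: "lcomb \<alpha> (\<lambda>x. \<psi> (uvec x)) {x \<in> I. lev x < j} \<in> F j" "x \<in> {x \<in> I. lev x < j}"
 define w where "w = lcomb \<alpha> uvec {x \<in> I. lev x < j}"
 have wx: "w y = (if y \<in> I \<and> lev y < j then \<alpha> y else 0)" for y
 proof -
  have "w y = (\<Sum>x\<in>{x \<in> I. lev x < j}. if y = x then \<alpha> x else 0)"
   unfolding w_def lcomb_def uvec_def by (intro sum.cong) auto
  then show ?thesis using fin by (simp add: sum.delta')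
 qed
 have "\<psi> w \<in> F j" using * unfolding w_def lin_lcomb[OF lin] by simp
 then obtain w' where w': "w' \<in> E j" "\<psi> w = \<psi> w'" unfolding F_def by blast
 have "w \<in> Vs I" by (simp add: Vs_def wx)
 then have "w = w'" using inj w' unfolding E_def by (auto dest: inj_onD)
 then have "w x \<noteq> 0 ==> j <= lev x" using w'(1) unfolding E_def by blast
 then have "w x = 0" using *(2) by (cases "w x = 0") auto
 then show "\<alpha> x = 0" using wx[of x] *(2) by simp
qed

lemma spanned_low:
 assumes "v \<in> Vs (Ix [u, u - r])"
 shows "spanned_mod (F j) (\<lambda>x. \<psi> (uvec x)) {x \<in> I. lev x < j} v"
proof -
 obtain w where w: "w \<in> Vs I" "v = \<psi> w" using assms surj by blast
 define w1 where "w1 = lcomb w uvec {x \<in> I. lev x < j}"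
 have w1: "w1 y = (if y \<in> I \<and> lev y < j then w y else 0)" for y
 proof -
  have "w1 y = (\<Sum>x\<in>{x \<in> I. lev x < j}. if y = x then w x else 0)"
   unfolding w1_def lcomb_def uvec_def by (intro sum.cong) auto
  then show ?thesis using fin by (simp add: sum.delta')
 qed
 have "(\<lambda>y. w y - w1 y) \<in> E j" using w(1) by (auto simp: E_def Vs_def w1 split: if_splits)
 then have "\<psi> (\<lambda>y. w y - w1 y) \<in> F j" unfolding F_def by blast
 then show ?thesis
  unfolding spanned_mod_def linD(4)[OF lin] w1_def lin_lcomb[OF lin] w(2) by blast
qed

text \<open>Modulo \<open>F j\<close> the module is generated by two elements, annihilated by \<open>X\<^sup>j\<close> and the order of \<open>y\<close>.\<close>

lemma F_order2:
 assumes "pvec u r (f, y) \<in> F j"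
 shows "fps_X ^ (card {x \<in> I. lev x < j} - j) dvd y"
proof (rule ccontr)
 let ?N = "card {x \<in> I. lev x < j}"
 assume "\<not> fps_X ^ (?N - j) dvd y"
 then have ex: "\<exists>i. i < ?N - j \<and> y $ i \<noteq> 0" unfolding fps_X_power_dvd_iff by blast
 define q where "q = (LEAST i. y $ i \<noteq> 0)"
 have q: "y $ q \<noteq> 0" "\<forall>i<q. y $ i = 0" "q < ?N - j"
 proof -
  show "y $ q \<noteq> 0" using ex LeastI[of "\<lambda>i. y $ i \<noteq> 0"] unfolding q_def by blast
  show "\<forall>i<q. y $ i = 0" using not_less_Least[of _ "\<lambda>i. y $ i \<noteq> 0"] unfolding q_def by blast
  show "q < ?N - j" using ex Least_le[of "\<lambda>i. y $ i \<noteq> 0"] unfolding q_def by (meson le_less_trans)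
 qed
 \<comment> \<open>If the order \<open>q\<close> of \<open>y\<close> were too small, the quotient by
   \<open>F j\<close> would be spanned by the monomials of degree below \<open>j\<close> in the
   first and below \<open>q\<close> in the second component, fewer than there are basis vectors at
   levels below \<open>j\<close>.\<close>
 let ?J = "{..<j} <+> {..<q}"
 define v :: "nat + nat => nat \<times> nat => 'k" where "v = case_sum (\<lambda>i. pvec u r (fps_X ^ i, 0)) (\<lambda>i. pvec u r (0, fps_X ^ i))"
 have lc: "lcomb \<beta> v ?J = pvec u r (Abs_fps (\<lambda>i. if i < j then \<beta> (Inl i) else 0), Abs_fps (\<lambda>i. if i < q then \<beta> (Inr i) else 0))" for \<beta> :: "nat + nat => 'k"
 proof
  fix x
  have X: "lcomb \<beta> v ?J x = (\<Sum>i<j. \<beta> (Inl i) * pvec u r (fps_X ^ i, 0) x) + (\<Sum>i<q. \<beta> (Inr i) * pvec u r (0, fps_X ^ i) x)"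
   unfolding lcomb_def v_def by (subst sum.Plus) simp_all
  show "lcomb \<beta> v ?J x = pvec u r (Abs_fps (\<lambda>i. if i < j then \<beta> (Inl i) else 0), Abs_fps (\<lambda>i. if i < q then \<beta> (Inr i) else 0)) x"
   unfolding X pvec_def by (simp add: fps_X_power_iff if_distrib cong: if_cong)
 qed
 have "?N <= card ?J"
 proof (rule indep_card_le[OF subsp_F _ _ indep_low])
  fix x assume "x \<in> {x \<in> I. lev x < j}"
  have "\<psi> (uvec x) \<in> Vs (Ix [u, u - r])" unfolding surj[symmetric] by (intro imageI uvec_Vs) (use \<open>x \<in> _\<close> in simp)
  then obtain w where w: "\<psi> (uvec x) = pvec u r w" by (rule pvec_surj)
  obtain q' e where q': "snd w = q' + e * y" "\<forall>i\<ge>q. q' $ i = 0" using fps_remainder[OF q(2,1)] by blast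
  obtain p' e' where p': "fst w - e * f = p' + e' * fps_X ^ j" "\<forall>i\<ge>j. p' $ i = 0"
   using fps_remainder[of j "fps_X ^ j"] by (auto simp: fps_X_power_iff) blast
  define \<beta> where "\<beta> = case_sum (\<lambda>i. p' $ i) (\<lambda>i. q' $ i)"
  have "lcomb \<beta> v ?J = pvec u r (p', q')"
  proof -
   have "Abs_fps (\<lambda>i. if i < j then \<beta> (Inl i) else 0) = p'" "Abs_fps (\<lambda>i. if i < q then \<beta> (Inr i) else 0) = q'"
    using p'(2) q'(2) by (auto simp: \<beta>_def fps_eq_iff)
   then show ?thesis unfolding lc by simp
  qed
  then have "(\<lambda>z. \<psi> (uvec x) z - lcomb \<beta> v ?J z) = pvec u r (fst w - p', snd w - q')"
   unfolding w by (simp add: pvec_lin)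
  also have "\<dots> = pvec u r (e * f + fps_X ^ j * e', e * y + fps_X ^ j * 0)"
   using p'(1) q'(1) by (simp add: algebra_simps)
  finally have "(\<lambda>z. \<psi> (uvec x) z - lcomb \<beta> v ?J z) \<in> F j"
   using F_add[OF F_mult[OF assms] F_X_mult[of j e' 0], of e] by simp
  then show "spanned_mod (F j) v ?J (\<psi> (uvec x))" unfolding spanned_mod_def by blast
 qed (use fin in simp_all)
 then show False using q(3) by (simp add: card_Plus)
qed

lemma A_F:
 assumes "pvec u r w \<in> F i" "\<And>v. v \<in> E i ==> sA v \<in> E j"
 shows "pvec u r (stp r c w) \<in> F j"
proof -
 obtain v where v: "v \<in> E i" "pvec u r w = \<psi> v" using assms(1) unfolding F_def by blast
 have "pvec u r (stp r c w) = \<psi> (sA v)"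
  unfolding qop_cmat[OF ru, symmetric] v(2) using v(1) by (intro A(1)) (simp add: E_def)
 then show ?thesis using assms(2)[OF v(1)] unfolding F_def by blast
qed

end

context level_flag begin

lemma sa_dvd:
 assumes "\<And>v. v \<in> Vs I ==> sA v \<in> E k" "k <= u"
 shows "pvec u r (sa c, sh c) \<in> F k" "fps_X ^ k dvd sa c"
proof -
 have "pvec u r (stp r c (1, 0)) \<in> F k"
  by (rule A_F[OF F_0[OF pvec_Vs]]) (simp add: E_def[of 0] assms(1))
 then show "pvec u r (sa c, sh c) \<in> F k" by (simp add: stp_def)
 then show "fps_X ^ k dvd sa c" using assms(2) by (rule F_order1)
qed

text \<open>Since the quotient by \<open>F k\<close> has dimension at most \<open>k\<close>, the
  second generator of the module, corrected by a multiple of \<open>X^k\<close> in the first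
  component, lies in \<open>F k\<close>. The image under \<open>A\<close> lies in
  \<open>F (k + m)\<close>, where the number of low levels makes second components divisible by
  \<open>X^m\<close>; the contribution of \<open>h\<close> is so too because
  \<open>m <= k\<close>.\<close>

lemma sb_dvd:
 assumes A1: "\<And>v. v \<in> Vs I ==> sA v \<in> E k" and A2: "\<And>v. v \<in> E k ==> sA v \<in> E (k + m)"
  and n1: "card {x \<in> I. lev x < k} <= k" and n2: "k + 2 * m <= card {x \<in> I. lev x < k + m}"
  and m: "m <= k" "k + m <= r"
 shows "fps_X ^ m dvd sb c"
proof -
 let ?J = "insert None (Some ` {..<k})"
 define w :: "nat option => nat \<times> nat => 'k" where "w = case_option (pvec u r (0, 1)) (\<lambda>i. pvec u r (fps_X ^ i, 0))"
 have lc: "lcomb \<alpha> w ?J = pvec u r (Abs_fps (\<lambda>i. if i < k then \<alpha> (Some i) else 0), fps_const (\<alpha> None))" for \<alpha>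
 proof
  fix x
  have X: "lcomb \<alpha> w ?J x = \<alpha> None * pvec u r (0, 1) x + (\<Sum>i<k. \<alpha> (Some i) * pvec u r (fps_X ^ i, 0) x)"
   unfolding lcomb_def w_def by (subst sum.insert) (auto simp: sum.reindex)
  show "lcomb \<alpha> w ?J x = pvec u r (Abs_fps (\<lambda>i. if i < k then \<alpha> (Some i) else 0), fps_const (\<alpha> None)) x"
   unfolding X pvec_def by (simp add: fps_X_power_iff if_distrib cong: if_cong)
 qed
 have "\<not> indep_mod (F k) w ?J"
 proof
  assume ind: "indep_mod (F k) w ?J"
  have "card ?J <= card {x \<in> I. lev x < k}"
  proof (rule indep_card_le[OF subsp_F _ _ ind])
   show "spanned_mod (F k) (\<lambda>x. \<psi> (uvec x)) {x \<in> I. lev x < k} (w i)" for i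
    by (rule spanned_low) (simp add: w_def pvec_Vs split: option.split)
  qed (use fin in simp_all)
  moreover have "card ?J = Suc k" by (subst card_insert_disjoint) (auto simp: card_image)
  ultimately show False using n1 by simp
 qed
 then obtain \<alpha> j where \<alpha>: "lcomb \<alpha> w ?J \<in> F k" "j \<in> ?J" "\<alpha> j \<noteq> 0" unfolding indep_mod_def by blast
 define p where "p = Abs_fps (\<lambda>i. if i < k then \<alpha> (Some i) else 0)"
 have pF: "pvec u r (p, fps_const (\<alpha> None)) \<in> F k" using \<alpha>(1) unfolding lc p_def .
 have ku: "k + m <= u" using m ru by linarith
 have Xp: "fps_X ^ k dvd p" using F_order1[OF pF] ku by simp
 have aN: "\<alpha> None \<noteq> 0"
 proof
  assume 0: "\<alpha> None = 0"
  have "\<alpha> (Some i) = 0" if "i < k" for i using Xp that unfolding fps_X_power_dvd_iff p_def by auto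
  then show False using \<alpha>(2,3) 0 by auto
 qed
 define q where "q = fps_const (inverse (\<alpha> None)) * p"
 have qF: "pvec u r (q, 1) \<in> F k"
  using F_mult[OF pF, of "fps_const (inverse (\<alpha> None))"] aN by (simp add: q_def)
 have Xq: "fps_X ^ k dvd q" unfolding q_def using Xp by (rule dvd_mult)
 have "pvec u r (stp r c (q, 1)) \<in> F (k + m)" by (rule A_F[OF qF A2])
 then have AF: "pvec u r (sa c * q + fps_X ^ r * sg c, sh c * q + sb c) \<in> F (k + m)" by (simp add: stp_def)
 have "fps_X ^ (card {x \<in> I. lev x < k + m} - (k + m)) dvd sh c * q + sb c" by (rule F_order2[OF AF])
 then have "fps_X ^ m dvd sh c * q + sb c" by (rule xdvd_le) (use n2 in linarith)
 moreover have "fps_X ^ m dvd sh c * q" using xdvd_le[OF Xq m(1)] by (rule dvd_mult)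
 ultimately show ?thesis using dvd_add_right_iff by blast
qed

text \<open>For \<open>j = u - k - 1\<close> the space \<open>F j\<close> has dimension at most
  \<open>k + 1\<close> and contains the independent elements \<open>X^j\<close> up to
  \<open>X^(u - 1)\<close> of the first summand, so these span it. If \<open>X^(k + 1)\<close>
  divided \<open>a\<close>, all of \<open>F j\<close> would be killed by \<open>A\<close>, but the
  basis vector at \<open>x\<close> is not.\<close>

lemma sa_exact:
 assumes a: "fps_X ^ k dvd sa c" and x: "x \<in> I" "lev x + k + 1 = u" "sA (uvec x) \<noteq> (\<lambda>_. 0)"
  and n: "card {x \<in> I. u <= lev x + k + 1} <= k + 1" and kr: "k < r"
 shows "sa c $ k \<noteq> 0"
proof
 assume ak: "sa c $ k = 0"
 define j where "j = u - k - 1"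
 have j: "j + k + 1 = u" using x(2) by (simp add: j_def)
 let ?B = "{x \<in> I. u <= lev x + k + 1}"
 define w :: "nat => nat \<times> nat => 'k" where "w = (\<lambda>i. pvec u r (fps_X ^ (j + i), 0))"
 have lc: "lcomb \<alpha> w {..<n} = pvec u r (fps_X ^ j * Abs_fps (\<lambda>i. if i < n then \<alpha> i else 0), 0)" for \<alpha> n
 proof
  fix x
  have "Abs_fps (\<lambda>i. if i < n then \<alpha> i else 0) = (\<Sum>i<n. fps_const (\<alpha> i) * fps_X ^ i)"
   by (auto simp: fps_eq_iff fps_sum_nth fps_X_power_iff if_distrib cong: if_cong)
  then have "fps_X ^ j * Abs_fps (\<lambda>i. if i < n then \<alpha> i else 0) = (\<Sum>i<n. fps_const (\<alpha> i) * fps_X ^ (j + i))"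
   by (simp add: sum_distrib_left power_add mult.left_commute)
  then show "lcomb \<alpha> w {..<n} x = pvec u r (fps_X ^ j * Abs_fps (\<lambda>i. if i < n then \<alpha> i else 0), 0) x"
   by (simp only: lcomb_def w_def pvec_def) (simp add: fps_sum_nth)
 qed
 have ind: "indep_mod {\<lambda>_. 0} w {..<k + 1}"
  unfolding indep_mod_def
 proof (intro allI impI ballI)
  fix \<alpha> i assume *: "lcomb \<alpha> w {..<k + 1} \<in> {\<lambda>_. 0}" "i \<in> {..<k + 1}"
  have "pvec u r (fps_X ^ j * Abs_fps (\<lambda>i. if i < k + 1 then \<alpha> i else 0), 0) = (\<lambda>_. 0)" using *(1) unfolding lc by simp
  then have "(fps_X ^ j * Abs_fps (\<lambda>i. if i < k + 1 then \<alpha> i else 0)) $ (j + i) = 0"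
   unfolding pvec_eq_0_iff using *(2) j by simp
  then show "\<alpha> i = 0" using *(2) by (simp add: fps_X_power_mult_nth)
 qed
 have "\<psi> (uvec x) \<in> F j"
 proof -
  have "uvec x \<in> E j" using x(2) j uvec_Vs[OF x(1)] by (simp add: E_def) (simp add: uvec_def)
  then show ?thesis unfolding F_def by (rule imageI)
 qed
 have sp: "spanned_mod {\<lambda>_. 0} (\<lambda>x. \<psi> (uvec x)) ?B v" if vF: "v \<in> F j" for v
 proof -
  obtain v' where v': "v' \<in> E j" "v = \<psi> v'" using vF unfolding F_def by blast
  have "v' = lcomb v' uvec ?B"
  proof
   fix y
   have "lcomb v' uvec ?B y = (\<Sum>z\<in>?B. if y = z then v' z else 0)" unfolding lcomb_def uvec_def by (intro sum.cong) auto
   also have "\<dots> = (if y \<in> ?B then v' y else 0)" using fin by (simp add: sum.delta')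
   also have "\<dots> = v' y" using v'(1) j unfolding E_def Vs_def by fastforce
   finally show "v' y = lcomb v' uvec ?B y" by simp
  qed
  then have "v = lcomb v' (\<lambda>x. \<psi> (uvec x)) ?B" using v'(2) lin_lcomb[OF lin] by metis
  then show ?thesis unfolding spanned_0_iff by blast
 qed
 have wF: "w i \<in> F j" for i
  unfolding w_def power_add using F_X_mult[of j "fps_X ^ i" 0] by simp
 have "spanned_mod {\<lambda>_. 0} w {..<k + 1} (\<psi> (uvec x))"
 proof (rule indep_imp_spanned[OF subsp_0 _ _ _ ind])
  show "card ?B <= card {..<k + 1}" using n by simp
  show "spanned_mod {\<lambda>_. 0} (\<lambda>x. \<psi> (uvec x)) ?B (w i)" for i by (rule sp[OF wF])
  show "spanned_mod {\<lambda>_. 0} (\<lambda>x. \<psi> (uvec x)) ?B (\<psi> (uvec x))" by (rule sp) fact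
 qed (use fin in simp_all)
 then obtain \<beta> where \<beta>: "\<psi> (uvec x) = lcomb \<beta> w {..<k + 1}" unfolding spanned_0_iff by blast
 define f where "f = Abs_fps (\<lambda>i. if i < k + 1 then \<beta> i else 0)"
 have "\<psi> (sA (uvec x)) = pvec u r (stp r c (fps_X ^ j * f, 0))"
  unfolding A(1)[OF uvec_Vs[OF x(1)], symmetric] \<beta> lc f_def[symmetric] qop_cmat[OF ru] ..
 also have "\<dots> = (\<lambda>_. 0)"
  unfolding pvec_eq_0_iff
 proof
  have "fps_X ^ (k + 1) dvd sa c"
   using a ak unfolding fps_X_power_dvd_iff by (metis Suc_eq_plus1 less_antisym)
  then have "fps_X ^ u dvd sa c * (fps_X ^ j * f)" by (rule xdvd_mult[of _ _ j]) (use j in auto)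
  then show "\<forall>i<u. fst (stp r c (fps_X ^ j * f, 0)) $ i = 0" by (simp add: stp_def fps_X_power_dvd_iff)
  have "fps_X ^ (u - r) dvd fps_X ^ j * f" by (rule xdvd_le[of j]) (use j kr in auto)
  then have "fps_X ^ (u - r) dvd sh c * (fps_X ^ j * f)" by (rule dvd_mult)
  then show "\<forall>i<u - r. snd (stp r c (fps_X ^ j * f, 0)) $ i = 0" by (simp add: stp_def fps_X_power_dvd_iff)
 qed
 finally have "\<psi> (sA (uvec x)) = \<psi> (\<lambda>_. 0)" using linD(3)[OF lin] by simp
 moreover have "(\<lambda>_. 0) \<in> Vs I" by (simp add: Vs_def)
 ultimately have "sA (uvec x) = (\<lambda>_. 0)" using inj A(2) by (auto dest: inj_onD)
 then show False using x(3) by simp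
qed

end

section \<open>Commuting pairs of nilpotent matrices as level flags\<close>

lemma jmat_T_form: "T_form ps (jmat ps)"
proof -
 have "T_move ((!) ps) s p t q"
  if "(s, p) \<in> Ix ps" "(t, q) \<in> Ix ps" "ent ps (jmat ps) (t, q) (s, p) \<noteq> 0" for s p t q
  using that index_jmat[OF that(1,2)] by (auto simp: T_move_def split: if_splits)
 moreover have "comm ps (jmat ps)" by (simp add: comm_def)
 ultimately show ?thesis unfolding T_form_def by blast
qed

lemma shift_one: "qop u r (jmat [u, u - r]) v = shift [u, u - r] 1 v"
 by (rule opk_jmat)

lemma conj_commute:
 assumes c: "S \<in> sqm n" "T \<in> sqm n" "J \<in> sqm n" "K \<in> sqm n"
  and ST: "S * T = 1\<^sub>m n" "T * S = 1\<^sub>m n" and A: "A = S * J * T" and AK: "A * K = K * (A :: 'k::field mat)"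
 shows "(T * K * S) * J = J * (T * K * S)"
proof -
 note asc = assoc_mult_mat[of _ n n _ n _ n]
 have Ac: "A \<in> sqm n" using c by (simp add: A)
 have "A * S = S * J * (T * S)" unfolding A by (rule asc) (use c in simp_all)
 then have AS: "S * J = A * S" using c ST by simp
 have "T * A = T * (S * (J * T))" unfolding A using c by (simp add: asc)
 also have "\<dots> = (T * S) * (J * T)" by (rule asc[symmetric]) (use c in simp_all)
 finally have TA: "T * A = J * T" using c ST by simp
 have "(T * K * S) * J = T * K * (S * J)" by (rule asc) (use c in simp_all)
 also have "\<dots> = T * (K * (A * S))" unfolding AS by (rule asc) (use c Ac in simp_all)
 also have "K * (A * S) = (K * A) * S" by (rule asc[symmetric]) (use c Ac in simp_all)
 also have "\<dots> = A * K * S" by (simp add: AK)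
 also have "\<dots> = A * (K * S)" by (rule asc) (use c Ac in simp_all)
 also have "T * (A * (K * S)) = (T * A) * (K * S)" by (rule asc[symmetric]) (use c Ac in simp_all)
 also have "\<dots> = J * (T * (K * S))" unfolding TA by (rule asc) (use c in simp_all)
 also have "T * (K * S) = T * K * S" by (rule asc[symmetric]) (use c in simp_all)
 finally show ?thesis .
qed

text \<open>The base change that brings \<open>A\<close> to Jordan form carries the Jordan matrix of
  \<open>Q\<close> to a nilpotent matrix commuting with that of \<open>P\<close>; so commuting pairs
  can be viewed from either partition.\<close>

lemma transport:
 fixes A :: "'k::field mat"
 assumes P: "has_jordan_type A P" and cA: "comm (parts Q) A"
 obtains S T where "sum_mset P = sum_mset Q" "S \<in> sqm (sum_mset Q)" "T \<in> sqm (sum_mset Q)"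
  "S * T = 1\<^sub>m (sum_mset Q)" "T * S = 1\<^sub>m (sum_mset Q)"
  "A = S * jmat (parts P) * T" "T * jmat (parts Q) * S \<in> nilpotent_commutator P"
proof -
 let ?n = "sum_mset Q" and ?J = "jmat (parts P) :: 'k mat" and ?K = "jmat (parts Q) :: 'k mat"
 obtain S T where w: "A \<in> sqm (sum_mset P)" "S \<in> sqm (sum_mset P)"
  "T \<in> sqm (sum_mset P)" "S * T = 1\<^sub>m (sum_mset P)" "T * S = 1\<^sub>m (sum_mset P)"
  "A = S * ?J * T" using P by (rule has_jordan_typeE)
 have n: "sum_mset P = ?n" using carrier_matD(1)[OF w(1)] carrier_matD(1)[OF commD(1)[OF cA]] by simp
 note w = w[unfolded n]
 have K: "?K \<in> sqm ?n" and J: "?J \<in> sqm ?n"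
  using jmat_carrier[of "parts Q"] jmat_carrier[of "parts P"] n by simp_all
 have "T * ?K * S * ?J = ?J * (T * ?K * S)" by (rule conj_commute[OF w(2,3) J K w(4,5,6) commD(2)[OF cA]])
 then have "comm (parts P) (T * ?K * S)" using w K n by (simp add: comm_def)
 moreover have "(T * ?K * S) ^\<^sub>m ?n = 0\<^sub>m ?n ?n"
  using similar_pow_zero[OF w(3,2) K w(5,4)] T_form_nilpotent[OF jmat_T_form] by blast
 ultimately have "T * ?K * S \<in> nilpotent_commutator P" using n by (simp add: nilpotent_commutator_iff)
 then show ?thesis using that[OF n w(2-6)] by blast
qed

text \<open>A Jordan basis of \<open>A\<close> is determined only up to the commutator of
  \<open>jmat (parts P)\<close>. This freedom is spent on bringing multiplication by
  \<open>X\<close> into triangular form.\<close>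

lemma commuting_normal_form:
 fixes A :: "'k::field mat"
 assumes r: "1 <= r" "r < u" and A: "A \<in> nilpotent_commutator {#u, u - r#}" and P: "has_jordan_type A P"
 obtains S T C where "sum_mset P = u + (u - r)" "S \<in> sqm (u + (u - r))" "T \<in> sqm (u + (u - r))"
  "S * T = 1\<^sub>m (u + (u - r))" "T * S = 1\<^sub>m (u + (u - r))"
  "A = S * jmat (parts P) * T" "jmat [u, u - r] = S * C * T" "T_form (parts P) C"
proof -
 let ?n = "u + (u - r)" and ?ps = "parts P"
 let ?J = "jmat ?ps :: 'k mat" and ?K = "jmat [u, u - r] :: 'k mat"
 note asc = assoc_mult_mat[of _ ?n ?n _ ?n _ ?n]
 have "comm (parts {#u, u - r#}) A" using A by (simp add: nilpotent_commutator_iff)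
 from transport[OF P this] obtain S T where n: "sum_mset P = ?n" and w: "S \<in> sqm ?n" "T \<in> sqm ?n"
  "S * T = 1\<^sub>m ?n" "T * S = 1\<^sub>m ?n" "A = S * ?J * T" and BN: "T * ?K * S \<in> nilpotent_commutator P"
  by (auto simp: parts_two)
 have K: "?K \<in> sqm ?n" and J: "?J \<in> sqm ?n"
  using jmat_carrier[of "[u, u - r]"] jmat_carrier[of ?ps] n by simp_all
 define B where "B = T * ?K * S"
 have B: "B \<in> sqm ?n" unfolding B_def using w K by simp
 obtain g h where gh: "comm ?ps g" "comm ?ps h" "g * h = 1\<^sub>m ?n" "h * g = 1\<^sub>m ?n" "T_form ?ps (h * (B * g))"
  using nilpotent_commutator_conj[OF BN[folded B_def]] n by metis
 have c: "g \<in> sqm ?n" "h \<in> sqm ?n" using commD(1)[OF gh(1)] commD(1)[OF gh(2)] n by simp_all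
 define C where "C = h * (B * g)"
 have C: "C \<in> sqm ?n" using c B by (simp add: C_def)
 show ?thesis
 proof (rule that[OF n])
  show "S * g \<in> sqm ?n" "h * T \<in> sqm ?n" using c w by simp_all
  have 1: "(S * g) * X * (h * T) = S * (g * X * h) * T" if X: "X \<in> sqm ?n" for X
   using c w(1,2) X by (simp add: asc)
  have "(S * g) * (h * T) = S * ((g * h) * T)" using c w(1,2) by (simp add: asc)
  then show "(S * g) * (h * T) = 1\<^sub>m ?n" using gh(3) w by simp
  have "(h * T) * (S * g) = h * ((T * S) * g)" using c w(1,2) by (simp add: asc)
  then show "(h * T) * (S * g) = 1\<^sub>m ?n" using gh(4) c w by simp
  have "g * ?J * h = ?J * (g * h)" unfolding commD(2)[OF gh(1)] by (rule asc) (use c J in simp_all)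
  then have "g * ?J * h = ?J" using gh(3) J by simp
  then show "A = (S * g) * ?J * (h * T)" unfolding 1[OF J] using w(5) by simp
  have "g * C * h = B" unfolding C_def by (rule conj_conj[OF c B gh(3)])
  then have "(S * g) * C * (h * T) = S * B * T" unfolding 1[OF C] by simp
  also have "\<dots> = (S * T) * ?K * (S * T)" unfolding B_def using w(1,2) K by (simp add: asc)
  also have "\<dots> = ?K" using w(3) K by simp
  finally show "?K = (S * g) * C * (h * T)" by simp
  show "T_form ?ps C" unfolding C_def by (rule gh(5))
 qed
qed

text \<open>The divisibilities have three sources: \<open>X^k\<close> for \<open>a\<close> comes
  from the levels reached by the image of \<open>A\<close>, \<open>X^(k + l)\<close> for the
  determinant from the corank of \<open>A\<close>, and the one for \<open>b\<close> from whichever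
  alternative of \<open>good_levels\<close> applies.\<close>

lemma leveled_in_box:
 fixes c :: "coord => 'k::field"
 assumes L: "leveled P u r k l" and P: "has_jordan_type (cmat u r c) P"
 shows "in_box r k l c"
proof -
 let ?n = "u + (u - r)" and ?ps = "parts P"
 let ?I = "Ix ?ps" and ?Q = "Ix [u, u - r]"
 have p: "1 <= k" "k < r" "1 <= l" "l <= u - r" "r < u" and pf: "\<forall>i. prof P i = nu u r k l i" and len: "length ?ps = k + l"
  using L unfolding leveled_def by blast+
 obtain lev where gl: "good_levels (k + l) ((!) ?ps) u r k l lev" using L unfolding leveled_def by auto
 have r: "1 <= r" "r < u" using p by simp_all
 obtain S T C where n: "sum_mset P = ?n" and S: "S \<in> sqm ?n" "T \<in> sqm ?n"
  "S * T = 1\<^sub>m ?n" "T * S = 1\<^sub>m ?n"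
  and AS: "cmat u r c = S * jmat ?ps * T" and KS: "(jmat [u, u - r] :: 'k mat) = S * C * T" and C: "T_form ?ps C"
  using commuting_normal_form[OF r cmat_mem[OF r] P] .
 define \<psi> where "\<psi> = opk ?Q (ix [u, u - r]) ?I (ix ?ps) S"
 define sA where "sA = opk ?I (ix ?ps) ?I (ix ?ps) (jmat ?ps :: 'k mat)"
 define sC where "sC = opk ?I (ix ?ps) ?I (ix ?ps) C"
 define lv where "lv = (\<lambda>(s, p). lev s p)"
 have iP: "indexing ?n ?I (ix ?ps)" using indexing_ix[of ?ps] n by simp
 note iQ = indexing_ix2[of u "u - r"]
 have J: "(jmat ?ps :: 'k mat) \<in> sqm ?n" using jmat_carrier[of ?ps] n by simp
 have K: "(jmat [u, u - r] :: 'k mat) \<in> sqm ?n" using jmat_carrier[of "[u, u - r]"] by simp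
 have cC: "C \<in> sqm ?n" using C commD(1)[of ?ps C] n by (simp add: T_form_def)
 have MS: "S * X * T * S = S * X" if X: "X \<in> sqm ?n" for X :: "'k mat"
 proof -
  have "S * X * T * S = S * X * (T * S)" by (rule assoc_mult_mat[of _ ?n ?n _ ?n _ ?n]) (use S X in simp_all)
  then show ?thesis using S X by simp
 qed
 have pos: "0 < ?ps ! s" if "s < k + l" for s
 proof -
  have "set ?ps = set_mset P" by (metis mset_parts set_mset_mset)
  then have "?ps ! s \<in># P" using that len nth_mem[of s ?ps] by simp
  then show ?thesis using P by (cases "?ps ! s") (auto simp: has_jordan_type_iff is_partition_def)
 qed
 have gl1: "lev s p < lev t q" if "s < k + l" "t < k + l" "p < ?ps ! s" "q < ?ps ! t" "T_move ((!) ?ps) s p t q" for s p t q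
  using gl that unfolding good_levels_def by blast
 have gl2: "lev s p < u" if "s < k + l" "p < ?ps ! s" for s p
  using gl that unfolding good_levels_def by blast
 have gl3: "k <= lev s p" if "s < k + l" "p < ?ps ! s" "1 <= p" for s p
  using gl that unfolding good_levels_def by blast
 have mI: "(s, p) \<in> ?I \<longleftrightarrow> s < k + l \<and> p < ?ps ! s" for s p using len by (simp add: Ix_def)
 interpret level_flag u r c ?I lv \<psi> sA sC
 proof
  show "\<psi> ` Vs ?I = Vs ?Q"
  proof
   show "\<psi> ` Vs ?I \<subseteq> Vs ?Q" using opk_Vs unfolding \<psi>_def by blast
   show "Vs ?Q \<subseteq> \<psi> ` Vs ?I"
   proof
    fix v :: "nat \<times> nat => 'k" assume "v \<in> Vs ?Q"
    then have "v = \<psi> (opk ?I (ix ?ps) ?Q (ix [u, u - r]) T v)"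
     unfolding \<psi>_def by (rule opk_inverse[OF iQ iP S(1,2,3), symmetric])
    then show "v \<in> \<psi> ` Vs ?I" using opk_Vs by blast
   qed
  qed
  show "inj_on \<psi> (Vs ?I)"
   unfolding \<psi>_def by (rule inj_on_inverseI[of _ "opk ?I (ix ?ps) ?Q (ix [u, u - r]) T"]) (rule opk_inverse[OF iP iQ S(2,1,4)])
  show "qop u r (cmat u r c) (\<psi> v) = \<psi> (sA v)" if "v \<in> Vs ?I" for v
   unfolding \<psi>_def sA_def opk_mult[OF iP iQ iQ cmat_carrier S(1), symmetric] opk_mult[OF iP iP iQ S(1) J, symmetric]
   unfolding AS MS[OF J] ..
  show "shift [u, u - r] 1 (\<psi> v) = \<psi> (sC v)" if "v \<in> Vs ?I" for v
   unfolding \<psi>_def sC_def shift_one[symmetric] opk_mult[OF iP iQ iQ K S(1), symmetric] opk_mult[OF iP iP iQ S(1) cC, symmetric]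
   unfolding KS MS[OF cC] ..
  show "j + 1 <= lv x" if v: "v \<in> Vs ?I" "\<And>y. v y \<noteq> 0 ==> j <= lv y" "sC v x \<noteq> 0" for v x j
  proof -
   have x: "x \<in> ?I" using v(3) by (auto simp: sC_def opk_def split: if_splits)
   have "\<exists>y\<in>?I. ent ?ps C x y * v y \<noteq> 0"
   proof (rule ccontr)
    assume "\<not> ?thesis"
    then have "(\<Sum>y\<in>?I. ent ?ps C x y * v y) = 0" by (intro sum.neutral) blast
    then show False using v(3) by (simp add: sC_def opk_def split: if_splits)
   qed
   then obtain y where y: "y \<in> ?I" "ent ?ps C x y \<noteq> 0" "v y \<noteq> 0" by (metis mult_zero_left mult_zero_right)
   obtain s p t q where st: "y = (s, p)" "x = (t, q)" by (cases x, cases y)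
   have "T_move ((!) ?ps) s p t q" using C y x unfolding T_form_def st by blast
   then have "lev s p < lev t q" using gl1 x y(1) unfolding st mI by blast
   then show ?thesis using v(2)[OF y(3)] by (simp add: lv_def st)
  qed
  show "lv x < u" if "x \<in> ?I" for x using gl2 that mI by (cases x) (simp add: lv_def)
  show "sA v \<in> Vs ?I" "sC v \<in> Vs ?I" for v unfolding sA_def sC_def by (rule opk_Vs)+
  show "lin \<psi>" unfolding \<psi>_def by (rule lin_opk)
 qed (use r in simp_all)
 have sA: "sA v = shift ?ps 1 v" for v unfolding sA_def by (rule opk_jmat)
 have A1: "sA v \<in> E k" if "v \<in> Vs ?I" for v :: "nat \<times> nat => 'k"
  unfolding E_def
 proof (intro CollectI conjI allI impI)
  show "sA v \<in> Vs ?I" unfolding sA_def by (rule opk_Vs)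
  fix x assume x: "sA v x \<noteq> 0"
  obtain s p where sp: "x = (s, p)" by (cases x)
  have "(s, p) \<in> ?I" "1 <= p" using x by (auto simp: sA sp shift_def split: if_splits)
  then show "k <= lv x" using gl3 mI by (simp add: lv_def sp)
 qed
 have a: "fps_X ^ k dvd sa c" by (rule sa_dvd(2)[OF A1]) (use p in simp_all)
 have "length ?ps = size P" by (metis mset_parts size_mset)
 then have cork: "prof P 1 = k + l" using prof_1[of P] P len by (simp add: has_jordan_type_iff)
 have "cmat u r c ^\<^sub>m 1 = cmat u r c"
  using left_mult_one_mat[OF cmat_carrier[of u r c]] carrier_matD(1)[OF cmat_carrier[of u r c]] by simp
 then have "corank (Vs ?Q) (qop u r (cmat u r c)) (k + l)"
  using corank_jordan_type[OF P, unfolded n, OF iQ, of 1] cork by simp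
 then have d: "fps_X ^ (k + l) dvd dd r c" by (rule corank_dvd_dd[OF r(2)])
 define m where "m = min l (r - k)"
 have m: "m <= l" "k + m <= r" "k + m <= k + l" using p by (auto simp: m_def)
 have "fps_X ^ m dvd sb c"
 proof (cases "m <= k")
  case True
  then have G: "\<forall>s<k + l. lev s 0 = s" "\<forall>s<m. 2 <= ?ps ! s \<and> lev s 1 = k + s"
    "\<forall>s<k + l. \<forall>p. p + 1 < ?ps ! s \<and> k <= lev s p --> k + m <= lev s (p + 1)"
   using gl unfolding good_levels_def m_def[symmetric] by simp_all
  show ?thesis
  proof (rule sb_dvd[OF A1 _ _ _ True m(2)])
   fix v :: "nat \<times> nat => 'k" assume v: "v \<in> E k"
   show "sA v \<in> E (k + m)"
    unfolding E_def
   proof (intro CollectI conjI allI impI)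
    show "sA v \<in> Vs ?I" unfolding sA_def by (rule opk_Vs)
    fix x assume x: "sA v x \<noteq> 0"
    obtain s p where sp: "x = (s, p)" by (cases x)
    have "(s, p) \<in> ?I" "1 <= p" "v (s, p - 1) \<noteq> 0" using x by (auto simp: sA sp shift_def split: if_splits)
    moreover have "k <= lev s (p - 1)" using v calculation(3) unfolding E_def unfolding lv_def by auto
    ultimately show "k + m <= lv x" using G(3)[rule_format, of s "p - 1"] mI by (simp add: lv_def sp)
   qed
  next
   have "{x \<in> ?I. lv x < k} \<subseteq> (\<lambda>s. (s, 0)) ` {..<k}"
   proof
    fix x assume x: "x \<in> {x \<in> ?I. lv x < k}"
    obtain s p where sp: "x = (s, p)" by (cases x)
    have *: "s < k + l" "p < ?ps ! s" "lev s p < k" using x mI by (auto simp: sp lv_def)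
    then have "p = 0" using gl3[of s p] by (cases p) auto
    then show "x \<in> (\<lambda>s. (s, 0)) ` {..<k}" using * G(1) sp by auto
   qed
   then have "card {x \<in> ?I. lv x < k} <= card ((\<lambda>s. (s, 0 :: nat)) ` {..<k})" by (rule card_mono[rotated]) simp
   also have "\<dots> <= k" using card_image_le[of "{..<k}" "\<lambda>s. (s, 0 :: nat)"] by simp
   finally show "card {x \<in> ?I. lv x < k} <= k" .
  next
   let ?X = "(\<lambda>s. (s, 0)) ` {..<k + m} \<union> (\<lambda>s. (s, 1)) ` {..<m} :: (nat \<times> nat) set"
   have "card ?X = card ((\<lambda>s. (s, 0 :: nat)) ` {..<k + m}) + card ((\<lambda>s. (s, 1 :: nat)) ` {..<m})"
    by (rule card_Un_disjoint) auto
   also have "\<dots> = k + 2 * m" by (simp add: card_image inj_on_def)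
   finally have "k + 2 * m = card ?X" by simp
   also have "?X \<subseteq> {x \<in> ?I. lv x < k + m}"
   proof
    fix x assume "x \<in> ?X"
    then consider s where "x = (s, 0)" "s < k + m" | s where "x = (s, 1)" "s < m" by auto
    then show "x \<in> {x \<in> ?I. lv x < k + m}"
    proof cases
     case 1
     then show ?thesis using m(3) pos[of s] G(1) mI by (simp add: lv_def)
    next
     case 2
     then show ?thesis using m(1) G(2) mI by (auto simp: lv_def)
    qed
   qed
   then have "card ?X <= card {x \<in> ?I. lv x < k + m}" by (rule card_mono[rotated]) simp
   finally show "k + 2 * m <= card {x \<in> ?I. lv x < k + m}" .
  qed
 next
  case False
  then have G: "\<exists>s<k + l. \<exists>p. p + 1 < ?ps ! s \<and> lev s p + k + 1 = u"
    "card {(s, p). s < k + l \<and> p < ?ps ! s \<and> u <= lev s p + k + 1} <= k + 1"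
   using gl unfolding good_levels_def m_def[symmetric] by simp_all
  obtain s p where sp: "s < k + l" "p + 1 < ?ps ! s" "lev s p + k + 1 = u" using G(1) by blast
  have e: "{x \<in> ?I. u <= lv x + k + 1} = {(s, p). s < k + l \<and> p < ?ps ! s \<and> u <= lev s p + k + 1}"
   using mI by (auto simp: lv_def)
  have "sA (uvec (s, p)) (s, p + 1) = 1"
   using sp mI by (simp add: sA shift_def uvec_def)
  then have nz: "sA (uvec (s, p)) \<noteq> (\<lambda>_. 0)" by auto
  \<comment> \<open>As the order of \<open>a\<close> is exactly \<open>k\<close>, divisibility of
    the determinant by \<open>X^(k + m)\<close> passes to \<open>b\<close>; the product
    \<open>X^r g h\<close> does not interfere because \<open>k + m <= r\<close>.\<close>
  have ak: "sa c $ k \<noteq> 0"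
   by (rule sa_exact[OF a _ _ nz]) (use sp G(2) e mI p in "simp_all add: lv_def")
  have "fps_X ^ (k + m) dvd dd r c" using xdvd_le[OF d m(3)] .
  moreover have "fps_X ^ (k + m) dvd fps_X ^ r * sg c * sh c"
   unfolding mult.assoc by (rule dvd_mult2) (use m(2) in "rule le_imp_power_dvd")
  ultimately have "fps_X ^ (k + m) dvd sa c * sb c"
   unfolding dd_def using dvd_diff_left_iff by blast
  then show ?thesis
   using fps_mult_exact(1)[of k "sa c" m "sb c"] a ak unfolding fps_X_power_dvd_iff by blast
 qed
 then show ?thesis using a d by (simp add: in_box_def m_def)
qed

section \<open>Polynomials over an infinite field\<close>

definition PV :: "'x set => ('x, 'k::comm_ring_1) mpol set" where
 "PV V = {p. mvars p \<subseteq> V}"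

abbreviation mcst :: "'k => ('x, 'k::comm_ring_1) mpol" where
 "mcst \<equiv> single 0"

lemma PV_iff: "p \<in> PV V \<longleftrightarrow> (\<forall>m\<in>keys p. keys m \<subseteq> V)"
 by (auto simp: PV_def mvars_def)

lemma PV_basic [intro, simp]:
 "0 \<in> PV V" "1 \<in> PV V" "mcst a \<in> PV V" "p \<in> PV V ==> q \<in> PV V ==> p + q \<in> PV V"
 "p \<in> PV V ==> q \<in> PV V ==> p * q \<in> PV V" "p \<in> PV V ==> - p \<in> PV V"
 "p \<in> PV V ==> q \<in> PV V ==> p - q \<in> PV V"
proof -
 show "0 \<in> PV V" "1 \<in> PV V" "mcst a \<in> PV V" for a by (auto simp: PV_iff split: if_splits)
 show add: "p + q \<in> PV V" if "p \<in> PV V" "q \<in> PV V" for p q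
  using that Poly_Mapping.keys_add[of p q] unfolding PV_iff by blast
 have neg: "- p \<in> PV V" if "p \<in> PV V" for p
 proof -
  have "keys (- p) = keys p" by (auto simp: in_keys_iff)
  then show ?thesis using that by (simp add: PV_iff)
 qed
 show "p \<in> PV V ==> - p \<in> PV V" by (rule neg)
 show "p - q \<in> PV V" if "p \<in> PV V" "q \<in> PV V" using add[OF that(1) neg[OF that(2)]] by simp
 show "p * q \<in> PV V" if "p \<in> PV V" "q \<in> PV V"
  unfolding PV_iff
 proof
  fix m assume "m \<in> keys (p * q)"
  then obtain a b where ab: "m = a + b" "a \<in> keys p" "b \<in> keys q" using keys_mult[of p q] by blast
  then show "keys m \<subseteq> V" using that Poly_Mapping.keys_add[of a b] unfolding PV_iff by blast
 qed
qed

lemma PV_mono: "p \<in> PV V ==> V \<subseteq> W ==> p \<in> PV W"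
 by (auto simp: PV_def)

lemma PV_mvar [intro, simp]: "x \<in> V ==> mvar x \<in> PV V"
 by (auto simp: PV_iff mvar_def split: if_splits)

lemma PV_single: "keys m \<subseteq> V ==> single m a \<in> PV V"
 by (auto simp: PV_iff split: if_splits)

lemma PV_sum: "(\<And>i. i \<in> A ==> f i \<in> PV V) ==> sum f A \<in> PV V"
 by (induction A rule: infinite_finite_induct) auto

lemma PV_prod: "(\<And>i. i \<in> A ==> f i \<in> PV V) ==> prod f A \<in> PV V"
 by (induction A rule: infinite_finite_induct) auto

lemma PV_power: "p \<in> PV V ==> p ^ i \<in> PV V"
 by (induction i) auto

lemma meval_mcst [simp]: "meval c (mcst a) = a"
 by (simp add: meval_single)

lemma meval_uminus [simp]: "meval c (- p) = - meval c p"
 using meval_add[of c p "- p"] by (simp add: eq_neg_iff_add_eq_0 add.commute)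

lemma meval_diff: "meval c (p - q) = meval c p - meval c q"
 using meval_add[of c p "- q"] by simp

lemma meval_sum: "meval c (sum f A) = (\<Sum>i\<in>A. meval c (f i))"
 by (induction A rule: infinite_finite_induct) (simp_all add: meval_add)

lemma meval_prod: "meval c (prod f A) = (\<Prod>i\<in>A. meval c (f i))"
 by (induction A rule: infinite_finite_induct) (simp_all add: meval_mult)

lemma meval_power: "meval c (p ^ i) = meval c p ^ i"
 by (induction i) (simp_all add: meval_mult)

lemma meval_cong:
 assumes "p \<in> PV V" "\<And>x. x \<in> V ==> c x = c' x"
 shows "meval c p = meval c' p"
 unfolding meval_def mon_eval_def
proof (intro sum.cong refl arg_cong2[where f = "(*)"] prod.cong)
 fix m x assume "m \<in> keys p" "x \<in> keys m"
 then have "x \<in> V" using assms(1) unfolding PV_iff by blast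
 then show "c x ^ lookup m x = c' x ^ lookup m x" using assms(2) by simp
qed

lemma mpol_sum_monomials: "p = (\<Sum>m\<in>keys p. single m (lookup p m))"
 by (rule poly_mapping_eqI) (auto simp: lookup_sum lookup_single when_def in_keys_iff)

lemma mpol_monomial_induct:
 fixes p :: "('x, 'k::comm_ring_1) mpol"
 assumes p: "p \<in> PV V" and single: "\<And>m a. keys m \<subseteq> V ==> Q (single m a)"
  and add: "\<And>p q. Q p ==> Q q ==> Q (p + q)"
 shows "Q p"
proof -
 have Z: "Q 0" using single[of 0 0] by simp
 have "Q (\<Sum>m\<in>K. single m (lookup p m))" if "finite K" "K \<subseteq> keys p" for K
  using that
 proof (induction K rule: finite_induct)
  case (insert m K)
  then have "keys m \<subseteq> V" using p unfolding PV_iff by blast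
  then show ?case using insert by (simp add: add single)
 qed (simp add: Z)
 then show ?thesis using mpol_sum_monomials[of p] by (metis finite_keys order_refl)
qed

lemma mpol_gen_induct [consumes 1, case_names cst var add mult]:
 fixes p :: "('x, 'k::comm_ring_1) mpol"
 assumes p: "p \<in> PV V" and cst: "\<And>a. Q (mcst a)" and var: "\<And>x. x \<in> V ==> Q (mvar x)"
  and add: "\<And>p q. Q p ==> Q q ==> Q (p + q)" and mult: "\<And>p q. Q p ==> Q q ==> Q (p * q)"
 shows "Q p"
proof (rule mpol_monomial_induct[OF p])
 show "Q (p + q)" if "Q p" "Q q" for p q using that by (rule add)
 have pow: "Q (single (single x i) 1)" if "x \<in> V" for x i
 proof (induction i)
  case 0
  then show ?case using cst[of 1] by simp
 next
  case (Suc i)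
  have "single (single x (Suc i)) 1 = mvar x * single (single x i) (1 :: 'k)"
   by (simp add: mvar_def mult_single single_add[symmetric])
  then show ?case using mult[OF var[OF that] Suc] by simp
 qed
 have mon: "keys m \<subseteq> V ==> Q (single m 1)" for m :: "'x \<Rightarrow>\<^sub>0 nat"
 proof (induction m rule: update_induct)
  case const
  then show ?case using cst[of 1] by simp
 next
  case (update m x i)
  have e: "Poly_Mapping.update x i m = m + single x i"
   using update(1) by (intro poly_mapping_eqI) (auto simp: lookup_update lookup_add lookup_single in_keys_iff when_def)
  have "Q (single m 1 * single (single x i) 1)"
   using update by (intro mult pow) (auto simp: keys_update)
  then show ?case unfolding e by (simp add: mult_single)
 qed
 fix m :: "'x \<Rightarrow>\<^sub>0 nat" and a :: 'k assume "keys m \<subseteq> V"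
 then have "Q (mcst a * single m 1)" by (intro mult cst mon)
 then show "Q (single m a)" by (simp add: mult_single)
qed

text \<open>Substitution is stated through evaluation at points, which is all that zero sets
  see.\<close>

lemma mpol_subst:
 fixes p :: "('x, 'k::comm_ring_1) mpol"
 assumes "p \<in> PV V" and "\<And>x. x \<in> V ==> f x \<in> PV W"
 shows "\<exists>q\<in>PV W. \<forall>c. meval c q = meval (\<lambda>x. meval c (f x)) p"
 using assms(1)
proof (induction p rule: mpol_gen_induct)
 case (cst a)
 show ?case by (intro bexI[of _ "mcst a"]) auto
next
 case (var x)
 then show ?case using assms(2) by (intro bexI[of _ "f x"]) auto
next
 case (add p q)
 then obtain p' q' where "p' \<in> PV W" "q' \<in> PV W" "\<And>c. meval c p' = meval (\<lambda>x. meval c (f x)) p" "\<And>c. meval c q' = meval (\<lambda>x. meval c (f x)) q"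
  by blast
 then show ?case by (intro bexI[of _ "p' + q'"]) (auto simp: meval_add)
next
 case (mult p q)
 then obtain p' q' where "p' \<in> PV W" "q' \<in> PV W" "\<And>c. meval c p' = meval (\<lambda>x. meval c (f x)) p" "\<And>c. meval c q' = meval (\<lambda>x. meval c (f x)) q"
  by blast
 then show ?case by (intro bexI[of _ "p' * q'"]) (auto simp: meval_mult)
qed

definition slice :: "'x => nat => ('x, 'k::comm_ring_1) mpol => ('x, 'k) mpol" where
 "slice x i p = (\<Sum>m\<in>{m \<in> keys p. lookup m x = i}.
  single (Poly_Mapping.update x 0 m) (lookup p m))"

text \<open>Induction on the variables: \<open>slice x i p\<close> is the coefficient of the
  \<open>i\<close>-th power of \<open>x\<close>. For fixed values of the other variables
  \<open>p\<close> becomes a univariate polynomial with infinitely many zeros.\<close>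

lemma mpol_eq_0:
 fixes p :: "('x, 'k::field) mpol"
 assumes inf: "infinite (UNIV :: 'k set)" and V: "finite V" "p \<in> PV V" and z: "\<And>c. meval c p = 0"
 shows "p = 0"
 using V z
proof (induction V arbitrary: p rule: finite_induct)
 case empty
 then have "keys p \<subseteq> {0}" unfolding PV_iff by auto
 then have "meval c p = lookup p 0" for c by (simp add: meval_superset[of "{0}"])
 then have "lookup p 0 = 0" using empty.prems(2) by simp
 then show ?case using \<open>keys p \<subseteq> {0}\<close> by (intro poly_mapping_eqI) (auto simp: in_keys_iff)
next
 case (insert x V)
 define K where "K = keys p"
 define D where "D = Suc (Max (insert 0 ((\<lambda>m. lookup m x) ` K)))"
 have D: "lookup m x < D" if "m \<in> K" for m
  using that unfolding D_def less_Suc_eq_le by (intro Max_ge) (auto simp: K_def)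
 have up: "mon_eval c m = c x ^ lookup m x * mon_eval c (Poly_Mapping.update x 0 m)" for c :: "'x => 'k" and m
 proof -
  have "m = single x (lookup m x) + Poly_Mapping.update x 0 m"
   by (intro poly_mapping_eqI) (auto simp: lookup_add lookup_single lookup_update when_def)
  then have "mon_eval c m = mon_eval c (single x (lookup m x)) * mon_eval c (Poly_Mapping.update x 0 m)"
   by (metis mon_eval_add)
  moreover have "mon_eval c (single x i) = c x ^ i" for i
   by (simp add: mon_eval_superset[of "{x}"])
  ultimately show ?thesis by simp
 qed
 have sl: "slice x i p \<in> PV V" for i
  unfolding slice_def
 proof (intro PV_sum PV_single)
  fix m assume "m \<in> {m \<in> keys p. lookup m x = i}"
  then have "keys m \<subseteq> insert x V" using insert.prems(1) unfolding PV_iff by blast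
  then show "keys (Poly_Mapping.update x 0 m) \<subseteq> V" by (auto simp: keys_update)
 qed
 have ev: "meval c p = (\<Sum>i<D. meval c (slice x i p) * c x ^ i)" for c
 proof -
  have "meval c p = (\<Sum>i<D. \<Sum>m\<in>{m \<in> K. lookup m x = i}. lookup p m * mon_eval c m)"
   unfolding meval_def K_def[symmetric] by (rule sum.group[symmetric]) (use D in "auto simp: K_def")
  also have "\<dots> = (\<Sum>i<D. meval c (slice x i p) * c x ^ i)"
   unfolding slice_def meval_sum K_def[symmetric] sum_distrib_right
  proof (intro sum.cong refl)
   fix i m assume "m \<in> {m \<in> K. lookup m x = i}"
   then show "lookup p m * mon_eval c m =
     meval c (single (Poly_Mapping.update x 0 m) (lookup p m)) * c x ^ i"
    by (subst up) (simp add: meval_single)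
  qed
  finally show ?thesis .
 qed
 have sl0: "slice x i p = 0" if "i < D" for i
 proof (rule insert.IH[OF sl])
  fix c
  have *: "meval (c(x := t)) (slice x j p) = meval c (slice x j p)" for t j
   by (rule meval_cong[OF sl]) (use insert.hyps in auto)
  have "poly (\<Sum>j<D. monom (meval c (slice x j p)) j) t = 0" for t
   using ev[of "c(x := t)"] insert.prems(2) unfolding * by (simp add: poly_sum poly_monom)
  then have "(\<Sum>j<D. monom (meval c (slice x j p)) j) = 0" by (rule poly_eq_0_infinite[OF inf])
  then have "coeff (\<Sum>j<D. monom (meval c (slice x j p)) j) i = 0" by simp
  then show "meval c (slice x i p) = 0" using that by (simp add: coeff_sum)
 qed
 show ?case
 proof (rule poly_mapping_eqI)
  fix m
  show "lookup p m = lookup 0 m"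
  proof (cases "m \<in> K")
   case True
   let ?i = "lookup m x"
   have eq: "m' = m" if "lookup m' x = ?i" "Poly_Mapping.update x 0 m' = Poly_Mapping.update x 0 m" for m'
   proof (rule poly_mapping_eqI)
    fix y
    have "lookup (Poly_Mapping.update x 0 m') y = lookup (Poly_Mapping.update x 0 m) y" using that(2) by simp
    then show "lookup m' y = lookup m y" using that(1) by (auto simp: lookup_update split: if_splits)
   qed
   have "0 = lookup (slice x ?i p) (Poly_Mapping.update x 0 m)" using sl0[OF D[OF True]] by simp
   also have "\<dots> = (\<Sum>m'\<in>{m' \<in> K. lookup m' x = ?i}. if m' = m then lookup p m' else 0)"
    unfolding slice_def lookup_sum K_def[symmetric] 
   proof (intro sum.cong refl)
    fix m' assume m': "m' \<in> {m' \<in> K. lookup m' x = ?i}"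
    have u: "Poly_Mapping.update x 0 m' = Poly_Mapping.update x 0 m \<longleftrightarrow> m' = m"
    proof
     assume "Poly_Mapping.update x 0 m' = Poly_Mapping.update x 0 m"
     then show "m' = m" using m' by (intro eq) blast
    qed simp
    show "lookup (single (Poly_Mapping.update x 0 m') (lookup p m')) (Poly_Mapping.update x 0 m) =
      (if m' = m then lookup p m' else 0)"
     unfolding lookup_single when_def u ..
   qed
   also have "\<dots> = lookup p m" using True by (subst sum.delta) (auto simp: K_def)
   finally show ?thesis by simp
  qed (simp add: K_def in_keys_iff)
 qed
qed

lemma mpol_nonzero_point:
 fixes p :: "('x, 'k::field) mpol"
 assumes "infinite (UNIV :: 'k set)" "finite V" "p \<in> PV V" "p \<noteq> 0"
 obtains c where "meval c p \<noteq> 0"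
 using mpol_eq_0[OF assms(1-3)] assms(4) by blast

text \<open>On the line from a point where \<open>p\<close> is nonzero to one where \<open>q\<close>
  is nonzero, both restrict to nonzero univariate polynomials.\<close>

lemma mpol_mult_nonzero:
 fixes p q :: "('x, 'k::field) mpol"
 assumes inf: "infinite (UNIV :: 'k set)" and V: "finite V" "p \<in> PV V" "q \<in> PV V" and nz: "p \<noteq> 0" "q \<noteq> 0"
 shows "p * q \<noteq> 0"
proof
 assume *: "p * q = 0"
 obtain c0 where c0: "meval c0 p \<noteq> 0" using mpol_nonzero_point[OF inf V(1,2) nz(1)] .
 obtain c1 where c1: "meval c1 q \<noteq> 0" using mpol_nonzero_point[OF inf V(1,3) nz(2)] .
 obtain f where f: "\<And>t. poly f t = meval (\<lambda>x. poly [:c0 x, c1 x - c0 x:] t) p" using meval_poly by metis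
 obtain g where g: "\<And>t. poly g t = meval (\<lambda>x. poly [:c0 x, c1 x - c0 x:] t) q" using meval_poly by metis
 have "poly (f * g) t = 0" for t using * meval_mult[of _ p q] by (simp add: f g)
 then have "f * g = 0" by (rule poly_eq_0_infinite[OF inf])
 moreover have "poly f 0 \<noteq> 0" "poly g 1 \<noteq> 0" unfolding f g using c0 c1 by simp_all
 ultimately show False by auto
qed

section \<open>Ideals with coprime leading monomials\<close>

definition idl :: "'x set => (nat => ('x, 'k::field) mpol) => nat => ('x, 'k) mpol set" where
 "idl V f n = {p. \<exists>q. (\<forall>i. q i \<in> PV V) \<and> p = (\<Sum>i<n. q i * f i)}"

lemma idl_0: "0 \<in> idl V f n"
 unfolding idl_def by (intro CollectI exI[of _ "\<lambda>_. 0"]) simp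

lemma idl_add: "p \<in> idl V f n ==> q \<in> idl V f n ==> p + q \<in> idl V f n"
proof -
 assume "p \<in> idl V f n" "q \<in> idl V f n"
 then obtain a b where "\<forall>i. a i \<in> PV V" "p = (\<Sum>i<n. a i * f i)" "\<forall>i. b i \<in> PV V" "q = (\<Sum>i<n. b i * f i)"
  unfolding idl_def by blast
 then show ?thesis unfolding idl_def by (intro CollectI exI[of _ "\<lambda>i. a i + b i"]) (simp add: sum.distrib distrib_right)
qed

lemma idl_mult: "p \<in> idl V f n ==> e \<in> PV V ==> e * p \<in> idl V f n"
proof -
 assume "p \<in> idl V f n" "e \<in> PV V"
 then obtain a where "\<forall>i. a i \<in> PV V" "p = (\<Sum>i<n. a i * f i)" unfolding idl_def by blast
 then show ?thesis using \<open>e \<in> PV V\<close> unfolding idl_def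
  by (intro CollectI exI[of _ "\<lambda>i. e * a i"]) (simp add: sum_distrib_left mult.assoc)
qed

lemma idl_minus: "p \<in> idl V f n ==> q \<in> idl V f n ==> p - q \<in> idl V f n"
 using idl_add[of p V f n "- 1 * q"] idl_mult[of q V f n "- 1"] by simp

lemma idl_gen: "i < n ==> f i \<in> idl V f n"
 unfolding idl_def by (intro CollectI exI[of _ "\<lambda>j. if j = i then 1 else 0"]) (simp add: if_distrib[of "\<lambda>x. x * _"] cong: if_cong)

definition wt :: "('x => nat) => ('x \<Rightarrow>\<^sub>0 nat) => nat" where
 "wt w m = (\<Sum>x\<in>keys m. w x * lookup m x)"

definition mdvd :: "('x \<Rightarrow>\<^sub>0 nat) => ('x \<Rightarrow>\<^sub>0 nat) => bool" where
 "mdvd m n \<longleftrightarrow> (\<forall>x. lookup m x <= lookup n x)"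

lemma wt_add: "wt w (m + n) = wt w m + wt w n"
proof -
 define K where "K = keys m \<union> keys n"
 have *: "wt w l = (\<Sum>x\<in>K. w x * lookup l x)" if "keys l \<subseteq> K" for l
  unfolding wt_def by (rule sum.mono_neutral_left) (use that in "auto simp: K_def in_keys_iff")
 have "keys (m + n) \<subseteq> K" using Poly_Mapping.keys_add[of m n] by (simp add: K_def)
 then show ?thesis using *[of m] *[of n] *[of "m + n"] by (simp add: K_def lookup_add distrib_left sum.distrib)
qed

lemma wt_single: "wt w (single x i) = w x * i"
 by (simp add: wt_def)

lemma mdvd_obtain:
 assumes "mdvd m n"
 obtains l where "n = l + m"
proof
 show "n = (n - m) + m"
  using assms by (intro poly_mapping_eqI) (simp add: lookup_add lookup_minus mdvd_def)
qed

lemma lookup_times: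
 fixes p q :: "('x, 'k::comm_ring_1) mpol"
 shows "lookup (p * q) k =
  (\<Sum>a\<in>keys p. \<Sum>b\<in>keys q. if a + b = k then lookup p a * lookup q b else 0)"
proof -
 have "p * q = (\<Sum>a\<in>keys p. \<Sum>b\<in>keys q.
   single (a + b) (lookup p a * lookup q b))"
  by (subst mpol_sum_monomials[of p], subst mpol_sum_monomials[of q]) (simp add: sum_product mult_single)
 then show ?thesis by (simp add: lookup_sum lookup_single when_def)
qed

text \<open>A substitute for a monomial order: a weight for which the leading monomial of each
  generator is its unique heaviest one. Ties among other monomials may occur.\<close>

locale leading =
 fixes V :: "'x set" and f :: "nat => ('x, 'k::field) mpol" and N :: nat and lt :: "nat => 'x \<Rightarrow>\<^sub>0 nat" and w :: "'x => nat"
 assumes fV: "\<And>i. i < N ==> f i \<in> PV V" and lc: "\<And>i. i < N ==> lookup (f i) (lt i) \<noteq> 0"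
  and low: "\<And>i m. i < N ==> m \<in> keys (f i) ==> m \<noteq> lt i ==> wt w m < wt w (lt i)"
  and coprime: "\<And>i j. i < N ==> j < N ==> i \<noteq> j ==> keys (lt i) \<inter> keys (lt j) = {}"
begin

definition std :: "nat => ('x, 'k) mpol => bool" where
 "std n p \<longleftrightarrow> (\<forall>m\<in>keys p. \<forall>i<n. \<not> mdvd (lt i) m)"

lemma std_add: "std n p ==> std n q ==> std n (p + q)"
 unfolding std_def using Poly_Mapping.keys_add[of p q] by blast

lemma std_0: "std n 0"
 by (simp add: std_def)

lemma reduce_sum:
 assumes "finite A" "\<And>a. a \<in> A ==> \<exists>s\<in>PV V. std n s \<and> g a - s \<in> idl V f n"
 shows "\<exists>s\<in>PV V. std n s \<and> sum g A - s \<in> idl V f n"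
 using assms
proof (induction A rule: finite_induct)
 case empty
 then show ?case by (intro bexI[of _ 0]) (simp_all add: std_0 idl_0)
next
 case (insert a A)
 obtain s where s: "s \<in> PV V" "std n s" "g a - s \<in> idl V f n" using insert.prems by blast
 obtain t where t: "t \<in> PV V" "std n t" "sum g A - t \<in> idl V f n" using insert by blast
 have "sum g (insert a A) - (s + t) = (g a - s) + (sum g A - t)" using insert.hyps by simp
 then have "sum g (insert a A) - (s + t) \<in> idl V f n" using idl_add[OF s(3) t(3)] by (simp only:)
 then show ?case using s t by (intro bexI[of _ "s + t"]) (simp_all only: std_add PV_basic)
qed

text \<open>Subtracting the multiple of \<open>f i\<close> that cancels the monomial leaves only
  lighter ones, so induction on the weight terminates.\<close>

lemma reduce_monomial:
 assumes "n <= N" "keys m \<subseteq> V"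
 shows "\<exists>s\<in>PV V. std n s \<and> single m a - s \<in> idl V f n"
 using assms(2)
proof (induction "wt w m" arbitrary: m a rule: less_induct)
 case less
 show ?case
 proof (cases "\<exists>i<n. mdvd (lt i) m")
  case False
  then have "std n (single m a)" by (simp add: std_def)
  then show ?thesis using less.prems by (intro bexI[of _ "single m a"]) (simp_all add: PV_single idl_0)
 next
  case True
  then obtain i l where i: "i < n" "m = l + lt i" using mdvd_obtain by metis
  have iN: "i < N" using i assms(1) by simp
  have "keys l \<subseteq> keys m" unfolding i(2) by (auto simp: in_keys_iff lookup_add)
  then have l: "keys l \<subseteq> V" using less.prems by simp
  define b where "b = a / lookup (f i) (lt i)"
  define g where "g = single m a - single l b * f i"
  have gV: "g \<in> PV V" unfolding g_def using less.prems l fV[OF iN] by (simp add: PV_single)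
  have wg: "wt w m' < wt w m" if m': "m' \<in> keys g" for m'
  proof -
   have lk: "lookup (single l b * f i) k =
     (\<Sum>t\<in>keys (f i). if l + t = k then b * lookup (f i) t else 0)" for k
    unfolding lookup_times by (cases "b = 0") (simp_all cong: if_cong)
   have "lookup g m = 0"
    unfolding g_def lookup_minus lk i(2) using lc[OF iN]
    by (simp add: b_def in_keys_iff)
   then have "m' \<noteq> m" using m' by (auto simp: in_keys_iff)
   then have "lookup (single l b * f i) m' \<noteq> 0"
    using m' unfolding g_def by (auto simp: in_keys_iff lookup_minus lookup_single when_def)
   then have "\<exists>t\<in>keys (f i). l + t = m'"
   proof (intro ccontr[of "\<exists>t\<in>_. _ t"])
    assume *: "\<not> (\<exists>t\<in>keys (f i). l + t = m')"
    have "lookup (single l b * f i) m' = 0" unfolding lk by (intro sum.neutral) (use * in auto)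
    then show False using \<open>lookup (single l b * f i) m' \<noteq> 0\<close> by blast
   qed
   then obtain t where t: "t \<in> keys (f i)" "m' = l + t" by blast
   then have "t \<noteq> lt i" using \<open>m' \<noteq> m\<close> i(2) by auto
   then show ?thesis using low[OF iN t(1)] by (simp add: t(2) i(2) wt_add)
  qed
  have "\<exists>s\<in>PV V. std n s \<and> (\<Sum>k\<in>keys g. single k (lookup g k)) - s \<in> idl V f n"
   by (rule reduce_sum) (use less.hyps[OF wg] gV in "auto simp: PV_iff")
  then obtain s where s: "s \<in> PV V" "std n s" "g - s \<in> idl V f n" using mpol_sum_monomials[of g] by metis
  have "single l b * f i \<in> idl V f n" by (intro idl_mult idl_gen i(1) PV_single l)
  then have "(g - s) + single l b * f i \<in> idl V f n" by (rule idl_add[OF s(3)])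
  then have "single m a - s \<in> idl V f n" by (simp add: g_def)
  then show ?thesis using s by blast
 qed
qed

lemma reduce:
 assumes "n <= N" "p \<in> PV V"
 shows "\<exists>s\<in>PV V. std n s \<and> p - s \<in> idl V f n"
proof -
 have "\<exists>s\<in>PV V. std n s \<and> (\<Sum>k\<in>keys p. single k (lookup p k)) - s \<in> idl V f n"
  by (rule reduce_sum) (use assms reduce_monomial[OF assms(1)] in "auto simp: PV_iff")
 then show ?thesis using mpol_sum_monomials[of p] by metis
qed

text \<open>Reducing the coefficient of \<open>f i\<close> modulo the earlier generators only changes earlier coefficients.\<close>

lemma normal_coefficients:
 assumes "n <= N" "p \<in> idl V f n"
 shows "\<exists>q. (\<forall>i. q i \<in> PV V) \<and> (\<forall>i<n. std i (q i)) \<and> p = (\<Sum>i<n. q i * f i)"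
 using assms
proof (induction n arbitrary: p)
 case 0
 then show ?case by (intro exI[of _ "\<lambda>_. 0"]) (simp add: idl_def)
next
 case (Suc n)
 obtain q where q: "\<forall>i. q i \<in> PV V" "p = (\<Sum>i<Suc n. q i * f i)" using Suc.prems(2) unfolding idl_def by blast
 obtain s where s: "s \<in> PV V" "std n s" "q n - s \<in> idl V f n"
  using reduce[of n "q n"] Suc.prems(1) q(1) by auto
 have fn: "f n \<in> PV V" using fV Suc.prems(1) by simp
 have "(\<Sum>i<n. q i * f i) + f n * (q n - s) \<in> idl V f n"
  by (rule idl_add[OF _ idl_mult[OF s(3) fn]]) (use q(1) in "auto simp: idl_def")
 then obtain q' where q': "\<forall>i. q' i \<in> PV V" "\<forall>i<n. std i (q' i)" "(\<Sum>i<n. q i * f i) + f n * (q n - s) = (\<Sum>i<n. q' i * f i)"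
  using Suc.IH Suc.prems(1) by (meson Suc_leD)
 have "p = (\<Sum>i<n. q' i * f i) + s * f n" using q(2) q'(3)[symmetric] by (simp add: algebra_simps)
 also have "\<dots> = (\<Sum>i<Suc n. (q'(n := s)) i * f i)" by simp
 finally show ?case using q' s(1,2) by (intro exI[of _ "q'(n := s)"]) (auto simp: less_Suc_eq)
qed

lemma mdvd_coprime:
 assumes "i < N" "j < N" "i \<noteq> j" "a + lt i = b + lt j"
 shows "mdvd (lt i) b"
 unfolding mdvd_def
proof
 fix x
 have "lookup (a + lt i) x = lookup (b + lt j) x" using assms(4) by simp
 moreover have "lookup (lt i) x = 0 \<or> lookup (lt j) x = 0"
  using coprime[OF assms(1-3)] by (auto simp: in_keys_iff)
 ultimately show "lookup (lt i) x <= lookup b x" by (auto simp: lookup_add)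
qed

text \<open>Buchberger's criterion for coprime leading monomials. In a representation with
  normalised coefficients, consider the heaviest product of a coefficient monomial with a leading
  monomial. If another product hit the same monomial, coprimality would make the earlier of the two
  leading monomials divide a monomial of the later coefficient, against normalisation. So it
  survives in \<open>p\<close>, although it is not standard.\<close>

lemma std_idl_0:
 assumes p: "p \<in> idl V f N" "std N p"
 shows "p = 0"
proof (rule ccontr)
 assume "p \<noteq> 0"
 obtain q where q: "\<forall>i. q i \<in> PV V" "\<And>i. i < N ==> std i (q i)" "p = (\<Sum>i<N. q i * f i)"
  using normal_coefficients[OF order_refl p(1)] by blast
 define S where "S = (SIGMA i:{..<N}. keys (q i))"
 have fin: "finite S" by (simp add: S_def)
 have "S \<noteq> {}"
 proof
  assume "S = {}"
  then have "keys (q i) = {}" if "i < N" for i using that unfolding S_def by blast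
  then have "q i = 0" if "i < N" for i using that by simp
  then show False using q(3) \<open>p \<noteq> 0\<close> by simp
 qed
 define h where "h = (\<lambda>(i, m). wt w m + wt w (lt i))"
 obtain i m where im: "(i, m) \<in> S" "\<And>j l. (j, l) \<in> S ==> h (j, l) <= h (i, m)"
 proof -
  have "Max (h ` S) \<in> h ` S" using fin \<open>S \<noteq> {}\<close> by simp
  then obtain z where "z \<in> S" "h z = Max (h ` S)" by auto
  then show ?thesis using that[of "fst z" "snd z"] Max_ge[OF finite_imageI[OF fin], of _ h] by auto
 qed
 have i: "i < N" "m \<in> keys (q i)" using im(1) by (simp_all add: S_def)
 have term0: "a = m \<and> b = lt i \<and> j = i" if j: "j < N" "a \<in> keys (q j)" "b \<in> keys (f j)" "a + b = m + lt i" for j a b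
 proof -
  have "wt w a + wt w (lt j) <= wt w m + wt w (lt i)" using im(2)[of j a] j by (simp add: S_def h_def)
  moreover have "wt w a + wt w b = wt w m + wt w (lt i)" using j(4) by (metis wt_add)
  ultimately have b: "b = lt j" using low[OF j(1,3)] by linarith
  have "j = i"
  proof (rule ccontr)
   assume ji: "j \<noteq> i"
   show False
   proof (cases "j < i")
    case True
    have "mdvd (lt j) m" by (rule mdvd_coprime[OF j(1) i(1) ji]) (use j(4) b in simp)
    then show False using q(2)[OF i(1)] i(2) True unfolding std_def by blast
   next
    case False
    have "mdvd (lt i) a" by (rule mdvd_coprime[OF i(1) j(1) ji[symmetric]]) (use j(4) b in simp)
    then show False using q(2)[OF j(1)] j(2) False ji unfolding std_def by (meson nat_neq_iff)
   qed
  qed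
  then show ?thesis using b j(4) by simp
 qed
 have "lookup (q j * f j) (m + lt i) = (if j = i then lookup (q i) m * lookup (f i) (lt i) else 0)" if j: "j < N" for j
 proof (cases "j = i")
  case True
  have "(\<Sum>a\<in>keys (q i). \<Sum>b\<in>keys (f i). if a + b = m + lt i then lookup (q i) a * lookup (f i) b else 0) =
    (\<Sum>a\<in>keys (q i). \<Sum>b\<in>keys (f i). if b = lt i then (if a = m then lookup (q i) a * lookup (f i) b else 0) else 0)"
   by (intro sum.cong refl) (use term0[OF i(1)] in auto)
  also have "\<dots> = lookup (q i) m * lookup (f i) (lt i)"
   using i lc[OF i(1)] by (simp add: in_keys_iff)
  finally show ?thesis unfolding lookup_times True by simp
 next
  case False
  have "(\<Sum>a\<in>keys (q j). \<Sum>b\<in>keys (f j). if a + b = m + lt i then lookup (q j) a * lookup (f j) b else 0) = 0"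
  proof (intro sum.neutral ballI)
   fix a b assume "a \<in> keys (q j)" "b \<in> keys (f j)"
   then have "a + b \<noteq> m + lt i" using term0[OF j] False by blast
   then show "(if a + b = m + lt i then lookup (q j) a * lookup (f j) b else 0) = 0" by simp
  qed
  then show ?thesis unfolding lookup_times using False by simp
 qed
 then have "lookup p (m + lt i) = lookup (q i) m * lookup (f i) (lt i)"
  unfolding q(3) lookup_sum using i(1) by simp
 also have "\<dots> \<noteq> 0" using i lc by (simp add: in_keys_iff)
 finally have "m + lt i \<in> keys p" by (simp add: in_keys_iff)
 moreover have "mdvd (lt i) (m + lt i)" by (simp add: mdvd_def lookup_add)
 ultimately show False using p(2) i(1) unfolding std_def by blast
qed

text \<open>A variable absent from all leading monomials multiplies standard polynomials to standard
  ones; so a standard representative whose product with it lies in the ideal is zero.\<close>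

lemma variable_cancel:
 assumes x: "\<And>i. i < N ==> x \<notin> keys (lt i)" and p: "p \<in> PV V" "mvar x * p \<in> idl V f N" and xV: "x \<in> V"
 shows "p \<in> idl V f N"
proof -
 obtain s where s: "s \<in> PV V" "std N s" "p - s \<in> idl V f N" using reduce[OF order_refl p(1)] by blast
 have "mvar x * (p - s) \<in> idl V f N" using xV by (intro idl_mult[OF s(3)]) simp
 then have "mvar x * p - mvar x * (p - s) \<in> idl V f N" by (rule idl_minus[OF p(2)])
 then have xs: "mvar x * s \<in> idl V f N" by (simp add: right_diff_distrib)
 have lk: "lookup (mvar x * s) k = (\<Sum>b\<in>keys s. if single x 1 + b = k then lookup s b else 0)" for k
 proof -
  have *: "keys (mvar x :: ('x, 'k) mpol) = {single x 1}" "lookup (mvar x :: ('x, 'k) mpol) (single x 1) = 1"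
   by (simp_all add: mvar_def)
  have **: "(\<Sum>a\<in>{single x 1}. g a) = g (single x 1)" for g :: "('x \<Rightarrow>\<^sub>0 nat) => 'k" by simp
  show ?thesis unfolding lookup_times *(1) ** *(2) mult_1_left ..
 qed
 have "std N (mvar x * s)"
  unfolding std_def
 proof (intro ballI allI impI notI)
  fix k i assume k: "k \<in> keys (mvar x * s)" and i: "i < N" "mdvd (lt i) k"
  have "\<exists>b\<in>keys s. single x 1 + b = k"
  proof (rule ccontr)
   assume "\<not> ?thesis"
   then have "lookup (mvar x * s) k = 0" unfolding lk by (intro sum.neutral) auto
   then show False using k by (simp add: in_keys_iff)
  qed
  then obtain b where b: "b \<in> keys s" "k = single x 1 + b" by blast
  have "mdvd (lt i) b"
   unfolding mdvd_def
  proof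
   fix y
   show "lookup (lt i) y <= lookup b y"
    using i(2) x[OF i(1)] unfolding mdvd_def b(2) by (cases "y = x") (auto simp: lookup_add lookup_single when_def in_keys_iff dest: spec[of _ y])
  qed
  then show False using s(2) b(1) i(1) unfolding std_def by blast
 qed
 then have "mvar x * s = 0" using std_idl_0[OF xs] by simp
 have "lookup s b = 0" for b
 proof -
  have "lookup (mvar x * s) (single x 1 + b) = lookup s b"
   unfolding lk by (simp add: in_keys_iff)
  then show ?thesis using \<open>mvar x * s = 0\<close> by simp
 qed
 then have "s = 0" by (intro poly_mapping_eqI) simp
 then show ?thesis using s(3) by simp
qed

end

section \<open>The ideal of the box equations\<close>

definition beq :: "nat => nat => nat => 'k::field cpol" where
 "beq r k n = (\<Sum>j=0..n. mvar (Ca (k + j)) * mvar (Cb (r - k + n - j)) - mvar (Cg j) * mvar (Ch (n - j)))"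

text \<open>Both forms of the box equations in one list, to be used for indices below
  \<open>k + l - 2\<close>; equations \<open>beq\<close> occur in that range only if
  \<open>k + l > r\<close>.\<close>

definition bgen :: "nat => nat => nat => nat => 'k::field cpol" where
 "bgen r k l i = (if i < k - 1 then mvar (Ca (i + 1))
  else if i < k - 1 + (min l (r - k) - 1) then mvar (Cb (i - (k - 1) + 1))
  else beq r k (i - (k - 1) - (min l (r - k) - 1)))"

abbreviation pm :: "'x => 'x => 'x \<Rightarrow>\<^sub>0 nat" where
 "pm x y \<equiv> single x (Suc 0) + single y (Suc 0)"

text \<open>The weights \<open>C - 4 i\<^sup>2\<close> for \<open>a\<^sub>k\<^sub>+\<^sub>i\<close> and \<open>b\<^sub>r\<^sub>-\<^sub>k\<^sub>+\<^sub>i\<close>, \<open>C - (2 j - 1)\<^sup>2\<close> for \<open>g\<^sub>j\<close> and \<open>C - (2 j + 1)\<^sup>2\<close> for \<open>h\<^sub>j\<close>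
 single out one middle term of each equation, alternately a product of \<open>a\<close> and \<open>b\<close> and one of \<open>g\<close>
 and \<open>h\<close>; so the leading monomials are coprime, and they avoid \<open>g\<^sub>0\<close>.\<close>

definition dlt :: "nat => nat => coord => nat" where
 "dlt r k x = (case x of Ca j => 4 * (j - k)\<^sup>2 | Cb j => 4 * (j - (r - k))\<^sup>2
  | Cg j => nat ((2 * int j - 1)\<^sup>2) | Ch j => (2 * j + 1)\<^sup>2)"

definition bw :: "nat => nat => nat => coord => nat" where
 "bw u r k x = 16 * u\<^sup>2 + 1 - dlt r k x"

definition elt :: "nat => nat => nat => coord \<Rightarrow>\<^sub>0 nat" where
 "elt r k n = (if even n then pm (Ca (k + n div 2)) (Cb (r - k + n div 2)) else pm (Cg (n div 2 + 1)) (Ch (n div 2)))"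

definition blt :: "nat => nat => nat => nat => coord \<Rightarrow>\<^sub>0 nat" where
 "blt r k l i = (if i < k - 1 then single (Ca (i + 1)) 1
  else if i < k - 1 + (min l (r - k) - 1) then single (Cb (i - (k - 1) + 1)) 1
  else elt r k (i - (k - 1) - (min l (r - k) - 1)))"

lemma mvar_times: "mvar x * mvar y = single (pm x y) 1"
 by (simp add: mvar_def mult_single)

lemma leading_term:
 assumes f: "f = (\<Sum>t\<in>A. single (mm t) (a t :: 'k::field))" and A: "finite A" "t0 \<in> A" "a t0 \<noteq> 0"
  and low: "\<And>t. t \<in> A ==> t \<noteq> t0 ==> wt w (mm t) < wt w (mm t0)"
 shows "lookup f (mm t0) \<noteq> 0"
  and "m \<in> keys f ==> m \<noteq> mm t0 ==> wt w m < wt w (mm t0)"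
proof -
 have "lookup f (mm t0) = (\<Sum>t\<in>A. if t = t0 then a t else 0)"
  unfolding f lookup_sum
 proof (intro sum.cong refl)
  fix t assume t: "t \<in> A"
  have "t \<noteq> t0 ==> mm t \<noteq> mm t0" using low[OF t] by auto
  then show "lookup (single (mm t) (a t)) (mm t0) = (if t = t0 then a t else 0)"
   by (cases "t = t0") (simp_all add: lookup_single when_def)
 qed
 then show "lookup f (mm t0) \<noteq> 0" using A by simp
 assume m: "m \<in> keys f" "m \<noteq> mm t0"
 have "\<exists>t\<in>A. mm t = m"
 proof (rule ccontr)
  assume *: "\<not> ?thesis"
  have "lookup f m = 0"
   unfolding f lookup_sum by (intro sum.neutral) (use * in "auto simp: lookup_single when_def")
  then show False using m(1) by (simp add: in_keys_iff)
 qed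
 then show "wt w m < wt w (mm t0)" using low m(2) by blast
qed

lemma wt_pm: "wt w (pm x y) = w x + w y"
 by (simp add: wt_add wt_single)

lemma beq_leading:
 assumes n: "k + n < 2 * u" "r - k + n < 2 * u" "n < u"
 shows "lookup (beq r k n :: 'k::field cpol) (elt r k n) \<noteq> 0"
  and "m \<in> keys (beq r k n :: 'k cpol) ==> m \<noteq> elt r k n ==> wt (bw u r k) m < wt (bw u r k) (elt r k n)"
proof -
 define A where "A = {0..n} <+> {0..n}"
 define mm where "mm = case_sum (\<lambda>j. pm (Ca (k + j)) (Cb (r - k + n - j))) (\<lambda>j. pm (Cg j) (Ch (n - j)))"
 define a :: "nat + nat => 'k" where "a = case_sum (\<lambda>_. 1) (\<lambda>_. - 1)"
 define dv where "dv = case_sum (\<lambda>j. (2 * int j - int n)\<^sup>2) (\<lambda>j. (2 * int j - 1 - int n)\<^sup>2)"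
 define t0 where "t0 = (if even n then Inl (n div 2) else Inr (n div 2 + 1) :: nat + nat)"
 have f: "beq r k n = (\<Sum>t\<in>A. single (mm t) (a t))"
  unfolding A_def by (subst sum.Plus) (simp_all add: beq_def mm_def a_def mvar_times sum_subtractf single_uminus sum_negf)
 have bd: "(2 * j + 1)\<^sup>2 <= 16 * u\<^sup>2" if "j <= n" for j
 proof -
  have "(2 * j + 1)\<^sup>2 <= (4 * u)\<^sup>2" by (rule power_mono) (use that n(3) in auto)
  then show ?thesis by (simp add: power_mult_distrib)
 qed
 \<comment> \<open>By the parallelogram identity the weight of a term is a constant minus twice the
   square of its distance \<open>2 * j - n\<close> or \<open>2 * j - 1 - n\<close> from the middle.
   The distances of the two kinds of products have opposite parity, so exactly one term has distance
   zero.\<close>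
 have W: "int (wt (bw u r k) (mm t)) = 2 * (16 * (int u)\<^sup>2 + 1) - 2 * (int n)\<^sup>2 - 2 * dv t" if t: "t \<in> A" for t
 proof (cases t)
  case (Inl j)
  then have j: "j <= n" using t by (auto simp: A_def)
  have "4 * j\<^sup>2 <= (2 * j + 1)\<^sup>2" "4 * (n - j)\<^sup>2 <= (2 * (n - j) + 1)\<^sup>2" by (simp_all add: power2_eq_square)
  then have le: "4 * j\<^sup>2 <= 16 * u\<^sup>2 + 1" "4 * (n - j)\<^sup>2 <= 16 * u\<^sup>2 + 1" using bd[OF j] bd[of "n - j"] by simp_all
  have e: "r - k + n - j - (r - k) = n - j" by simp
  have "int (bw u r k (Ca (k + j))) = 16 * (int u)\<^sup>2 + 1 - 4 * (int j)\<^sup>2"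
   using le(1) by (simp add: bw_def dlt_def of_nat_diff)
  moreover have "int (bw u r k (Cb (r - k + n - j))) = 16 * (int u)\<^sup>2 + 1 - 4 * (int n - int j)\<^sup>2"
   using le(2) j e by (simp add: bw_def dlt_def of_nat_diff)
  ultimately show ?thesis by (simp add: mm_def dv_def Inl wt_pm power2_eq_square algebra_simps)
 next
  case (Inr j)
  then have j: "j <= n" using t by (auto simp: A_def)
  have "(2 * int j - 1)\<^sup>2 <= (2 * int j + 1)\<^sup>2" by (simp add: power2_eq_square algebra_simps)
  also have "\<dots> = int ((2 * j + 1)\<^sup>2)" by simp
  also have "\<dots> <= int (16 * u\<^sup>2)" using bd[OF j] by (rule zle_int[THEN iffD2])
  finally have le: "nat ((2 * int j - 1)\<^sup>2) <= 16 * u\<^sup>2 + 1" by (simp add: nat_le_iff)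
  have "int (bw u r k (Cg j)) = 16 * (int u)\<^sup>2 + 1 - (2 * int j - 1)\<^sup>2"
   using le by (simp add: bw_def dlt_def of_nat_diff)
  moreover have "int (bw u r k (Ch (n - j))) = 16 * (int u)\<^sup>2 + 1 - (2 * (int n - int j) + 1)\<^sup>2"
   using bd[of "n - j"] j by (simp add: bw_def dlt_def of_nat_diff)
  ultimately show ?thesis by (simp add: mm_def dv_def Inr wt_pm power2_eq_square algebra_simps)
 qed
 have t0: "t0 \<in> A" "a t0 \<noteq> 0" "mm t0 = elt r k n" "dv t0 = 0"
  by (auto simp: t0_def A_def a_def mm_def elt_def dv_def add.commute[of "r - k"] elim!: evenE oddE)
 have low: "wt (bw u r k) (mm t) < wt (bw u r k) (mm t0)" if t: "t \<in> A" "t \<noteq> t0" for t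
 proof -
  have "dv t \<noteq> 0"
  proof (cases t)
   case (Inl j)
   have "2 * int j \<noteq> int n" using t(2) unfolding t0_def Inl by (auto elim!: evenE split: if_splits) presburger+
   then show ?thesis by (simp add: dv_def Inl)
  next
   case (Inr j)
   have "2 * int j - 1 \<noteq> int n" using t(2) unfolding t0_def Inr by (auto split: if_splits) presburger+
   then show ?thesis by (simp add: dv_def Inr)
  qed
  moreover have "0 <= dv t" by (cases t) (simp_all add: dv_def)
  ultimately have "int (wt (bw u r k) (mm t)) < int (wt (bw u r k) (mm t0))"
   unfolding W[OF t(1)] W[OF t0(1)] t0(4) by simp
  then show ?thesis by simp
 qed
 have "finite A" by (simp add: A_def)
 from leading_term[OF f this t0(1,2) low] show "lookup (beq r k n :: 'k cpol) (elt r k n) \<noteq> 0"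
  "m \<in> keys (beq r k n :: 'k cpol) ==> m \<noteq> elt r k n ==> wt (bw u r k) m < wt (bw u r k) (elt r k n)"
  unfolding t0(3) by blast+
qed

lemma keys_pm: "keys (pm x y) = {x, y}"
 by (auto simp: in_keys_iff lookup_add lookup_single when_def split: if_splits)

locale box_params =
 fixes u r k l :: nat
 assumes k: "1 <= k" "k < r" and l: "1 <= l" "l <= u - r" and ru: "r < u"
begin

definition "m = min l (r - k)"

definition "ka = k - 1"
definition "mb = m - 1"

lemma m: "1 <= m" "m <= l" "m <= r - k" "k = ka + 1" "m = mb + 1" "k + l - 2 = ka + mb + (k + l - r)"
 using k l by (auto simp: m_def ka_def mb_def)

lemma bgen_alt:
 "bgen r k l i = (if i < ka then mvar (Ca (i + 1)) else if i < ka + mb then mvar (Cb (i - ka + 1)) else beq r k (i - ka - mb))"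
 "blt r k l i = (if i < ka then single (Ca (i + 1)) 1 else if i < ka + mb then single (Cb (i - ka + 1)) 1
  else elt r k (i - ka - mb))"
 unfolding bgen_def blt_def m_def[symmetric] ka_def[symmetric] mb_def[symmetric] by (rule refl)+

lemma bgen_cases:
 assumes "i < k + l - 2"
 obtains j where "1 <= j" "j < k" "i + 1 = j" "bgen r k l i = (mvar (Ca j) :: 'k::field cpol)" "blt r k l i = single (Ca j) 1"
 | j where "1 <= j" "j < m" "i + 1 = ka + j" "bgen r k l i = (mvar (Cb j) :: 'k cpol)" "blt r k l i = single (Cb j) 1"
 | n where "n < k + l - r" "i = ka + mb + n" "bgen r k l i = (beq r k n :: 'k cpol)" "blt r k l i = elt r k n"
proof -
 consider "i < ka" | "\<not> i < ka" "i < ka + mb" | "\<not> i < ka" "\<not> i < ka + mb" by blast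
 then show ?thesis
 proof cases
  case 1
  show ?thesis by (rule that(1)[of "i + 1"]) (use 1 m in "simp_all add: bgen_alt")
 next
  case 2
  show ?thesis by (rule that(2)[of "i - ka + 1"]) (use 2 m in "simp_all add: bgen_alt")
 next
  case 3
  have "i - ka - mb < k + l - r" using assms 3 unfolding m(6) by linarith
  moreover have "i = ka + mb + (i - ka - mb)" using 3 by linarith
  ultimately show ?thesis by (rule that(3)) (use 3 in "simp_all only: bgen_alt if_False")
 qed
qed

lemma bgen_index:
 "1 <= j ==> j < k ==> bgen r k l (j - 1) = mvar (Ca j)"
 "1 <= j ==> j < m ==> bgen r k l (ka + j - 1) = mvar (Cb j)"
 "bgen r k l (ka + mb + n) = beq r k n"
proof -
 show "bgen r k l (j - 1) = mvar (Ca j)" if "1 <= j" "j < k"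
 proof -
  have "j - 1 < ka" "j - 1 + 1 = j" using that m(4) by linarith+
  then show ?thesis unfolding bgen_alt by (simp only: if_True)
 qed
 show "bgen r k l (ka + j - 1) = mvar (Cb j)" if "1 <= j" "j < m"
 proof -
  have "\<not> ka + j - 1 < ka" "ka + j - 1 < ka + mb" "ka + j - 1 - ka + 1 = j" using that m(5) by linarith+
  then show ?thesis unfolding bgen_alt by (simp only: if_True if_False)
 qed
 show "bgen r k l (ka + mb + n) = beq r k n" by (simp add: bgen_alt)
qed

text \<open>One transfer rule for all properties of the generators: membership in a ring or ideal,
  vanishing at a point, and being different from a given polynomial are instances of
  \<open>Q\<close>.\<close>

lemma bgen_ball:
 fixes Q :: "'k::field cpol => bool"
 shows "(\<forall>i<k + l - 2. Q (bgen r k l i)) \<longleftrightarrow> (\<forall>j. 1 <= j \<and> j < k --> Q (mvar (Ca j))) \<and> (\<forall>j. 1 <= j \<and> j < m --> Q (mvar (Cb j))) \<and>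
  (\<forall>n<k + l - r. Q (beq r k n))"
proof
 assume *: "\<forall>i<k + l - 2. Q (bgen r k l i)"
 show "(\<forall>j. 1 <= j \<and> j < k --> Q (mvar (Ca j))) \<and> (\<forall>j. 1 <= j \<and> j < m --> Q (mvar (Cb j))) \<and> (\<forall>n<k + l - r. Q (beq r k n))"
 proof (intro conjI allI impI)
  fix j assume j: "1 <= j \<and> j < k"
  then have "j - 1 < k + l - 2" using m(4,6) by linarith
  from *[rule_format, OF this] show "Q (mvar (Ca j))" using j by (simp only: bgen_index)
 next
  fix j assume j: "1 <= j \<and> j < m"
  then have "ka + j - 1 < k + l - 2" using m(5,6) by linarith
  from *[rule_format, OF this] show "Q (mvar (Cb j))" using j by (simp only: bgen_index)
 next
  fix n assume n: "n < k + l - r"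
  then have "ka + mb + n < k + l - 2" using m(6) by linarith
  from *[rule_format, OF this] show "Q (beq r k n)" by (simp only: bgen_index)
 qed
next
 assume *: "(\<forall>j. 1 <= j \<and> j < k --> Q (mvar (Ca j))) \<and> (\<forall>j. 1 <= j \<and> j < m --> Q (mvar (Cb j))) \<and> (\<forall>n<k + l - r. Q (beq r k n))"
 show "\<forall>i<k + l - 2. Q (bgen r k l i)"
 proof (intro allI impI)
  fix i assume "i < k + l - 2"
  then show "Q (bgen r k l i)" by (cases rule: bgen_cases[where 'k = 'k]) (use * in simp_all)
 qed
qed

lemma beq_range:
 assumes "n < k + l - r"
 shows "r < k + l" "k + n < u" "r - k + n < l" "n < u - r"
 using assms k l ru by linarith+

lemma bgen_PV: "i < k + l - 2 ==> (bgen r k l i :: 'k::field cpol) \<in> PV (coords u r)"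
proof -
 have "\<forall>i<k + l - 2. (bgen r k l i :: 'k cpol) \<in> PV (coords u r)"
  unfolding bgen_ball[of "\<lambda>p. p \<in> PV (coords u r)"]
 proof (intro conjI allI impI)
  show "(mvar (Ca j) :: 'k cpol) \<in> PV (coords u r)" if "1 <= j \<and> j < k" for j using that k ru by (intro PV_mvar) simp
  show "(mvar (Cb j) :: 'k cpol) \<in> PV (coords u r)" if "1 <= j \<and> j < m" for j using that m l by (intro PV_mvar) simp
  show "(beq r k n :: 'k cpol) \<in> PV (coords u r)" if n: "n < k + l - r" for n
   unfolding beq_def
  proof (intro PV_sum PV_basic PV_mvar)
   fix j :: nat assume "j \<in> {0..n}"
   then have "j <= n" by simp
   moreover from this have "1 <= r - k + n - j" "r - k + n - j < u - r" using beq_range[OF n] k l by linarith+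
   ultimately show "Ca (k + j) \<in> coords u r" "Cb (r - k + n - j) \<in> coords u r" "Cg j \<in> coords u r" "Ch (n - j) \<in> coords u r"
    using beq_range[OF n] k l by simp_all
  qed
 qed
 then show "i < k + l - 2 ==> (bgen r k l i :: 'k cpol) \<in> PV (coords u r)" by blast
qed

lemma keys_elt: "keys (elt r k n) =
  (if even n then {Ca (k + n div 2), Cb (r - k + n div 2)} else {Cg (n div 2 + 1), Ch (n div 2)})"
 by (simp add: elt_def keys_pm)

text \<open>The leading monomials of the \<open>beq\<close> are coprime to the listed variables
  because their \<open>a\<close> and \<open>b\<close> indices start at \<open>k\<close> and
  \<open>r - k >= m\<close>. Among each other they differ in \<open>n div 2\<close> or in the kind
  of variables.\<close>

sublocale leading "coords u r" "bgen r k l :: nat => 'k::field cpol" "k + l - 2" "blt r k l" "bw u r k"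
proof
 show "bgen r k l i \<in> PV (coords u r)" if "i < k + l - 2" for i using that by (rule bgen_PV)
 show "lookup (bgen r k l i :: 'k cpol) (blt r k l i) \<noteq> 0" if "i < k + l - 2" for i
  using that
 proof (cases rule: bgen_cases[where 'k = 'k])
  case (3 n)
  have "k + n < 2 * u" "r - k + n < 2 * u" "n < u" using beq_range[OF 3(1)] l by linarith+
  then show ?thesis unfolding 3(3,4) by (rule beq_leading)
 qed (simp_all add: mvar_def)
 show "wt (bw u r k) n < wt (bw u r k) (blt r k l i)"
  if "i < k + l - 2" "n \<in> keys (bgen r k l i :: 'k cpol)" "n \<noteq> blt r k l i" for i n
  using that(1)
 proof (cases rule: bgen_cases[where 'k = 'k])
  case (3 n')
  have "k + n' < 2 * u" "r - k + n' < 2 * u" "n' < u" using beq_range[OF 3(1)] l by linarith+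
  then show ?thesis using that(2,3) unfolding 3(3,4) by (rule beq_leading)
 qed (use that(2,3) in "simp_all add: mvar_def split: if_splits")
 show "keys (blt r k l i) \<inter> keys (blt r k l j) = {}"
  if "i < k + l - 2" "j < k + l - 2" "i \<noteq> j" for i j
  using that(1)
 proof (cases rule: bgen_cases[where 'k = 'k])
  case (1 a)
  note I = 1
  from that(2) show ?thesis by (cases rule: bgen_cases[where 'k = 'k]) (use that(3) I in "auto simp: keys_elt")
 next
  case (2 a)
  note I = 2
  from that(2) show ?thesis by (cases rule: bgen_cases[where 'k = 'k]) (use that(3) I m(3) in "auto simp: keys_elt")
 next
  case (3 a)
  note I = 3
  from that(2) show ?thesis
  proof (cases rule: bgen_cases[where 'k = 'k])
   case (3 b)
   then have "a \<noteq> b" using I that(3) by blast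
   then show ?thesis unfolding I(4) 3(4) keys_elt by (auto elim!: evenE oddE)
  qed (use I m(3) in "auto simp: keys_elt")
 qed
qed

definition "J = (idl (coords u r) (bgen r k l) (k + l - 2) :: 'k::field cpol set)"

lemma box_equations_bgen: "(box_equations r k l :: 'k::field cpol set) = bgen r k l ` {..<k + l - 2}"
proof -
 have A: "bgen r k l ` {..<k + l - 2} =
   (\<lambda>j. mvar (Ca j)) ` {1..k - 1} \<union> (\<lambda>j. mvar (Cb j)) ` {1..m - 1} \<union> (beq r k ` {..<k + l - r} :: 'k cpol set)" (is "?L = ?R")
 proof (rule Set.set_eqI)
  fix p :: "'k cpol"
  have "p \<notin> ?L \<longleftrightarrow> (\<forall>i<k + l - 2. bgen r k l i \<noteq> p)" by auto
  also have "\<dots> \<longleftrightarrow> p \<notin> ?R"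
  proof -
   have "{1..k - 1} = {j. 1 <= j \<and> j < k}" "{1..m - 1} = {j. 1 <= j \<and> j < m}" using k(1) m(1) by auto
   then show ?thesis unfolding bgen_ball[of "\<lambda>q. q \<noteq> p"] by blast
  qed
  finally show "p \<in> ?L \<longleftrightarrow> p \<in> ?R" by blast
 qed
 show ?thesis
 proof (cases "k + l <= r")
  case True
  then have "m = l" by (simp add: m_def)
  then show ?thesis unfolding A box_equations_def using True by simp
 next
  case False
  then have "m = r - k" "{0..k + l - r - 1} = {..<k + l - r}" using k by (auto simp: m_def)
  then show ?thesis unfolding A box_equations_def beq_def using False by simp
 qed
qed

lemma bgen_inj: "inj_on (bgen r k l :: nat => 'k::field cpol) {..<k + l - 2}"
proof (rule inj_onI, rule ccontr)
 fix i j assume ij: "i \<in> {..<k + l - 2}" "j \<in> {..<k + l - 2}" "bgen r k l i = (bgen r k l j :: 'k cpol)" "i \<noteq> j"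
 have "keys (blt r k l i) \<noteq> {}"
  using ij(1) unfolding lessThan_iff by (cases rule: bgen_cases[where 'k = 'k]) (simp_all add: keys_elt)
 then have ne: "blt r k l i \<noteq> blt r k l j" using coprime[of i j] ij by auto
 have "blt r k l i \<in> keys (bgen r k l i :: 'k cpol)" "blt r k l j \<in> keys (bgen r k l j :: 'k cpol)"
  using lc[of i] lc[of j] ij(1,2) by (simp_all add: in_keys_iff)
 then show False using low[of i "blt r k l j"] low[of j "blt r k l i"] ij ne by (metis lessThan_iff less_asym)
qed

text \<open>If \<open>k + l > r\<close>, the first two divisibilities let \<open>X^r\<close> be
  factored out of the determinant, and \<open>beq r k n\<close> is the coefficient at
  \<open>r + n\<close>. If \<open>k + l <= r\<close>, they give the third one, and there is no
  \<open>beq\<close>.\<close>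

lemma in_box_iff: "in_box r k l (c :: coord => 'k::field) \<longleftrightarrow> (\<forall>i<k + l - 2. meval c (bgen r k l i) = 0)"
proof -
 have a: "fps_X ^ k dvd sa c \<longleftrightarrow> (\<forall>j. 1 <= j \<and> j < k --> c (Ca j) = 0)"
  unfolding fps_X_power_dvd_iff sa_def by auto
 have b: "fps_X ^ m dvd sb c \<longleftrightarrow> (\<forall>j. 1 <= j \<and> j < m --> c (Cb j) = 0)"
  unfolding fps_X_power_dvd_iff sb_def by auto
 have d: "fps_X ^ (k + l) dvd dd r c \<longleftrightarrow> (\<forall>n<k + l - r. meval c (beq r k n) = 0)"
  if ab: "fps_X ^ k dvd sa c" "fps_X ^ m dvd sb c"
 proof (cases "k + l <= r")
  case True
  then have "m = l" by (simp add: m_def)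
  then have "fps_X ^ (k + l) dvd sa c * sb c" unfolding power_add using ab by (intro mult_dvd_mono) simp_all
  moreover have "fps_X ^ (k + l) dvd fps_X ^ r * sg c * sh c"
   unfolding mult.assoc using True by (intro dvd_mult2 le_imp_power_dvd)
  ultimately show ?thesis using True unfolding dd_def by (simp add: dvd_diff)
 next
  case False
  then have mrk: "m = r - k" using k by (simp add: m_def)
  obtain a' b' where ab': "sa c = fps_X ^ k * a'" "sb c = fps_X ^ m * b'" using ab by (elim dvdE)
  have "(fps_X :: 'k fps) ^ k * fps_X ^ m = fps_X ^ r" using k by (simp add: mrk power_add[symmetric])
  then have dd: "dd r c = fps_X ^ r * (a' * b' - sg c * sh c)"
   unfolding dd_def ab' by (simp add: algebra_simps)
  have a'j: "a' $ j = c (Ca (k + j))" for j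
  proof -
   have "sa c $ (k + j) = a' $ j" unfolding ab' by (simp only: fps_X_power_mult_nth) simp
   then show ?thesis using k by (simp add: sa_def)
  qed
  have b'j: "b' $ j = c (Cb (r - k + j))" for j
  proof -
   have "sb c $ (m + j) = b' $ j" unfolding ab' by (simp only: fps_X_power_mult_nth) simp
   then show ?thesis using k by (simp add: sb_def mrk)
  qed
  have n: "dd r c $ (r + n) = meval c (beq r k n)" for n
  proof -
   have "dd r c $ (r + n) = (a' * b' - sg c * sh c) $ n" unfolding dd by (simp only: fps_X_power_mult_nth) simp
   then show ?thesis
    by (simp add: fps_mult_nth a'j b'j beq_def meval_sum meval_diff meval_mult sum_subtractf sg_def sh_def)
  qed
  have low: "dd r c $ i = 0" if "i < r" for i unfolding dd using that by (simp add: fps_X_power_mult_nth)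
  show ?thesis
   unfolding fps_X_power_dvd_iff
  proof
   assume "\<forall>i<k + l. dd r c $ i = 0"
   then show "\<forall>i<k + l - r. meval c (beq r k i) = 0" unfolding n[symmetric] by simp
  next
   assume *: "\<forall>i<k + l - r. meval c (beq r k i) = 0"
   show "\<forall>i<k + l. dd r c $ i = 0"
   proof (intro allI impI)
    fix i assume i: "i < k + l"
    show "dd r c $ i = 0"
    proof (cases "i < r")
     case F: False
     then show ?thesis using n[of "i - r"] * i by simp
    qed (rule low)
   qed
  qed
 qed
 show ?thesis unfolding in_box_def bgen_ball[of "\<lambda>p. meval c p = 0"] m_def[symmetric] meval_mvar using a b d by blast
qed

lemma J_vanish: "p \<in> J ==> in_box r k l c ==> meval c p = 0"
 unfolding J_def idl_def in_box_iff by (auto simp: meval_sum meval_mult)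

text \<open>The coordinates left after solving: \<open>beq r k n\<close> is linear in
  \<open>h_n\<close> with coefficient \<open>-g_0\<close> and otherwise contains only
  \<open>h\<close> of smaller index.\<close>

definition "free = coords u r - ({Ca j | j. j < k} \<union> {Cb j | j. j < m} \<union> {Ch n | n. n < k + l - r})"

lemma free_basic: "free \<subseteq> coords u r" "Cg 0 \<in> free" "finite (coords u r)"
 using ru by (auto simp: free_def coords_def)

text \<open>The polynomials with this property form a ring that contains the free coordinates and
  those lying in the ideal. The remaining \<open>h_n\<close> are reached by induction on
  \<open>n\<close>, writing \<open>g_0 h_n\<close> as \<open>R - beq r k n\<close>.\<close>

lemma elimination:
 fixes p :: "'k::field cpol"
 assumes "p \<in> PV (coords u r)"
 shows "\<exists>e. \<exists>p0\<in>PV free. mvar (Cg 0) ^ e * p - p0 \<in> J"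
proof -
 let ?g = "mvar (Cg 0) :: 'k cpol"
 let ?S = "\<lambda>p :: 'k cpol. p \<in> PV (coords u r) \<and> (\<exists>e. \<exists>p0\<in>PV free. ?g ^ e * p - p0 \<in> J)"
 have fc: "p \<in> PV free ==> p \<in> PV (coords u r)" for p :: "'k cpol" using free_basic(1) by (rule PV_mono[rotated])
 have gp: "?g ^ e \<in> PV (coords u r)" "?g ^ e \<in> PV free" for e using free_basic by (auto intro!: PV_power)
 have J0: "(0 :: 'k cpol) \<in> J" and J1: "p \<in> J ==> q \<in> J ==> p + q \<in> J"
  and J2: "p \<in> J ==> q \<in> PV (coords u r) ==> q * p \<in> J" and J3: "p \<in> J ==> q \<in> J ==> p - q \<in> J" for p q :: "'k cpol"
  unfolding J_def by (simp_all only: idl_0 idl_add idl_mult idl_minus)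
 have F: "?S p" if "p \<in> PV free" for p
  using that fc J0 by (auto intro!: exI[of _ 0] bexI[of _ p])
 have add: "?S (p + q)" if p: "?S p" and q: "?S q" for p q
 proof -
  obtain e p0 e' q0 where *: "p0 \<in> PV free" "?g ^ e * p - p0 \<in> J" "q0 \<in> PV free" "?g ^ e' * q - q0 \<in> J" using p q by blast
  have "?g ^ (e + e') * (p + q) - (?g ^ e' * p0 + ?g ^ e * q0) = ?g ^ e' * (?g ^ e * p - p0) + ?g ^ e * (?g ^ e' * q - q0)"
   by (simp add: power_add algebra_simps)
  also have "\<dots> \<in> J" by (intro J1 J2 * gp)
  finally show ?thesis using p q * gp by (intro conjI PV_basic exI[of _ "e + e'"] bexI[of _ "?g ^ e' * p0 + ?g ^ e * q0"]) auto
 qed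
 have mult: "?S (p * q)" if p: "?S p" and q: "?S q" for p q
 proof -
  obtain e p0 e' q0 where *: "p0 \<in> PV free" "?g ^ e * p - p0 \<in> J" "q0 \<in> PV free" "?g ^ e' * q - q0 \<in> J" using p q by blast
  have "?g ^ (e + e') * (p * q) - p0 * q0 = (?g ^ e * p) * (?g ^ e' * q - q0) + q0 * (?g ^ e * p - p0)"
   by (simp add: power_add algebra_simps)
  also have "\<dots> \<in> J" using p * gp fc by (intro J1 J2) auto
  finally show ?thesis using p q * by (intro conjI PV_basic exI[of _ "e + e'"] bexI[of _ "p0 * q0"]) auto
 qed
 have diff: "?S (p - q)" if p: "?S p" and q: "?S q" for p q
  using add[OF p mult[OF F[of "- 1"] q]] by simp
 have sum: "?S (sum f A)" if "\<And>i. i \<in> A ==> ?S (f i)" for f :: "nat => 'k cpol" and A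
  using that by (induction A rule: infinite_finite_induct) (use F[of 0] add in auto)
 have Z: "?S (mvar x)" if "x \<in> coords u r" "(mvar x :: 'k cpol) \<in> J" for x
  using that by (auto intro!: exI[of _ 0] bexI[of _ 0])
 have "\<forall>i<k + l - 2. bgen r k l i \<in> (J :: 'k cpol set)" unfolding J_def by (auto intro: idl_gen)
 note gJ = this[unfolded bgen_ball[of "\<lambda>p. p \<in> J"]]
 have nh: "?S (mvar x)" if x: "x \<in> coords u r" "\<And>n. n < k + l - r ==> x \<noteq> Ch n" for x
 proof (cases "x \<in> free")
  case True
  then show ?thesis by (intro F) simp
 next
  case False
  then consider j where "x = Ca j" "j < k" | j where "x = Cb j" "j < m" using x unfolding free_def by blast
  then have "(mvar x :: 'k cpol) \<in> J"
   by cases (use x gJ in auto)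
  then show ?thesis by (rule Z[OF x(1)])
 qed
 have h: "?S (mvar (Ch n))" if "n < k + l - r" for n
  using that
 proof (induction n rule: less_induct)
  case (less n)
  note rg = beq_range[OF less.prems]
  define R :: "'k cpol" where "R = (\<Sum>j=0..n. mvar (Ca (k + j)) * mvar (Cb (r - k + n - j))) - (\<Sum>j=1..n. mvar (Cg j) * mvar (Ch (n - j)))"
  have "?S R"
   unfolding R_def
  proof (intro diff sum)
   show "?S (mvar (Ca (k + j)) * mvar (Cb (r - k + n - j)))" if "j \<in> {0..n}" for j
    using that rg k l by (intro mult nh) auto
   show "?S (mvar (Cg j) * mvar (Ch (n - j)))" if "j \<in> {1..n}" for j
    using that rg less.prems by (intro mult nh less.IH) auto
  qed
  then obtain e p0 where e: "p0 \<in> PV free" "?g ^ e * R - p0 \<in> J" by blast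
  have "beq r k n = R - ?g * mvar (Ch n)"
   unfolding beq_def R_def sum_subtractf by (simp add: sum.atLeast_Suc_atMost[of 0 n])
  then have gh: "?g * mvar (Ch n) = R - beq r k n" by simp
  have "?g ^ Suc e * mvar (Ch n) - p0 = ?g ^ e * (?g * mvar (Ch n)) - p0" by (simp add: mult_ac)
  also have "\<dots> = (?g ^ e * R - p0) - ?g ^ e * beq r k n" unfolding gh by (simp add: right_diff_distrib)
  also have "\<dots> \<in> J" using gJ less.prems by (intro J3[OF e(2)] J2 gp) auto
  finally show ?case using e(1) rg by (intro conjI exI[of _ "Suc e"] bexI[of _ p0] PV_mvar) simp_all
 qed
 have "?S p"
  using assms
 proof (induction p rule: mpol_gen_induct)
  case (cst a)
  show ?case by (rule F) simp
 next
  case (var x)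
  then show ?case using nh[of x] h by (cases "\<exists>n<k + l - r. x = Ch n") auto
 qed (use add mult in blast)+
 then show ?thesis by blast
qed

text \<open>The equations for the \<open>h_n\<close> say that the product of the series for
  \<open>g\<close> and \<open>h\<close> agrees with \<open>T\<close> up to a certain degree; the
  series for \<open>g\<close> is invertible since its constant term is
  \<open>c (Cg 0)\<close>.\<close>

lemma solve:
 fixes c :: "coord => 'k::field"
 assumes g: "c (Cg 0) \<noteq> 0"
 obtains c' where "in_box r k l c'" "\<And>x. x \<in> free ==> c' x = c x"
proof
 define T where "T = Abs_fps (\<lambda>n. \<Sum>j=0..n. c (Ca (k + j)) * c (Cb (r - k + n - j)))"
 define H where "H = inverse (sg c) * T"
 have "sg c * H = T" using g inverse_mult_eq_1'[of "sg c"] by (simp add: H_def sg_def mult.assoc[symmetric])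
 then have TH: "(\<Sum>j=0..n. c (Cg j) * H $ (n - j)) = (\<Sum>j=0..n. c (Ca (k + j)) * c (Cb (r - k + n - j)))" for n
  by (metis (no_types, lifting) T_def fps_mult_nth fps_nth_Abs_fps sg_def sum.cong)
 define c' where "c' = (\<lambda>x. case x of Ca j => if j < k then 0 else c x | Cb j => if j < m then 0 else c x
  | Ch n => if n < k + l - r then H $ n else c x | Cg j => c x)"
 show "in_box r k l c'"
  unfolding in_box_iff bgen_ball[of "\<lambda>p. meval c' p = 0"]
 proof (intro conjI allI impI)
  fix n assume n: "n < k + l - r"
  have "meval c' (beq r k n) = (\<Sum>j=0..n. c (Ca (k + j)) * c (Cb (r - k + n - j)) - c (Cg j) * H $ (n - j))"
   unfolding beq_def meval_sum meval_diff meval_mult meval_mvar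
   by (intro sum.cong refl) (use n m(3) in "auto simp: c'_def")
  also have "\<dots> = 0" unfolding sum_subtractf TH by simp
  finally show "meval c' (beq r k n) = 0" .
 qed (simp_all add: c'_def)
 show "c' x = c x" if "x \<in> free" for x
  using that by (cases x) (auto simp: c'_def free_def)
qed

lemma J_cancel: "p \<in> PV (coords u r) ==> mvar (Cg 0) ^ e * p \<in> J ==> (p :: 'k::field cpol) \<in> J"
proof (induction e)
 case (Suc e)
 have "mvar (Cg 0) ^ e * p \<in> J"
  unfolding J_def
 proof (rule variable_cancel)
  show "Cg 0 \<notin> keys (blt r k l i)" if "i < k + l - 2" for i
   using that by (cases rule: bgen_cases[where 'k = 'k]) (auto simp: keys_elt)
  show "mvar (Cg 0) ^ e * p \<in> PV (coords u r)" using Suc.prems(1) free_basic by (auto intro!: PV_power)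
  show "mvar (Cg 0) * (mvar (Cg 0) ^ e * p) \<in> idl (coords u r) (bgen r k l) (k + l - 2)"
   using Suc.prems(2) by (simp add: J_def mult.assoc)
 qed (use free_basic in auto)
 then show ?case using Suc by blast
qed simp

text \<open>After elimination both polynomials depend on free coordinates only.\<close>

lemma nonvanishing_point:
 fixes p q :: "'k::field cpol"
 assumes inf: "infinite (UNIV :: 'k set)" and p: "p \<in> PV (coords u r)" "p \<notin> J" and q: "q \<in> PV (coords u r)" "q \<notin> J"
 shows "\<exists>c. in_box r k l c \<and> meval c p \<noteq> 0 \<and> meval c q \<noteq> 0"
proof -
 let ?g = "mvar (Cg 0) :: 'k cpol"
 obtain e p0 where e: "p0 \<in> PV free" "?g ^ e * p - p0 \<in> J" using elimination[OF p(1)] by blast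
 obtain d q0 where d: "q0 \<in> PV free" "?g ^ d * q - q0 \<in> J" using elimination[OF q(1)] by blast
 have "p0 \<noteq> 0" "q0 \<noteq> 0" using J_cancel[OF p(1), of e] J_cancel[OF q(1), of d] e d p q by auto
 have fin: "finite free" using free_basic finite_subset by blast
 have "lookup ?g (single (Cg 0) 1) = 1" by (simp add: mvar_def)
 then have g: "?g \<in> PV free" "?g \<noteq> 0" using free_basic(2) by auto
 have "?g * (p0 * q0) \<noteq> 0"
  by (intro mpol_mult_nonzero[OF inf fin] g) (use e d \<open>p0 \<noteq> 0\<close> \<open>q0 \<noteq> 0\<close> in auto)
 moreover have pq: "?g * (p0 * q0) \<in> PV free" using g e d by auto
 ultimately obtain c where c: "meval c (?g * (p0 * q0)) \<noteq> 0" using mpol_nonzero_point[OF inf fin] by blast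
 then have "c (Cg 0) \<noteq> 0" by (auto simp: meval_mult)
 then obtain c' where c': "in_box r k l c'" "\<And>x. x \<in> free ==> c' x = c x" using solve by blast
 have "meval c' (?g * (p0 * q0)) \<noteq> 0" using c meval_cong[OF pq c'(2)] by simp
 moreover have "meval c' (?g ^ e * p) = meval c' p0" "meval c' (?g ^ d * q) = meval c' q0"
  using J_vanish[OF e(2) c'(1)] J_vanish[OF d(2) c'(1)] by (simp_all add: meval_diff)
 ultimately show ?thesis using c'(1) by (auto simp: meval_mult)
qed

text \<open>The role of the Nullstellensatz is taken by \<open>nonvanishing_point\<close>, applied
  to the pair of \<open>p\<close> with itself.\<close>

lemma J_eq:
 assumes inf: "infinite (UNIV :: 'k::field set)" and p: "p \<in> PV (coords u r)"
 shows "(\<forall>c :: coord => 'k. in_box r k l c --> meval c p = 0) \<longleftrightarrow> p \<in> J"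
 using nonvanishing_point[OF inf p _ p] J_vanish by blast

end

section \<open>Closed sets in coordinates\<close>

abbreviation NN :: "nat => nat => 'k::field mat set" where
 "NN u r \<equiv> nilpotent_commutator {#u, u - r#}"

definition zs :: "nat => nat => 'k::field cpol set => 'k mat set" where
 "zs u r S = {B \<in> NN u r. \<forall>p\<in>S. meval (coord_val u r B) p = 0}"

definition bx :: "nat => nat => nat => nat => 'k::field mat set" where
 "bx u r k l = {B \<in> NN u r. in_box r k l (coord_val u r B)}"

lemma entry_poly:
 assumes "1 <= r" "r < u"
 shows "\<exists>f\<in>PV (coords u r). \<forall>c :: coord => 'k::field. meval c f = entry (cmat u r c) ij"
proof (cases "fst ij < u + (u - r) \<and> snd ij < u + (u - r)")
 case True
 have "ix [u, u - r] ` Ix [u, u - r] = {..<u + (u - r)}"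
  using indexing_ix2[of u "u - r"] by (simp add: indexing_def bij_betw_def)
 moreover have "fst ij \<in> {..<u + (u - r)}" "snd ij \<in> {..<u + (u - r)}" using True by simp_all
 ultimately obtain x y where "x \<in> Ix [u, u - r]" "y \<in> Ix [u, u - r]" "fst ij = ix [u, u - r] y" "snd ij = ix [u, u - r] x" by blast
 then have xy: "x \<in> Ix [u, u - r]" "y \<in> Ix [u, u - r]" "ij = (ix [u, u - r] y, ix [u, u - r] x)" by (simp_all add: prod_eq_iff)
 obtain s p t q where st: "x = (s, p)" "y = (t, q)" by (cases x, cases y)
 have e: "entry (cmat u r c) ij = ent [u, u - r] (cmat u r c) (t, q) (s, p)" for c :: "coord => 'k"
  using True carrier_matD[OF cmat_carrier[of u r c]] by (simp add: entry_def xy(3) st split: prod.split)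
 show ?thesis
  unfolding e ent_cmat[OF xy(1,2)[unfolded st]]
  by (rule bexI[of _ "if t = 0 \<and> s = 0 then (if p < q then mvar (Ca (q - p)) else 0)
   else if t = 0 then (if p + r <= q then mvar (Cg (q - p - r)) else 0)
   else if s = 0 then (if p <= q then mvar (Ch (q - p)) else 0)
   else (if p < q then mvar (Cb (q - p)) else 0)"])
   (use xy st in "auto simp: mem_Ix2 intro!: PV_mvar")
next
 case False
 have "entry (cmat u r c) ij = 0" for c :: "coord => 'k"
  using False carrier_matD[OF cmat_carrier[of u r c]] by (auto simp: entry_def split: prod.split)
 then show ?thesis by (intro bexI[of _ 0]) simp_all
qed

text \<open>Entries are polynomials in the coordinates and coordinates are entries, so the topology
  given by matrix entries is the Zariski topology of the affine coordinate space.\<close>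

lemma closedin_iff:
 fixes Z :: "'k::field mat set"
 assumes r: "1 <= r" "r < u"
 shows "closedin (zariski (NN u r)) Z \<longleftrightarrow> (\<exists>S\<subseteq>PV (coords u r). Z = zs u r S)"
proof -
 have cl: "closedin (zariski (NN u r)) Z \<longleftrightarrow> (\<exists>S. Z = {B \<in> NN u r. \<forall>p\<in>S. meval (entry B) p = 0})"
 proof -
  have "NN u r - Z = NN u r - {B \<in> NN u r. \<forall>p\<in>S. meval (entry B) p = 0} \<longleftrightarrow> Z = {B \<in> NN u r. \<forall>p\<in>S. meval (entry B) p = 0}"
   if "Z \<subseteq> NN u r" for S using that by blast
  then show ?thesis unfolding closedin_def openin_zariski topspace_zariski by blast
 qed
 have "\<forall>ij. \<exists>f\<in>PV (coords u r). \<forall>c :: coord => 'k. meval c f = entry (cmat u r c) ij" using entry_poly[OF r] by blast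
 then obtain f where f: "\<And>ij. f ij \<in> PV (coords u r)" "\<And>ij c. meval c (f ij) = entry (cmat u r (c :: coord => 'k)) ij" by metis
 have "\<exists>q\<in>PV (coords u r). \<forall>B\<in>NN u r. meval (coord_val u r B) q = meval (entry B) p" for p :: "(nat \<times> nat, 'k) mpol"
 proof -
  obtain q where q: "q \<in> PV (coords u r)" "\<And>c. meval c q = meval (\<lambda>x. meval c (f x)) p"
   using mpol_subst[of p UNIV f "coords u r"] f(1) PV_mono[of p _ UNIV] by (auto simp: PV_def)
  have "meval (coord_val u r B) q = meval (entry B) p" if "B \<in> NN u r" for B
   unfolding q(2) f(2) nilpotent_commutator_cmat[OF r that, symmetric] ..
  then show ?thesis using q(1) by blast
 qed
 then obtain T where T: "\<And>p. T p \<in> PV (coords u r)" "\<And>p B. B \<in> NN u r ==> meval (coord_val u r B) (T p) = meval (entry B) (p :: (nat \<times> nat, 'k) mpol)"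
  by metis
 define g where "g = (\<lambda>x. mvar (case x of Ca i => (0, i) | Cb i => (u, u + i) | Cg i => (0, u + i) | Ch i => (u, r + i)) :: (nat \<times> nat, 'k) mpol)"
 have "\<exists>q. \<forall>B\<in>NN u r. meval (entry B) q = meval (coord_val u r B) p" if p: "p \<in> PV (coords u r)" for p :: "'k cpol"
 proof -
  obtain q where q: "\<And>c. meval c q = meval (\<lambda>x. meval c (g x)) p" using mpol_subst[OF p, of g UNIV] by (auto simp: PV_def)
  have "meval (entry B) q = meval (coord_val u r B) p" if B: "B \<in> NN u r" for B
   unfolding q
  proof (rule meval_cong[OF p])
   fix x assume "x \<in> coords u r"
   moreover have "dim_row B = u + (u - r)" "dim_col B = u + (u - r)"
    using B commD(1)[of "[u, u - r]" B] by (auto simp: nilpotent_commutator_iff parts_two)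
   ultimately show "meval (entry B) (g x) = coord_val u r B x" by (cases x) (auto simp: g_def entry_def)
  qed
  then show ?thesis by blast
 qed
 then obtain T' where T': "\<And>p B. p \<in> PV (coords u r) ==> B \<in> NN u r ==> meval (entry B) (T' p) = meval (coord_val u r B) (p :: 'k cpol)"
  by metis
 show ?thesis
  unfolding cl
 proof
  assume "\<exists>S. Z = {B \<in> NN u r. \<forall>p\<in>S. meval (entry B) p = 0}"
  then obtain S where "Z = {B \<in> NN u r. \<forall>p\<in>S. meval (entry B) p = 0}" by blast
  then have "Z = zs u r (T ` S)" using T(2) by (auto simp: zs_def)
  then show "\<exists>S\<subseteq>PV (coords u r). Z = zs u r S" using T(1) by blast
 next
  assume "\<exists>S\<subseteq>PV (coords u r). Z = zs u r S"
  then obtain S where S: "S \<subseteq> PV (coords u r)" "Z = zs u r S" by blast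
  have "meval (entry B) (T' p) = meval (coord_val u r B) p" if "p \<in> S" "B \<in> NN u r" for p B using T' S(1) that by blast
  then have "Z = {B \<in> NN u r. \<forall>p\<in>T' ` S. meval (entry B) p = 0}" unfolding S(2) zs_def by auto
  then show "\<exists>S. Z = {B \<in> NN u r. \<forall>p\<in>S. meval (entry B) p = 0}" by blast
 qed
qed

definition vanish :: "nat => nat => 'k::field mat set => 'k cpol => bool" where
 "vanish u r Z p \<longleftrightarrow> (\<forall>B\<in>Z. meval (coord_val u r B) p = 0)"

lemma irreducible_vanish:
 fixes G :: "'k::field mat set"
 assumes r: "1 <= r" "r < u" and G: "irreducible_closed (zariski (NN u r)) G"
  and p: "p \<in> PV (coords u r)" "q \<in> PV (coords u r)" "vanish u r G (p * q)" "\<not> vanish u r G p"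
 shows "vanish u r G q"
proof -
 have c: "closedin (zariski (NN u r)) (zs u r {p})" if "p \<in> PV (coords u r)" for p :: "'k cpol"
  unfolding closedin_iff[OF r] using that by blast
 have GN: "G \<subseteq> NN u r" using G closedin_subset unfolding irreducible_closed_def by fastforce
 then have "G \<subseteq> zs u r {p} \<union> zs u r {q}" using p(3) by (auto simp: vanish_def zs_def meval_mult)
 then have "G \<subseteq> zs u r {p} \<or> G \<subseteq> zs u r {q}" using G c p(1,2) unfolding irreducible_closed_def by blast
 then show ?thesis using p(4) unfolding vanish_def zs_def by blast
qed

lemma closed_separate:
 assumes r: "1 <= r" "r < u" and F: "closedin (zariski (NN u r)) F" "F \<subset> G" "G \<subseteq> NN u r"
 obtains p where "p \<in> PV (coords u r)" "vanish u r F p" "\<not> vanish u r G (p :: 'k::field cpol)"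
proof -
 obtain S where S: "S \<subseteq> PV (coords u r)" "F = zs u r S" using F(1) unfolding closedin_iff[OF r] by blast
 obtain B where B: "B \<in> G" "B \<notin> F" using F(2) by blast
 then obtain p where "p \<in> S" "meval (coord_val u r B) p \<noteq> 0" using S(2) F(3) by (auto simp: zs_def)
 then show ?thesis using that[of p] S B(1) unfolding vanish_def zs_def by blast
qed

section \<open>Growth of coordinate rings\<close>

text \<open>The degree is bounded in each variable separately, so that the monomials within a bound
  form a cube whose size is an exact power.\<close>

definition expb :: "nat => ('x, 'k::field) mpol => bool" where
 "expb d p \<longleftrightarrow> (\<forall>m\<in>keys p. \<forall>x. lookup m x <= d)"

lemma expb_mult: "expb d p ==> expb e q ==> expb (d + e) (p * q)"
 unfolding expb_def
proof (intro ballI allI)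
 fix m x assume *: "\<forall>m\<in>keys p. \<forall>x. lookup m x <= d" "\<forall>m\<in>keys q. \<forall>x. lookup m x <= e"
  "m \<in> keys (p * q)"
 then obtain a b where "m = a + b" "a \<in> keys p" "b \<in> keys q" using keys_mult[of p q] by blast
 then show "lookup m x <= d + e" using * by (simp add: lookup_add add_mono)
qed

lemma expb_power: "expb d p ==> expb (d * i) (p ^ i)"
proof (induction i)
 case (Suc i)
 then show ?case using expb_mult[of d p "d * i" "p ^ i"] by simp
qed (simp add: expb_def)

lemma expb_mono: "expb d p ==> d <= e ==> expb e p"
 unfolding expb_def by (meson order_trans)

lemma expb_exists: "\<exists>d. expb d p"
proof -
 let ?A = "\<Union>m\<in>keys p. lookup m ` keys m"
 have "lookup m x <= Max (insert 0 ?A)" if "m \<in> keys p" for m x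
  using that by (cases "x \<in> keys m") (auto simp: in_keys_iff intro!: Max_ge)
 then show ?thesis unfolding expb_def by blast
qed

definition boxmon :: "'x set => nat => ('x \<Rightarrow>\<^sub>0 nat) set" where
 "boxmon V e = (\<lambda>t. \<Sum>x\<in>V. single x (t x)) ` (V \<rightarrow>\<^sub>E {..e})"

lemma boxmon_lookup:
 "finite V ==> lookup (\<Sum>x\<in>V. single x (t x :: nat)) y = (if y \<in> V then t y else 0)"
 by (simp add: lookup_sum lookup_single when_def)

lemma boxmon_mem:
 assumes "finite V"
 shows "m \<in> boxmon V e \<longleftrightarrow> keys m \<subseteq> V \<and> (\<forall>x. lookup m x <= e)"
proof
 assume "m \<in> boxmon V e"
 then show "keys m \<subseteq> V \<and> (\<forall>x. lookup m x <= e)"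
  using boxmon_lookup[OF assms] by (auto simp: boxmon_def in_keys_iff PiE_iff split: if_splits)
next
 assume *: "keys m \<subseteq> V \<and> (\<forall>x. lookup m x <= e)"
 define t where "t = restrict (lookup m) V"
 have "m = (\<Sum>x\<in>V. single x (t x))"
  using * by (intro poly_mapping_eqI) (auto simp: boxmon_lookup[OF assms] t_def in_keys_iff)
 moreover have "t \<in> V \<rightarrow>\<^sub>E {..e}" using * by (auto simp: t_def)
 ultimately show "m \<in> boxmon V e" unfolding boxmon_def by blast
qed

lemma boxmon_card: "finite V ==> finite (boxmon V e) \<and> card (boxmon V e) = (e + 1) ^ card V"
proof
 assume V: "finite V"
 show "finite (boxmon V e)" using V by (simp add: boxmon_def finite_PiE)
 have "inj_on (\<lambda>t. \<Sum>x\<in>V. single x (t x :: nat)) (V \<rightarrow>\<^sub>E {..e})"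
  by (rule inj_onI, rule PiE_ext) (assumption, assumption, metis boxmon_lookup[OF V])
 then show "card (boxmon V e) = (e + 1) ^ card V"
  unfolding boxmon_def using V by (simp add: card_image card_PiE)
qed

definition indep_on :: "nat => nat => 'k::field mat set => 'i set => ('i => 'k cpol) => bool" where
 "indep_on u r Z I w \<longleftrightarrow> (\<forall>\<alpha>. vanish u r Z (\<Sum>t\<in>I. mcst (\<alpha> t) * w t) --> (\<forall>t\<in>I. \<alpha> t = 0))"

text \<open>A lower bound for the Hilbert function of the coordinate ring of \<open>Z\<close>,
  playing the role of a lower bound for its dimension. The constant \<open>K\<close> absorbs the
  degrees of the functions collected along a chain.\<close>

definition growth :: "nat => nat => 'k::field mat set => nat => nat => bool" where
 "growth u r Z D K \<longleftrightarrow> (\<forall>e. \<exists>(I :: nat set) w. finite I \<and> card I = (e + 1) ^ D \<and>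
  (\<forall>t\<in>I. w t \<in> PV (coords u r) \<and> expb (K * e) (w t)) \<and> indep_on u r Z I w)"

text \<open>If \<open>f\<close> vanishes on \<open>F\<close> but not on the irreducible set \<open>G\<close>, then independent functions on \<open>F\<close>,
 multiplied by different powers of \<open>f\<close>, remain independent on \<open>G\<close>.\<close>

lemma growth_step:
 fixes F G :: "'k::field mat set"
 assumes r: "1 <= r" "r < u" and G: "irreducible_closed (zariski (NN u r)) G" and FG: "F \<subseteq> G"
  and f: "f \<in> PV (coords u r)" "vanish u r F f" "\<not> vanish u r G f" "expb d f" and gr: "growth u r F D K"
 shows "growth u r G (Suc D) (K + d)"
 unfolding growth_def
proof
 fix e
 obtain I :: "nat set" and w where I: "finite I" "card I = (e + 1) ^ D" "\<And>t. t \<in> I ==> w t \<in> PV (coords u r)"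
   "\<And>t. t \<in> I ==> expb (K * e) (w t)" "indep_on u r F I w"
  using gr unfolding growth_def by metis
 define I' where "I' = I \<times> {..e}"
 define w' where "w' = (\<lambda>(t, j). w t * f ^ j)"
 have fj: "f ^ j \<in> PV (coords u r)" for j using f(1) by (rule PV_power)
 have nf: "\<not> vanish u r G (f ^ j)" for j using f(3) by (auto simp: vanish_def meval_power)
 have ind: "indep_on u r G I' w'"
  unfolding indep_on_def
 proof (intro allI impI)
  fix \<alpha> assume van: "vanish u r G (\<Sum>t\<in>I'. mcst (\<alpha> t) * w' t)"
  define h where "h = (\<lambda>j. \<Sum>t\<in>I. mcst (\<alpha> (t, j)) * w t)"
  have hP: "h j \<in> PV (coords u r)" for j unfolding h_def using I(3) by (intro PV_sum PV_basic)
  have "(\<Sum>t\<in>I'. mcst (\<alpha> t) * w' t) = (\<Sum>j\<le>e. f ^ j * h j)"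
  proof -
   have "(\<Sum>t\<in>I'. mcst (\<alpha> t) * w' t) = (\<Sum>(t, j)\<in>I \<times> {..e}. mcst (\<alpha> (t, j)) * (w t * f ^ j))"
    unfolding I'_def w'_def by (intro sum.cong) auto
   also have "\<dots> = (\<Sum>j\<le>e. \<Sum>t\<in>I. mcst (\<alpha> (t, j)) * (w t * f ^ j))"
    unfolding sum.cartesian_product[symmetric] by (rule sum.swap)
   finally show ?thesis by (simp add: h_def sum_distrib_left mult_ac)
  qed
  then have van': "vanish u r G (\<Sum>j\<le>e. f ^ j * h j)" using van by simp
  have "\<forall>t\<in>I. \<alpha> (t, j) = 0" if "j <= e" for j
   using that
  proof (induction j rule: less_induct)
   case (less j)
   have h0: "h i = 0" if "i < j" for i using less that by (simp add: h_def)
   define R where "R = (\<Sum>i\<in>{Suc j..e}. f ^ (i - Suc j) * h i)"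
   have "(\<Sum>i\<le>e. f ^ i * h i) = (\<Sum>i\<in>{j..e}. f ^ i * h i)"
    using h0 by (intro sum.mono_neutral_right) auto
   also have "\<dots> = f ^ j * h j + (\<Sum>i\<in>{Suc j..e}. f ^ i * h i)" using less.prems by (rule sum.atLeast_Suc_atMost)
   also have "(\<Sum>i\<in>{Suc j..e}. f ^ i * h i) = f ^ Suc j * R"
    unfolding R_def sum_distrib_left
    by (intro sum.cong refl) (simp only: mult.assoc[symmetric] power_add[symmetric] atLeastAtMost_iff le_add_diff_inverse)
   also have "f ^ j * h j + f ^ Suc j * R = f ^ j * (h j + f * R)" by (simp add: algebra_simps)
   \<comment> \<open>The lowest remaining power of \<open>f\<close> has been factored out.
     Irreducibility of \<open>G\<close> cancels it, and restriction to \<open>F\<close>, where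
     \<open>f\<close> vanishes, isolates \<open>h j\<close>.\<close>
   finally have "vanish u r G (f ^ j * (h j + f * R))" using van' by simp
   moreover have "h j + f * R \<in> PV (coords u r)" unfolding R_def using hP f(1) fj by (intro PV_basic PV_sum)
   ultimately have "vanish u r G (h j + f * R)" using irreducible_vanish[OF r G fj] nf by blast
   then have "vanish u r F (h j + f * R)" using FG unfolding vanish_def by blast
   then have "vanish u r F (h j)" using f(2) by (simp add: vanish_def meval_add meval_mult)
   then show ?case using I(5)[unfolded indep_on_def, rule_format, of "\<lambda>t. \<alpha> (t, j)"] unfolding h_def by blast
  qed
  then show "\<forall>t\<in>I'. \<alpha> t = 0" by (auto simp: I'_def)
 qed
 have fin: "finite I'" using I(1) by (simp add: I'_def)
 obtain b where b: "bij_betw b {..<card I'} I'" using ex_bij_betw_nat_finite[OF fin] by (auto simp: lessThan_atLeast0)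
 have "indep_on u r G {..<card I'} (w' \<circ> b)"
  unfolding indep_on_def
 proof (intro allI impI ballI)
  fix \<alpha> t assume *: "vanish u r G (\<Sum>t\<in>{..<card I'}. mcst (\<alpha> t) * (w' \<circ> b) t)" "t \<in> {..<card I'}"
  let ?b = "inv_into {..<card I'} b"
  have "(\<Sum>t\<in>I'. mcst (\<alpha> (?b t)) * w' t) = (\<Sum>t\<in>{..<card I'}. mcst (\<alpha> (?b (b t))) * w' (b t))"
   by (rule sum.reindex_bij_betw[OF b, symmetric])
  also have "\<dots> = (\<Sum>t\<in>{..<card I'}. mcst (\<alpha> t) * (w' \<circ> b) t)"
   by (intro sum.cong refl) (use b in "auto simp: bij_betw_def")
  finally have "vanish u r G (\<Sum>t\<in>I'. mcst (\<alpha> (?b t)) * w' t)" using *(1) by simp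
  moreover have "b t \<in> I'" "?b (b t) = t" using b *(2) by (auto simp: bij_betw_def)
  ultimately show "\<alpha> t = 0" using ind[unfolded indep_on_def, rule_format, of "\<lambda>t. \<alpha> (?b t)" "b t"] by simp
 qed
 moreover have "card I' = (e + 1) ^ Suc D" by (simp add: I'_def card_cartesian_product I(2) algebra_simps)
 moreover have "(w' \<circ> b) t \<in> PV (coords u r) \<and> expb ((K + d) * e) ((w' \<circ> b) t)" if "t \<in> {..<card I'}" for t
 proof -
  have "b t \<in> I'" using b that by (auto simp: bij_betw_def)
  then obtain s j where s: "b t = (s, j)" "s \<in> I" "j <= e" by (auto simp: I'_def)
  have "expb (K * e + d * j) (w s * f ^ j)" using I(4)[OF s(2)] f(4) by (intro expb_mult expb_power)
  then have "expb ((K + d) * e) (w s * f ^ j)" by (rule expb_mono) (use s(3) in "simp add: distrib_right")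
  then show ?thesis using I(3)[OF s(2)] fj s by (simp add: w'_def)
 qed
 ultimately show "\<exists>(I :: nat set) w. finite I \<and> card I = (e + 1) ^ Suc D \<and> (\<forall>t\<in>I. w t \<in> PV (coords u r) \<and> expb ((K + d) * e) (w t)) \<and> indep_on u r G I w"
  by (intro exI[of _ "{..<card I'}"] exI[of _ "w' \<circ> b"]) auto
qed

text \<open>Independent functions are in particular independent polynomials, and the polynomials
  with exponents at most \<open>K * e\<close> form a space whose dimension grows only like the power
  \<open>card (coords u r)\<close> of \<open>e\<close>.\<close>

lemma growth_bound:
 fixes G :: "'k::field mat set"
 assumes gr: "growth u r G D K" and fin: "finite (coords u r)"
 shows "D <= card (coords u r)"
proof (rule ccontr)
 let ?N = "card (coords u r)"
 assume D: "\<not> D <= ?N"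
 \<comment> \<open>With \<open>?N\<close> coordinates this choice violates the inequality
   \<open>e + 1 <= (K + 1) ^ ?N\<close>, to which the comparison of the two counts is
   reduced.\<close>
 define e where "e = (K + 1) ^ ?N"
 obtain I :: "nat set" and w where I: "finite I" "card I = (e + 1) ^ D" "\<And>t. t \<in> I ==> w t \<in> PV (coords u r)"
   "\<And>t. t \<in> I ==> expb (K * e) (w t)" "indep_on u r G I w"
  using gr unfolding growth_def by metis
 let ?M = "boxmon (coords u r) (K * e)"
 have M: "finite ?M" "card ?M = (K * e + 1) ^ ?N" using boxmon_card[OF fin] by blast+
 have "card I <= card ?M"
 proof (rule indep_card_le[OF subsp_0 I(1) M(1)])
  show "indep_mod {\<lambda>_. 0} (\<lambda>t. lookup (w t)) I"
   unfolding indep_mod_def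
  proof (intro allI impI)
   fix \<alpha> assume *: "lcomb \<alpha> (\<lambda>t. lookup (w t)) I \<in> {\<lambda>_. 0}"
   have L: "lookup (mcst a * p) m = a * lookup p m" for a and p :: "'k cpol" and m
    unfolding lookup_times by (cases "a = 0") (simp_all add: in_keys_iff cong: if_cong)
   have "(\<Sum>t\<in>I. mcst (\<alpha> t) * w t) = 0"
   proof (rule poly_mapping_eqI)
    fix m
    have "lookup (\<Sum>t\<in>I. mcst (\<alpha> t) * w t) m = lcomb \<alpha> (\<lambda>t. lookup (w t)) I m"
     unfolding lookup_sum L lcomb_def ..
    then show "lookup (\<Sum>t\<in>I. mcst (\<alpha> t) * w t) m = lookup 0 m"
     using fun_cong[OF singletonD[OF *], of m] by (simp only: lookup_zero)
   qed
   then have "vanish u r G (\<Sum>t\<in>I. mcst (\<alpha> t) * w t)" unfolding vanish_def by (intro ballI) (simp only: meval_0)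
   then show "\<forall>t\<in>I. \<alpha> t = 0" using I(5) unfolding indep_on_def by blast
  qed
  fix t assume t: "t \<in> I"
  have "lookup (w t) \<in> Vs ?M"
   using I(3,4)[OF t] unfolding Vs_def boxmon_mem[OF fin] PV_iff expb_def by (auto simp: in_keys_iff)
  then show "spanned_mod {\<lambda>_. 0} uvec ?M (lookup (w t))"
   unfolding spanned_0_iff using Vs_expand[OF M(1)] by blast
 qed
 then have "(e + 1) ^ D <= (K * e + 1) ^ ?N" using I(2) M(2) by simp
 moreover have "(e + 1) ^ Suc ?N <= (e + 1) ^ D" using D by (intro power_increasing) auto
 moreover have "(K * e + 1) ^ ?N <= ((K + 1) * (e + 1)) ^ ?N" by (rule power_mono) (simp_all add: algebra_simps)
 ultimately have "(e + 1) ^ Suc ?N <= ((K + 1) * (e + 1)) ^ ?N" by linarith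
 then have "(e + 1) * (e + 1) ^ ?N <= (K + 1) ^ ?N * (e + 1) ^ ?N" by (simp only: power_mult_distrib power_Suc)
 then have "e + 1 <= (K + 1) ^ ?N" by (rule mult_right_le_imp_le) simp
 then show False by (simp add: e_def)
qed

section \<open>Irreducibility, ideal and codimension of the box variety\<close>

context box_params begin

lemma r1: "1 <= r"
 using k by simp

lemma coord_val_PV:
 fixes p :: "'k::field cpol"
 shows "p \<in> PV (coords u r) ==> meval (coord_val u r (cmat u r c)) p = meval c p"
 by (rule meval_cong, assumption, rule coord_val_cmat[OF r1 ru])

lemma bx_cmat: "cmat u r c \<in> bx u r k l \<longleftrightarrow> in_box r k l c"
proof -
 have "in_box r k l (coord_val u r (cmat u r c)) \<longleftrightarrow> in_box r k l c"
  unfolding in_box_iff by (intro all_cong) (simp only: coord_val_PV[OF bgen_PV])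
 then show ?thesis using cmat_mem[OF r1 ru, of c] by (simp add: bx_def)
qed

lemma bx_zs: "bx u r k l = zs u r (bgen r k l ` {..<k + l - 2})"
 by (auto simp: bx_def zs_def in_box_iff)

lemma bx_closed: "closedin (zariski (NN u r)) (bx u r k l)"
 unfolding closedin_iff[OF r1 ru] bx_zs by (rule exI[of _ "bgen r k l ` {..<k + l - 2}"]) (auto intro: bgen_PV)

lemma vanish_bx:
 assumes "infinite (UNIV :: 'k::field set)" "p \<in> PV (coords u r)"
 shows "vanish u r (bx u r k l :: 'k mat set) p \<longleftrightarrow> p \<in> J"
proof -
 have "vanish u r (bx u r k l :: 'k mat set) p \<longleftrightarrow> (\<forall>c :: coord => 'k. in_box r k l c --> meval c p = 0)"
  using bx_cmat coord_val_PV[OF assms(2)] unfolding vanish_def by (auto simp: bx_def[of u r k l]) metis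
 then show ?thesis using J_eq[OF assms] by simp
qed

text \<open>A closed set that does not contain the box variety satisfies an equation outside
  \<open>J\<close>; a point of the box variety at which two such equations are nonzero lies in
  neither of the two closed sets.\<close>

lemma bx_irreducible:
 assumes inf: "infinite (UNIV :: 'k::field set)"
 shows "irreducible_closed (zariski (NN u r)) (bx u r k l :: 'k mat set)"
 unfolding irreducible_closed_def
proof (intro conjI allI impI bx_closed)
 have "in_box r k l (diag_point k l :: coord => 'k)" by (rule diag_point_in_box[OF k(1) l(1)])
 then show "(bx u r k l :: 'k mat set) \<noteq> {}" unfolding bx_cmat[symmetric] by blast
 fix C D :: "'k mat set"
 assume *: "closedin (zariski (NN u r)) C \<and> closedin (zariski (NN u r)) D \<and> bx u r k l \<subseteq> C \<union> D"
 show "bx u r k l \<subseteq> C \<or> bx u r k l \<subseteq> D"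
 proof (rule ccontr)
  assume n: "\<not> ?thesis"
  have ex: "\<exists>p\<in>PV (coords u r). vanish u r Z p \<and> p \<notin> J" if Z: "closedin (zariski (NN u r)) Z" "\<not> bx u r k l \<subseteq> Z" for Z :: "'k mat set"
  proof -
   have "bx u r k l \<inter> Z \<subset> bx u r k l" using Z(2) by blast
   moreover have "closedin (zariski (NN u r)) (bx u r k l \<inter> Z)" using bx_closed Z(1) by (rule closedin_Int)
   moreover have "Z \<subseteq> NN u r" using closedin_subset[OF Z(1)] by simp
   ultimately obtain S where S: "S \<subseteq> PV (coords u r)" "Z = zs u r S" using Z(1) unfolding closedin_iff[OF r1 ru] by blast
   obtain B where "B \<in> bx u r k l" "B \<notin> Z" using Z(2) by blast
   then obtain p where p: "p \<in> S" "meval (coord_val u r B) p \<noteq> 0" unfolding S(2) zs_def bx_def by blast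
   then have "p \<notin> J" using vanish_bx[OF inf] S(1) \<open>B \<in> bx u r k l\<close> unfolding vanish_def by blast
   then show ?thesis using p(1) S unfolding vanish_def zs_def by blast
  qed
  obtain p q where p: "p \<in> PV (coords u r)" "vanish u r C p" "p \<notin> J" and q: "q \<in> PV (coords u r)" "vanish u r D q" "q \<notin> J"
   using ex[of C] ex[of D] * n by blast
  obtain c where "in_box r k l c" "meval c p \<noteq> 0" "meval c q \<noteq> 0" using nonvanishing_point[OF inf p(1,3) q(1,3)] by blast
  then have "cmat u r c \<in> bx u r k l" "cmat u r c \<notin> C" "cmat u r c \<notin> D"
   using p q coord_val_PV bx_cmat unfolding vanish_def by (metis, metis, metis)
  then show False using * by blast
 qed
qed

lemma genideal_J: "genideal (coord_ring u r) (box_equations r k l) = (J :: 'k::field cpol set)"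
proof
 interpret R: cring "coord_ring u r :: 'k cpol ring" by (rule cring_coord_ring)
 have car: "carrier (coord_ring u r :: 'k cpol ring) = PV (coords u r)" by (simp add: coord_ring_def PV_def)
 have sel: "a \<otimes>\<^bsub>coord_ring u r\<^esub> b = a * b" "a \<oplus>\<^bsub>coord_ring u r\<^esub> b = a + b" "\<zero>\<^bsub>coord_ring u r\<^esub> = (0 :: 'k cpol)" for a b :: "'k cpol"
  by (simp_all add: coord_ring_def)
 have sub: "box_equations r k l \<subseteq> carrier (coord_ring u r :: 'k cpol ring)"
  unfolding car box_equations_bgen using bgen_PV by blast
 have JP: "J \<subseteq> (PV (coords u r) :: 'k cpol set)"
  unfolding J_def idl_def using bgen_PV by (auto intro!: PV_sum)
 have "ideal (J :: 'k cpol set) (coord_ring u r)"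
 proof (rule idealI[OF R.ring_axioms])
  show "subgroup J (add_monoid (coord_ring u r :: 'k cpol ring))"
  proof (rule R.add.subgroupI)
   show "J \<subseteq> carrier (coord_ring u r :: 'k cpol ring)" using JP car by simp
   show "(J :: 'k cpol set) \<noteq> {}" unfolding J_def using idl_0 by blast
   show "\<ominus>\<^bsub>coord_ring u r\<^esub> a \<in> J" if a: "a \<in> J" for a :: "'k cpol"
   proof -
    have "a \<in> PV (coords u r)" "- a \<in> PV (coords u r)" using a JP PV_basic(6) by blast+
    then have "\<ominus>\<^bsub>coord_ring u r\<^esub> a = - a" by (intro R.minus_equality) (simp_all add: car sel)
    also have "- a = - 1 * a" by simp
    also have "\<dots> \<in> J" unfolding J_def by (rule idl_mult[OF a[unfolded J_def]]) simp
    finally show ?thesis .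
   qed
   show "a \<oplus>\<^bsub>coord_ring u r\<^esub> b \<in> J" if "a \<in> J" "b \<in> J" for a b :: "'k cpol"
    using that idl_add unfolding J_def sel by blast
  qed
  show "x \<otimes>\<^bsub>coord_ring u r\<^esub> a \<in> J" "a \<otimes>\<^bsub>coord_ring u r\<^esub> x \<in> J" if "a \<in> J" "x \<in> carrier (coord_ring u r)" for a x :: "'k cpol"
   using idl_mult[of a "coords u r" "bgen r k l" "k + l - 2" x] that unfolding J_def car sel by (simp_all only: mult.commute)
 qed
 then show "genideal (coord_ring u r) (box_equations r k l) \<subseteq> (J :: 'k cpol set)"
  by (rule R.genideal_minimal) (auto simp: box_equations_bgen J_def intro: idl_gen)
 interpret G: ideal "genideal (coord_ring u r) (box_equations r k l) :: 'k cpol set" "coord_ring u r"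
  by (rule R.genideal_ideal[OF sub])
 show "(J :: 'k cpol set) \<subseteq> genideal (coord_ring u r) (box_equations r k l)"
 proof
  fix p :: "'k cpol" assume "p \<in> J"
  then obtain q where q: "\<forall>i. q i \<in> PV (coords u r)" "p = (\<Sum>i<k + l - 2. q i * bgen r k l i)" unfolding J_def idl_def by blast
  have "(\<Sum>i<n. q i * bgen r k l i) \<in> genideal (coord_ring u r) (box_equations r k l)" if "n <= k + l - 2" for n
   using that
  proof (induction n)
   case 0
   then show ?case using G.zero_closed unfolding sel by simp
  next
   case (Suc n)
   then have "bgen r k l n \<in> (box_equations r k l :: 'k cpol set)" unfolding box_equations_bgen by auto
   then have "bgen r k l n \<in> genideal (coord_ring u r) (box_equations r k l :: 'k cpol set)" using R.genideal_self[OF sub] by blast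
   then have "q n * bgen r k l n \<in> genideal (coord_ring u r) (box_equations r k l)"
    using G.I_l_closed[of "bgen r k l n" "q n"] q(1) unfolding car sel by blast
   then show ?case using Suc G.a_closed[of "\<Sum>i<n. q i * bgen r k l i" "q n * bgen r k l n"] unfolding sel by simp
  qed
  then show "p \<in> genideal (coord_ring u r) (box_equations r k l)" unfolding q(2) by blast
 qed
qed

lemma box_variety_bx: "(box_variety u r k l :: 'k::field mat set) = bx u r k l"
proof -
 have "(\<forall>p\<in>(J :: 'k cpol set). meval c p = 0) \<longleftrightarrow> in_box r k l c" for c
  using J_vanish idl_gen[of _ "k + l - 2" "bgen r k l" "coords u r"] unfolding in_box_iff J_def by blast
 then show ?thesis unfolding box_variety_def genideal_J zero_locus_def bx_def by simp
qed

text \<open>By \<open>solve\<close>, the free coordinates can be prescribed arbitrarily as long as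
  \<open>g_0\<close> is nonzero, so no nonzero polynomial in them vanishes on the box
  variety.\<close>

lemma free_J:
 assumes inf: "infinite (UNIV :: 'k::field set)" and p: "p \<in> PV free" "p \<in> (J :: 'k cpol set)"
 shows "p = 0"
proof (rule ccontr)
 assume "p \<noteq> 0"
 have fin: "finite free" using free_basic finite_subset by blast
 have "lookup (mvar (Cg 0) :: 'k cpol) (single (Cg 0) 1) = 1" by (simp add: mvar_def)
 then have g: "mvar (Cg 0) \<in> PV free" "(mvar (Cg 0) :: 'k cpol) \<noteq> 0" using free_basic(2) by auto
 have "mvar (Cg 0) * p \<noteq> 0" by (rule mpol_mult_nonzero[OF inf fin g(1) p(1) g(2) \<open>p \<noteq> 0\<close>])
 then obtain c where c: "meval c (mvar (Cg 0) * p) \<noteq> 0" using mpol_nonzero_point[OF inf fin PV_basic(5)[OF g(1) p(1)]] by blast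
 then have "c (Cg 0) \<noteq> 0" by (auto simp: meval_mult)
 then obtain c' where c': "in_box r k l c'" "\<And>x. x \<in> free ==> c' x = c x" using solve by blast
 have "meval c' p = meval c p" by (rule meval_cong[OF p(1) c'(2)])
 then show False using c J_vanish[OF p(2) c'(1)] by (simp add: meval_mult)
qed

lemma growth_bx:
 assumes inf: "infinite (UNIV :: 'k::field set)"
 shows "growth u r (bx u r k l :: 'k mat set) (card free) 1"
 unfolding growth_def
proof
 fix e
 have fin: "finite free" using free_basic finite_subset by blast
 let ?M = "boxmon free e"
 have M: "finite ?M" "card ?M = (e + 1) ^ card free" using boxmon_card[OF fin] by blast+
 obtain b where b: "bij_betw b {..<card ?M} ?M" using ex_bij_betw_nat_finite[OF M(1)] by (auto simp: lessThan_atLeast0)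
 define w :: "nat => 'k cpol" where "w = (\<lambda>t. single (b t) 1)"
 have bM: "keys (b t) \<subseteq> free" "\<And>x. lookup (b t) x <= e" if "t < card ?M" for t
  using b that boxmon_mem[OF fin] by (auto simp: bij_betw_def)
 have "indep_on u r (bx u r k l :: 'k mat set) {..<card ?M} w"
  unfolding indep_on_def
 proof (intro allI impI ballI)
  fix \<alpha> t assume *: "vanish u r (bx u r k l :: 'k mat set) (\<Sum>t\<in>{..<card ?M}. mcst (\<alpha> t) * w t)" "t \<in> {..<card ?M}"
  have P: "(\<Sum>t\<in>{..<card ?M}. mcst (\<alpha> t) * w t) \<in> PV free"
   using bM by (auto simp: w_def intro!: PV_sum PV_basic PV_single)
  then have "(\<Sum>t\<in>{..<card ?M}. mcst (\<alpha> t) * w t) = 0"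
   using free_J[OF inf P] vanish_bx[OF inf PV_mono[OF P free_basic(1)]] *(1) by blast
  then have "0 = lookup (\<Sum>t\<in>{..<card ?M}. mcst (\<alpha> t) * w t) (b t)" by simp
  also have "\<dots> = (\<Sum>s\<in>{..<card ?M}. if s = t then \<alpha> s else 0)"
   unfolding lookup_sum w_def mult_single
  proof (intro sum.cong refl)
   fix s assume "s \<in> {..<card ?M}"
   then have "b s = b t \<longleftrightarrow> s = t" using b *(2) by (auto simp: bij_betw_def inj_on_def)
   then show "lookup (single (0 + b s) (\<alpha> s * 1)) (b t) = (if s = t then \<alpha> s else 0)"
    by (simp add: lookup_single when_def)
  qed
  finally show "\<alpha> t = 0" using *(2) by simp
 qed
 moreover have "w t \<in> PV (coords u r) \<and> expb (1 * e) (w t)" if "t \<in> {..<card ?M}" for t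
  using bM[of t] that free_basic(1) by (auto simp: w_def expb_def intro!: PV_single)
 ultimately show "\<exists>(I :: nat set) w. finite I \<and> card I = (e + 1) ^ card free \<and>
   (\<forall>t\<in>I. w t \<in> PV (coords u r) \<and> expb (1 * e) (w t)) \<and> indep_on u r (bx u r k l :: 'k mat set) I w"
  using M(2) by (intro exI[of _ "{..<card ?M}"] exI[of _ w]) simp
qed

text \<open>Every strict inclusion raises the growth exponent by one. It starts at
  \<open>card free\<close> and cannot exceed the number of coordinates; the difference is at most
  the number of coordinates solved for.\<close>

lemma chain_bound:
 fixes F :: "nat => 'k::field mat set"
 assumes inf: "infinite (UNIV :: 'k set)" and F: "F 0 = bx u r k l"
  "\<forall>i\<le>n. irreducible_closed (zariski (NN u r)) (F i)" "\<forall>i<n. F i \<subset> F (Suc i)"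
 shows "n <= k + l - 2"
proof -
 have "\<exists>K. growth u r (F i) (card free + i) K" if "i <= n" for i
  using that
 proof (induction i)
  case 0
  then show ?case using growth_bx[OF inf] F(1) by auto
 next
  case (Suc i)
  then obtain K where K: "growth u r (F i) (card free + i) K" by auto
  have irr: "irreducible_closed (zariski (NN u r)) (F i)" "irreducible_closed (zariski (NN u r)) (F (Suc i))" and sub: "F i \<subset> F (Suc i)"
   using F Suc.prems by simp_all
  have "F (Suc i) \<subseteq> NN u r" using irr(2) closedin_subset unfolding irreducible_closed_def by fastforce
  then obtain f where f: "f \<in> PV (coords u r)" "vanish u r (F i) f" "\<not> vanish u r (F (Suc i)) f"
   using closed_separate[OF r1 ru _ sub] irr(1) unfolding irreducible_closed_def by blast
  obtain d where "expb d f" using expb_exists by blast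
  then show ?case using growth_step[OF r1 ru irr(2) _ f _ K] sub by auto
 qed
 then obtain K where "growth u r (F n) (card free + n) K" by blast
 then have "card free + n <= card (coords u r)" by (rule growth_bound) (rule free_basic)
 also have "coords u r \<subseteq> free \<union> (Ca ` {1..<k} \<union> (Cb ` {1..<m} \<union> Ch ` {..<k + l - r}))" (is "_ \<subseteq> free \<union> ?X")
  by (auto simp: free_def coords_def)
 then have "card (coords u r) <= card (free \<union> ?X)" using free_basic(1,3) finite_subset by (intro card_mono) auto
 also have "\<dots> <= card free + card ?X" by (rule card_Un_le)
 also have "card ?X <= (k - 1) + ((m - 1) + (k + l - r))"
  using card_image_le[of "{1..<k}" Ca] card_image_le[of "{1..<m}" Cb] card_image_le[of "{..<k + l - r}" Ch]
  by (intro order_trans[OF card_Un_le] add_mono) simp_all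
 finally show ?thesis using m by linarith
qed

end

lemma in_box_smaller:
 assumes "1 <= k" "k < r" "1 <= l"
 shows "in_box r k (l + 1) c ==> in_box r k l c" "1 < k ==> in_box r k 1 c ==> in_box r (k - 1) 1 c"
 using assms unfolding in_box_def by (auto elim!: xdvd_le)

lemma codimension_bx:
 assumes inf: "infinite (UNIV :: 'k::field set)" and v: "1 <= k" "k < r" "1 <= l" "l <= u - r" "r < u"
 shows "codimension (zariski (NN u r)) (bx u r k l :: 'k mat set) = enat (k + l - 2)"
proof -
 \<comment> \<open>An explicit chain of length \<open>k + l - 2\<close>: the parameter
   \<open>l\<close> decreases to 1, after that \<open>k\<close> does, ending at
   \<open>bx u r 1 1\<close>. The diagonal point for the smaller parameters shows that each
   inclusion is strict.\<close>
 define F :: "nat => 'k mat set" where "F = (\<lambda>i. if i < l then bx u r k (l - i) else bx u r (k - (i - (l - 1))) 1)"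
 have BP: "box_params u r k' l'" if "1 <= k'" "k' <= k" "1 <= l'" "l' <= l" for k' l' using that v by unfold_locales auto
 have irr: "irreducible_closed (zariski (NN u r)) (F i)" if "i <= k + l - 2" for i
  unfolding F_def using that v by (auto intro!: box_params.bx_irreducible[OF BP inf])
 have ord: "\<not> (fps_X :: 'k fps) ^ (a + 1) dvd fps_X ^ a" for a
  unfolding fps_X_power_dvd_iff by (auto simp: fps_X_power_iff intro!: exI[of _ a])
 have strict: "F i \<subset> F (Suc i)" if i: "i < k + l - 2" for i
 proof (cases "Suc i < l")
  case True
  define l' where "l' = l - Suc i"
  have l': "1 <= l'" "l - i = l' + 1" "l' <= l" using True by (auto simp: l'_def)
  have "cmat u r (diag_point k l' :: coord => 'k) \<in> bx u r k l'"
   unfolding box_params.bx_cmat[OF BP[OF v(1) order_refl l'(1,3)]] by (rule diag_point_in_box[OF v(1) l'(1)])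
  moreover have "\<not> in_box r k (l' + 1) (diag_point k l' :: coord => 'k)"
   using ord[of "k + l'"] unfolding in_box_def diag_point_series[OF v(1) l'(1)] by simp
  then have "cmat u r (diag_point k l' :: coord => 'k) \<notin> bx u r k (l' + 1)"
   by (subst box_params.bx_cmat[OF BP]) (use v l' in auto)
  moreover have "(bx u r k (l' + 1) :: 'k mat set) \<subseteq> bx u r k l'" using in_box_smaller(1)[OF v(1,2) l'(1)] by (auto simp: bx_def)
  ultimately show ?thesis using True l'(2) unfolding F_def l'_def[symmetric] by (auto simp: l'_def)
 next
  case False
  define k' where "k' = k - (Suc i - (l - 1))"
  have k': "1 <= k'" "k - (i - (l - 1)) = k' + 1" "k' < k" "k' + 1 <= k" using False i v by (auto simp: k'_def)
  have "cmat u r (diag_point k' 1 :: coord => 'k) \<in> bx u r k' 1"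
   by (subst box_params.bx_cmat[OF BP]) (use v k' diag_point_in_box[OF k'(1)] in auto)
  moreover have "\<not> in_box r (k' + 1) 1 (diag_point k' 1 :: coord => 'k)"
   using ord[of k'] unfolding in_box_def diag_point_series[OF k'(1) order_refl] by simp
  then have "cmat u r (diag_point k' 1 :: coord => 'k) \<notin> bx u r (k' + 1) 1"
   by (subst box_params.bx_cmat[OF BP]) (use v k' in auto)
  moreover have "(bx u r (k' + 1) 1 :: 'k mat set) \<subseteq> bx u r k' 1" using in_box_smaller(2)[of "k' + 1" r 1] k' v by (auto simp: bx_def)
  moreover have "F i = bx u r (k' + 1) 1"
  proof (cases "i < l")
   case True
   then have "l - i = 1" "k = k' + 1" using False i k'(2) by simp_all
   then show ?thesis using True by (simp add: F_def)
  qed (simp only: F_def k'(2) if_False)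
  ultimately show ?thesis using False unfolding F_def k'_def[symmetric] by auto
 qed
 have "F 0 = bx u r k l" using v by (simp add: F_def)
 show ?thesis
  unfolding codimension_def
 proof (rule antisym)
  show "Sup {enat n |n. \<exists>F :: nat => 'k mat set. F 0 = bx u r k l \<and> (\<forall>i\<le>n. irreducible_closed (zariski (NN u r)) (F i)) \<and> (\<forall>i<n. F i \<subset> F (Suc i))} <= enat (k + l - 2)"
   by (rule Sup_least) (use box_params.chain_bound[OF BP[OF v(1) order_refl v(3) order_refl] inf] in auto)
  show "enat (k + l - 2) <= Sup {enat n |n. \<exists>F :: nat => 'k mat set. F 0 = bx u r k l \<and> (\<forall>i\<le>n. irreducible_closed (zariski (NN u r)) (F i)) \<and> (\<forall>i<n. F i \<subset> F (Suc i))}"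
   by (rule Sup_upper) (use \<open>F 0 = bx u r k l\<close> irr strict in blast)
 qed
qed

section \<open>Generic points, and the partitions with generic type
  \<open>(u, u - r)\<close>\<close>

lemma jmat_pow_zero:
 "(jmat ps :: 'k::field mat) ^\<^sub>m i = 0\<^sub>m (sum_list ps) (sum_list ps) \<longleftrightarrow> (\<forall>q\<in>set ps. q <= i)"
proof
 assume 0: "(jmat ps :: 'k mat) ^\<^sub>m i = 0\<^sub>m (sum_list ps) (sum_list ps)"
 have "ps ! s <= i" if s: "s < length ps" for s
 proof (rule ccontr)
  assume "\<not> ps ! s <= i"
  then have I: "(s, 0) \<in> Ix ps" "(s, i) \<in> Ix ps" using s by (auto simp: Ix_def)
  have "opk (Ix ps) (ix ps) (Ix ps) (ix ps) ((jmat ps :: 'k mat) ^\<^sub>m i) (uvec (s, 0)) (s, i) = 1"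
   unfolding opk_jmat_pow[OF uvec_Vs[OF I(1)]] using I(2) by (simp add: shift_def uvec_def)
  then show False
   unfolding opk_uvec[OF finite_Ix I] 0 using Ix_lt[OF I(1)] Ix_lt[OF I(2)] by simp
 qed
 then show "\<forall>q\<in>set ps. q <= i" by (metis in_set_conv_nth)
next
 assume le: "\<forall>q\<in>set ps. q <= i"
 show "(jmat ps :: 'k mat) ^\<^sub>m i = 0\<^sub>m (sum_list ps) (sum_list ps)"
 proof (rule level_nilpotent[OF indexing_ix jmat_carrier, where lev = snd])
  show "snd x < snd y" if "x \<in> Ix ps" "y \<in> Ix ps" "ent ps (jmat ps :: 'k mat) y x \<noteq> 0" for x y
   using that index_jmat[of "fst x" "snd x" ps "fst y" "snd y", where 'a = 'k] by (auto simp: of_bool_def split: if_splits)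
  show "snd x < i" if "x \<in> Ix ps" for x using that le by (fastforce simp: Ix_def dest: nth_mem)
 qed
qed

lemma type_pow_zero:
 fixes B :: "'k::field mat"
 assumes "has_jordan_type B P"
 shows "B ^\<^sub>m i = 0\<^sub>m (sum_mset P) (sum_mset P) \<longleftrightarrow> (\<forall>q\<in>#P. q <= i)"
proof -
 obtain S T where w: "S \<in> sqm (sum_mset P)" "T \<in> sqm (sum_mset P)"
  "S * T = 1\<^sub>m (sum_mset P)" "T * S = 1\<^sub>m (sum_mset P)" "B = S * jmat (parts P) * T"
  using assms by (rule has_jordan_typeE)
 have "B ^\<^sub>m i = 0\<^sub>m (sum_mset P) (sum_mset P) \<longleftrightarrow> (jmat (parts P) :: 'k mat) ^\<^sub>m i = 0\<^sub>m (sum_mset P) (sum_mset P)"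
  unfolding w(5) by (rule similar_pow_zero[OF w(1,2) _ w(3,4)]) (use jmat_carrier[of "parts P"] in simp)
 also have "\<dots> \<longleftrightarrow> (\<forall>q\<in>set (parts P). q <= i)" using jmat_pow_zero[of "parts P" i, where 'k = 'k] by simp
 finally show ?thesis by (metis mset_parts set_mset_mset)
qed

text \<open>Whether matrices of types \<open>P\<close> and \<open>Q\<close> can commute is a
  symmetric question: the base change of \<open>transport\<close> exchanges their roles.\<close>

lemma type_swap:
 fixes A :: "'k::field mat"
 assumes "has_jordan_type A P" "comm (parts Q) A" "is_partition Q"
 obtains B where "B \<in> nilpotent_commutator P" "has_jordan_type (B :: 'k mat) Q"
proof -
 let ?n = "sum_mset Q" and ?K = "jmat (parts Q) :: 'k mat"
 obtain S T where w: "S \<in> sqm ?n" "T \<in> sqm ?n"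
  "S * T = 1\<^sub>m ?n" "T * S = 1\<^sub>m ?n" "T * ?K * S \<in> nilpotent_commutator P"
  using transport[OF assms(1,2)] by metis
 have K: "?K \<in> sqm ?n" using jmat_carrier[of "parts Q"] by simp
 have "similar_mat_wit (T * ?K * S) ?K T S" unfolding similar_mat_wit_def Let_def using w K by auto
 then have "has_jordan_type (T * ?K * S) Q" using assms(3) unfolding has_jordan_type_iff similar_mat_def by blast
 then show ?thesis using that w(5) by blast
qed

definition pcoeff :: "nat => 'x set => (('x => 'k::field) => 'k fps) => bool" where
 "pcoeff n V F \<longleftrightarrow> (\<forall>j\<le>n. \<exists>q\<in>PV V. \<forall>c. meval c q = F c $ j)"

lemma pcoeff_const: "pcoeff n V (\<lambda>_. f)"
 unfolding pcoeff_def by (intro allI impI, rule_tac x = "mcst (f $ j)" in bexI) simp_all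

lemma pcoeff_add:
 assumes "pcoeff n V F" "pcoeff n V G"
 shows "pcoeff n V (\<lambda>c. F c + G c)"
 unfolding pcoeff_def
proof (intro allI impI)
 fix j assume "j <= n"
 then obtain p q where pq: "p \<in> PV V" "\<forall>c. meval c p = F c $ j" "q \<in> PV V" "\<forall>c. meval c q = G c $ j"
  using assms unfolding pcoeff_def by meson
 show "\<exists>q\<in>PV V. \<forall>c. meval c q = (F c + G c) $ j"
  by (rule bexI[of _ "p + q"]) (use pq in "simp_all add: meval_add")
qed

lemma pcoeff_mult:
 assumes "pcoeff n V F" "pcoeff n V G"
 shows "pcoeff n V (\<lambda>c. F c * G c)"
 unfolding pcoeff_def
proof (intro allI impI)
 fix j assume j: "j <= n"
 obtain f where f: "\<And>i. i <= n ==> f i \<in> PV V \<and> (\<forall>c. meval c (f i) = F c $ i)"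
  using assms(1) unfolding pcoeff_def by metis
 obtain g where g: "\<And>i. i <= n ==> g i \<in> PV V \<and> (\<forall>c. meval c (g i) = G c $ i)"
  using assms(2) unfolding pcoeff_def by metis
 show "\<exists>q\<in>PV V. \<forall>c. meval c q = (F c * G c) $ j"
 proof (intro bexI allI)
  show "(\<Sum>i=0..j. f i * g (j - i)) \<in> PV V" using f g j by (intro PV_sum PV_basic) auto
  show "meval c (\<Sum>i=0..j. f i * g (j - i)) = (F c * G c) $ j" for c
   unfolding meval_sum fps_mult_nth meval_mult using f g j by (intro sum.cong) auto
 qed
qed

lemma pcoeff_power: "pcoeff n V F ==> pcoeff n V (\<lambda>c. F c ^ i)"
 by (induction i) (simp_all add: pcoeff_const pcoeff_mult)

lemma pcoeff_diff: "pcoeff n V F ==> pcoeff n V G ==> pcoeff n V (\<lambda>c. F c - G c)"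
 using pcoeff_add[OF _ pcoeff_mult[OF pcoeff_const[of n V "-1"]]] by fastforce

lemma pcoeff_series:
 assumes "n + r < u"
 shows "pcoeff n (coords u r) sa" "pcoeff n (coords u r) sb" "pcoeff n (coords u r) sg" "pcoeff n (coords u r) sh"
proof -
 have *: "\<exists>q\<in>PV (coords u r). \<forall>c. meval c q = (if j = 0 then 0 else c x)" if "j \<noteq> 0 ==> x \<in> coords u r" for x j
  by (rule bexI[of _ "if j = 0 then 0 else mvar x"]) (use that in auto)
 show "pcoeff n (coords u r) sa" "pcoeff n (coords u r) sb"
  unfolding pcoeff_def sa_def sb_def fps_nth_Abs_fps by (intro allI impI *; use assms in simp)+
 have *: "\<exists>q\<in>PV (coords u r). \<forall>c. meval c q = c x" if "x \<in> coords u r" for x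
  by (rule bexI[of _ "mvar x"]) (use that in auto)
 show "pcoeff n (coords u r) sg" "pcoeff n (coords u r) sh"
  unfolding pcoeff_def sg_def sh_def fps_nth_Abs_fps by (intro allI impI *; use assms in simp)+
qed

text \<open>The coefficients entering \<open>good\<close> have indices up to \<open>2 * u\<close>,
  so they are polynomials in the coordinates only for a larger parameter \<open>u'\<close>.\<close>

lemma good_poly:
 assumes "2 * u + r < u'" "r < u"
 shows "\<exists>q\<in>PV (coords u' r). \<forall>c :: coord => 'k::field. meval c q = good u r k l i c"
proof -
 note s = pcoeff_series[OF assms(1)]
 have dd: "pcoeff (2 * u) (coords u' r) (\<lambda>c :: coord => 'k. dd r c ^ i)"
  unfolding dd_def by (intro pcoeff_power pcoeff_diff pcoeff_mult pcoeff_const s)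
 have al: "pcoeff (2 * u) (coords u' r) (\<lambda>c :: coord => 'k. al r c i) \<and> pcoeff (2 * u) (coords u' r) (\<lambda>c :: coord => 'k. ga r c i)"
  by (induction i) (auto intro!: pcoeff_add pcoeff_mult pcoeff_const s)
 have "nu u r k l i <= 2 * u" by (simp add: nu_def min_le_iff_disj)
 then have "nu u r k l i - (u - r) <= 2 * u" by simp
 with \<open>nu u r k l i <= 2 * u\<close> show ?thesis
  using dd al bexI[of "\<lambda>q. \<forall>c :: coord => 'k. meval c q = 1" 1 "PV (coords u' r)"]
  unfolding good_def pcoeff_def by (cases "nu u r k l i = 2 * u - r"; cases "nu u r k l i = i * (k + l)") simp_all
qed

text \<open>From \<open>i = 2 * u\<close> on \<open>good\<close> is therefore 1, so a generic point
  has to satisfy only finitely many conditions.\<close>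

lemma nu_top:
 assumes "1 <= k" "k < r" "1 <= l" "r < u" "2 * u <= i"
 shows "nu u r k l i = 2 * u - r"
proof -
 have k: "i <= i * k" "i <= i * (k + l)" using assms by simp_all
 obtain j where j: "i = j + 2" "u <= j + 1" using assms by (intro that[of "i - 2"]) auto
 have "1 <= min l (r - k)" using assms by simp
 then have "j * 1 <= j * min l (r - k)" by (rule mult_le_mono2)
 moreover have "u + i * min l (r - k) - 2 * min l (r - k) = u + j * min l (r - k)" unfolding j(1) by (simp add: algebra_simps)
 ultimately have "2 * u - r <= u + i * min l (r - k) - 2 * min l (r - k)" using assms j by linarith
 moreover have "2 * u - r <= i * (k + l)" "2 * u - r <= u - r + i * k" "i \<noteq> 0" using assms k by linarith+
 ultimately show ?thesis unfolding nu_def by simp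
qed

context box_params begin

lemma generic_point:
 fixes p :: "'k::field cpol"
 assumes inf: "infinite (UNIV :: 'k set)" and p: "p \<in> PV (coords u r)" "p \<notin> J"
 obtains c P where "in_box r k l c" "meval c p \<noteq> 0" "has_jordan_type (cmat u r c) P" "\<forall>i. prof P i = nu u r k l i"
proof -
 \<comment> \<open>The conditions \<open>good\<close> reach beyond the coordinates for
   \<open>u\<close>. Neither the box equations nor \<open>in_box\<close> mention \<open>u\<close>,
   so the point is sought in the coordinate ring for \<open>3 * u + 1\<close>, where
   \<open>good_poly\<close> applies; \<open>cmat u r\<close> then uses only the truncation.\<close>
 let ?u = "3 * u + 1"
 interpret W: box_params ?u r k l using k l ru by unfold_locales auto
 have sub: "coords u r \<subseteq> coords ?u r" by (auto simp: coords_def)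
 have pW: "p \<in> PV (coords ?u r)" "p \<notin> W.J" using PV_mono[OF p(1) sub] p J_eq[OF inf p(1)] W.J_vanish by blast+
 have "\<exists>q\<in>PV (coords ?u r). \<forall>c :: coord => 'k. meval c q = good u r k l i c" for i
  by (rule good_poly) (use ru in auto)
 then obtain G where G: "\<And>i. G i \<in> PV (coords ?u r)" "\<And>i c. meval (c :: coord => 'k) (G i) = good u r k l i c" by metis
 have GJ: "G i \<notin> W.J" if i: "1 <= i" for i
  using good_nonempty[OF k l ru i, where 'k = 'k] W.J_vanish G(2) by metis
 \<comment> \<open>Each \<open>G i\<close> with \<open>1 <= i\<close> is nonzero somewhere on the
   box locus, and \<open>nonvanishing_point\<close> keeps the growing product outside the
   ideal.\<close>
 have "p * (\<Prod>i=1..N. G i) \<in> PV (coords ?u r) \<and> p * (\<Prod>i=1..N. G i) \<notin> W.J" for N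
 proof (induction N)
  case (Suc N)
  then obtain c where c: "in_box r k l c" "meval c (p * (\<Prod>i=1..N. G i)) \<noteq> 0" "meval c (G (Suc N)) \<noteq> 0"
   using W.nonvanishing_point[OF inf _ _ G(1) GJ, of "p * (\<Prod>i=1..N. G i)" "Suc N"] by auto
  then have "meval c (p * (\<Prod>i=1..Suc N. G i)) \<noteq> 0" by (simp add: meval_mult)
  then show ?case using c(1) W.J_vanish pW(1) PV_prod[of "{1..Suc N}" G] G(1) by (metis PV_basic(5))
 qed (use pW in simp)
 then obtain c where c: "in_box r k l c" "meval c (p * (\<Prod>i=1..2 * u. G i)) \<noteq> 0"
  using W.J_eq[OF inf, of "p * (\<Prod>i=1..2 * u. G i)"] by blast
 have "good u r k l i c \<noteq> 0" if "1 <= i" for i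
 proof (cases "i <= 2 * u")
  case True
  then show ?thesis using c(2) that unfolding meval_mult meval_prod G(2) by simp
 next
  case False
  then show ?thesis using nu_top[of k r l u i] k l ru by (simp add: good_def)
 qed
 then obtain P where "has_jordan_type (cmat u r c) P" "\<forall>i. prof P i = nu u r k l i"
  using good_type[OF k l ru c(1)] by blast
 then show ?thesis using that c by (simp add: meval_mult)
qed

lemma type_exists:
 assumes inf: "infinite (UNIV :: 'k::field set)"
 obtains A P where "A \<in> NN u r" "has_jordan_type (A :: 'k mat) P" "\<forall>i. prof P i = nu u r k l i"
proof -
 have "(1 :: 'k cpol) \<notin> J" using J_vanish[OF _ diag_point_in_box[OF k(1) l(1)], of "1 :: 'k cpol"] by (metis meval_1 zero_neq_one)
 from generic_point[OF inf PV_basic(2) this] obtain c P where "has_jordan_type (cmat u r c :: 'k mat) P" "\<forall>i. prof P i = nu u r k l i" .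
 then show ?thesis by (rule that[OF cmat_mem[OF r1 ru]])
qed

text \<open>By \<open>leveled_in_box\<close> the locus lies in the closed box variety. Conversely,
  an equation of the closure outside \<open>J\<close> would be nonzero at some generic point; but
  the Jordan type of that point has profile \<open>nu\<close>, hence is \<open>P\<close>, and the
  point belongs to the locus.\<close>

lemma closure_locus:
 assumes inf: "infinite (UNIV :: 'k::field set)" and L: "leveled P u r k l" and P: "is_partition P"
 shows "zariski (NN u r) closure_of jordan_locus {#u, u - r#} P = (bx u r k l :: 'k mat set)"
proof (rule antisym)
 let ?T = "zariski (NN u r :: 'k mat set)" and ?W = "jordan_locus {#u, u - r#} P :: 'k mat set"
 have "?W \<subseteq> bx u r k l"
 proof
  fix B assume B: "B \<in> ?W"
  then have N: "B \<in> NN u r" and t: "has_jordan_type B P" by (simp_all add: jordan_locus_def)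
  have "in_box r k l (coord_val u r B)"
   by (rule leveled_in_box[OF L]) (use t nilpotent_commutator_cmat[OF r1 ru N] in simp)
  then show "B \<in> bx u r k l" using N by (simp add: bx_def)
 qed
 then show "?T closure_of ?W \<subseteq> bx u r k l" by (rule closure_of_minimal[OF _ bx_closed])
 obtain S where S: "S \<subseteq> PV (coords u r)" "?T closure_of ?W = zs u r S"
  using closedin_closure_of[of ?T ?W] unfolding closedin_iff[OF r1 ru] by blast
 have "p \<in> J" if p: "p \<in> S" for p
 proof (rule ccontr)
  assume "p \<notin> J"
  have pV: "p \<in> PV (coords u r)" using p S(1) by blast
  obtain c P' where "in_box r k l c" and c: "meval c p \<noteq> 0" "has_jordan_type (cmat u r c) P'" "\<forall>i. prof P' i = nu u r k l i"
   using generic_point[OF inf pV \<open>p \<notin> J\<close>] .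
  have "is_partition P'" using c(2) by (simp add: has_jordan_type_iff)
  moreover have "prof P' i = prof P i" for i using c(3) L by (simp add: leveled_def)
  ultimately have "P' = P" by (rule prof_inject[OF _ P])
  then have "cmat u r c \<in> ?W" unfolding jordan_locus_def using c(2) cmat_mem[OF r1 ru, of c] by blast
  moreover have "?W \<subseteq> ?T closure_of ?W" by (rule closure_of_subset) (auto simp: jordan_locus_def)
  ultimately have "cmat u r c \<in> zs u r S" unfolding S(2) by blast
  then have "meval (coord_val u r (cmat u r c)) p = 0" using p unfolding zs_def by blast
  then show False using c(1) coord_val_PV[OF pV] by simp
 qed
 then show "bx u r k l \<subseteq> ?T closure_of ?W" unfolding S(2) zs_def bx_def using J_vanish by blast
qed

end

lemma size_dim:
 assumes "B \<in> nilpotent_commutator P" "has_jordan_type B Q"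
 shows "sum_mset P = sum_mset Q"
proof -
 have "B \<in> sqm (sum_mset Q)" using assms(2) by (rule has_jordan_typeE)
 moreover have "B \<in> sqm (sum_mset P)"
  using assms(1) commD(1)[of "parts P" B] by (simp add: nilpotent_commutator_iff)
 ultimately show ?thesis by auto
qed

lemma two_parts_cases:
 fixes B :: "'k::field mat"
 assumes B: "B \<in> nilpotent_commutator P" "has_jordan_type B {#u, u - r#}" and P: "is_partition P" and ru: "r < u"
 shows "(\<exists>j x y. 1 <= j \<and> 1 <= x \<and> (j = 1 --> y = 0) \<and> P = replicate_mset x j + replicate_mset y (j - 1)) \<or>
  (\<exists>u r k l. leveled P u r k l)"
proof (rule cluster_cases[OF B(1) P])
 have n: "sum_mset P = u + (u - r)" using size_dim[OF B] by simp
 then show "P \<noteq> {#}" using ru by auto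
 show I: "indexing (sum_mset P) (Ix (parts P)) (ix (parts P))" using indexing_ix[of "parts P"] by simp
 have "B \<in> sqm (sum_mset P)"
  using B(1) commD(1)[of "parts P" B] by (simp add: nilpotent_commutator_iff)
 then have "B ^\<^sub>m 1 = B" by simp
 moreover have "prof {#u, u - r#} 1 = 2" using ru by simp
 ultimately show "corank (Vs (Ix (parts P))) (opk (Ix (parts P)) (ix (parts P)) (Ix (parts P)) (ix (parts P)) B) 2"
  using corank_jordan_type[OF B(2), of "Ix (parts P)" "ix (parts P)" 1] I size_dim[OF B] by metis
qed

lemma cluster_prof:
 assumes "P = replicate_mset x j + replicate_mset y (j - 1)" "1 <= j" "1 <= x" "j = 1 --> y = 0"
 shows "prof P i = min (i * (x + y)) (sum_mset P)" "x + y <= sum_mset P" "is_partition P"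
proof -
 obtain d where d: "j = Suc d" using assms(2) by (cases j) auto
 have s: "sum_mset P = (x + y) * d + x" using assms(1) d by (simp add: algebra_simps)
 show "x + y <= sum_mset P" unfolding s using assms(4) d by (cases d) auto
 show "is_partition P" using assms d by (auto simp: is_partition_def)
 have p: "prof P i = x * min i (Suc d) + y * min i d" using assms(1) d by simp
 show "prof P i = min (i * (x + y)) (sum_mset P)"
 proof (cases "i <= d")
  case True
  then have "(x + y) * i <= (x + y) * d" by (rule mult_le_mono2)
  then have "i * (x + y) <= sum_mset P" unfolding s by (metis mult.commute trans_le_add1)
  moreover have "prof P i = i * (x + y)" using True p by (simp add: min_def algebra_simps)
  ultimately show ?thesis by simp
 next
  case False
  then have "(x + y) * (d + 1) <= (x + y) * i" by (intro mult_le_mono2) simp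
  then have "sum_mset P <= i * (x + y)" unfolding s by (simp add: algebra_simps)
  moreover have "min i (Suc d) = Suc d" "min i d = d" using False by simp_all
  then have "prof P i = sum_mset P" unfolding p s by (simp add: algebra_simps)
  ultimately show ?thesis by simp
 qed
qed

lemma mat_pow_pow:
 fixes A :: "'k::field mat"
 assumes A: "A \<in> sqm n"
 shows "(A ^\<^sub>m a) ^\<^sub>m i = A ^\<^sub>m (a * i)"
proof -
 interpret M: ring "ring_mat TYPE('k) n ()" by (rule ring_mat)
 show ?thesis
  using M.nat_pow_pow[of A a i] A pow_mat_ring_pow[OF A, of _ "()"] pow_mat_ring_pow[OF pow_carrier_mat[OF A], of a i "()"]
  by (simp add: ring_mat_simps)
qed

text \<open>The power \<open>x + y\<close> of a single Jordan block has the profile of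
  \<open>P\<close> and hence type \<open>P\<close>; exchanging the two commuting matrices yields
  \<open>B\<close>.\<close>

lemma cluster_one_block:
 fixes P :: "nat multiset"
 assumes P: "P = replicate_mset x j + replicate_mset y (j - 1)" "1 <= j" "1 <= x" "j = 1 --> y = 0"
 obtains B :: "'k::field mat" where "B \<in> nilpotent_commutator P" "has_jordan_type B {#sum_mset P#}"
proof -
 obtain n where n: "sum_mset P = n" by simp
 let ?J = "jmat [n] :: 'k mat"
 note c = cluster_prof[OF P, unfolded n]
 have J: "?J \<in> sqm n" using jmat_carrier[of "[n]"] by simp
 have I: "indexing n (Ix [n]) (ix [n])" using indexing_ix[of "[n]"] by simp
 note pw = mat_pow_pow[OF J, of "x + y"]
 have "has_jordan_type (?J ^\<^sub>m (x + y)) P"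
 proof (rule has_jordan_typeI[OF _ _ I c(3)])
  show "?J ^\<^sub>m (x + y) \<in> sqm n" using J by simp
  have "\<forall>q\<in>set [n]. q <= (x + y) * n" using P(3) by (simp add: algebra_simps trans_le_add1)
  then show "(?J ^\<^sub>m (x + y)) ^\<^sub>m n = 0\<^sub>m n n" using jmat_pow_zero[of "[n]" "(x + y) * n", where 'k = 'k] pw by simp
  show "corank (Vs (Ix [n])) (opk (Ix [n]) (ix [n]) (Ix [n]) (ix [n]) ((?J ^\<^sub>m (x + y)) ^\<^sub>m i)) (prof P i)" for i
   using corank_jmat[of "[n]" "(x + y) * i", where 'k = 'k] c(1)[of i] unfolding pw by (simp add: mult.commute)
 qed
 moreover have "parts {#n#} = [n]" by (rule parts_eqI) simp_all
 moreover have "comm [n] ?J" using jmat_T_form[of "[n]"] unfolding T_form_def by blast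
 then have "comm [n] (?J ^\<^sub>m (x + y))" by (rule comm_pow)
 moreover have "is_partition {#n#}" using c(2) P(3) by (simp add: is_partition_def)
 ultimately show ?thesis using type_swap[of "?J ^\<^sub>m (x + y)" P "{#n#}"] that unfolding n by metis
qed

text \<open>After conjugation into triangular form every nonzero entry of \<open>B\<close> raises
  the level, and all levels are below \<open>u\<close>.\<close>

lemma leveled_pow_zero:
 fixes B :: "'k::field mat"
 assumes L: "leveled P u r k l" and B: "B \<in> nilpotent_commutator P"
 shows "B ^\<^sub>m u = 0\<^sub>m (sum_mset P) (sum_mset P)"
proof -
 let ?n = "sum_mset P" and ?ps = "parts P"
 obtain lev where "good_levels (length ?ps) ((!) ?ps) u r k l lev" using L unfolding leveled_def by blast
 then have lev: "s < length ?ps ==> t < length ?ps ==> p < ?ps ! s ==> q < ?ps ! t ==> T_move ((!) ?ps) s p t q ==> lev s p < lev t q"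
  "s < length ?ps ==> p < ?ps ! s ==> lev s p < u" for s t p q
  unfolding good_levels_def by blast+
 obtain g h where gh: "comm ?ps g" "comm ?ps h" "g * h = 1\<^sub>m ?n" "h * g = 1\<^sub>m ?n" "T_form ?ps (h * (B * g))"
  using nilpotent_commutator_conj[OF B] .
 have c: "g \<in> sqm ?n" "h \<in> sqm ?n" "B \<in> sqm ?n" "h * (B * g) \<in> sqm ?n"
  using commD(1)[OF gh(1)] commD(1)[OF gh(2)] B gh(5) commD(1)[of ?ps "h * (B * g)"] commD(1)[of ?ps B]
  by (simp_all add: nilpotent_commutator_iff T_form_def)
 have I: "indexing ?n (Ix ?ps) (ix ?ps)" using indexing_ix[of ?ps] by simp
 have "(h * (B * g)) ^\<^sub>m u = 0\<^sub>m ?n ?n"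
 proof (rule level_nilpotent[OF I c(4), where lev = "\<lambda>x. lev (fst x) (snd x)"])
  fix x y assume xy: "x \<in> Ix ?ps" "y \<in> Ix ?ps" "ent ?ps (h * (B * g)) y x \<noteq> 0"
  obtain s p t q where st: "x = (s, p)" "y = (t, q)" by (cases x, cases y)
  have "T_move ((!) ?ps) s p t q" using gh(5) xy unfolding T_form_def st by blast
  then show "lev (fst x) (snd x) < lev (fst y) (snd y)" using lev(1) xy(1,2) by (auto simp: st Ix_def)
 qed (use lev(2) in "auto simp: Ix_def")
 then have "(g * (h * (B * g)) * h) ^\<^sub>m u = 0\<^sub>m ?n ?n" using similar_pow_zero[OF c(1,2,4) gh(3,4)] by simp
 then show ?thesis unfolding conj_conj[OF c(1,2,3) gh(3)] .
qed

lemma is_partition_two: "r < u ==> is_partition {#u, u - r#}"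
 by (simp add: is_partition_def)

text \<open>The generic index \<open>u\<close> is the largest one in the commutator. A single
  cluster would allow the index \<open>2 * u - r\<close>, which is greater than \<open>u\<close>.
  For two clusters with parameter \<open>u'\<close>, an element of index \<open>u'\<close> exists by
  exchanging roles in a matrix from \<open>type_exists\<close>, and the levels bound every index by
  \<open>u'\<close>; so \<open>u' = u\<close>.\<close>

lemma generic_type_leveled:
 fixes u r :: nat
 assumes inf: "infinite (UNIV :: 'k::field set)" and P: "is_partition P" and ru: "r < u" "2 <= r"
  and gen: "generic_jordan_type TYPE('k) P {#u, u - r#}"
 obtains k l where "leveled P u r k l"
proof -
 obtain U where U: "openin (zariski (nilpotent_commutator P :: 'k mat set)) U" "U \<noteq> {}"
  "\<And>B. B \<in> U ==> has_jordan_type B {#u, u - r#}" using gen unfolding generic_jordan_type_def by blast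
 obtain B0 where B0: "B0 \<in> U" using U(2) by blast
 have B0N: "B0 \<in> nilpotent_commutator P" using B0 openin_subset[OF U(1)] by auto
 have n: "sum_mset P = u + (u - r)" using size_dim[OF B0N U(3)[OF B0]] by simp
 have zero: "B ^\<^sub>m v = 0\<^sub>m (sum_mset P) (sum_mset P) \<longleftrightarrow> u <= v" if "B \<in> U" for B v
  using type_pow_zero[OF U(3)[OF that], of v] n by auto
 have le: "\<forall>q\<in>#Q. q <= u" if "B1 \<in> nilpotent_commutator P" "has_jordan_type (B1 :: 'k mat) Q" for B1 Q
 proof -
  have "B1 ^\<^sub>m u = 0\<^sub>m (sum_mset P) (sum_mset P)" by (rule generic_index[OF inf U(1,2) _ that(1)]) (simp add: zero)
  then show ?thesis using type_pow_zero[OF that(2)] size_dim[OF that] by simp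
 qed
 from two_parts_cases[OF B0N U(3)[OF B0] P ru(1)] show ?thesis
 proof (elim disjE exE conjE)
  fix j x y assume *: "1 <= j" "1 <= x" "j = 1 --> y = 0" "P = replicate_mset x j + replicate_mset y (j - 1)"
  obtain B1 :: "'k mat" where "B1 \<in> nilpotent_commutator P" "has_jordan_type B1 {#sum_mset P#}"
   using cluster_one_block[OF *(4,1,2,3)] .
  then show ?thesis using le n ru by fastforce
 next
  fix u' r' k l assume L: "leveled P u' r' k l"
  then interpret W: box_params u' r' k l by unfold_locales (auto simp: leveled_def)
  obtain A P' where A: "A \<in> NN u' r'" "has_jordan_type (A :: 'k mat) P'" "\<forall>i. prof P' i = nu u' r' k l i"
   using W.type_exists[OF inf] .
  have "P' = P" by (rule prof_inject[OF _ P]) (use A L in "simp_all add: has_jordan_type_iff leveled_def")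
  moreover have "comm (parts {#u', u' - r'#}) A" using A(1) by (simp add: nilpotent_commutator_iff)
  ultimately obtain B1 :: "'k mat" where "B1 \<in> nilpotent_commutator P" "has_jordan_type B1 {#u', u' - r'#}"
   using type_swap[OF A(2)] is_partition_two[OF W.ru] by metis
  then have "u' <= u" using le by fastforce
  moreover have "u <= u'" using leveled_pow_zero[OF L B0N] zero[OF B0] by simp
  moreover have "sum_mset P + r' = 2 * u'" using L by (simp add: leveled_def)
  ultimately have "u = u'" "r = r'" using n ru by linarith+
  then show ?thesis using that L by simp
 qed
qed

text \<open>A generic point of the box variety has profile \<open>nu\<close>, so its type is
  \<open>box_partition\<close>, and the analysis of clusters applies to that type. One cluster is
  impossible since its Burge code has only one run of \<open>Beta\<close>; for two clusters the
  parameters agree by \<open>nu_inject\<close>.\<close>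

lemma box_partition_leveled:
 fixes u r :: nat
 assumes inf: "infinite (UNIV :: 'k::field set)" and v: "1 <= k" "k < r" "1 <= l" "l <= u - r" "r < u"
 shows "leveled (box_partition u r k l) u r k l" "is_partition (box_partition u r k l)"
proof -
 interpret box_params u r k l using v by unfold_locales
 obtain A P where A: "A \<in> NN u r" "has_jordan_type (A :: 'k mat) P" "\<forall>i. prof P i = nu u r k l i"
  using type_exists[OF inf] .
 have P: "is_partition P" using A(2) by (simp add: has_jordan_type_iff)
 have bp: "box_partition u r k l = P" using box_partition_eqI[OF P _ v] A(3) by blast
 have code: "burge_code P = box_word u r k l" by (rule burge_code_nu[OF P]) (use A(3) v in auto)
 have "comm (parts {#u, u - r#}) A" using A(1) by (simp add: nilpotent_commutator_iff)
 then obtain B :: "'k mat" where B: "B \<in> nilpotent_commutator P" "has_jordan_type B {#u, u - r#}"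
  using type_swap[OF A(2)] is_partition_two[OF v(5)] by metis
 have "leveled P u r k l"
  using two_parts_cases[OF B P v(5)]
 proof (elim disjE exE conjE)
  fix j x y assume *: "1 <= j" "1 <= x" "j = 1 --> y = 0" "P = replicate_mset x j + replicate_mset y (j - 1)"
  note c = cluster_prof[OF *(4,1,2,3)]
  let ?a = "sum_mset P - (x + y)"
  have "burge_code P = replicate ?a Alpha @ replicate (x + y) Beta @ [Alpha]"
   by (rule burge_code_almost_rectangular[OF P c(1,2)]) (use c(2) *(2) in linarith)
  then have eq: "replicate ?a Alpha @ replicate (x + y) Beta @ [Alpha] = box_word u r k l" using code by simp
  obtain i i' i'' where i: "x + y = Suc i" "l = Suc i'" "r - k = Suc i''"
   using *(2) v by (intro that[of "x + y - 1" "l - 1" "r - k - 1"]) auto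
  have "replicate ?a Alpha @ Beta # (replicate i Beta @ Alpha # []) =
   replicate (u - r - l) Alpha @ Beta # (replicate i' Beta @ Alpha # (replicate i'' Alpha @ replicate k Beta @ [Alpha]))"
   using eq unfolding box_word_def i by simp
  from replicate_append_inject[OF this] have "replicate i Beta @ Alpha # [] = replicate i' Beta @ Alpha # (replicate i'' Alpha @ replicate k Beta @ [Alpha])"
   by simp
  from replicate_append_inject[OF this] show ?thesis by simp
 next
  fix u' r' k' l' assume L: "leveled P u' r' k' l'"
  then have "u = u' \<and> r = r' \<and> k = k' \<and> l = l'"
   by (intro nu_inject[OF P _ _ v]) (use A(3) in "auto simp: leveled_def")
  then show ?thesis using L by simp
 qed
 then show "leveled (box_partition u r k l) u r k l" "is_partition (box_partition u r k l)" using bp P by simp_all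
qed

theorem theorem1p3:
  fixes u r :: nat
  assumes "infinite (UNIV :: 'k::field set)"
    and "r \<ge> 2" and "u > r"
  shows "(\<forall>P. is_partition P \<and> generic_jordan_type TYPE('k) P {#u, u - r#} \<longrightarrow>
            (let T = zariski (nilpotent_commutator {#u, u - r#} :: 'k mat set);
                 Z = T closure_of (jordan_locus {#u, u - r#} P)
             in irreducible_complete_intersection u r Z \<and>
                codimension T Z + 2 = enat (size P)))
       \<and> (\<forall>k l. 1 \<le> k \<and> k \<le> r - 1 \<and> 1 \<le> l \<and> l \<le> u - r \<longrightarrow>
            zariski (nilpotent_commutator {#u, u - r#} :: 'k mat set)
              closure_of (jordan_locus {#u, u - r#} (box_partition u r k l))
            = box_variety u r k l)"
proof (intro conjI allI impI)
 fix P assume P: "is_partition P \<and> generic_jordan_type TYPE('k) P {#u, u - r#}"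
 then obtain k l where L: "leveled P u r k l" using generic_type_leveled[OF assms(1) _ assms(3,2)] by blast
 then interpret box_params u r k l by unfold_locales (auto simp: leveled_def)
 let ?Z = "bx u r k l :: 'k mat set" and ?F = "box_equations r k l :: 'k cpol set"
 have cl: "zariski (NN u r) closure_of jordan_locus {#u, u - r#} P = ?Z"
  using closure_locus[OF assms(1) L] P by blast
 have co: "codimension (zariski (NN u r)) ?Z = enat (k + l - 2)" by (rule codimension_bx[OF assms(1) k l ru])
 have car: "carrier (coord_ring u r :: 'k cpol ring) = PV (coords u r)" by (simp add: coord_ring_def PV_def)
 have "vanishing_ideal u r ?Z = J"
 proof (rule Set.set_eqI)
  fix p :: "'k cpol"
  have "p \<in> PV (coords u r)" if "p \<in> J"
   using that unfolding J_def idl_def by (auto intro!: PV_sum PV_basic bgen_PV)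
  then show "p \<in> vanishing_ideal u r ?Z \<longleftrightarrow> p \<in> J"
   using vanish_bx[OF assms(1), of p] unfolding vanishing_ideal_def vanish_def car by blast
 qed
 moreover have "finite ?F" "?F \<subseteq> PV (coords u r)" "card ?F = k + l - 2"
  unfolding box_equations_bgen by (auto simp: card_image[OF bgen_inj] intro: bgen_PV)
 ultimately have "irreducible_complete_intersection u r ?Z"
  unfolding irreducible_complete_intersection_def Let_def car
  using bx_irreducible[OF assms(1)] co genideal_J[where 'k = 'k] by metis
 moreover have "size P = k + l" using L unfolding leveled_def by (metis mset_parts size_mset)
 then have "codimension (zariski (NN u r)) ?Z + 2 = enat (size P)"
  unfolding co using k l by (simp add: numeral_eq_enat)
 ultimately show "let T = zariski (nilpotent_commutator {#u, u - r#} :: 'k mat set);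
   Z = T closure_of (jordan_locus {#u, u - r#} P)
  in irreducible_complete_intersection u r Z \<and> codimension T Z + 2 = enat (size P)"
  unfolding Let_def cl by blast
next
 fix k l assume "1 <= k \<and> k <= r - 1 \<and> 1 <= l \<and> l <= u - r"
 then have v: "1 <= k" "k < r" "1 <= l" "l <= u - r" "r < u" using assms by auto
 interpret box_params u r k l using v by unfold_locales
 show "zariski (NN u r :: 'k mat set) closure_of (jordan_locus {#u, u - r#} (box_partition u r k l)) = box_variety u r k l"
  unfolding box_variety_bx by (rule closure_locus[OF assms(1) box_partition_leveled[OF assms(1) v]])
qed

end
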